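(* Assume $\lim_{n\to\infty}p_n/n=\tau\in[0,1)$, $\rho_0\in[C_1,C_2]$ for some constants $0<C_1\le C_2<1$, and that Condition A (A1--A4) holds for the linear model $\boldsymbol Y=X\boldsymbol\beta_0+\boldsymbol\epsilon$. Let $$\hat\rho=\frac{\hat\eta}{\hat\eta+\hat\sigma_\epsilon^2},\qquad \hat\eta=\hat{\boldsymbol\beta}^T(X^TX/n)\hat{\boldsymbol\beta}-\hat\sigma_\epsilon^2p_n/n .$$ Then $\hat\rho-\rho_0=o_{\mathrm P}(1)$ and $$\frac{\hat\rho-\rho_0}{\sigma_{\hat\rho}}\xrightarrow{\ \mathcal D\ }N(0,1),$$ where $$\sigma_{\hat\rho}^2=n^{-1}(\eta_0+\sigma_\epsilon^2)^{-4}\Big[\frac{2\sigma_\epsilon^8\tau}{1-\tau}-\Big\{2+\frac{4\tau}{\tau-1}\Big\}\sigma_\epsilon^6\eta_0+\sigma_\epsilon^4\Big\{\mathrm E(Y_1^4)-\nu_4+\eta_0^2\frac{4\tau-2}{1-\tau}\Big\}+\eta_0^2\nu_4\Big].$$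
   Context: Model: $Y_i=\boldsymbol X_i^T\boldsymbol\beta_0+\epsilon_i$, $i=1,\dots,n$, with deterministic $\boldsymbol\beta_0\in\mathbb R^{p_n}$, $\boldsymbol Y=(Y_1,\dots,Y_n)^T$, $X=(\boldsymbol X_1,\dots,\boldsymbol X_n)^T\in\mathbb R^{n\times p_n}$, $\boldsymbol\epsilon=(\epsilon_1,\dots,\epsilon_n)^T$, $\mathrm E(\boldsymbol X_i)=\mathbf 0$, $\mathrm{Cov}(\boldsymbol X_i)=\Sigma$. The quantities $p_n,\boldsymbol\beta_0,\sigma_\epsilon^2,\Sigma$ may vary with $n$, except that $\boldsymbol\beta_0$ and $\sigma_\epsilon^2$ do not vary with $n$ when $p_n$ is fixed. Limits are as $n\to\infty$. Condition A (constants $c,C,c^*$ do not depend on $n$). A1: $\{\boldsymbol X_i\}_{i=1}^n$ are i.i.d., $\boldsymbol X_i=\Sigma^{1/2}\boldsymbol Z_i$ with $\boldsymbol Z_i=(z_{i1},\dots,z_{ip_n})^T$, $\{z_{ij}\}_{j=1}^{p_n}$ independent for each $i$, $\mathrm E(z_{ij})=0$, $\mathrm E(z_{ij}^2)=1$, and there is $c^*>0$ with $\mathrm P(|z_{ij}|\ge t)\le 2\exp(-c^*t^2)$ for all $n\ge1$, $i\le n$, $j\le p_n$, $t>0$. A2: $\{\epsilon_i\}_{i=1}^n$ are i.i.d. and independent of $\{\boldsymbol X_i\}_{i=1}^n$, $\mathrm E(\epsilon_i)=0$, $\mathrm E(\epsilon_i^2)=\sigma_\epsilon^2\ge c>0$,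 $\mathrm E(\epsilon_i^8)=O(\sigma_\epsilon^8)$. A3: $0<c<\lambda_{\min}(\Sigma)\le\lambda_{\max}(\Sigma)<C<\infty$. A4: $\|\boldsymbol\beta_0\|_\infty\le C<\infty$. Signal strength $\eta_0=\boldsymbol\beta_0^T\Sigma\boldsymbol\beta_0$; fraction of variance explained $\rho_0=\eta_0/(\eta_0+\sigma_\epsilon^2)$; $\nu_4=\mathrm E(\epsilon_i^4)$. Estimators: $\hat{\boldsymbol\beta}=(X^TX)^{-1}X^T\boldsymbol Y$ (well defined with probability tending to 1), $\hat\sigma_\epsilon^2=\|\boldsymbol Y-X\hat{\boldsymbol\beta}\|_2^2/(n-p_n)$. *)

theory Defs
  imports
    "HOL-Probability.Probability"
    "HOL-Library.Landau_Symbols"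
    "Jordan_Normal_Form.Spectral_Radius"
begin

(* Dimensions vary with n, so vectors and matrices are those of Jordan_Normal_Form; the
   fixed-dimension namesakes of HOL-Analysis are hidden. Indices run from 0. *)
hide_type (open) Finite_Cartesian_Product.vec
hide_const (open) Finite_Cartesian_Product.vec Finite_Cartesian_Product.mat
  Finite_Cartesian_Product.row Finite_Cartesian_Product.column
no_notation Finite_Cartesian_Product.vec_nth (infixl "$" 90)
no_notation inner (infix "\<bullet>" 70)


section \<open>Random vectors and modes of convergence\<close>

text \<open>The Borel sets of \<open>\<real>\<^sup>d\<close>, carried over to vectors of dimension \<open>d\<close>.\<close>
definition borel_vec :: "nat \<Rightarrow> real vec measure" where
  "borel_vec d = vimage_algebra (carrier_vec d) (\<lambda>v. \<lambda>j\<in>{..<d}. v $ j)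
                   (Pi\<^sub>M {..<d} (\<lambda>_. borel))"

definition iid :: "'a measure \<Rightarrow> 'b measure \<Rightarrow> nat \<Rightarrow> (nat \<Rightarrow> 'a \<Rightarrow> 'b) \<Rightarrow> bool" where
  "iid M N n U \<longleftrightarrow> prob_space.indep_vars M (\<lambda>_. N) U {..<n} \<and>
     (\<forall>i<n. distr M N (U i) = distr M N (U 0))"

text \<open>As \<^const>\<open>prob_space.indep_var\<close>, but the two random elements may have different types.\<close>
definition indep_of ::
    "'a measure \<Rightarrow> 'b measure \<Rightarrow> ('a \<Rightarrow> 'b) \<Rightarrow> 'c measure \<Rightarrow> ('a \<Rightarrow> 'c) \<Rightarrow> bool" where
  "indep_of M N U K V \<longleftrightarrow> U \<in> M \<rightarrow>\<^sub>M N \<and> V \<in> M \<rightarrow>\<^sub>M K \<and>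
     prob_space.indep_set M (sets (vimage_algebra (space M) U N))
                            (sets (vimage_algebra (space M) V K))"

text \<open>\<open>T\<^sub>n = o\<^sub>P(1)\<close>. Measurability is required because \<^const>\<open>measure\<close> is \<open>0\<close> on
  non-measurable sets.\<close>
definition small_oP :: "(nat \<Rightarrow> 'a measure) \<Rightarrow> (nat \<Rightarrow> 'a \<Rightarrow> real) \<Rightarrow> bool" where
  "small_oP M T \<longleftrightarrow> (\<forall>\<^sub>F n in sequentially. T n \<in> borel_measurable (M n)) \<and>
     (\<forall>e>0. (\<lambda>n. measure (M n) {\<omega> \<in> space (M n). \<bar>T n \<omega>\<bar> > e}) \<longlonglongrightarrow> 0)"


section \<open>The linear model\<close>

text \<open>\<open>R = S\<^sup>1\<^sup>/\<^sup>2\<close>: the (unique) symmetric positive semidefinite square root.\<close>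
definition is_psd_sqrt :: "nat \<Rightarrow> real mat \<Rightarrow> real mat \<Rightarrow> bool" where
  "is_psd_sqrt d R S \<longleftrightarrow> R \<in> carrier_mat d d \<and> transpose_mat R = R \<and>
     (\<forall>v\<in>carrier_vec d. 0 \<le> v \<bullet> (R *\<^sub>v v)) \<and> R * R = S"

definition lambda_min :: "real mat \<Rightarrow> real" where
  "lambda_min S = Min (spectrum S)"

definition lambda_max :: "real mat \<Rightarrow> real" where
  "lambda_max S = Max (spectrum S)"

definition centered_with_cov :: "'a measure \<Rightarrow> nat \<Rightarrow> ('a \<Rightarrow> real vec) \<Rightarrow> real mat \<Rightarrow> bool" where
  "centered_with_cov M d U S \<longleftrightarrow>
     (\<forall>j<d. integrable M (\<lambda>\<omega>. U \<omega> $ j) \<and> (\<integral>\<omega>. U \<omega> $ j \<partial>M) = 0) \<and>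
     (\<forall>j<d. \<forall>k<d. integrable M (\<lambda>\<omega>. U \<omega> $ j * U \<omega> $ k) \<and>
                   (\<integral>\<omega>. U \<omega> $ j * U \<omega> $ k \<partial>M) = S $$ (j, k))"

definition design :: "nat \<Rightarrow> nat \<Rightarrow> (nat \<Rightarrow> 'a \<Rightarrow> real vec) \<Rightarrow> 'a \<Rightarrow> real mat" where
  "design n d X \<omega> = mat n d (\<lambda>(i, j). X i \<omega> $ j)"

definition response :: "(nat \<Rightarrow> 'a \<Rightarrow> real vec) \<Rightarrow> real vec \<Rightarrow> (nat \<Rightarrow> 'a \<Rightarrow> real) \<Rightarrow> nat \<Rightarrow> 'a \<Rightarrow> real"
  where "response X \<beta> \<epsilon> i \<omega> = X i \<omega> \<bullet> \<beta> + \<epsilon> i \<omega>"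

definition response_vec ::
    "nat \<Rightarrow> (nat \<Rightarrow> 'a \<Rightarrow> real vec) \<Rightarrow> real vec \<Rightarrow> (nat \<Rightarrow> 'a \<Rightarrow> real) \<Rightarrow> 'a \<Rightarrow> real vec" where
  "response_vec n X \<beta> \<epsilon> \<omega> = vec n (\<lambda>i. response X \<beta> \<epsilon> i \<omega>)"

text \<open>
  The model is a triangular array: for each \<open>n \<ge> 1\<close>, \<open>M n\<close> is the underlying probability space,
  \<open>p n\<close> the dimension, \<open>X n i\<close> the covariate vectors and \<open>\<epsilon> n i\<close> the errors (\<open>i < n\<close>),
  \<open>\<beta> n\<close> the coefficient vector, \<open>S n\<close> the covariance matrix and \<open>(\<sigma> n)\<^sup>2\<close> the error variance.
  The last clause keeps \<open>\<beta>\<close> and \<open>\<sigma>\<^sup>2\<close> fixed when the dimension is fixed.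
\<close>
definition linear_model ::
    "(nat \<Rightarrow> 'a measure) \<Rightarrow> (nat \<Rightarrow> nat) \<Rightarrow> (nat \<Rightarrow> nat \<Rightarrow> 'a \<Rightarrow> real vec) \<Rightarrow> (nat \<Rightarrow> real vec) \<Rightarrow>
     (nat \<Rightarrow> real mat) \<Rightarrow> (nat \<Rightarrow> real) \<Rightarrow> bool" where
  "linear_model M p X \<beta> S \<sigma> \<longleftrightarrow>
     (\<forall>n\<ge>1. prob_space (M n) \<and> \<beta> n \<in> carrier_vec (p n) \<and> S n \<in> carrier_mat (p n) (p n) \<and>
        (\<forall>i<n. X n i \<in> M n \<rightarrow>\<^sub>M borel_vec (p n) \<and> centered_with_cov (M n) (p n) (X n i) (S n))) \<and>
     ((\<forall>n\<ge>1. p n = p 1) \<longrightarrow> (\<forall>n\<ge>1. \<beta> n = \<beta> 1 \<and> (\<sigma> n)\<^sup>2 = (\<sigma> 1)\<^sup>2))"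

definition condition_A1 ::
    "(nat \<Rightarrow> 'a measure) \<Rightarrow> (nat \<Rightarrow> nat) \<Rightarrow> (nat \<Rightarrow> nat \<Rightarrow> 'a \<Rightarrow> real vec) \<Rightarrow> (nat \<Rightarrow> real mat) \<Rightarrow> bool"
  where
  "condition_A1 M p X S \<longleftrightarrow>
     (\<forall>n\<ge>1. iid (M n) (borel_vec (p n)) n (X n)) \<and>
     (\<exists>R Z. (\<forall>n\<ge>1. is_psd_sqrt (p n) (R n) (S n) \<and>
               (\<forall>i<n. Z n i \<in> M n \<rightarrow>\<^sub>M borel_vec (p n) \<and>
                  (\<forall>\<omega>\<in>space (M n). X n i \<omega> = R n *\<^sub>v Z n i \<omega>) \<and>
                  prob_space.indep_vars (M n) (\<lambda>_. borel) (\<lambda>j \<omega>. Z n i \<omega> $ j) {..<p n} \<and>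
                  (\<forall>j<p n. integrable (M n) (\<lambda>\<omega>. Z n i \<omega> $ j) \<and>
                     (\<integral>\<omega>. Z n i \<omega> $ j \<partial>M n) = 0 \<and>
                     integrable (M n) (\<lambda>\<omega>. (Z n i \<omega> $ j)\<^sup>2) \<and>
                     (\<integral>\<omega>. (Z n i \<omega> $ j)\<^sup>2 \<partial>M n) = 1))) \<and>
            (\<exists>c>0. \<forall>n\<ge>1. \<forall>i<n. \<forall>j<p n. \<forall>t>0.
               measure (M n) {\<omega> \<in> space (M n). \<bar>Z n i \<omega> $ j\<bar> \<ge> t} \<le> 2 * exp (- c * t\<^sup>2)))"

definition condition_A2 ::
    "(nat \<Rightarrow> 'a measure) \<Rightarrow> (nat \<Rightarrow> nat) \<Rightarrow> (nat \<Rightarrow> nat \<Rightarrow> 'a \<Rightarrow> real vec) \<Rightarrow>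
     (nat \<Rightarrow> nat \<Rightarrow> 'a \<Rightarrow> real) \<Rightarrow> (nat \<Rightarrow> real) \<Rightarrow> bool" where
  "condition_A2 M p X \<epsilon> \<sigma> \<longleftrightarrow>
     (\<forall>n\<ge>1. iid (M n) borel n (\<epsilon> n) \<and>
        indep_of (M n)
          (Pi\<^sub>M {..<n} (\<lambda>_. borel)) (\<lambda>\<omega>. \<lambda>i\<in>{..<n}. \<epsilon> n i \<omega>)
          (Pi\<^sub>M {..<n} (\<lambda>_. borel_vec (p n))) (\<lambda>\<omega>. \<lambda>i\<in>{..<n}. X n i \<omega>) \<and>
        (\<forall>i<n. integrable (M n) (\<lambda>\<omega>. (\<epsilon> n i \<omega>) ^ 8) \<and>
           (\<integral>\<omega>. \<epsilon> n i \<omega> \<partial>M n) = 0 \<and> (\<integral>\<omega>. (\<epsilon> n i \<omega>)\<^sup>2 \<partial>M n) = (\<sigma> n)\<^sup>2)) \<and>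
     (\<exists>c>0. \<forall>n\<ge>1. (\<sigma> n)\<^sup>2 \<ge> c) \<and>
     (\<lambda>n. \<integral>\<omega>. (\<epsilon> n 0 \<omega>) ^ 8 \<partial>M n) \<in> O(\<lambda>n. (\<sigma> n) ^ 8)"

definition condition_A3 :: "(nat \<Rightarrow> real mat) \<Rightarrow> bool" where
  "condition_A3 S \<longleftrightarrow> (\<exists>c>0. \<exists>C. \<forall>n\<ge>1.
     c < lambda_min (S n) \<and> lambda_min (S n) \<le> lambda_max (S n) \<and> lambda_max (S n) < C)"

definition condition_A4 :: "(nat \<Rightarrow> nat) \<Rightarrow> (nat \<Rightarrow> real vec) \<Rightarrow> bool" where
  "condition_A4 p \<beta> \<longleftrightarrow> (\<exists>C. \<forall>n\<ge>1. \<forall>j<p n. \<bar>\<beta> n $ j\<bar> \<le> C)"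

definition condition_A ::
    "(nat \<Rightarrow> 'a measure) \<Rightarrow> (nat \<Rightarrow> nat) \<Rightarrow> (nat \<Rightarrow> nat \<Rightarrow> 'a \<Rightarrow> real vec) \<Rightarrow> (nat \<Rightarrow> real vec) \<Rightarrow>
     (nat \<Rightarrow> nat \<Rightarrow> 'a \<Rightarrow> real) \<Rightarrow> (nat \<Rightarrow> real mat) \<Rightarrow> (nat \<Rightarrow> real) \<Rightarrow> bool" where
  "condition_A M p X \<beta> \<epsilon> S \<sigma> \<longleftrightarrow>
     condition_A1 M p X S \<and> condition_A2 M p X \<epsilon> \<sigma> \<and> condition_A3 S \<and> condition_A4 p \<beta>"

definition eta0 :: "real vec \<Rightarrow> real mat \<Rightarrow> real" where
  "eta0 \<beta> S = \<beta> \<bullet> (S *\<^sub>v \<beta>)"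

definition rho0 :: "real vec \<Rightarrow> real mat \<Rightarrow> real \<Rightarrow> real" where
  "rho0 \<beta> S \<sigma> = eta0 \<beta> S / (eta0 \<beta> S + \<sigma>\<^sup>2)"


section \<open>Estimators\<close>

text \<open>Ordinary least squares; the value on singular Gram matrices is a convention.\<close>
definition beta_hat :: "real mat \<Rightarrow> real vec \<Rightarrow> real vec" where
  "beta_hat X Y = (case mat_inverse (transpose_mat X * X) of
       Some G \<Rightarrow> G *\<^sub>v (transpose_mat X *\<^sub>v Y)
     | None \<Rightarrow> 0\<^sub>v (dim_col X))"

definition sigma2_hat :: "real mat \<Rightarrow> real vec \<Rightarrow> real" where
  "sigma2_hat X Y = (let r = Y - X *\<^sub>v beta_hat X Y in
     (r \<bullet> r) / (real (dim_row X) - real (dim_col X)))"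

definition eta_hat :: "real mat \<Rightarrow> real vec \<Rightarrow> real" where
  "eta_hat X Y =
     beta_hat X Y \<bullet> (((1 / real (dim_row X)) \<cdot>\<^sub>m (transpose_mat X * X)) *\<^sub>v beta_hat X Y)
       - sigma2_hat X Y * real (dim_col X) / real (dim_row X)"

definition rho_hat :: "real mat \<Rightarrow> real vec \<Rightarrow> real" where
  "rho_hat X Y = eta_hat X Y / (eta_hat X Y + sigma2_hat X Y)"

text \<open>\<open>m4 = E(Y\<^sub>1\<^sup>4)\<close> and \<open>\<nu>4 = E(\<epsilon>\<^sub>1\<^sup>4)\<close>.\<close>
definition var_rho_hat :: "nat \<Rightarrow> real \<Rightarrow> real \<Rightarrow> real \<Rightarrow> real \<Rightarrow> real \<Rightarrow> real" where
  "var_rho_hat n \<tau> \<eta> \<sigma> m4 \<nu>4 =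
     1 / real n * (1 / (\<eta> + \<sigma>\<^sup>2) ^ 4) *
     (2 * \<sigma> ^ 8 * \<tau> / (1 - \<tau>) - (2 + 4 * \<tau> / (\<tau> - 1)) * \<sigma> ^ 6 * \<eta>
      + \<sigma> ^ 4 * (m4 - \<nu>4 + \<eta>\<^sup>2 * ((4 * \<tau> - 2) / (1 - \<tau>))) + \<eta>\<^sup>2 * \<nu>4)"

end

theory Submission
  imports Defs "HOL-Real_Asymp.Real_Asymp"
begin

text \<open>
  With \<open>a = \<parallel>Y\<parallel>\<^sup>2 / n\<close> one has \<open>rho_hat = 1 - sigma2_hat / a\<close>, where \<open>(n - p) sigma2_hat\<close> is the
  quadratic form of a projection \<open>Q\<close> in the errors. \<open>Q\<close> is built by Gram-Schmidt on the columns of the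
  whitened design; this requires no inverse and makes sense for every design. The leading term of
  \<open>rho_hat - rho0\<close> is a polynomial of degree two in the errors, given the design, plus a sum of
  independent terms that depend on the design only.

  Its asymptotic variance requires the diagonal of \<open>Q\<close> to be almost constant. The potential
  \<open>dev n Q = (\<Sum>i. Q\<^sub>i\<^sub>i\<^sup>2) - (tr Q)\<^sup>2 / n\<close> starts at \<open>0\<close>, and one Gram-Schmidt step with a fresh random column
  increases its expectation by \<open>O(n powr (-1/2))\<close> only, because the step lowers large diagonal entries
  more than small ones. Hence the final expectation is \<open>O(sqrt n) = o(n)\<close>.

  The characteristic function of such a polynomial \<open>B\<close> satisfies \<open>E(B exp (i t B)) = i t v E(exp (i t B))\<close>
  up to a small error, by expanding in one variable at a time. Solving this approximate differential
  equation compares it with \<open>exp (- t\<^sup>2 v / 2)\<close>, and Levy's continuity theorem concludes.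
\<close>

section \<open>Moments of linear and quadratic forms in independent variables\<close>

text \<open>For a design of full rank the deviation is an exact quotient: in units of the error
  variance, \<open>rho_hat - rho0 = (a - V q) / (V a)\<close>, with \<open>a\<close> the mean
  squared response, \<open>q\<close> the residual variance and \<open>V = 1 + \<eta>\<close> for the
  signal-to-noise ratio \<eta>. Only the numerator fluctuates to first order; of the denominator
  merely consistency is used. The obstacle is the diagonal of \<open>Q\<close>. It multiplies the
  squared errors, whose fourth moment is arbitrary, so an uneven diagonal would bring a term into
  the variance that the stated formula does not have. But a fresh standardised column projected by
  \<open>Q\<close> has squared entries with means \<open>Q\<^sub>i\<^sub>i\<close>: this is why a
  step presses harder on large entries, and by Cauchy-Schwarz the mean drift of the potential is
  nonpositive. Dimension, coefficients and error variance move with n, so the estimates are explicit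
  finite-sample bounds whose constants depend only on bounds for moments, \<eta> and n / (n - p);
  limits are taken at the very end. Conditioning on the design is Fubini on a product of
  laws.\<close>

lemma prod4_le:
  fixes a b c d :: real
  shows "\<bar>a * b * c * d\<bar> \<le> a ^ 4 + b ^ 4 + c ^ 4 + d ^ 4"
proof -
  have *: "\<bar>u * v\<bar> \<le> (u\<^sup>2 + v\<^sup>2) / 2" for u v :: real
    using zero_le_power2[of "\<bar>u\<bar> - \<bar>v\<bar>"] by (simp add: power2_eq_square algebra_simps abs_mult)
  have "\<bar>a * b * c * d\<bar> = \<bar>(a * b) * (c * d)\<bar>" by (simp add: mult.assoc)
  also have "\<dots> \<le> ((a * b)\<^sup>2 + (c * d)\<^sup>2) / 2" by (rule *)
  also have "(a * b)\<^sup>2 = \<bar>a\<^sup>2 * b\<^sup>2\<bar>" by (simp add: power_mult_distrib)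
  also have "\<dots> \<le> (a ^ 4 + b ^ 4) / 2" using *[of "a\<^sup>2" "b\<^sup>2"] by simp
  also have "(c * d)\<^sup>2 = \<bar>c\<^sup>2 * d\<^sup>2\<bar>" by (simp add: power_mult_distrib)
  also have "\<dots> \<le> (c ^ 4 + d ^ 4) / 2" using *[of "c\<^sup>2" "d\<^sup>2"] by simp
  finally have "\<bar>a * b * c * d\<bar> \<le> ((a ^ 4 + b ^ 4) / 2 + (c ^ 4 + d ^ 4) / 2) / 2" by simp
  moreover have "0 \<le> u ^ 4" for u :: real by simp
  note this[of a] this[of b] this[of c] this[of d]
  ultimately show ?thesis by argo
qed

lemma add_pow4_le: "(a + b) ^ 4 \<le> 8 * (a ^ 4 + b ^ 4)" for a b :: real
proof -
  have 1: "(u + v)\<^sup>2 \<le> 2 * (u\<^sup>2 + v\<^sup>2)" for u v :: real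
    using sum_squares_bound[of u v] by (simp add: power2_sum)
  have "((a + b)\<^sup>2)\<^sup>2 \<le> (2 * (a\<^sup>2 + b\<^sup>2))\<^sup>2"
    by (rule power_mono[OF 1]) auto
  also have "\<dots> = 4 * (a\<^sup>2 + b\<^sup>2)\<^sup>2" by (simp only: power_mult_distrib) simp
  also have "\<dots> \<le> 4 * (2 * ((a\<^sup>2)\<^sup>2 + (b\<^sup>2)\<^sup>2))" by (intro mult_left_mono 1) auto
  finally show ?thesis by simp
qed

section \<open>Integrability through fourth moments, and the Cauchy-Schwarz inequality\<close>

context prob_space
begin

text \<open>A linear space in which any product of at most four members is integrable, by
  \<open>prod4_le\<close>. It discharges the integrability conditions of the fourth-moment
  expansions below.\<close>

definition L4 :: "('a \<Rightarrow> real) \<Rightarrow> bool" where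
  "L4 f \<longleftrightarrow> f \<in> borel_measurable M \<and> integrable M (\<lambda>\<omega>. f \<omega> ^ 4)"

lemma L4_measurable [measurable_dest]: "L4 f \<Longrightarrow> f \<in> borel_measurable M"
  by (simp add: L4_def)

lemma L4_int4: "L4 f \<Longrightarrow> integrable M (\<lambda>\<omega>. f \<omega> ^ 4)"
  by (simp add: L4_def)

lemma L4_const [simp]: "L4 (\<lambda>_. c)"
  by (simp add: L4_def)

lemma L4_cmult: "L4 f \<Longrightarrow> L4 (\<lambda>\<omega>. c * f \<omega>)"
  by (auto simp: L4_def power_mult_distrib)

lemma L4_bound:
  assumes [measurable]: "f \<in> borel_measurable M" and g: "integrable M g"
    and "\<And>\<omega>. \<omega> \<in> space M \<Longrightarrow> f \<omega> ^ 4 \<le> g \<omega>"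
  shows "L4 f"
proof -
  have "integrable M (\<lambda>\<omega>. f \<omega> ^ 4)"
  proof (rule Bochner_Integration.integrable_bound[OF g])
    have "\<bar>f \<omega> ^ 4\<bar> \<le> \<bar>g \<omega>\<bar>" if "\<omega> \<in> space M" for \<omega>
      using assms(3)[OF that] by simp
    then show "AE \<omega> in M. norm (f \<omega> ^ 4) \<le> norm (g \<omega>)" by auto
  qed simp
  then show ?thesis by (simp add: L4_def)
qed

lemma L4_add:
  assumes "L4 f" "L4 g" shows "L4 (\<lambda>\<omega>. f \<omega> + g \<omega>)"
proof (rule L4_bound)
  show "(\<lambda>\<omega>. f \<omega> + g \<omega>) \<in> borel_measurable M" using assms by (auto simp: L4_def)
  show "integrable M (\<lambda>\<omega>. 8 * (f \<omega> ^ 4 + g \<omega> ^ 4))" using assms by (auto simp: L4_def)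
qed (rule add_pow4_le)

lemma L4_diff: "L4 f \<Longrightarrow> L4 g \<Longrightarrow> L4 (\<lambda>\<omega>. f \<omega> - g \<omega>)"
  using L4_add[of f "\<lambda>\<omega>. - 1 * g \<omega>"] L4_cmult[of g "-1"] by simp

lemma L4_sum: "(\<And>i. i \<in> I \<Longrightarrow> L4 (f i)) \<Longrightarrow> L4 (\<lambda>\<omega>. \<Sum>i\<in>I. f i \<omega>)"
  by (induction I rule: infinite_finite_induct) (auto intro: L4_add)

lemma L4_prod4:
  assumes "L4 a" "L4 b" "L4 c" "L4 d"
  shows "integrable M (\<lambda>\<omega>. a \<omega> * b \<omega> * c \<omega> * d \<omega>)"
proof (rule Bochner_Integration.integrable_bound)
  show "integrable M (\<lambda>\<omega>. a \<omega> ^ 4 + b \<omega> ^ 4 + c \<omega> ^ 4 + d \<omega> ^ 4)"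
    using assms by (auto simp: L4_def)
  show "AE \<omega> in M. norm (a \<omega> * b \<omega> * c \<omega> * d \<omega>) \<le> norm (a \<omega> ^ 4 + b \<omega> ^ 4 + c \<omega> ^ 4 + d \<omega> ^ 4)"
    using prod4_le by (auto intro: order_trans[OF _ abs_ge_self])
qed (use assms in \<open>auto simp: L4_def\<close>)

lemma L4_prod3: "L4 a \<Longrightarrow> L4 b \<Longrightarrow> L4 c \<Longrightarrow> integrable M (\<lambda>\<omega>. a \<omega> * b \<omega> * c \<omega>)"
  using L4_prod4[of a b c "\<lambda>_. 1"] by simp

lemma L4_prod2: "L4 a \<Longrightarrow> L4 b \<Longrightarrow> integrable M (\<lambda>\<omega>. a \<omega> * b \<omega>)"
  using L4_prod3[of a b "\<lambda>_. 1"] by simp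

lemma L4_integrable: "L4 a \<Longrightarrow> integrable M a"
  using L4_prod2[of a "\<lambda>_. 1"] by simp

lemma L4_sq: "L4 a \<Longrightarrow> integrable M (\<lambda>\<omega>. (a \<omega>)\<^sup>2)"
  using L4_prod2[of a a] by (simp add: power2_eq_square)

lemma L4_cube: "L4 a \<Longrightarrow> integrable M (\<lambda>\<omega>. a \<omega> ^ 3)"
  using L4_prod3[of a a a] by (simp add: power3_eq_cube)

lemma L4_sq_sq: "L4 a \<Longrightarrow> L4 b \<Longrightarrow> integrable M (\<lambda>\<omega>. (a \<omega>)\<^sup>2 * (b \<omega>)\<^sup>2)"
  using L4_prod4[of a a b b] by (simp add: power2_eq_square mult.assoc)

lemma expectation_square_le:
  fixes f :: "'a \<Rightarrow> real"
  assumes [measurable]: "f \<in> borel_measurable M" and int: "integrable M (\<lambda>\<omega>. (f \<omega>)\<^sup>2)"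
  shows "integrable M f" "(expectation f)\<^sup>2 \<le> expectation (\<lambda>\<omega>. (f \<omega>)\<^sup>2)"
proof -
  have *: "\<bar>y\<bar> \<le> 1 + y\<^sup>2" for y :: real
    using zero_le_power2[of "\<bar>y\<bar> - 1/2"] by (simp add: power2_diff power2_abs power2_eq_square[of "1/2"])
  show f: "integrable M f"
    by (rule Bochner_Integration.integrable_bound[of _ "\<lambda>\<omega>. 1 + (f \<omega>)\<^sup>2"])
       (use int in \<open>auto intro!: AE_I2 order_trans[OF *]\<close>)
  have "0 \<le> expectation (\<lambda>\<omega>. (f \<omega> - expectation f)\<^sup>2)" by simp
  then show "(expectation f)\<^sup>2 \<le> expectation (\<lambda>\<omega>. (f \<omega>)\<^sup>2)"
    using f int variance_eq[of f] by simp
qed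

text \<open>The bounds \<open>A\<close> and \<open>B\<close> are chosen by the caller, because the
  second moments are known only up to explicit constants. For positive \<open>a\<close> and
  \<open>b\<close> above them the claim comes from expanding E (b f - a g)^2 \<ge> 0.\<close>

lemma expectation_Cauchy_Schwarz:
  assumes "integrable M (\<lambda>\<omega>. (f \<omega>)\<^sup>2)" "integrable M (\<lambda>\<omega>. (g \<omega>)\<^sup>2)" "integrable M (\<lambda>\<omega>. f \<omega> * g \<omega> :: real)"
    and "expectation (\<lambda>\<omega>. (f \<omega>)\<^sup>2) \<le> A\<^sup>2" "expectation (\<lambda>\<omega>. (g \<omega>)\<^sup>2) \<le> B\<^sup>2" "0 \<le> A" "0 \<le> B"
  shows "expectation (\<lambda>\<omega>. f \<omega> * g \<omega>) \<le> A * B"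
proof -
  have *: "expectation (\<lambda>\<omega>. f \<omega> * g \<omega>) \<le> a * b" if "A \<le> a" "B \<le> b" "0 < a" "0 < b" for a b
  proof -
    have "0 \<le> expectation (\<lambda>\<omega>. (b * f \<omega> - a * g \<omega>)\<^sup>2)" by simp
    also have "(\<lambda>\<omega>. (b * f \<omega> - a * g \<omega>)\<^sup>2) =
      (\<lambda>\<omega>. b\<^sup>2 * (f \<omega>)\<^sup>2 + a\<^sup>2 * (g \<omega>)\<^sup>2 - 2 * a * b * (f \<omega> * g \<omega>))"
      by (auto simp: power2_eq_square algebra_simps)
    also have "expectation \<dots> = b\<^sup>2 * expectation (\<lambda>\<omega>. (f \<omega>)\<^sup>2) + a\<^sup>2 * expectation (\<lambda>\<omega>. (g \<omega>)\<^sup>2)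
        - 2 * a * b * expectation (\<lambda>\<omega>. f \<omega> * g \<omega>)"
      using assms by simp
    also have "\<dots> \<le> b\<^sup>2 * a\<^sup>2 + a\<^sup>2 * b\<^sup>2 - 2 * a * b * expectation (\<lambda>\<omega>. f \<omega> * g \<omega>)"
    proof -
      have "A\<^sup>2 \<le> a\<^sup>2" "B\<^sup>2 \<le> b\<^sup>2" using assms that by (auto intro!: power_mono)
      with assms show ?thesis
        by (intro diff_right_mono add_mono mult_left_mono) auto
    qed
    finally have "(a * b) * expectation (\<lambda>\<omega>. f \<omega> * g \<omega>) \<le> (a * b) * (a * b)"
      by (simp add: power2_eq_square algebra_simps)
    then show ?thesis using that by (simp add: mult_le_cancel_left_pos)
  qed
  \<comment> \<open>\<open>A\<close> or \<open>B\<close> may be 0, where the division by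
    \<open>a * b\<close> breaks down; the strict case passes to the limit.\<close>
  have "((\<lambda>e. (A + e) * (B + e)) \<longlongrightarrow> (A + 0) * (B + 0)) (at_right 0)"
    by (intro tendsto_intros)
  then have "((\<lambda>e. (A + e) * (B + e)) \<longlongrightarrow> A * B) (at_right 0)" by simp
  then show ?thesis
    by (rule tendsto_lowerbound) (auto simp: eventually_at_right_less intro!: eventually_at_rightI[of 0 1] * assms add_nonneg_pos)
qed

end

text \<open>Eighth moments are what polynomials of degree two need, since their fourth powers
  contain \<open>x i ^ 8\<close>. The bounds depend on the distributions through \<open>K\<close>
  only, and \<open>1 \<le> K\<close> lets lower powers of \<open>K\<close> be absorbed into higher
  ones.\<close>

locale indep_std = prob_space M for M :: "'a measure" +
  fixes n :: nat and x :: "nat \<Rightarrow> 'a \<Rightarrow> real" and K :: real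
  assumes indep: "indep_vars (\<lambda>_. borel) x {..<n}"
    and mean: "i < n \<Longrightarrow> expectation (x i) = 0"
    and var: "i < n \<Longrightarrow> expectation (\<lambda>\<omega>. (x i \<omega>)\<^sup>2) = 1"
    and int8: "i < n \<Longrightarrow> integrable M (\<lambda>\<omega>. x i \<omega> ^ 8)"
    and mom8: "i < n \<Longrightarrow> expectation (\<lambda>\<omega>. x i \<omega> ^ 8) \<le> K"
    and K_ge_1: "1 \<le> K"
begin

lemma x_measurable [measurable]: "i < n \<Longrightarrow> x i \<in> borel_measurable M"
  using indep by (auto simp: indep_vars_def)

lemma L4_x2: "i < n \<Longrightarrow> L4 (\<lambda>\<omega>. (x i \<omega>)\<^sup>2)"
  using int8[of i] by (auto simp: L4_def)

lemma L4_x: assumes "i < n" shows "L4 (x i)"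
proof (rule L4_bound)
  show "integrable M (\<lambda>\<omega>. 1 + x i \<omega> ^ 8)" using int8[OF assms] by auto
  have "y ^ 4 \<le> 1 + y ^ 8" for y :: real
    using zero_le_power2[of "y ^ 4 - 1/2"] by (simp add: power2_diff power2_eq_square[of "1/2"])
  then show "x i \<omega> ^ 4 \<le> 1 + x i \<omega> ^ 8" for \<omega> .
qed (use assms in simp)

lemma x_integrable: "i < n \<Longrightarrow> integrable M (x i)"
  using L4_x L4_integrable by blast

lemma mom4: assumes "i < n" shows "expectation (\<lambda>\<omega>. x i \<omega> ^ 4) \<le> K"
proof -
  have "y ^ 4 \<le> (1 + y ^ 8) / 2" for y :: real
    using zero_le_power2[of "y ^ 4 - 1"] by (simp add: power2_diff)
  then have "expectation (\<lambda>\<omega>. x i \<omega> ^ 4) \<le> expectation (\<lambda>\<omega>. (1 + x i \<omega> ^ 8) / 2)"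
    using L4_int4[OF L4_x[OF assms]] int8[OF assms] by (intro integral_mono) auto
  also have "\<dots> = (1 + expectation (\<lambda>\<omega>. x i \<omega> ^ 8)) / 2"
    using int8[OF assms] by (simp add: prob_space)
  also have "\<dots> \<le> K" using mom8[OF assms] K_ge_1 by simp
  finally show ?thesis .
qed

text \<open>The two factors read disjoint blocks of the family. \<open>indep_var_restrict\<close>
  speaks of restricted families; \<open>eq\<close> says that \<open>G\<close> reads only the
  coordinates in \<open>J\<close> and so removes the restriction. The value type is general because
  \<open>G\<close> will also be a complex exponential.\<close>

lemma indep_one:
  fixes f :: "real \<Rightarrow> 'b::{real_normed_field, banach, second_countable_topology}"
    and G :: "(nat \<Rightarrow> real) \<Rightarrow> 'b"
  assumes k: "k < n" and J: "J \<subseteq> {..<n}" "k \<notin> J"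
    and f: "f \<in> borel_measurable borel" and G: "G \<in> borel_measurable (Pi\<^sub>M J (\<lambda>_. borel))"
    and eq: "\<And>y. G (restrict y J) = G y"
    and int: "integrable M (\<lambda>\<omega>. f (x k \<omega>))" "integrable M (\<lambda>\<omega>. G (\<lambda>i. x i \<omega>))"
  shows "integrable M (\<lambda>\<omega>. f (x k \<omega>) * G (\<lambda>i. x i \<omega>))"
    "expectation (\<lambda>\<omega>. f (x k \<omega>) * G (\<lambda>i. x i \<omega>)) =
       expectation (\<lambda>\<omega>. f (x k \<omega>)) * expectation (\<lambda>\<omega>. G (\<lambda>i. x i \<omega>))"
proof -
  have "indep_var
    borel ((\<lambda>y. f (y k)) \<circ> (\<lambda>\<omega>. restrict (\<lambda>i. x i \<omega>) {k}))
    borel (G \<circ> (\<lambda>\<omega>. restrict (\<lambda>i. x i \<omega>) J))"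
    using k J f G
    by (intro indep_var_compose[OF indep_var_restrict[OF indep]]) auto
  also have "((\<lambda>y. f (y k)) \<circ> (\<lambda>\<omega>. restrict (\<lambda>i. x i \<omega>) {k})) = (\<lambda>\<omega>. f (x k \<omega>))"
    by auto
  also have "(G \<circ> (\<lambda>\<omega>. restrict (\<lambda>i. x i \<omega>) J)) = (\<lambda>\<omega>. G (\<lambda>i. x i \<omega>))"
    by (auto simp: eq)
  finally have *: "indep_var borel (\<lambda>\<omega>. f (x k \<omega>)) borel (\<lambda>\<omega>. G (\<lambda>i. x i \<omega>))" .
  show "integrable M (\<lambda>\<omega>. f (x k \<omega>) * G (\<lambda>i. x i \<omega>))"
    "expectation (\<lambda>\<omega>. f (x k \<omega>) * G (\<lambda>i. x i \<omega>)) =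
       expectation (\<lambda>\<omega>. f (x k \<omega>)) * expectation (\<lambda>\<omega>. G (\<lambda>i. x i \<omega>))"
    using indep_var_integrable[OF * int] indep_var_lebesgue_integral[OF * int] by auto
qed

end

section \<open>Fourth moments of linear forms and of polynomials of degree two\<close>

context indep_std
begin

lemma L4_lin: "k \<le> n \<Longrightarrow> L4 (\<lambda>\<omega>. \<Sum>i<k. a i * x i \<omega>)"
  by (intro L4_sum L4_cmult L4_x) auto

lemma expectation_lin: "k \<le> n \<Longrightarrow> expectation (\<lambda>\<omega>. \<Sum>i<k. a i * x i \<omega>) = 0"
  by (subst Bochner_Integration.integral_sum) (auto simp: mean intro!: x_integrable)

lemma expectation_x4_bounds:
  assumes "i < n"
  shows "expectation (\<lambda>\<omega>. ((x i \<omega>)\<^sup>2 - 1)\<^sup>2) \<le> K" "expectation (\<lambda>\<omega>. ((x i \<omega>)\<^sup>2 - 1) ^ 4) \<le> 16 * K"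
proof -
  have i2: "integrable M (\<lambda>\<omega>. (x i \<omega>)\<^sup>2)" and i4: "integrable M (\<lambda>\<omega>. x i \<omega> ^ 4)"
    using L4_x[OF assms] L4_sq L4_int4 by auto
  have "(\<lambda>\<omega>. ((x i \<omega>)\<^sup>2 - 1)\<^sup>2) = (\<lambda>\<omega>. x i \<omega> ^ 4 - 2 * (x i \<omega>)\<^sup>2 + 1)"
    by (auto simp: power2_diff)
  then show "expectation (\<lambda>\<omega>. ((x i \<omega>)\<^sup>2 - 1)\<^sup>2) \<le> K"
    using i2 i4 mom4[OF assms] var[OF assms] by (simp add: prob_space)
  have "expectation (\<lambda>\<omega>. ((x i \<omega>)\<^sup>2 - 1) ^ 4) \<le> expectation (\<lambda>\<omega>. 8 * (x i \<omega> ^ 8 + 1))"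
  proof (rule integral_mono)
    show "integrable M (\<lambda>\<omega>. ((x i \<omega>)\<^sup>2 - 1) ^ 4)"
      using L4_diff[OF L4_x2[OF assms] L4_const[of 1]] by (rule L4_int4)
    show "((x i \<omega>)\<^sup>2 - 1) ^ 4 \<le> 8 * (x i \<omega> ^ 8 + 1)" for \<omega>
      using add_pow4_le[of "(x i \<omega>)\<^sup>2" "- 1"] by simp
  qed (use int8[OF assms] in auto)
  also have "\<dots> = 8 * (expectation (\<lambda>\<omega>. x i \<omega> ^ 8) + 1)"
    using int8[OF assms] by (simp add: prob_space)
  also have "\<dots> \<le> 16 * K" using mom8[OF assms] K_ge_1 by simp
  finally show "expectation (\<lambda>\<omega>. ((x i \<omega>)\<^sup>2 - 1) ^ 4) \<le> 16 * K" .
qed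

lemma indep_lin_pow:
  fixes f :: "real \<Rightarrow> real"
  assumes "k < n" "f \<in> borel_measurable borel"
    and "integrable M (\<lambda>\<omega>. f (x k \<omega>))" "integrable M (\<lambda>\<omega>. (\<Sum>i<k. a i * x i \<omega>) ^ m)"
  shows "expectation (\<lambda>\<omega>. f (x k \<omega>) * (\<Sum>i<k. a i * x i \<omega>) ^ m) =
    expectation (\<lambda>\<omega>. f (x k \<omega>)) * expectation (\<lambda>\<omega>. (\<Sum>i<k. a i * x i \<omega>) ^ m)"
  using assms by (intro indep_one(2)[where J="{..<k}" and G="\<lambda>y. (\<Sum>i<k. a i * y i) ^ m"]) auto

lemma second_moment_lin:
  "k \<le> n \<Longrightarrow> expectation (\<lambda>\<omega>. (\<Sum>i<k. a i * x i \<omega>)\<^sup>2) = (\<Sum>i<k. (a i)\<^sup>2)"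
proof (induction k)
  case (Suc k)
  define S where "S \<omega> = (\<Sum>i<k. a i * x i \<omega>)" for \<omega>
  have k: "k < n" using Suc by simp
  have S: "L4 S" using L4_lin[of k a] k unfolding S_def[abs_def] by simp
  have eq: "(\<lambda>\<omega>. (\<Sum>i<Suc k. a i * x i \<omega>)\<^sup>2) =
    (\<lambda>\<omega>. (S \<omega>)\<^sup>2 + 2 * a k * (x k \<omega> * S \<omega> ^ 1) + (a k)\<^sup>2 * (x k \<omega>)\<^sup>2)"
    unfolding S_def by (auto simp: power2_eq_square algebra_simps)
  have "expectation (\<lambda>\<omega>. x k \<omega> * S \<omega> ^ 1) = 0"
    unfolding S_def using k indep_lin_pow[OF k, of "\<lambda>t. t" a 1] mean[OF k] x_integrable[OF k]
      L4_integrable[OF S[unfolded S_def[abs_def]]] by simp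
  then show ?case
    unfolding eq using L4_sq[OF S] L4_sq[OF L4_x[OF k]] L4_prod2[OF L4_x[OF k] S] Suc var[OF k]
    by (simp add: S_def)
qed (simp add: prob_space)

text \<open>Expand the fourth power in the new variable \<open>x k\<close>, which is independent of
  the old sum. The odd terms vanish since both have mean zero, and the rest is dominated by the
  completed square \<open>3 * K * (A + (a k)\<^sup>2)\<^sup>2\<close>; the coefficient 6 of the
  middle term is what asks for the factor 3.\<close>

lemma fourth_moment_lin:
  "k \<le> n \<Longrightarrow> expectation (\<lambda>\<omega>. (\<Sum>i<k. a i * x i \<omega>) ^ 4) \<le> 3 * K * (\<Sum>i<k. (a i)\<^sup>2)\<^sup>2"
proof (induction k)
  case (Suc k)
  define S where "S \<omega> = (\<Sum>i<k. a i * x i \<omega>)" for \<omega>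
  define A where "A = (\<Sum>i<k. (a i)\<^sup>2)"
  have k: "k < n" using Suc by simp
  have S: "L4 S" using L4_lin[of k a] k unfolding S_def[abs_def] by simp
  have eq: "(\<lambda>\<omega>. (\<Sum>i<Suc k. a i * x i \<omega>) ^ 4) =
    (\<lambda>\<omega>. S \<omega> ^ 4 + 4 * a k * (x k \<omega> * S \<omega> ^ 3) + 6 * (a k)\<^sup>2 * ((x k \<omega>)\<^sup>2 * S \<omega> ^ 2)
       + 4 * (a k) ^ 3 * (x k \<omega> ^ 3 * S \<omega> ^ 1) + (a k) ^ 4 * (x k \<omega>) ^ 4)"
    unfolding S_def by (rule ext) (simp add: eval_nat_numeral algebra_simps)
  have i: "integrable M (\<lambda>\<omega>. x k \<omega> * S \<omega> ^ 3)" "integrable M (\<lambda>\<omega>. (x k \<omega>)\<^sup>2 * S \<omega> ^ 2)"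
    "integrable M (\<lambda>\<omega>. x k \<omega> ^ 3 * S \<omega> ^ 1)"
    using L4_prod4[OF L4_x[OF k] S S S] L4_sq_sq[OF L4_x[OF k] S]
      L4_prod4[OF L4_x[OF k] L4_x[OF k] L4_x[OF k] S]
    by (simp_all add: power3_eq_cube mult.assoc)
  have "expectation (\<lambda>\<omega>. x k \<omega> * S \<omega> ^ 3) = 0"
    unfolding S_def using k indep_lin_pow[OF k, of "\<lambda>t. t" a 3] mean[OF k] x_integrable[OF k]
      L4_cube[OF S[unfolded S_def[abs_def]]] by simp
  moreover have "expectation (\<lambda>\<omega>. (x k \<omega>)\<^sup>2 * S \<omega> ^ 2) = A"
    unfolding S_def A_def
    using k indep_lin_pow[OF k, of "\<lambda>t. t\<^sup>2" a 2] var[OF k] L4_sq[OF L4_x[OF k]]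
      L4_sq[OF S[unfolded S_def[abs_def]]] second_moment_lin[of k a] by simp
  moreover have "expectation (\<lambda>\<omega>. x k \<omega> ^ 3 * S \<omega> ^ 1) = 0"
    unfolding S_def using k indep_lin_pow[OF k, of "\<lambda>t. t ^ 3" a 1] L4_cube[OF L4_x[OF k]]
      L4_integrable[OF S[unfolded S_def[abs_def]]] expectation_lin[of k a] by simp
  ultimately have "expectation (\<lambda>\<omega>. (\<Sum>i<Suc k. a i * x i \<omega>) ^ 4) =
      expectation (\<lambda>\<omega>. S \<omega> ^ 4) + 6 * (a k)\<^sup>2 * A + (a k) ^ 4 * expectation (\<lambda>\<omega>. x k \<omega> ^ 4)"
    unfolding eq using L4_int4[OF S] L4_int4[OF L4_x[OF k]] i by simp
  also have "\<dots> \<le> 3 * K * A\<^sup>2 + 6 * K * ((a k)\<^sup>2 * A) + (a k) ^ 4 * (3 * K)"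
  proof (intro add_mono mult_left_mono)
    show "expectation (\<lambda>\<omega>. S \<omega> ^ 4) \<le> 3 * K * A\<^sup>2" using Suc by (simp add: S_def A_def)
    show "expectation (\<lambda>\<omega>. x k \<omega> ^ 4) \<le> 3 * K" using mom4[OF k] K_ge_1 by simp
    have "0 \<le> (a k)\<^sup>2 * A" by (simp add: A_def sum_nonneg)
    then have "1 * ((a k)\<^sup>2 * A) \<le> K * ((a k)\<^sup>2 * A)" using K_ge_1 by (intro mult_right_mono)
    then show "6 * (a k)\<^sup>2 * A \<le> 6 * K * ((a k)\<^sup>2 * A)" by simp
  qed simp
  also have "\<dots> = 3 * K * (A + (a k)\<^sup>2)\<^sup>2"
    by (simp add: power2_sum algebra_simps)
  finally show ?case by (simp add: A_def)
qed (simp add: prob_space)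

text \<open>Lower triangular coefficients: for independent standardised variables the summand of
  index \<open>i\<close> has conditional mean zero given the earlier ones. The partial sums in
  \<open>k\<close> then form a martingale, and their moments can be bounded by induction on
  \<open>k\<close>.\<close>

definition chaos :: "(nat \<Rightarrow> real) \<Rightarrow> (nat \<Rightarrow> nat \<Rightarrow> real) \<Rightarrow> nat \<Rightarrow> (nat \<Rightarrow> real) \<Rightarrow> real" where
  "chaos m N k y = (\<Sum>i<k. m i * ((y i)\<^sup>2 - 1) + y i * (\<Sum>j<i. N i j * y j))"

lemma chaos_restrict [simp]: "chaos m N k (restrict y {..<k}) = chaos m N k y"
  unfolding chaos_def by (intro sum.cong refl arg_cong2[where f="(+)"] arg_cong2[where f="(*)"]) auto

lemma chaos_measurable: "chaos m N k \<in> borel_measurable (Pi\<^sub>M {..<k} (\<lambda>_. borel))"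
proof -
  have "(\<lambda>y. \<Sum>j<i. N i j * y j) \<in> borel_measurable (Pi\<^sub>M {..<k} (\<lambda>_. borel))" if "i < k" for i
    using that by (intro borel_measurable_sum borel_measurable_times) auto
  then show ?thesis unfolding chaos_def
    by (intro borel_measurable_sum borel_measurable_add borel_measurable_times) auto
qed

text \<open>Adding \<open>x k\<close> changes the sum \<open>q\<close> by an increment
  \<open>D\<close> of conditional mean zero, hence E (q^3 D) = 0. The bound is kept as the square of
  a quantity linear in the coefficient sum: the mixed moment E (q^2 D^2), of order F times the new
  coefficients, then fits into the cross term of the square, and 24 K leaves enough room.\<close>

lemma fourth_moment_chaos:
  "k \<le> n \<Longrightarrow> L4 (\<lambda>\<omega>. chaos m N k (\<lambda>i. x i \<omega>)) \<and>
    expectation (\<lambda>\<omega>. chaos m N k (\<lambda>i. x i \<omega>) ^ 4) \<le> (24 * K * (\<Sum>i<k. (m i)\<^sup>2 + (\<Sum>j<i. (N i j)\<^sup>2)))\<^sup>2"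
proof (induction k)
  case 0
  have *: "chaos m N 0 = (\<lambda>_. 0)" by (simp add: chaos_def fun_eq_iff)
  show ?case unfolding * by simp
next
  case (Suc k)
  define q where "q \<omega> = chaos m N k (\<lambda>i. x i \<omega>)" for \<omega>
  define F where "F = 24 * K * (\<Sum>i<k. (m i)\<^sup>2 + (\<Sum>j<i. (N i j)\<^sup>2))"
  define L where "L \<omega> = (\<Sum>j<k. N k j * x j \<omega>)" for \<omega>
  define l where "l = (\<Sum>j<k. (N k j)\<^sup>2)"
  define y where "y \<omega> = (x k \<omega>)\<^sup>2 - 1" for \<omega>
  define D where "D \<omega> = m k * y \<omega> + x k \<omega> * L \<omega>" for \<omega>
  have k: "k < n" and k': "k \<le> n" using Suc by auto
  have qL: "L4 q" and qF: "expectation (\<lambda>\<omega>. q \<omega> ^ 4) \<le> F\<^sup>2"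
    using Suc.IH[OF k'] unfolding q_def[abs_def] F_def by auto
  have F0: "0 \<le> F" and l0: "0 \<le> l" using K_ge_1 by (auto simp: F_def l_def intro!: mult_nonneg_nonneg sum_nonneg add_nonneg_nonneg)
  have L: "L4 L" unfolding L_def[abs_def] by (rule L4_lin[OF k'])
  have X: "L4 (x k)" by (rule L4_x[OF k])
  have Y: "L4 y" unfolding y_def[abs_def] by (intro L4_diff L4_x2 k L4_const)
  have [measurable]: "q \<in> borel_measurable M" "L \<in> borel_measurable M" "x k \<in> borel_measurable M"
    using qL L X by (auto simp: L4_def)
  have L_meas: "(\<lambda>y. \<Sum>j<k. N k j * y j) \<in> borel_measurable (Pi\<^sub>M {..<k} (\<lambda>_. borel))"
    by (intro borel_measurable_sum borel_measurable_times) auto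
  \<comment> \<open>Both \<open>q\<close> and \<open>L\<close> are functions of the variables before
    \<open>k\<close>, so \<open>x k\<close> separates from any joint function of the two.\<close>
  have fac: "integrable M (\<lambda>\<omega>. f (x k \<omega>) * g (q \<omega>) (L \<omega>))"
       "expectation (\<lambda>\<omega>. f (x k \<omega>) * g (q \<omega>) (L \<omega>)) = expectation (\<lambda>\<omega>. f (x k \<omega>)) * expectation (\<lambda>\<omega>. g (q \<omega>) (L \<omega>))"
    if "f \<in> borel_measurable borel" "case_prod g \<in> borel_measurable (borel \<Otimes>\<^sub>M borel)"
      "integrable M (\<lambda>\<omega>. f (x k \<omega>))" "integrable M (\<lambda>\<omega>. g (q \<omega>) (L \<omega>))" for f :: "real \<Rightarrow> real" and g
  proof -
    have "(\<lambda>y. (chaos m N k y, \<Sum>j<k. N k j * y j)) \<in> Pi\<^sub>M {..<k} (\<lambda>_. borel) \<rightarrow>\<^sub>M borel \<Otimes>\<^sub>M borel"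
      using L_meas chaos_measurable by measurable
    from measurable_compose[OF this that(2)]
    have "(\<lambda>y. g (chaos m N k y) (\<Sum>j<k. N k j * y j)) \<in> borel_measurable (Pi\<^sub>M {..<k} (\<lambda>_. borel))"
      by simp
    from indep_one[where J="{..<k}" and G = "\<lambda>y. g (chaos m N k y) (\<Sum>j<k. N k j * y j)", OF k _ _ that(1) this]
    show "integrable M (\<lambda>\<omega>. f (x k \<omega>) * g (q \<omega>) (L \<omega>))"
       "expectation (\<lambda>\<omega>. f (x k \<omega>) * g (q \<omega>) (L \<omega>)) = expectation (\<lambda>\<omega>. f (x k \<omega>)) * expectation (\<lambda>\<omega>. g (q \<omega>) (L \<omega>))"
      using that k unfolding q_def L_def by auto
  qed
  have xL4: "integrable M (\<lambda>\<omega>. x k \<omega> ^ 4 * L \<omega> ^ 4)"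
    and ExL4: "expectation (\<lambda>\<omega>. x k \<omega> ^ 4 * L \<omega> ^ 4) \<le> K * (3 * K * l\<^sup>2)"
  proof -
    show "integrable M (\<lambda>\<omega>. x k \<omega> ^ 4 * L \<omega> ^ 4)"
      using L4_int4[OF X] L4_int4[OF L] by (intro fac(1)[of "\<lambda>t. t ^ 4" "\<lambda>_ l. l ^ 4"]) auto
    have "expectation (\<lambda>\<omega>. x k \<omega> ^ 4 * L \<omega> ^ 4) = expectation (\<lambda>\<omega>. x k \<omega> ^ 4) * expectation (\<lambda>\<omega>. L \<omega> ^ 4)"
      using L4_int4[OF X] L4_int4[OF L] by (intro fac(2)[of "\<lambda>t. t ^ 4" "\<lambda>_ l. l ^ 4"]) auto
    also have "\<dots> \<le> K * (3 * K * l\<^sup>2)"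
      using mom4[OF k] fourth_moment_lin[OF k', of "N k"] K_ge_1 unfolding L_def l_def
      by (intro mult_mono) auto
    finally show "expectation (\<lambda>\<omega>. x k \<omega> ^ 4 * L \<omega> ^ 4) \<le> K * (3 * K * l\<^sup>2)" .
  qed
  have xL: "L4 (\<lambda>\<omega>. x k \<omega> * L \<omega>)"
    unfolding L4_def using xL4 by (simp add: power_mult_distrib)
  have DL: "L4 D" unfolding D_def[abs_def] by (intro L4_add L4_cmult Y xL)
  have Ey: "expectation y = 0"
    unfolding y_def using L4_sq[OF X] var[OF k] by (simp add: prob_space)
  have q3D: "expectation (\<lambda>\<omega>. q \<omega> ^ 3 * D \<omega>) = 0"
  proof -
    have 1: "expectation (\<lambda>\<omega>. y \<omega> * q \<omega> ^ 3) = 0"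
      using fac(2)[of "\<lambda>t. t\<^sup>2 - 1" "\<lambda>q l. q ^ 3"] L4_cube[OF qL] L4_integrable[OF Y] Ey
      unfolding y_def by simp
    have 2: "expectation (\<lambda>\<omega>. x k \<omega> * (q \<omega> ^ 3 * L \<omega>)) = 0"
      using fac(2)[of "\<lambda>t. t" "\<lambda>q l. q ^ 3 * l"] L4_prod4[OF qL qL qL L] L4_integrable[OF X] mean[OF k]
      by (simp add: power3_eq_cube)
    have 3: "integrable M (\<lambda>\<omega>. y \<omega> * q \<omega> ^ 3)" "integrable M (\<lambda>\<omega>. x k \<omega> * (q \<omega> ^ 3 * L \<omega>))"
      using L4_prod4[OF Y qL qL qL] L4_prod4[OF qL qL qL xL] by (simp_all add: power3_eq_cube mult_ac)
    have "(\<lambda>\<omega>. q \<omega> ^ 3 * D \<omega>) = (\<lambda>\<omega>. m k * (y \<omega> * q \<omega> ^ 3) + x k \<omega> * (q \<omega> ^ 3 * L \<omega>))"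
      by (auto simp: D_def algebra_simps)
    then show ?thesis using 1 2 3 by simp
  qed
  have q2D2: "expectation (\<lambda>\<omega>. (q \<omega>)\<^sup>2 * (D \<omega>)\<^sup>2) \<le> 2 * K * (m k)\<^sup>2 * F + 4 * K * F * l"
  proof -
    have Eq2: "expectation (\<lambda>\<omega>. (q \<omega>)\<^sup>2) \<le> F"
    proof (rule power2_le_imp_le[OF order_trans[OF _ qF] F0])
      have "integrable M (\<lambda>\<omega>. ((q \<omega>)\<^sup>2)\<^sup>2)" using L4_int4[OF qL] by simp
      from expectation_square_le(2)[OF _ this] show "(expectation (\<lambda>\<omega>. (q \<omega>)\<^sup>2))\<^sup>2 \<le> expectation (\<lambda>\<omega>. q \<omega> ^ 4)"
        by simp
    qed
    have l: "3 * K * l\<^sup>2 \<le> (2 * K * l)\<^sup>2"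
    proof -
      have "3 * K \<le> 4 * K\<^sup>2" using K_ge_1 by (simp add: power2_eq_square)
      then have "3 * K * l\<^sup>2 \<le> 4 * K\<^sup>2 * l\<^sup>2" by (intro mult_right_mono) auto
      then show ?thesis by (simp add: power_mult_distrib)
    qed
    \<comment> \<open>\<open>q\<close> and \<open>L\<close> are dependent; Cauchy-Schwarz reduces
      the mixed moment to their fourth moments.\<close>
    have EqL: "expectation (\<lambda>\<omega>. (q \<omega>)\<^sup>2 * (L \<omega>)\<^sup>2) \<le> F * (2 * K * l)"
    proof (rule expectation_Cauchy_Schwarz)
      show "expectation (\<lambda>\<omega>. ((L \<omega>)\<^sup>2)\<^sup>2) \<le> (2 * K * l)\<^sup>2"
        using fourth_moment_lin[OF k', of "N k"] l unfolding L_def l_def by simp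
      show "0 \<le> 2 * K * l" using K_ge_1 l0 by simp
    qed (use L4_int4[OF qL] L4_int4[OF L] L4_sq_sq[OF qL L] qF F0 in auto)
    have i1: "integrable M (\<lambda>\<omega>. (y \<omega>)\<^sup>2 * (q \<omega>)\<^sup>2)" by (rule L4_sq_sq[OF Y qL])
    have i2: "integrable M (\<lambda>\<omega>. (x k \<omega>)\<^sup>2 * ((q \<omega>)\<^sup>2 * (L \<omega>)\<^sup>2))"
    proof -
      have "(\<lambda>\<omega>. (x k \<omega>)\<^sup>2 * ((q \<omega>)\<^sup>2 * (L \<omega>)\<^sup>2)) = (\<lambda>\<omega>. (x k \<omega> * L \<omega>)\<^sup>2 * (q \<omega>)\<^sup>2)"
        by (auto simp: power_mult_distrib)
      then show ?thesis using L4_sq_sq[OF xL qL] by simp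
    qed
    have e1: "expectation (\<lambda>\<omega>. (y \<omega>)\<^sup>2 * (q \<omega>)\<^sup>2) \<le> K * F"
    proof -
      have "expectation (\<lambda>\<omega>. (y \<omega>)\<^sup>2 * (q \<omega>)\<^sup>2) = expectation (\<lambda>\<omega>. (y \<omega>)\<^sup>2) * expectation (\<lambda>\<omega>. (q \<omega>)\<^sup>2)"
        unfolding y_def
        by (rule fac(2)[of "\<lambda>t. (t\<^sup>2 - 1)\<^sup>2" "\<lambda>q l. q\<^sup>2"])
           (use L4_sq[OF qL] L4_sq[OF Y[unfolded y_def[abs_def]]] in simp_all)
      also have "\<dots> \<le> K * F" unfolding y_def
        using expectation_x4_bounds(1)[OF k] Eq2 K_ge_1 by (intro mult_mono) auto
      finally show ?thesis .
    qed
    have e2: "expectation (\<lambda>\<omega>. (x k \<omega>)\<^sup>2 * ((q \<omega>)\<^sup>2 * (L \<omega>)\<^sup>2)) \<le> F * (2 * K * l)"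
      using fac(2)[of "\<lambda>t. t\<^sup>2" "\<lambda>q l. q\<^sup>2 * l\<^sup>2"] L4_sq_sq[OF qL L] L4_sq[OF X] var[OF k] EqL by simp
    have "expectation (\<lambda>\<omega>. (q \<omega>)\<^sup>2 * (D \<omega>)\<^sup>2) \<le>
      expectation (\<lambda>\<omega>. 2 * (m k)\<^sup>2 * ((y \<omega>)\<^sup>2 * (q \<omega>)\<^sup>2) + 2 * ((x k \<omega>)\<^sup>2 * ((q \<omega>)\<^sup>2 * (L \<omega>)\<^sup>2)))"
    proof (rule integral_mono)
      fix \<omega>
      have "(D \<omega>)\<^sup>2 \<le> 2 * (m k * y \<omega>)\<^sup>2 + 2 * (x k \<omega> * L \<omega>)\<^sup>2"
        unfolding D_def using sum_squares_bound[of "m k * y \<omega>" "x k \<omega> * L \<omega>"] by (simp add: power2_sum)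
      then have "(q \<omega>)\<^sup>2 * (D \<omega>)\<^sup>2 \<le> (q \<omega>)\<^sup>2 * (2 * (m k * y \<omega>)\<^sup>2 + 2 * (x k \<omega> * L \<omega>)\<^sup>2)"
        by (intro mult_left_mono) auto
      then show "(q \<omega>)\<^sup>2 * (D \<omega>)\<^sup>2 \<le> 2 * (m k)\<^sup>2 * ((y \<omega>)\<^sup>2 * (q \<omega>)\<^sup>2) + 2 * ((x k \<omega>)\<^sup>2 * ((q \<omega>)\<^sup>2 * (L \<omega>)\<^sup>2))"
        by (simp add: power_mult_distrib algebra_simps)
    qed (use L4_sq_sq[OF qL DL] i1 i2 in auto)
    also have "\<dots> = 2 * (m k)\<^sup>2 * expectation (\<lambda>\<omega>. (y \<omega>)\<^sup>2 * (q \<omega>)\<^sup>2)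
        + 2 * expectation (\<lambda>\<omega>. (x k \<omega>)\<^sup>2 * ((q \<omega>)\<^sup>2 * (L \<omega>)\<^sup>2))"
      using i1 i2 by simp
    also have "\<dots> \<le> 2 * (m k)\<^sup>2 * (K * F) + 2 * (F * (2 * K * l))"
      using e1 e2 by (intro add_mono mult_left_mono) auto
    finally show ?thesis by (simp add: mult_ac)
  qed
  have D4: "expectation (\<lambda>\<omega>. D \<omega> ^ 4) \<le> 8 * ((m k) ^ 4 * (16 * K) + K * (3 * K * l\<^sup>2))"
  proof -
    have "expectation (\<lambda>\<omega>. D \<omega> ^ 4) \<le> expectation (\<lambda>\<omega>. 8 * ((m k) ^ 4 * y \<omega> ^ 4 + x k \<omega> ^ 4 * L \<omega> ^ 4))"
      using L4_int4[OF DL] L4_int4[OF Y] xL4 add_pow4_le[of "m k * y _" "x k _ * L _"]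
      by (intro integral_mono) (auto simp: D_def power_mult_distrib)
    also have "\<dots> = 8 * ((m k) ^ 4 * expectation (\<lambda>\<omega>. y \<omega> ^ 4) + expectation (\<lambda>\<omega>. x k \<omega> ^ 4 * L \<omega> ^ 4))"
      using L4_int4[OF Y] xL4 by simp
    also have "\<dots> \<le> 8 * ((m k) ^ 4 * (16 * K) + K * (3 * K * l\<^sup>2))"
      using ExL4 expectation_x4_bounds(2)[OF k] unfolding y_def
      by (intro mult_left_mono add_mono) auto
    finally show ?thesis .
  qed
  have qD: "chaos m N (Suc k) (\<lambda>i. x i \<omega>) = q \<omega> + D \<omega>" for \<omega>
    unfolding q_def D_def y_def L_def chaos_def by simp
  have "expectation (\<lambda>\<omega>. (q \<omega> + D \<omega>) ^ 4) \<le>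
     expectation (\<lambda>\<omega>. q \<omega> ^ 4 + 4 * (q \<omega> ^ 3 * D \<omega>) + 8 * ((q \<omega>)\<^sup>2 * (D \<omega>)\<^sup>2) + 3 * D \<omega> ^ 4)"
  proof (rule integral_mono)
    fix \<omega>
    \<comment> \<open>This square is exactly the difference of the two sides; it trades the term 4 q
      D^3 for even powers.\<close>
    have "0 \<le> 2 * (D \<omega>)\<^sup>2 * (q \<omega> - D \<omega>)\<^sup>2" by simp
    then show "(q \<omega> + D \<omega>) ^ 4 \<le> q \<omega> ^ 4 + 4 * (q \<omega> ^ 3 * D \<omega>) + 8 * ((q \<omega>)\<^sup>2 * (D \<omega>)\<^sup>2) + 3 * D \<omega> ^ 4"
      by (simp add: eval_nat_numeral algebra_simps)
  qed (use L4_int4[OF L4_add[OF qL DL]] L4_int4[OF DL] L4_int4[OF qL] L4_sq_sq[OF qL DL] L4_prod4[OF qL qL qL DL]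
      in \<open>auto simp: power3_eq_cube\<close>)
  also have "\<dots> = expectation (\<lambda>\<omega>. q \<omega> ^ 4) + 8 * expectation (\<lambda>\<omega>. (q \<omega>)\<^sup>2 * (D \<omega>)\<^sup>2) + 3 * expectation (\<lambda>\<omega>. D \<omega> ^ 4)"
    using L4_int4[OF DL] L4_int4[OF qL] L4_sq_sq[OF qL DL] L4_prod4[OF qL qL qL DL] q3D
    by (simp add: power3_eq_cube)
  also have "\<dots> \<le> F\<^sup>2 + 8 * (2 * K * (m k)\<^sup>2 * F + 4 * K * F * l) + 3 * (8 * ((m k) ^ 4 * (16 * K) + K * (3 * K * l\<^sup>2)))"
    using qF q2D2 D4 by (intro add_mono mult_left_mono) auto
  also have "\<dots> \<le> (F + 24 * K * ((m k)\<^sup>2 + l))\<^sup>2"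
  proof -
    have 1: "(m k) ^ 4 * (16 * K) \<le> 16 * K\<^sup>2 * (m k) ^ 4"
      using K_ge_1 by (simp add: power2_eq_square mult.commute mult_left_mono)
    have 2: "0 \<le> K * F * (m k)\<^sup>2" "0 \<le> K * F * l" "0 \<le> K\<^sup>2 * (m k)^4" "0 \<le> K\<^sup>2 * ((m k)\<^sup>2 * l)" "0 \<le> K\<^sup>2 * l\<^sup>2"
      using K_ge_1 F0 l0 by auto
    have "(F + 24 * K * ((m k)\<^sup>2 + l))\<^sup>2 = F\<^sup>2 + 48 * (K * F * (m k)\<^sup>2) + 48 * (K * F * l)
       + 576 * (K\<^sup>2 * (m k)^4) + 1152 * (K\<^sup>2 * ((m k)\<^sup>2 * l)) + 576 * (K\<^sup>2 * l\<^sup>2)"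
      by (simp add: power2_eq_square eval_nat_numeral algebra_simps)
    moreover have "8 * (2 * K * (m k)\<^sup>2 * F + 4 * K * F * l) = 16 * (K * F * (m k)\<^sup>2) + 32 * (K * F * l)"
      by (simp add: algebra_simps)
    moreover have "3 * (8 * ((m k) ^ 4 * (16 * K) + K * (3 * K * l\<^sup>2))) = 24 * ((m k) ^ 4 * (16 * K)) + 72 * (K\<^sup>2 * l\<^sup>2)"
      by (simp add: power2_eq_square algebra_simps)
    ultimately show ?thesis using 1 2 by argo
  qed
  finally show ?case using L4_add[OF qL DL] unfolding qD by (simp add: F_def l_def distrib_left add.assoc)
qed

end

section \<open>Matrices as functions of two indices, and their quadratic forms\<close>

lemma sum_square_split:
  fixes f :: "nat \<Rightarrow> nat \<Rightarrow> real"
  shows "(\<Sum>i<n. \<Sum>j<n. f i j) = (\<Sum>i<n. f i i + (\<Sum>j<i. f i j + f j i))"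
proof (induction n)
  case (Suc n)
  have "(\<Sum>i<Suc n. \<Sum>j<Suc n. f i j) = (\<Sum>i<n. \<Sum>j<n. f i j) + (f n n + (\<Sum>j<n. f n j + f j n))"
    by (simp add: sum.distrib)
  then show ?case using Suc by simp
qed simp

text \<open>Matrices are plain functions, of which only the entries below \<open>n\<close> matter.
  This avoids carrier conditions while the dimension varies; the matrices of the statement are
  translated in the section on least squares.\<close>

definition quad :: "nat \<Rightarrow> (nat \<Rightarrow> nat \<Rightarrow> real) \<Rightarrow> (nat \<Rightarrow> real) \<Rightarrow> real" where
  "quad n Q v = (\<Sum>i<n. \<Sum>k<n. Q i k * v i * v k)"

definition trace :: "nat \<Rightarrow> (nat \<Rightarrow> nat \<Rightarrow> real) \<Rightarrow> real" where
  "trace n Q = (\<Sum>i<n. Q i i)"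

definition frob2 :: "nat \<Rightarrow> (nat \<Rightarrow> nat \<Rightarrow> real) \<Rightarrow> real" where
  "frob2 n Q = (\<Sum>i<n. \<Sum>k<n. (Q i k)\<^sup>2)"

definition mv :: "nat \<Rightarrow> (nat \<Rightarrow> nat \<Rightarrow> real) \<Rightarrow> (nat \<Rightarrow> real) \<Rightarrow> nat \<Rightarrow> real" where
  "mv n Q v i = (\<Sum>k<n. Q i k * v k)"

definition ip :: "nat \<Rightarrow> (nat \<Rightarrow> real) \<Rightarrow> (nat \<Rightarrow> real) \<Rightarrow> real" where
  "ip n u v = (\<Sum>i<n. u i * v i)"

definition symm :: "nat \<Rightarrow> (nat \<Rightarrow> nat \<Rightarrow> real) \<Rightarrow> bool" where
  "symm n Q \<longleftrightarrow> (\<forall>i<n. \<forall>k<n. Q i k = Q k i)"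

context indep_std
begin

text \<open>Symmetry folds the upper triangle into the lower one, so the centred form is a
  \<open>chaos\<close> with coefficients \<open>Q i i\<close> and \<open>2 * Q i j\<close>. Their
  squares sum to at most \<open>2 * frob2 n Q\<close>, which turns 24 into 48.\<close>

lemma fourth_moment_quad:
  assumes "symm n Q"
  shows "L4 (\<lambda>\<omega>. quad n Q (\<lambda>i. x i \<omega>) - trace n Q)"
    "expectation (\<lambda>\<omega>. (quad n Q (\<lambda>i. x i \<omega>) - trace n Q) ^ 4) \<le> (48 * K * frob2 n Q)\<^sup>2"
proof -
  let ?m = "\<lambda>i. Q i i" and ?N = "\<lambda>i j. 2 * Q i j"
  have sym: "Q j i = Q i j" if "i < n" "j < i" for i j
    using assms that by (auto simp: symm_def)
  have eq: "quad n Q y - trace n Q = chaos ?m ?N n y" for y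
  proof -
    have "chaos ?m ?N n y = (\<Sum>i<n. (Q i i * y i * y i + (\<Sum>j<i. Q i j * y i * y j + Q j i * y j * y i)) - Q i i)"
      unfolding chaos_def
    proof (intro sum.cong refl)
      fix i assume i: "i \<in> {..<n}"
      have "(\<Sum>j<i. Q i j * y i * y j + Q j i * y j * y i) = y i * (\<Sum>j<i. 2 * Q i j * y j)"
        unfolding sum_distrib_left using i sym[of i] by (intro sum.cong refl) auto
      then show "Q i i * ((y i)\<^sup>2 - 1) + y i * (\<Sum>j<i. 2 * Q i j * y j) =
          (Q i i * y i * y i + (\<Sum>j<i. Q i j * y i * y j + Q j i * y j * y i)) - Q i i"
        by (simp add: power2_eq_square right_diff_distrib mult.assoc)
    qed
    then show ?thesis
      unfolding quad_def trace_def sum_square_split by (simp add: sum_subtractf)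
  qed
  have v: "(\<Sum>i<n. (?m i)\<^sup>2 + (\<Sum>j<i. (?N i j)\<^sup>2)) \<le> 2 * frob2 n Q"
  proof -
    have "2 * frob2 n Q = (\<Sum>i<n. 2 * (Q i i)\<^sup>2 + (\<Sum>j<i. (?N i j)\<^sup>2))"
    proof -
      have "(\<Sum>j<i. (?N i j)\<^sup>2) = 2 * (\<Sum>j<i. (Q i j)\<^sup>2 + (Q j i)\<^sup>2)" if "i < n" for i
        unfolding sum_distrib_left using that sym[of i] by (intro sum.cong refl) (auto simp: power_mult_distrib)
      then show ?thesis
        unfolding frob2_def sum_square_split sum_distrib_left[of 2 _ "{..<n}"]
        by (intro sum.cong refl) (simp add: distrib_left)
    qed
    also have "\<dots> \<ge> (\<Sum>i<n. (?m i)\<^sup>2 + (\<Sum>j<i. (?N i j)\<^sup>2))"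
      by (intro sum_mono add_right_mono) auto
    finally show ?thesis .
  qed
  show "L4 (\<lambda>\<omega>. quad n Q (\<lambda>i. x i \<omega>) - trace n Q)"
    unfolding eq using fourth_moment_chaos[of n ?m ?N] by simp
  have "expectation (\<lambda>\<omega>. chaos ?m ?N n (\<lambda>i. x i \<omega>) ^ 4) \<le> (24 * K * (\<Sum>i<n. (?m i)\<^sup>2 + (\<Sum>j<i. (?N i j)\<^sup>2)))\<^sup>2"
    using fourth_moment_chaos[of n ?m ?N] by simp
  also have "\<dots> \<le> (24 * K * (2 * frob2 n Q))\<^sup>2"
    using v K_ge_1 by (intro power_mono mult_left_mono mult_nonneg_nonneg sum_nonneg add_nonneg_nonneg) auto
  finally show "expectation (\<lambda>\<omega>. (quad n Q (\<lambda>i. x i \<omega>) - trace n Q) ^ 4) \<le> (48 * K * frob2 n Q)\<^sup>2"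
    unfolding eq by (simp add: mult_ac)
qed

lemma frob2_nonneg: "0 \<le> frob2 m Q"
  by (auto simp: frob2_def intro!: sum_nonneg)

text \<open>Jensen's inequality applied to the fourth moment. The constant is not sharp, but the
  order \<open>frob2\<close> is what counts.\<close>

lemma variance_quad:
  assumes "symm n Q"
  shows "expectation (\<lambda>\<omega>. (quad n Q (\<lambda>i. x i \<omega>) - trace n Q)\<^sup>2) \<le> 48 * K * frob2 n Q"
proof (rule power2_le_imp_le)
  let ?q = "\<lambda>\<omega>. quad n Q (\<lambda>i. x i \<omega>) - trace n Q"
  note L = fourth_moment_quad(1)[OF assms]
  have [measurable]: "?q \<in> borel_measurable M" using L by (simp add: L4_def)
  have "(expectation (\<lambda>\<omega>. (?q \<omega>)\<^sup>2))\<^sup>2 \<le> expectation (\<lambda>\<omega>. ((?q \<omega>)\<^sup>2)\<^sup>2)"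
    using L4_int4[OF L] by (intro expectation_square_le(2)) auto
  also have "\<dots> \<le> (48 * K * frob2 n Q)\<^sup>2" using fourth_moment_quad(2)[OF assms] by simp
  finally show "(expectation (\<lambda>\<omega>. (?q \<omega>)\<^sup>2))\<^sup>2 \<le> (48 * K * frob2 n Q)\<^sup>2" .
  show "0 \<le> 48 * K * frob2 n Q" using K_ge_1 frob2_nonneg by simp
qed

end

section \<open>Gram-Schmidt projections\<close>

definition is_proj :: "nat \<Rightarrow> (nat \<Rightarrow> nat \<Rightarrow> real) \<Rightarrow> bool" where
  "is_proj n Q \<longleftrightarrow> symm n Q \<and> (\<forall>i<n. \<forall>k<n. (\<Sum>l<n. Q i l * Q l k) = Q i k)"

text \<open>If \<open>c\<close> lies in the kernel of \<open>Q\<close>, the division by zero leaves \<open>Q\<close> unchanged.\<close>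
definition gs_step :: "nat \<Rightarrow> (nat \<Rightarrow> nat \<Rightarrow> real) \<Rightarrow> (nat \<Rightarrow> real) \<Rightarrow> nat \<Rightarrow> nat \<Rightarrow> real" where
  "gs_step n Q c i k = Q i k - mv n Q c i * mv n Q c k / quad n Q c"

text \<open>Multiplied out, this is the sum of squared deviations of the diagonal entries from their
  mean; the present form is the one in which a rank one change of \<open>Q\<close> can be
  expanded.\<close>

definition dev :: "nat \<Rightarrow> (nat \<Rightarrow> nat \<Rightarrow> real) \<Rightarrow> real" where
  "dev n Q = (\<Sum>i<n. (Q i i)\<^sup>2) - (trace n Q)\<^sup>2 / real n"

lemma quad_ip: "quad n Q v = ip n v (mv n Q v)"
  unfolding quad_def ip_def mv_def by (simp add: sum_distrib_left mult_ac)

lemma ip_commute: "ip n u v = ip n v u"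
  by (simp add: ip_def mult.commute)

lemma ip_mv_symm: "symm n Q \<Longrightarrow> ip n u (mv n Q v) = ip n (mv n Q u) v"
proof -
  assume s: "symm n Q"
  have "ip n u (mv n Q v) = (\<Sum>i<n. \<Sum>k<n. u i * (Q i k * v k))"
    by (simp add: ip_def mv_def sum_distrib_left)
  also have "\<dots> = (\<Sum>k<n. \<Sum>i<n. u i * (Q i k * v k))" by (rule sum.swap)
  also have "\<dots> = (\<Sum>k<n. \<Sum>i<n. Q k i * u i * v k)"
    using s by (intro sum.cong refl) (auto simp: symm_def)
  also have "\<dots> = ip n (mv n Q u) v"
    by (simp add: ip_def mv_def sum_distrib_right)
  finally show ?thesis .
qed

lemma mv_cong: "(\<And>k. k < n \<Longrightarrow> u k = v k) \<Longrightarrow> mv n Q u i = mv n Q v i"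
  by (simp add: mv_def)

lemma ip_cong: "(\<And>k. k < n \<Longrightarrow> u k = u' k) \<Longrightarrow> (\<And>k. k < n \<Longrightarrow> v k = v' k) \<Longrightarrow> ip n u v = ip n u' v'"
  by (simp add: ip_def)

lemma ip_self_nonneg: "0 \<le> ip n v v"
  by (auto simp: ip_def intro: sum_nonneg)

lemma ip_self_zero: "ip n v v = 0 \<Longrightarrow> i < n \<Longrightarrow> v i = 0"
  unfolding ip_def by (subst (asm) sum_nonneg_eq_0_iff) auto

context
  fixes n :: nat and Q :: "nat \<Rightarrow> nat \<Rightarrow> real"
  assumes Q: "is_proj n Q"
begin

lemma proj_symm: "symm n Q"
  using Q by (simp add: is_proj_def)

lemma proj_idem: "i < n \<Longrightarrow> k < n \<Longrightarrow> (\<Sum>l<n. Q i l * Q l k) = Q i k"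
  using Q by (simp add: is_proj_def)

lemma proj_mv_mv: "i < n \<Longrightarrow> mv n Q (mv n Q v) i = mv n Q v i"
proof -
  assume i: "i < n"
  have "mv n Q (mv n Q v) i = (\<Sum>k<n. \<Sum>l<n. Q i k * (Q k l * v l))"
    by (simp add: mv_def sum_distrib_left)
  also have "\<dots> = (\<Sum>l<n. \<Sum>k<n. Q i k * (Q k l * v l))" by (rule sum.swap)
  also have "\<dots> = (\<Sum>l<n. (\<Sum>k<n. Q i k * Q k l) * v l)"
    by (simp add: sum_distrib_right mult.assoc)
  also have "\<dots> = mv n Q v i" using i by (simp add: proj_idem mv_def)
  finally show ?thesis .
qed

lemma proj_quad: "quad n Q v = ip n (mv n Q v) (mv n Q v)"
proof -
  have "quad n Q v = ip n v (mv n Q (mv n Q v))"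
    unfolding quad_ip by (rule ip_cong) (auto simp: proj_mv_mv)
  also have "\<dots> = ip n (mv n Q v) (mv n Q v)" by (rule ip_mv_symm[OF proj_symm])
  finally show ?thesis .
qed

lemma proj_quad_nonneg: "0 \<le> quad n Q v"
  unfolding proj_quad by (rule ip_self_nonneg)

lemma proj_quad_zero: "quad n Q v = 0 \<Longrightarrow> i < n \<Longrightarrow> mv n Q v i = 0"
  unfolding proj_quad by (rule ip_self_zero)

lemma proj_row: "i < n \<Longrightarrow> (\<Sum>k<n. (Q i k)\<^sup>2) = Q i i"
proof -
  assume i: "i < n"
  have "(\<Sum>k<n. (Q i k)\<^sup>2) = (\<Sum>k<n. Q i k * Q k i)"
    using i proj_symm by (intro sum.cong refl) (auto simp: power2_eq_square symm_def)
  then show ?thesis using proj_idem[OF i i] by simp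
qed

lemma proj_frob2: "frob2 n Q = trace n Q"
  by (simp add: frob2_def trace_def proj_row)

lemma proj_diag_bounds: assumes "i < n" shows "0 \<le> Q i i" "Q i i \<le> 1"
proof -
  show 0: "0 \<le> Q i i" unfolding proj_row[OF assms, symmetric] by (rule sum_nonneg) simp
  have "(Q i i)\<^sup>2 \<le> (\<Sum>k<n. (Q i k)\<^sup>2)" using assms by (intro member_le_sum) auto
  then have "(Q i i)\<^sup>2 \<le> Q i i" by (simp add: proj_row assms)
  then show "Q i i \<le> 1" using 0 by (cases "Q i i = 0") (auto simp: power2_eq_square)
qed

lemma gs_step_mv: "i < n \<Longrightarrow> mv n (gs_step n Q c) v i = mv n Q v i - mv n Q c i * ip n (mv n Q c) v / quad n Q c"
proof -
  have "mv n (gs_step n Q c) v i = (\<Sum>k<n. Q i k * v k - mv n Q c i / quad n Q c * (mv n Q c k * v k))"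
    unfolding mv_def[of n "gs_step n Q c"] gs_step_def by (intro sum.cong refl) (simp add: algebra_simps)
  also have "\<dots> = mv n Q v i - mv n Q c i / quad n Q c * ip n (mv n Q c) v"
    unfolding mv_def[of n Q v] ip_def by (simp only: sum_subtractf sum_distrib_left)
  finally show ?thesis by simp
qed

text \<open>With y = Q c one has \<open>quad n Q c\<close> = |y|^2, so the step subtracts the
  orthogonal projection onto the line of y, which lies in the range of \<open>Q\<close>.\<close>

lemma gs_step_proj: "is_proj n (gs_step n Q c)"
  unfolding is_proj_def
proof (intro conjI allI impI)
  show "symm n (gs_step n Q c)"
    using proj_symm by (simp add: symm_def gs_step_def mult.commute)
  fix i k assume i: "i < n" and k: "k < n"
  let ?y = "mv n Q c" and ?r = "quad n Q c"
  have "(\<Sum>l<n. gs_step n Q c i l * gs_step n Q c l k) = mv n (gs_step n Q c) (\<lambda>l. Q l k - ?y l * ?y k / ?r) i"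
    by (simp add: mv_def[of n "gs_step n Q c"] gs_step_def)
  also have "\<dots> = mv n Q (\<lambda>l. Q l k - ?y l * ?y k / ?r) i - ?y i * ip n ?y (\<lambda>l. Q l k - ?y l * ?y k / ?r) / ?r"
    by (rule gs_step_mv[OF i])
  also have "mv n Q (\<lambda>l. Q l k - ?y l * ?y k / ?r) i = (\<Sum>l<n. Q i l * Q l k) - mv n Q ?y i * ?y k / ?r"
  proof -
    have "mv n Q (\<lambda>l. Q l k - ?y l * ?y k / ?r) i = (\<Sum>l<n. Q i l * Q l k - Q i l * ?y l * (?y k / ?r))"
      unfolding mv_def[of n Q "\<lambda>l. Q l k - ?y l * ?y k / ?r"] by (intro sum.cong refl) (simp add: algebra_simps)
    also have "\<dots> = (\<Sum>l<n. Q i l * Q l k) - mv n Q ?y i * (?y k / ?r)"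
      unfolding mv_def[of n Q ?y] by (simp only: sum_subtractf sum_distrib_right)
    finally show ?thesis by simp
  qed
  also have "\<dots> = Q i k - ?y i * ?y k / ?r" using i k by (simp add: proj_idem proj_mv_mv)
  also have "ip n ?y (\<lambda>l. Q l k - ?y l * ?y k / ?r) = (\<Sum>l<n. Q l k * ?y l) - ip n ?y ?y * ?y k / ?r"
  proof -
    have "ip n ?y (\<lambda>l. Q l k - ?y l * ?y k / ?r) = (\<Sum>l<n. Q l k * ?y l - ?y l * ?y l * (?y k / ?r))"
      unfolding ip_def by (intro sum.cong refl) (simp add: algebra_simps)
    also have "\<dots> = (\<Sum>l<n. Q l k * ?y l) - ip n ?y ?y * (?y k / ?r)"
      unfolding ip_def by (simp only: sum_subtractf sum_distrib_right)
    finally show ?thesis by simp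
  qed
  also have "(\<Sum>l<n. Q l k * ?y l) = mv n Q ?y k"
    unfolding mv_def[of n Q ?y] using k proj_symm by (intro sum.cong refl) (auto simp: symm_def)
  also have "\<dots> = ?y k" by (rule proj_mv_mv[OF k])
  \<comment> \<open>If \<open>?r = 0\<close>, then \<open>?y\<close> vanishes as well, so the
    default value of the division does no harm.\<close>
  also have "?y k - ip n ?y ?y * ?y k / ?r = 0"
    using proj_quad[of c] proj_quad_zero[OF _ k, of c] by (cases "?r = 0") auto
  finally show "(\<Sum>l<n. gs_step n Q c i l * gs_step n Q c l k) = gs_step n Q c i k"
    by (simp add: gs_step_def)
qed

lemma gs_step_trace: "trace n (gs_step n Q c) = trace n Q - (if quad n Q c = 0 then 0 else 1)"
proof -
  have "trace n (gs_step n Q c) = trace n Q - ip n (mv n Q c) (mv n Q c) / quad n Q c"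
    by (simp add: trace_def gs_step_def sum_subtractf ip_def sum_divide_distrib)
  then show ?thesis using proj_quad[of c] by simp
qed

lemma gs_step_kill: "i < n \<Longrightarrow> mv n (gs_step n Q c) c i = 0"
  using proj_quad_zero[of c i] by (simp add: gs_step_mv quad_ip ip_commute)

lemma gs_step_kernel:
  assumes "\<And>i. i < n \<Longrightarrow> mv n Q v i = 0" "i < n"
  shows "mv n (gs_step n Q c) v i = 0"
proof -
  have "ip n (mv n Q c) v = ip n c (mv n Q v)" by (simp add: ip_mv_symm[OF proj_symm])
  also have "\<dots> = 0" using assms by (simp add: ip_def)
  finally show ?thesis using assms by (simp add: gs_step_mv)
qed

lemma gs_step_fix:
  assumes "\<And>i. i < n \<Longrightarrow> mv n Q v i = v i" "ip n c v = 0" "i < n"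
  shows "mv n (gs_step n Q c) v i = v i"
proof -
  have "ip n (mv n Q c) v = ip n c (mv n Q v)" by (simp add: ip_mv_symm[OF proj_symm])
  also have "\<dots> = ip n c v" using assms by (intro ip_cong) auto
  finally show ?thesis using assms by (simp add: gs_step_mv)
qed

lemma trace_square_le: "(trace n Q)\<^sup>2 \<le> real n * (\<Sum>i<n. (Q i i)\<^sup>2)"
  using Cauchy_Schwarz_ineq_sum[of "\<lambda>_. 1" "\<lambda>i. Q i i" "{..<n}"] by (simp add: trace_def)

lemma dev_nonneg: "n > 0 \<Longrightarrow> 0 \<le> dev n Q"
  using trace_square_le by (simp add: dev_def field_simps)

lemma dev_le: "dev n Q \<le> real n"
proof -
  have "(\<Sum>i<n. (Q i i)\<^sup>2) \<le> (\<Sum>i<n. 1)"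
    using proj_diag_bounds by (intro sum_mono power_le_one) auto
  then show ?thesis by (simp add: dev_def add_increasing2 diff_le_eq)
qed

lemma trace_le: "trace n Q \<le> real n" "0 \<le> trace n Q"
proof -
  have "(\<Sum>i<n. Q i i) \<le> (\<Sum>i<n. 1)"
    using proj_diag_bounds by (intro sum_mono) auto
  then show "trace n Q \<le> real n" by (simp add: trace_def)
  show "0 \<le> trace n Q" unfolding trace_def using proj_diag_bounds by (intro sum_nonneg) auto
qed

text \<open>The new diagonal entries are \<open>Q i i - (y i)\<^sup>2 / r\<close>. Squaring them
  gives the negative term and the last one; lowering the trace by one gives 2 m / n. The factor 1 /
  r is then replaced by 1 / m at a cost of order |r - m| / m, since \<open>Q i i \<le> 1\<close>
  makes the weighted sum at most r. For a random \<open>c\<close> with independent standardised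
  entries, m is the mean of r and \<open>Q i i\<close> that of \<open>(y i)\<^sup>2\<close>, which
  is what makes the two drift terms comparable.\<close>

lemma gs_step_dev_le:
  fixes c :: "nat \<Rightarrow> real"
  defines "y \<equiv> mv n Q c" and "r \<equiv> quad n Q c" and "m \<equiv> trace n Q"
  assumes n: "n > 0" and m: "m > 0"
  shows "dev n (gs_step n Q c) \<le> dev n Q - 2 / m * (\<Sum>i<n. Q i i * (y i)\<^sup>2) + 2 * m / n + 2 * (\<bar>r - m\<bar> / m)
     + (\<Sum>i<n. (y i) ^ 4) / r\<^sup>2"
proof (cases "r = 0")
  case True
  then have y: "y i = 0" if "i < n" for i using proj_quad_zero that by (simp add: y_def r_def)
  have "gs_step n Q c = Q" using True by (simp add: gs_step_def fun_eq_iff r_def)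
  then show ?thesis using n m y by simp
next
  case False
  have r0: "r > 0" using False proj_quad_nonneg[of c] by (simp add: r_def)
  define D where "D = (\<Sum>i<n. Q i i * (y i)\<^sup>2)"
  have ry: "r = (\<Sum>i<n. (y i)\<^sup>2)" by (simp add: r_def proj_quad ip_def y_def power2_eq_square)
  have D: "0 \<le> D" "D \<le> r"
    unfolding D_def ry using proj_diag_bounds
    by (auto intro!: sum_nonneg sum_mono mult_left_le_one_le)
  have "(\<Sum>i<n. (gs_step n Q c i i)\<^sup>2) = (\<Sum>i<n. (Q i i)\<^sup>2 - 2 / r * (Q i i * (y i)\<^sup>2) + (y i)^4 / r\<^sup>2)"
  proof (intro sum.cong refl)
    fix i
    have "(gs_step n Q c i i)\<^sup>2 = (Q i i - (y i)\<^sup>2 / r)\<^sup>2"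
      by (simp add: gs_step_def y_def r_def power2_eq_square)
    then show "(gs_step n Q c i i)\<^sup>2 = (Q i i)\<^sup>2 - 2 / r * (Q i i * (y i)\<^sup>2) + (y i)^4 / r\<^sup>2"
      by (simp add: power2_diff power_divide)
  qed
  also have "\<dots> = (\<Sum>i<n. (Q i i)\<^sup>2) - 2 / r * D + (\<Sum>i<n. (y i)^4) / r\<^sup>2"
    by (simp add: sum.distrib sum_subtractf D_def sum_distrib_left sum_divide_distrib)
  finally have 1: "dev n (gs_step n Q c) = (\<Sum>i<n. (Q i i)\<^sup>2) - 2 / r * D + (\<Sum>i<n. (y i)^4) / r\<^sup>2 - (m - 1)\<^sup>2 / n"
    using False by (simp add: dev_def gs_step_trace m_def r_def)
  have 2: "- (m - 1)\<^sup>2 / n \<le> - m\<^sup>2 / n + 2 * m / n"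
    using n by (simp add: power2_diff divide_simps)
  have 3: "- (2 / r * D) \<le> - (2 / m * D) + 2 * (\<bar>r - m\<bar> / m)"
  proof -
    have "2 / m * D - 2 / r * D = 2 * (D / r) * ((r - m) / m)"
      using r0 m by (simp add: field_simps)
    also have "\<dots> \<le> 2 * (D / r) * (\<bar>r - m\<bar> / m)"
      using D r0 m by (intro mult_left_mono divide_right_mono) auto
    also have "\<dots> \<le> 2 * 1 * (\<bar>r - m\<bar> / m)"
      using D r0 m by (intro mult_right_mono mult_left_mono) auto
    finally show ?thesis by simp
  qed
  have 4: "dev n Q = (\<Sum>i<n. (Q i i)\<^sup>2) - m\<^sup>2 / n" by (simp add: dev_def m_def)
  have 5: "- (m - 1)\<^sup>2 / n = - ((m - 1)\<^sup>2 / n)" "- m\<^sup>2 / n = - (m\<^sup>2 / n)" by simp_all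
  show ?thesis using 1 2 3 4 unfolding D_def[symmetric] 5 by linarith
qed

text \<open>The denominator is random and may be small. Where r \<ge> m / 2 it is replaced by (m /
  2)^2; elsewhere the ratio is at most 1, hence at most 4 (r - m)^2 / m^2. Both right-hand terms
  have controlled expectations.\<close>

lemma fourth_power_ratio_le:
  fixes c :: "nat \<Rightarrow> real"
  defines "y \<equiv> mv n Q c" and "r \<equiv> quad n Q c" and "m \<equiv> trace n Q"
  assumes m: "m > 0"
  shows "(\<Sum>i<n. (y i) ^ 4) / r\<^sup>2 \<le> 4 * (r - m)\<^sup>2 / m\<^sup>2 + 4 / m\<^sup>2 * (\<Sum>i<n. (y i) ^ 4)"
proof (cases "r \<ge> m / 2")
  case True
  have "(m / 2)\<^sup>2 \<le> r\<^sup>2" using True m by (intro power_mono) auto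
  then have "(\<Sum>i<n. (y i) ^ 4) / r\<^sup>2 \<le> (\<Sum>i<n. (y i) ^ 4) / (m / 2)\<^sup>2"
    using m True by (intro divide_left_mono sum_nonneg) auto
  also have "\<dots> = 4 / m\<^sup>2 * (\<Sum>i<n. (y i) ^ 4)" by (simp add: power_divide)
  finally show ?thesis using m by (simp add: add_increasing)
next
  case False
  have ry: "r = (\<Sum>i<n. (y i)\<^sup>2)" by (simp add: r_def proj_quad ip_def y_def power2_eq_square)
  have "(\<Sum>i<n. (y i) ^ 4) \<le> r\<^sup>2"
  proof -
    have "(\<Sum>i<n. (y i) ^ 4) = (\<Sum>i<n. (y i)\<^sup>2 * (y i)\<^sup>2)" by (simp flip: power_add)
    also have "\<dots> \<le> (\<Sum>i<n. (y i)\<^sup>2 * r)"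
      unfolding ry by (intro sum_mono mult_left_mono member_le_sum) auto
    also have "\<dots> = (\<Sum>i<n. (y i)\<^sup>2) * r" by (simp only: sum_distrib_right)
    also have "\<dots> = r\<^sup>2" by (simp only: ry[symmetric] power2_eq_square[of r])
    finally show ?thesis .
  qed
  then have "(\<Sum>i<n. (y i) ^ 4) / r\<^sup>2 \<le> 1" by (simp add: divide_le_eq_1)
  also have "1 \<le> 4 * (r - m)\<^sup>2 / m\<^sup>2"
  proof -
    have "(m / 2)\<^sup>2 \<le> (m - r)\<^sup>2" using False m by (intro power_mono) auto
    then show ?thesis using m by (simp add: power_divide power2_commute field_simps)
  qed
  also have "\<dots> \<le> 4 * (r - m)\<^sup>2 / m\<^sup>2 + 4 / m\<^sup>2 * (\<Sum>i<n. (y i) ^ 4)"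
    by (simp add: sum_nonneg)
  finally show ?thesis .
qed

end

text \<open>\<open>gs n W j\<close> projects onto the orthogonal complement of the columns \<open>0, \<dots>, j - 1\<close> of \<open>W\<close>.\<close>
primrec gs :: "nat \<Rightarrow> (nat \<Rightarrow> nat \<Rightarrow> real) \<Rightarrow> nat \<Rightarrow> nat \<Rightarrow> nat \<Rightarrow> real" where
  "gs n W 0 = (\<lambda>i k. if i = k then 1 else 0)"
| "gs n W (Suc j) = gs_step n (gs n W j) (\<lambda>i. W i j)"

text \<open>No step degenerates. This amounts to linear independence of the first \<open>p\<close>
  columns, by \<open>full_rank_independent\<close> and \<open>not_full_rank_dependent\<close>; in
  this form its probability can be estimated step by step.\<close>

definition full_rank :: "nat \<Rightarrow> (nat \<Rightarrow> nat \<Rightarrow> real) \<Rightarrow> nat \<Rightarrow> bool" where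
  "full_rank n W p \<longleftrightarrow> (\<forall>j<p. quad n (gs n W j) (\<lambda>i. W i j) \<noteq> 0)"

lemma gs_proj: "is_proj n (gs n W j)"
proof (induction j)
  case 0
  show ?case by (auto simp: is_proj_def symm_def if_distrib[where f="\<lambda>x. x * _"] cong: if_cong)
qed (simp add: gs_step_proj)

text \<open>A step lowers the trace by at most one, whether or not it degenerates. This lower bound
  is therefore available for every realisation of the past columns.\<close>

lemma gs_trace_ge: "real n - real j \<le> trace n (gs n W j)"
proof (induction j)
  case 0
  show ?case by (simp add: trace_def)
qed (use gs_step_trace[OF gs_proj] in auto)

lemma gs_trace_eq: "full_rank n W p \<Longrightarrow> j \<le> p \<Longrightarrow> trace n (gs n W j) = real n - real j"
proof (induction j)
  case 0
  show ?case by (simp add: trace_def)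
qed (use gs_step_trace[OF gs_proj] in \<open>auto simp: full_rank_def\<close>)

lemma gs_kernel: "l < j \<Longrightarrow> i < n \<Longrightarrow> mv n (gs n W j) (\<lambda>i. W i l) i = 0"
proof (induction j arbitrary: i)
  case (Suc j)
  then show ?case
    using gs_step_kill[OF gs_proj] gs_step_kernel[OF gs_proj] by (cases "l = j") auto
qed simp

lemma gs_fix:
  "(\<And>l. l < j \<Longrightarrow> ip n (\<lambda>i. W i l) v = 0) \<Longrightarrow> i < n \<Longrightarrow> mv n (gs n W j) v i = v i"
proof (induction j arbitrary: i)
  case 0
  then show ?case by (simp add: mv_def if_distrib[where f="\<lambda>x. x * _"] cong: if_cong)
next
  case (Suc j)
  then show ?case using gs_step_fix[OF gs_proj] by simp
qed

lemma mv_sum: "mv n Q (\<lambda>k. \<Sum>l\<in>A. f l k) i = (\<Sum>l\<in>A. mv n Q (f l) i)"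
  unfolding mv_def sum_distrib_left by (rule sum.swap)

lemma mv_cmult: "mv n Q (\<lambda>k. c * f k) i = c * mv n Q f i"
  by (simp add: mv_def sum_distrib_left mult_ac)

text \<open>To a vanishing combination apply the projection of stage \<open>l\<close>, the last
  index with a nonzero coefficient. It kills the earlier columns, so it kills column
  \<open>l\<close> too, and step \<open>l\<close> degenerates.\<close>

lemma full_rank_independent:
  assumes "full_rank n W p" and 0: "\<And>i. i < n \<Longrightarrow> (\<Sum>j<p. a j * W i j) = 0" and "j < p"
  shows "a j = 0"
proof (rule ccontr)
  assume "a j \<noteq> 0"
  define l where "l = Max {j. j < p \<and> a j \<noteq> 0}"
  have ne: "finite {j. j < p \<and> a j \<noteq> 0}" "{j. j < p \<and> a j \<noteq> 0} \<noteq> {}"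
    using \<open>a j \<noteq> 0\<close> assms by auto
  have l: "l < p" "a l \<noteq> 0" using Max_in[OF ne] by (auto simp: l_def)
  have z: "a k = 0" if "l < k" "k < p" for k
    using Max_ge[OF ne(1), of k] that by (fastforce simp: l_def[symmetric])
  have eq: "(\<Sum>j<Suc l. a j * W i j) = 0" if "i < n" for i
  proof -
    have "(\<Sum>j<p. a j * W i j) = (\<Sum>j<Suc l. a j * W i j)"
      using l z by (intro sum.mono_neutral_right) auto
    then show ?thesis using 0[OF that] by simp
  qed
  have "mv n (gs n W l) (\<lambda>i. W i l) i = 0" if "i < n" for i
  proof -
    have "0 = mv n (gs n W l) (\<lambda>i. \<Sum>j<Suc l. a j * W i j) i"
      using eq by (simp add: mv_def)
    also have "\<dots> = (\<Sum>j<Suc l. a j * mv n (gs n W l) (\<lambda>i. W i j) i)"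
      unfolding mv_sum mv_cmult ..
    also have "\<dots> = a l * mv n (gs n W l) (\<lambda>i. W i l) i"
      using that by (simp add: gs_kernel)
    finally show ?thesis using l by simp
  qed
  then have "quad n (gs n W l) (\<lambda>i. W i l) = 0" by (simp add: quad_ip ip_def)
  with l assms(1) show False by (simp add: full_rank_def)
qed

text \<open>The projection of stage \<open>j\<close> is a function of the columns before
  \<open>j\<close>, so column \<open>j\<close> is fresh for the next step.\<close>

lemma gs_cong:
  assumes "\<And>i l. i < n \<Longrightarrow> l < j \<Longrightarrow> W i l = W' i l"
  shows "gs n W j = gs n W' j"
  using assms
proof (induction j)
  case (Suc j)
  have mvq: "mv n Q (\<lambda>i. W i j) = mv n Q (\<lambda>i. W' i j)" "quad n Q (\<lambda>i. W i j) = quad n Q (\<lambda>i. W' i j)" for Q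
    using Suc.prems by (auto simp: mv_def quad_def fun_eq_iff)
  have eq: "gs n W j = gs n W' j" using Suc by simp
  show ?case unfolding gs.simps eq gs_step_def[abs_def] mvq ..
qed simp

lemma measurable_mv:
  "(\<And>k. k < n \<Longrightarrow> (\<lambda>\<omega>. Q \<omega> i k) \<in> borel_measurable N) \<Longrightarrow> (\<And>k. k < n \<Longrightarrow> (\<lambda>\<omega>. v \<omega> k) \<in> borel_measurable N) \<Longrightarrow>
    (\<lambda>\<omega>. mv n (Q \<omega>) (v \<omega>) i) \<in> borel_measurable N"
  unfolding mv_def by (intro borel_measurable_sum borel_measurable_times) auto

lemma measurable_quad:
  "(\<And>i k. i < n \<Longrightarrow> k < n \<Longrightarrow> (\<lambda>\<omega>. Q \<omega> i k) \<in> borel_measurable N) \<Longrightarrow> (\<And>k. k < n \<Longrightarrow> (\<lambda>\<omega>. v \<omega> k) \<in> borel_measurable N) \<Longrightarrow>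
    (\<lambda>\<omega>. quad n (Q \<omega>) (v \<omega>)) \<in> borel_measurable N"
  unfolding quad_def by (intro borel_measurable_sum borel_measurable_times) auto

lemma measurable_gs_step:
  assumes "\<And>i k. (\<lambda>\<omega>. Q \<omega> i k) \<in> borel_measurable N" "\<And>k. k < n \<Longrightarrow> (\<lambda>\<omega>. v \<omega> k) \<in> borel_measurable N"
  shows "(\<lambda>\<omega>. gs_step n (Q \<omega>) (v \<omega>) i k) \<in> borel_measurable N"
  unfolding gs_step_def using assms
  by (intro borel_measurable_diff borel_measurable_divide borel_measurable_times measurable_mv measurable_quad) auto

lemma measurable_gs:
  "(\<And>i l. i < n \<Longrightarrow> l < j \<Longrightarrow> (\<lambda>\<omega>. W \<omega> i l) \<in> borel_measurable N) \<Longrightarrow>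
    (\<lambda>\<omega>. gs n (W \<omega>) j i k) \<in> borel_measurable N"
proof (induction j arbitrary: i k)
  case (Suc j)
  show ?case unfolding gs.simps
    by (rule measurable_gs_step) (use Suc in auto)
qed simp

lemma measurable_dev:
  "(\<And>i. i < n \<Longrightarrow> (\<lambda>\<omega>. Q \<omega> i i) \<in> borel_measurable N) \<Longrightarrow> (\<lambda>\<omega>. dev n (Q \<omega>)) \<in> borel_measurable N"
  unfolding dev_def trace_def
  by (intro borel_measurable_diff borel_measurable_divide borel_measurable_sum borel_measurable_power) auto

section \<open>One Gram-Schmidt step with a random column\<close>

context indep_std
begin

text \<open>Integrate \<open>gs_step_dev_le\<close>. Since \<open>(y i)\<^sup>2\<close> has mean
  \<open>Q i i\<close>, the drift is - 2 / m times the sum of squared diagonal entries, plus 2 m /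
  n, and this is at most 0 by Cauchy-Schwarz. There remain the fluctuation |r - m| / m, of order 1 /
  sqrt m, and terms of order 1 / m. The constant is 253 = 1 + 48 + 192 + 12.\<close>

lemma expectation_dev_gs_step_le:
  assumes Q: "is_proj n Q" and m: "1 \<le> trace n Q"
  shows "expectation (\<lambda>\<omega>. dev n (gs_step n Q (\<lambda>i. x i \<omega>))) \<le> dev n Q + 253 * K / sqrt (trace n Q)"
proof -
  define m where "m = trace n Q"
  define y where "y i \<omega> = mv n Q (\<lambda>i. x i \<omega>) i" for i \<omega>
  define r where "r \<omega> = quad n Q (\<lambda>i. x i \<omega>)" for \<omega>
  define S where "S = (\<Sum>i<n. (Q i i)\<^sup>2)"
  have m1: "1 \<le> m" using assms by (simp add: m_def)
  have n0: "n > 0" using m by (cases n) (auto simp: trace_def)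
  have sy: "symm n Q" by (rule proj_symm[OF Q])
  have yL: "L4 (y i)" for i unfolding y_def[abs_def] mv_def by (intro L4_lin) simp
  have y2: "expectation (\<lambda>\<omega>. (y i \<omega>)\<^sup>2) = Q i i" if "i < n" for i
    unfolding y_def mv_def using second_moment_lin[of n "Q i"] proj_row[OF Q that] by simp
  have y4: "expectation (\<lambda>\<omega>. y i \<omega> ^ 4) \<le> 3 * K * (Q i i)\<^sup>2" if "i < n" for i
    unfolding y_def mv_def using fourth_moment_lin[of n "Q i"] proj_row[OF Q that] by simp
  have rL: "L4 (\<lambda>\<omega>. r \<omega> - m)" using fourth_moment_quad(1)[OF sy] by (simp add: r_def m_def)
  have r2: "expectation (\<lambda>\<omega>. (r \<omega> - m)\<^sup>2) \<le> 48 * K * m"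
    using variance_quad[OF sy] proj_frob2[OF Q] by (simp add: r_def m_def)
  have ri: "integrable M (\<lambda>\<omega>. (r \<omega> - m)\<^sup>2)" by (rule L4_sq[OF rL])
  have Sm: "S \<le> m"
    unfolding S_def m_def trace_def using proj_diag_bounds[OF Q]
    by (intro sum_mono) (auto simp: power2_eq_square mult_left_le)
  have S0: "0 \<le> S" by (simp add: S_def sum_nonneg)
  have mS: "m\<^sup>2 / n \<le> S"
    using trace_square_le[OF Q] n0 by (simp add: S_def m_def field_simps)
  \<comment> \<open>A pointwise bound that involves the random quantities only through moments
    already estimated.\<close>
  let ?G = "\<lambda>\<omega>. dev n Q - 2 / m * (\<Sum>i<n. Q i i * (y i \<omega>)\<^sup>2) + 2 * m / n
     + (sqrt m + (r \<omega> - m)\<^sup>2 / sqrt m) / m + (4 * (r \<omega> - m)\<^sup>2 / m\<^sup>2 + 4 / m\<^sup>2 * (\<Sum>i<n. y i \<omega> ^ 4))"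
  have pt: "dev n (gs_step n Q (\<lambda>i. x i \<omega>)) \<le> ?G \<omega>" for \<omega>
  proof -
    \<comment> \<open>Balanced for |t| of order sqrt m, the order of the standard deviation of
      \<open>r\<close>.\<close>
    have "2 * \<bar>t\<bar> \<le> sqrt m + t\<^sup>2 / sqrt m" for t
    proof -
      have "0 \<le> (sqrt m - \<bar>t\<bar>)\<^sup>2 / sqrt m" using m1 by (intro divide_nonneg_nonneg) auto
      also have "\<dots> = sqrt m + t\<^sup>2 / sqrt m - 2 * \<bar>t\<bar>"
        using m1 by (simp add: power2_diff add_divide_distrib diff_divide_distrib real_div_sqrt)
      finally show ?thesis by simp
    qed
    then have "2 * \<bar>r \<omega> - m\<bar> / m \<le> (sqrt m + (r \<omega> - m)\<^sup>2 / sqrt m) / m"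
      using m1 by (intro divide_right_mono) auto
    then have 1: "2 * (\<bar>r \<omega> - m\<bar> / m) \<le> (sqrt m + (r \<omega> - m)\<^sup>2 / sqrt m) / m" by simp
    have 2: "(\<Sum>i<n. y i \<omega> ^ 4) / (r \<omega>)\<^sup>2 \<le> 4 * (r \<omega> - m)\<^sup>2 / m\<^sup>2 + 4 / m\<^sup>2 * (\<Sum>i<n. y i \<omega> ^ 4)"
      using fourth_power_ratio_le[OF Q, of "\<lambda>i. x i \<omega>"] m1 unfolding y_def r_def m_def by simp
    have 3: "dev n (gs_step n Q (\<lambda>i. x i \<omega>)) \<le> dev n Q - 2 / m * (\<Sum>i<n. Q i i * (y i \<omega>)\<^sup>2) + 2 * m / n
       + 2 * (\<bar>r \<omega> - m\<bar> / m) + (\<Sum>i<n. y i \<omega> ^ 4) / (r \<omega>)\<^sup>2"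
      using gs_step_dev_le[OF Q n0, of "\<lambda>i. x i \<omega>"] m1 unfolding y_def r_def m_def by simp
    show ?thesis using 1 2 3 by linarith
  qed
  have bd: "\<bar>dev n (gs_step n Q c)\<bar> \<le> real n" for c
    using dev_nonneg[OF gs_step_proj[OF Q] n0] dev_le[OF gs_step_proj[OF Q]] by (simp add: abs_of_nonneg)
  have meas: "(\<lambda>\<omega>. dev n (gs_step n Q (\<lambda>i. x i \<omega>))) \<in> borel_measurable M"
    by (intro measurable_dev measurable_gs_step) auto
  have i1: "integrable M (\<lambda>\<omega>. dev n (gs_step n Q (\<lambda>i. x i \<omega>)))"
    using meas bd by (intro integrable_const_bound[of _ "real n"]) auto
  have i2: "integrable M (\<lambda>\<omega>. (\<Sum>i<n. Q i i * (y i \<omega>)\<^sup>2))" "integrable M (\<lambda>\<omega>. (\<Sum>i<n. y i \<omega> ^ 4))"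
    using L4_sq[OF yL] L4_int4[OF yL] by auto
  have iG: "integrable M ?G" using i2 ri
    by (intro Bochner_Integration.integrable_add Bochner_Integration.integrable_diff integrable_mult_right integrable_divide integrable_const)
  have "expectation (\<lambda>\<omega>. dev n (gs_step n Q (\<lambda>i. x i \<omega>))) \<le> expectation ?G"
    using i1 iG pt by (intro integral_mono) auto
  also have "\<dots> = dev n Q - 2 / m * (\<Sum>i<n. Q i i * Q i i) + 2 * m / n
     + (sqrt m + expectation (\<lambda>\<omega>. (r \<omega> - m)\<^sup>2) / sqrt m) / m
     + (4 * expectation (\<lambda>\<omega>. (r \<omega> - m)\<^sup>2) / m\<^sup>2 + 4 / m\<^sup>2 * (\<Sum>i<n. expectation (\<lambda>\<omega>. y i \<omega> ^ 4)))"
    using i2 ri L4_sq[OF yL] L4_int4[OF yL] by (simp add: prob_space y2)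
  also have "\<dots> \<le> dev n Q - 2 / m * S + 2 * m / n + (sqrt m + 48 * K * m / sqrt m) / m
     + (4 * (48 * K * m) / m\<^sup>2 + 4 / m\<^sup>2 * (\<Sum>i<n. 3 * K * (Q i i)\<^sup>2))"
    using r2 y4 m1 unfolding S_def power2_eq_square[of "Q _ _", symmetric]
    by (intro add_mono order_refl divide_right_mono mult_left_mono sum_mono) auto
  also have "\<dots> \<le> dev n Q + 253 * K / sqrt m"
  proof -
    \<comment> \<open>The gain from the trace term is absorbed by the drift, as m^2 / n \<le>
      S.\<close>
    have a: "2 * m / n \<le> 2 / m * S"
    proof -
      have "2 / m * (m\<^sup>2 / n) \<le> 2 / m * S" using mS m1 by (intro mult_left_mono) auto
      then show ?thesis using m1 by (simp add: power2_eq_square)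
    qed
    have s: "1 \<le> sqrt m" "sqrt m * sqrt m = m" using m1 by auto
    have b: "(sqrt m + 48 * K * m / sqrt m) / m = (1 + 48 * K) / sqrt m"
    proof -
      have 1: "m / sqrt m = sqrt m" using m1 by (simp add: real_div_sqrt)
      have "48 * K * m / sqrt m = 48 * K * sqrt m"
        unfolding times_divide_eq_right[symmetric] 1 ..
      then have "(sqrt m + 48 * K * m / sqrt m) / m = (1 + 48 * K) * (sqrt m / m)"
        by (simp only: distrib_right mult_1 times_divide_eq_right)
      also have "sqrt m / m = 1 / sqrt m" using s m1 by (simp add: divide_simps)
      finally show ?thesis by simp
    qed
    have c: "4 / m\<^sup>2 * (\<Sum>i<n. 3 * K * (Q i i)\<^sup>2) \<le> 12 * K / m"
    proof -
      have "4 / m\<^sup>2 * (\<Sum>i<n. 3 * K * (Q i i)\<^sup>2) = 4 / m\<^sup>2 * (3 * K * S)"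
        by (simp only: S_def sum_distrib_left)
      also have "\<dots> \<le> 4 / m\<^sup>2 * (3 * K * m)" using Sm K_ge_1 by (intro mult_left_mono) auto
      also have "\<dots> = 12 * K / m" using m1 by (simp add: power2_eq_square)
      finally show ?thesis .
    qed
    have d: "4 * (48 * K * m) / m\<^sup>2 = 192 * K / m" using m1 by (simp add: power2_eq_square)
    have e: "K / m \<le> K / sqrt m"
    proof -
      have "sqrt m \<le> m" using s mult_left_mono[of 1 "sqrt m" "sqrt m"] by simp
      then show ?thesis using K_ge_1 m1 by (intro divide_left_mono) auto
    qed
    have f: "1 / sqrt m \<le> K / sqrt m" using s K_ge_1 by (intro divide_right_mono) auto
    have g: "(1 + 48 * K) / sqrt m = 1 / sqrt m + 48 * (K / sqrt m)" "192 * K / m = 192 * (K / m)"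
      "12 * K / m = 12 * (K / m)" "253 * K / sqrt m = 253 * (K / sqrt m)"
      by (simp_all add: add_divide_distrib)
    show ?thesis using a b c d e f unfolding g by linarith
  qed
  finally show ?thesis by (simp add: m_def)
qed

text \<open>The form vanishes only if it misses its mean m by m. Markov's inequality for the fourth
  moment gives order 1 / m^2; second moments would give 1 / m, too weak for a union bound over
  \<open>p\<close> steps.\<close>

lemma prob_quad_zero_le:
  assumes Q: "is_proj n Q" and m: "1 \<le> trace n Q"
  shows "prob {\<omega> \<in> space M. quad n Q (\<lambda>i. x i \<omega>) = 0} \<le> (48 * K)\<^sup>2 / (trace n Q)\<^sup>2"
proof -
  define m where "m = trace n Q"
  have m1: "1 \<le> m" using assms by (simp add: m_def)
  have sy: "symm n Q" by (rule proj_symm[OF Q])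
  define q where "q \<omega> = quad n Q (\<lambda>i. x i \<omega>) - m" for \<omega>
  have qL: "L4 q" using fourth_moment_quad(1)[OF sy] by (simp add: q_def[abs_def] m_def)
  have [measurable]: "q \<in> borel_measurable M" using qL by (simp add: L4_def)
  have "prob {\<omega> \<in> space M. quad n Q (\<lambda>i. x i \<omega>) = 0} \<le> prob {\<omega> \<in> space M. m ^ 4 \<le> q \<omega> ^ 4}"
  proof (intro finite_measure_mono)
    show "{\<omega> \<in> space M. m ^ 4 \<le> q \<omega> ^ 4} \<in> events" by measurable
  qed (auto simp: q_def)
  also have "\<dots> \<le> expectation (\<lambda>\<omega>. q \<omega> ^ 4) / m ^ 4"
    using m1 L4_int4[OF qL] by (intro integral_Markov_inequality_measure[where A="{}"]) auto
  also have "\<dots> \<le> (48 * K * m)\<^sup>2 / m ^ 4"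
    using fourth_moment_quad(2)[OF sy] m1 unfolding q_def m_def proj_frob2[OF Q]
    by (intro divide_right_mono) auto
  also have "\<dots> = (48 * K)\<^sup>2 / m\<^sup>2"
    using m1 by (simp add: power_mult_distrib eval_nat_numeral)
  finally show ?thesis by (simp add: m_def)
qed

end

section \<open>Independent blocks, and the random array of design and errors\<close>

context prob_space
begin

text \<open>Fubini in the form that serves as conditioning: with the value of \<open>U\<close> held
  fixed, \<open>V\<close> is evaluated at a second point of the same space, as an independent copy.
  The hypothesis is the product form of the joint law that \<open>indep_var_distribution_eq\<close>
  delivers.\<close>

lemma expectation_decouple:
  fixes F :: "'b \<times> 'c \<Rightarrow> 'd::{banach, second_countable_topology}"
  assumes eq: "distr M S U \<Otimes>\<^sub>M distr M T V = distr M (S \<Otimes>\<^sub>M T) (\<lambda>\<omega>. (U \<omega>, V \<omega>))"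
    and U[measurable]: "U \<in> M \<rightarrow>\<^sub>M S" and V[measurable]: "V \<in> M \<rightarrow>\<^sub>M T"
    and F[measurable]: "F \<in> borel_measurable (S \<Otimes>\<^sub>M T)"
    and int: "integrable M (\<lambda>\<omega>. F (U \<omega>, V \<omega>))"
  shows "expectation (\<lambda>\<omega>. F (U \<omega>, V \<omega>)) = expectation (\<lambda>\<omega>. expectation (\<lambda>\<omega>'. F (U \<omega>, V \<omega>')))"
    "integrable M (\<lambda>\<omega>. expectation (\<lambda>\<omega>'. F (U \<omega>, V \<omega>')))"
proof -
  interpret S: prob_space "distr M S U" by (rule prob_space_distr) fact
  interpret T: prob_space "distr M T V" by (rule prob_space_distr) fact
  interpret ST: pair_prob_space "distr M S U" "distr M T V" ..
  have inner: "(\<integral>v. F (u, v) \<partial>distr M T V) = expectation (\<lambda>\<omega>'. F (u, V \<omega>'))" if "u \<in> space S" for u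
    using that by (intro integral_distr) auto
  have i: "integrable (distr M S U \<Otimes>\<^sub>M distr M T V) F"
    unfolding eq using int by (simp add: integrable_distr_eq)
  have m: "(\<lambda>u. \<integral>v. F (u, v) \<partial>distr M T V) \<in> borel_measurable S"
    by (rule T.borel_measurable_lebesgue_integral) simp
  have "expectation (\<lambda>\<omega>. F (U \<omega>, V \<omega>)) = integral\<^sup>L (distr M S U \<Otimes>\<^sub>M distr M T V) F"
    unfolding eq by (simp add: integral_distr)
  also have "\<dots> = (\<integral>u. \<integral>v. F (u, v) \<partial>distr M T V \<partial>distr M S U)"
    by (rule ST.integral_fst'[OF i, symmetric])
  also have "\<dots> = expectation (\<lambda>\<omega>. \<integral>v. F (U \<omega>, v) \<partial>distr M T V)"
    using m by (simp add: integral_distr)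
  also have "\<dots> = expectation (\<lambda>\<omega>. expectation (\<lambda>\<omega>'. F (U \<omega>, V \<omega>')))"
    using measurable_space[OF U] by (intro Bochner_Integration.integral_cong refl inner) auto
  finally show "expectation (\<lambda>\<omega>. F (U \<omega>, V \<omega>)) = expectation (\<lambda>\<omega>. expectation (\<lambda>\<omega>'. F (U \<omega>, V \<omega>')))" .
  have "integrable (distr M S U) (\<lambda>u. \<integral>v. F (u, v) \<partial>distr M T V)"
    by (rule ST.integrable_fst'[OF i])
  then have "integrable M (\<lambda>\<omega>. \<integral>v. F (U \<omega>, v) \<partial>distr M T V)"
    using m by (simp add: integrable_distr_eq)
  then show "integrable M (\<lambda>\<omega>. expectation (\<lambda>\<omega>'. F (U \<omega>, V \<omega>')))"
    by (rule Bochner_Integration.integrable_cong[THEN iffD1, rotated -1])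
       (use measurable_space[OF U] inner in auto)
qed

end

text \<open>The columns before \<open>p\<close> are the whitened design, and column \<open>p\<close>
  carries the errors divided by their standard deviation; hence the inclusive index range. With both
  in one independent family, the same decoupling serves the Gram-Schmidt steps and the integration
  over the errors.\<close>

locale indep_array = prob_space M for M :: "'a measure" +
  fixes n p :: nat and w :: "nat \<Rightarrow> nat \<Rightarrow> 'a \<Rightarrow> real" and K :: real
  assumes indep: "indep_vars (\<lambda>_. borel) (\<lambda>(i, j). w i j) ({..<n} \<times> {..p})"
    and mean: "i < n \<Longrightarrow> j \<le> p \<Longrightarrow> expectation (w i j) = 0"
    and var: "i < n \<Longrightarrow> j \<le> p \<Longrightarrow> expectation (\<lambda>\<omega>. (w i j \<omega>)\<^sup>2) = 1"
    and int8: "i < n \<Longrightarrow> j \<le> p \<Longrightarrow> integrable M (\<lambda>\<omega>. w i j \<omega> ^ 8)"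
    and mom8: "i < n \<Longrightarrow> j \<le> p \<Longrightarrow> expectation (\<lambda>\<omega>. w i j \<omega> ^ 8) \<le> K"
    and K_ge_1: "1 \<le> K"
begin

lemma w_measurable [measurable]: "i < n \<Longrightarrow> j \<le> p \<Longrightarrow> w i j \<in> borel_measurable M"
  using indep by (auto simp: indep_vars_def)

lemma indep_vars_pick:
  assumes "\<And>a. a \<in> L \<Longrightarrow> f a \<in> {..<n} \<times> {..p}" "inj_on f L"
  shows "indep_vars (\<lambda>_. borel) (\<lambda>a. w (fst (f a)) (snd (f a))) L"
proof -
  let ?X = "\<lambda>(i, j). w i j"
  have "indep_vars (\<lambda>a. Pi\<^sub>M {f a} (\<lambda>_. borel)) (\<lambda>a \<omega>. restrict (\<lambda>b. ?X b \<omega>) {f a}) L"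
    using assms by (intro indep_vars_restrict[OF indep]) (auto simp: disjoint_family_on_def inj_on_def)
  then have "indep_vars (\<lambda>_. borel) (\<lambda>a \<omega>. (\<lambda>y. y (f a)) (restrict (\<lambda>b. ?X b \<omega>) {f a})) L"
    by (rule indep_vars_compose2) auto
  then show ?thesis by (simp add: case_prod_beta)
qed

lemma column_indep_std: "j \<le> p \<Longrightarrow> indep_std M n (\<lambda>i. w i j) K"
  using indep_vars_pick[of "{..<n}" "\<lambda>i. (i, j)"]
  by unfold_locales (auto simp: mean var int8 mom8 K_ge_1 inj_on_def)

lemma row_indep_std: "i < n \<Longrightarrow> indep_std M (Suc p) (\<lambda>j. w i j) K"
  using indep_vars_pick[of "{..<Suc p}" "\<lambda>j. (i, j)"]
  by unfold_locales (auto simp: mean var int8 mom8 K_ge_1 inj_on_def)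

text \<open>\<open>F\<close> receives the array at two points; \<open>ext\<close> says that it reads
  only the block \<open>A\<close> at the first and the block \<open>B\<close> at the second.\<close>

lemma decouple:
  fixes F :: "(nat \<times> nat \<Rightarrow> real) \<times> (nat \<times> nat \<Rightarrow> real) \<Rightarrow> 'd::{banach, second_countable_topology}"
  assumes "A \<subseteq> {..<n} \<times> {..p}" "B \<subseteq> {..<n} \<times> {..p}" "A \<inter> B = {}"
    and F: "F \<in> borel_measurable (Pi\<^sub>M A (\<lambda>_. borel) \<Otimes>\<^sub>M Pi\<^sub>M B (\<lambda>_. borel))"
    and ext: "\<And>u v. F (restrict u A, restrict v B) = F (u, v)"
    and int: "integrable M (\<lambda>\<omega>. F (\<lambda>(i, j). w i j \<omega>, \<lambda>(i, j). w i j \<omega>))"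
  shows "expectation (\<lambda>\<omega>. F (\<lambda>(i, j). w i j \<omega>, \<lambda>(i, j). w i j \<omega>)) =
      expectation (\<lambda>\<omega>. expectation (\<lambda>\<omega>'. F (\<lambda>(i, j). w i j \<omega>, \<lambda>(i, j). w i j \<omega>')))"
    "integrable M (\<lambda>\<omega>. expectation (\<lambda>\<omega>'. F (\<lambda>(i, j). w i j \<omega>, \<lambda>(i, j). w i j \<omega>')))"
proof -
  let ?U = "\<lambda>A \<omega>. restrict (\<lambda>a. (case a of (i, j) \<Rightarrow> w i j) \<omega>) A"
  have "indep_var (Pi\<^sub>M A (\<lambda>_. borel)) (?U A) (Pi\<^sub>M B (\<lambda>_. borel)) (?U B)"
    by (rule indep_var_restrict[OF indep]) (use assms in auto)
  then have eq: "distr M (Pi\<^sub>M A (\<lambda>_. borel)) (?U A) \<Otimes>\<^sub>M distr M (Pi\<^sub>M B (\<lambda>_. borel)) (?U B) =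
     distr M (Pi\<^sub>M A (\<lambda>_. borel) \<Otimes>\<^sub>M Pi\<^sub>M B (\<lambda>_. borel)) (\<lambda>\<omega>. (?U A \<omega>, ?U B \<omega>))"
    and m: "?U A \<in> M \<rightarrow>\<^sub>M Pi\<^sub>M A (\<lambda>_. borel)" "?U B \<in> M \<rightarrow>\<^sub>M Pi\<^sub>M B (\<lambda>_. borel)"
    unfolding indep_var_distribution_eq by auto
  have U: "?U A \<omega> = restrict (\<lambda>(i, j). w i j \<omega>) A" for A \<omega> by (auto simp: restrict_def fun_eq_iff)
  have 1: "F (?U A \<omega>, ?U B \<omega>') = F (\<lambda>(i, j). w i j \<omega>, \<lambda>(i, j). w i j \<omega>')" for \<omega> \<omega>'
    unfolding U ext ..
  show "expectation (\<lambda>\<omega>. F (\<lambda>(i, j). w i j \<omega>, \<lambda>(i, j). w i j \<omega>)) =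
      expectation (\<lambda>\<omega>. expectation (\<lambda>\<omega>'. F (\<lambda>(i, j). w i j \<omega>, \<lambda>(i, j). w i j \<omega>')))"
    "integrable M (\<lambda>\<omega>. expectation (\<lambda>\<omega>'. F (\<lambda>(i, j). w i j \<omega>, \<lambda>(i, j). w i j \<omega>')))"
    using expectation_decouple[OF eq m F] int unfolding 1 by auto
qed

abbreviation W :: "'a \<Rightarrow> nat \<Rightarrow> nat \<Rightarrow> real" where
  "W \<omega> i j \<equiv> w i j \<omega>"

abbreviation Q :: "'a \<Rightarrow> nat \<Rightarrow> nat \<Rightarrow> nat \<Rightarrow> real" where
  "Q \<omega> j \<equiv> gs n (W \<omega>) j"

lemma Q_measurable [measurable]: "j \<le> p \<Longrightarrow> (\<lambda>\<omega>. Q \<omega> j i k) \<in> borel_measurable M"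
  by (intro measurable_gs) auto

lemma dev_Q_integrable: assumes "n > 0" "j \<le> p" shows "integrable M (\<lambda>\<omega>. dev n (Q \<omega> j))"
proof (rule integrable_const_bound[of _ "real n"])
  show "AE \<omega> in M. norm (dev n (Q \<omega> j)) \<le> real n"
    using dev_nonneg[OF gs_proj assms(1)] dev_le[OF gs_proj] by (simp add: abs_of_nonneg)
  show "(\<lambda>\<omega>. dev n (Q \<omega> j)) \<in> borel_measurable M"
    using assms by (intro measurable_dev) auto
qed

text \<open>The projection of stage \<open>j\<close> reads the columns before \<open>j\<close>, so
  column \<open>j\<close> may be resampled. Measurability of \<open>f\<close> is assumed for
  arguments that depend on a parameter, because on the product space the projection is itself a
  measurable function of the first component.\<close>

lemma decouple_column:
  fixes f :: "(nat \<Rightarrow> nat \<Rightarrow> real) \<Rightarrow> (nat \<Rightarrow> real) \<Rightarrow> real"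
  assumes j: "j < p"
    and meas: "\<And>N (P :: (nat \<times> nat \<Rightarrow> real) \<times> (nat \<times> nat \<Rightarrow> real) \<Rightarrow> nat \<Rightarrow> nat \<Rightarrow> real) v. (\<And>i k. (\<lambda>\<omega>. P \<omega> i k) \<in> borel_measurable N) \<Longrightarrow>
        (\<And>i. i < n \<Longrightarrow> (\<lambda>\<omega>. v \<omega> i) \<in> borel_measurable N) \<Longrightarrow> (\<lambda>\<omega>. f (P \<omega>) (v \<omega>)) \<in> borel_measurable N"
    and ext: "\<And>P u v. (\<And>i. i < n \<Longrightarrow> u i = v i) \<Longrightarrow> f P u = f P v"
    and int: "integrable M (\<lambda>\<omega>. f (Q \<omega> j) (\<lambda>i. w i j \<omega>))"
  shows "expectation (\<lambda>\<omega>. f (Q \<omega> j) (\<lambda>i. w i j \<omega>)) =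
      expectation (\<lambda>\<omega>. expectation (\<lambda>\<omega>'. f (Q \<omega> j) (\<lambda>i. w i j \<omega>')))"
    "integrable M (\<lambda>\<omega>. expectation (\<lambda>\<omega>'. f (Q \<omega> j) (\<lambda>i. w i j \<omega>')))"
proof -
  let ?A = "{..<n} \<times> {..<j}" and ?B = "{..<n} \<times> {j}"
  define F :: "(nat \<times> nat \<Rightarrow> real) \<times> (nat \<times> nat \<Rightarrow> real) \<Rightarrow> real" where
    "F = (\<lambda>uv. f (gs n (\<lambda>i l. fst uv (i, l)) j) (\<lambda>i. snd uv (i, j)))"
  have F: "F \<in> borel_measurable (Pi\<^sub>M ?A (\<lambda>_. borel) \<Otimes>\<^sub>M Pi\<^sub>M ?B (\<lambda>_. borel))"
    unfolding F_def
  proof (rule meas)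
    fix i k
    show "(\<lambda>uv. gs n (\<lambda>i l. fst uv (i, l)) j i k) \<in> borel_measurable (Pi\<^sub>M ?A (\<lambda>_. borel) \<Otimes>\<^sub>M Pi\<^sub>M ?B (\<lambda>_. borel))"
    proof (rule measurable_gs)
      fix i l assume "i < n" "l < j"
      then have "(\<lambda>u. u (i, l)) \<in> borel_measurable (Pi\<^sub>M ?A (\<lambda>_. borel))"
        by (intro measurable_component_singleton) auto
      from measurable_compose[OF measurable_fst this]
      show "(\<lambda>uv. fst uv (i, l)) \<in> borel_measurable (Pi\<^sub>M ?A (\<lambda>_. borel) \<Otimes>\<^sub>M Pi\<^sub>M ?B (\<lambda>_. borel))" .
    qed
    fix i assume "i < n"
    then have "(\<lambda>u. u (i, j)) \<in> borel_measurable (Pi\<^sub>M ?B (\<lambda>_. borel))"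
      by (intro measurable_component_singleton) auto
    from measurable_compose[OF measurable_snd this]
    show "(\<lambda>uv. snd uv (i, j)) \<in> borel_measurable (Pi\<^sub>M ?A (\<lambda>_. borel) \<Otimes>\<^sub>M Pi\<^sub>M ?B (\<lambda>_. borel))" .
  qed
  have ext': "F (restrict u ?A, restrict v ?B) = F (u, v)" for u v
  proof -
    have "gs n (\<lambda>i l. restrict u ?A (i, l)) j = gs n (\<lambda>i l. u (i, l)) j"
      by (rule gs_cong) auto
    then show ?thesis unfolding F_def by (auto intro: ext)
  qed
  show "expectation (\<lambda>\<omega>. f (Q \<omega> j) (\<lambda>i. w i j \<omega>)) =
      expectation (\<lambda>\<omega>. expectation (\<lambda>\<omega>'. f (Q \<omega> j) (\<lambda>i. w i j \<omega>')))"
    "integrable M (\<lambda>\<omega>. expectation (\<lambda>\<omega>'. f (Q \<omega> j) (\<lambda>i. w i j \<omega>')))"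
    unfolding atomize_conj
  proof -
    have *: "?A \<subseteq> {..<n} \<times> {..p}" "?B \<subseteq> {..<n} \<times> {..p}" "?A \<inter> ?B = {}" using j by auto
    show "expectation (\<lambda>\<omega>. f (Q \<omega> j) (\<lambda>i. w i j \<omega>)) =
        expectation (\<lambda>\<omega>. expectation (\<lambda>\<omega>'. f (Q \<omega> j) (\<lambda>i. w i j \<omega>'))) \<and>
      integrable M (\<lambda>\<omega>. expectation (\<lambda>\<omega>'. f (Q \<omega> j) (\<lambda>i. w i j \<omega>')))"
      using decouple[OF * F ext'] int by (simp add: F_def)
  qed
qed

text \<open>With the past held fixed, the one-step bound applies to the resampled column, and
  \<open>gs_trace_ge\<close> bounds the trace below by \<open>n - p\<close> for every past.\<close>

lemma expectation_dev_step:
  assumes j: "j < p" and pn: "p < n"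
  shows "expectation (\<lambda>\<omega>. dev n (Q \<omega> (Suc j))) \<le> expectation (\<lambda>\<omega>. dev n (Q \<omega> j)) + 253 * K / sqrt (real n - real p)"
proof -
  interpret c: indep_std M n "\<lambda>i. w i j" K by (rule column_indep_std) (use j in simp)
  let ?f = "\<lambda>P v. dev n (gs_step n P v)"
  have ext: "?f P u = ?f P v" if "\<And>i. i < n \<Longrightarrow> u i = v i" for P u v
  proof -
    have "mv n P u = mv n P v" "quad n P u = quad n P v"
      using that by (auto simp: mv_def quad_def fun_eq_iff)
    then show ?thesis by (simp add: gs_step_def[abs_def])
  qed
  have int: "integrable M (\<lambda>\<omega>. ?f (Q \<omega> j) (\<lambda>i. w i j \<omega>))"
    using dev_Q_integrable[of "Suc j"] j pn by simp
  note d = decouple_column[of j ?f, OF j _ ext int]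
  have "expectation (\<lambda>\<omega>. dev n (Q \<omega> (Suc j))) =
      expectation (\<lambda>\<omega>. expectation (\<lambda>\<omega>'. ?f (Q \<omega> j) (\<lambda>i. w i j \<omega>')))"
    unfolding gs.simps by (rule d) (auto intro!: measurable_dev measurable_gs_step)
  also have "\<dots> \<le> expectation (\<lambda>\<omega>. dev n (Q \<omega> j) + 253 * K / sqrt (real n - real p))"
  proof (rule integral_mono)
    show "integrable M (\<lambda>\<omega>. expectation (\<lambda>\<omega>'. ?f (Q \<omega> j) (\<lambda>i. w i j \<omega>')))"
      by (rule d) (auto intro!: measurable_dev measurable_gs_step)
    show "integrable M (\<lambda>\<omega>. dev n (Q \<omega> j) + 253 * K / sqrt (real n - real p))"
      using dev_Q_integrable[of j] j pn by auto
    fix \<omega>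
    have t: "real n - real p \<le> trace n (Q \<omega> j)" "1 \<le> real n - real p"
      using gs_trace_ge[of n j "W \<omega>"] j pn by auto
    have "expectation (\<lambda>\<omega>'. ?f (Q \<omega> j) (\<lambda>i. w i j \<omega>')) \<le> dev n (Q \<omega> j) + 253 * K / sqrt (trace n (Q \<omega> j))"
      using t by (intro c.expectation_dev_gs_step_le gs_proj) auto
    also have "\<dots> \<le> dev n (Q \<omega> j) + 253 * K / sqrt (real n - real p)"
      using t K_ge_1 by (intro add_left_mono divide_left_mono mult_pos_pos) auto
    finally show "expectation (\<lambda>\<omega>'. ?f (Q \<omega> j) (\<lambda>i. w i j \<omega>')) \<le> dev n (Q \<omega> j) + 253 * K / sqrt (real n - real p)" .
  qed
  also have "\<dots> = expectation (\<lambda>\<omega>. dev n (Q \<omega> j)) + 253 * K / sqrt (real n - real p)"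
    using dev_Q_integrable[of j] j pn by (simp add: prob_space)
  finally show ?thesis .
qed

text \<open>The increments add up, starting from the identity, whose diagonal is constant.\<close>

lemma expectation_dev_le:
  assumes pn: "p < n"
  shows "expectation (\<lambda>\<omega>. dev n (Q \<omega> p)) \<le> real p * (253 * K / sqrt (real n - real p))"
proof -
  have "j \<le> p \<Longrightarrow> expectation (\<lambda>\<omega>. dev n (Q \<omega> j)) \<le> real j * (253 * K / sqrt (real n - real p))" for j
  proof (induction j)
    case 0
    have "dev n (Q \<omega> 0) = 0" for \<omega> using pn by (simp add: dev_def trace_def power2_eq_square)
    then show ?case by simp
  next
    case (Suc j)
    then show ?case using expectation_dev_step[of j] pn by (auto simp: distrib_right add_divide_distrib)
  qed
  then show ?thesis by simp
qed

lemma prob_step_degenerate_le: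
  assumes j: "j < p" and pn: "p < n"
  shows "prob {\<omega> \<in> space M. quad n (Q \<omega> j) (\<lambda>i. w i j \<omega>) = 0} \<le> (48 * K)\<^sup>2 / (real n - real p)\<^sup>2"
proof -
  interpret c: indep_std M n "\<lambda>i. w i j" K by (rule column_indep_std) (use j in simp)
  let ?f = "\<lambda>P v. indicator {0::real} (quad n P v) :: real"
  have ext: "?f P u = ?f P v" if "\<And>i. i < n \<Longrightarrow> u i = v i" for P u v
  proof -
    have "quad n P u = quad n P v" using that by (auto simp: quad_def)
    then show ?thesis by simp
  qed
  have [measurable]: "(\<lambda>\<omega>. quad n (Q \<omega> j) (\<lambda>i. w i j \<omega>)) \<in> borel_measurable M"
    using j by (intro measurable_quad) auto
  have [measurable]: "(\<lambda>\<omega>. quad n P (\<lambda>i. w i j \<omega>)) \<in> borel_measurable M" for P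
    using j by (intro measurable_quad) auto
  have int: "integrable M (\<lambda>\<omega>. ?f (Q \<omega> j) (\<lambda>i. w i j \<omega>))"
    by (rule integrable_const_bound[of _ 1]) (auto simp: indicator_def)
  have m: "(\<lambda>\<omega>. ?f (P \<omega>) (v \<omega>)) \<in> borel_measurable N"
    if "\<And>i k. (\<lambda>\<omega>. P \<omega> i k) \<in> borel_measurable N" "\<And>i. i < n \<Longrightarrow> (\<lambda>\<omega>. v \<omega> i) \<in> borel_measurable N"
    for N and P :: "(nat \<times> nat \<Rightarrow> real) \<times> (nat \<times> nat \<Rightarrow> real) \<Rightarrow> nat \<Rightarrow> nat \<Rightarrow> real" and v
    by (rule measurable_compose[OF measurable_quad borel_measurable_indicator]) (use that in auto)
  note d = decouple_column[of j ?f, OF j m ext int]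
  have ind: "prob {\<omega> \<in> space M. g \<omega> = 0} = expectation (\<lambda>\<omega>. indicator {0::real} (g \<omega>))"
    if [measurable]: "g \<in> borel_measurable M" for g
  proof -
    have "expectation (\<lambda>\<omega>. indicator {0::real} (g \<omega>)) = expectation (indicator {\<omega> \<in> space M. g \<omega> = 0} :: 'a \<Rightarrow> real)"
      by (intro Bochner_Integration.integral_cong) (auto simp: indicator_def)
    then show ?thesis by simp
  qed
  have "prob {\<omega> \<in> space M. quad n (Q \<omega> j) (\<lambda>i. w i j \<omega>) = 0} = expectation (\<lambda>\<omega>. ?f (Q \<omega> j) (\<lambda>i. w i j \<omega>))"
    by (rule ind) measurable
  also have "\<dots> = expectation (\<lambda>\<omega>. expectation (\<lambda>\<omega>'. ?f (Q \<omega> j) (\<lambda>i. w i j \<omega>')))"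
    by (rule d)
  also have "\<dots> \<le> expectation (\<lambda>\<omega>. (48 * K)\<^sup>2 / (real n - real p)\<^sup>2)"
  proof (rule integral_mono)
    show "integrable M (\<lambda>\<omega>. expectation (\<lambda>\<omega>'. ?f (Q \<omega> j) (\<lambda>i. w i j \<omega>')))" by (rule d)
    fix \<omega>
    have t: "real n - real p \<le> trace n (Q \<omega> j)" "1 \<le> real n - real p"
      using gs_trace_ge[of n j "W \<omega>"] j pn by auto
    have "expectation (\<lambda>\<omega>'. ?f (Q \<omega> j) (\<lambda>i. w i j \<omega>')) = prob {\<omega>' \<in> space M. quad n (Q \<omega> j) (\<lambda>i. w i j \<omega>') = 0}"
      by (rule ind[symmetric]) measurable
    also have "\<dots> \<le> (48 * K)\<^sup>2 / (trace n (Q \<omega> j))\<^sup>2"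
      using t by (intro c.prob_quad_zero_le gs_proj) auto
    also have "\<dots> \<le> (48 * K)\<^sup>2 / (real n - real p)\<^sup>2"
      using t by (intro divide_left_mono power_mono mult_pos_pos zero_less_power) auto
    finally show "expectation (\<lambda>\<omega>'. ?f (Q \<omega> j) (\<lambda>i. w i j \<omega>')) \<le> (48 * K)\<^sup>2 / (real n - real p)\<^sup>2" .
  qed auto
  finally show ?thesis by (simp add: prob_space)
qed

lemma full_rank_sets [measurable]: "{\<omega> \<in> space M. full_rank n (W \<omega>) p} \<in> events"
proof -
  have [measurable]: "(\<lambda>\<omega>. quad n (Q \<omega> j) (\<lambda>i. w i j \<omega>)) \<in> borel_measurable M" if "j < p" for j
    using that by (intro measurable_quad) auto
  have "{\<omega> \<in> space M. full_rank n (W \<omega>) p} =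
     space M \<inter> (\<Inter>j\<in>{..<p}. {\<omega> \<in> space M. quad n (Q \<omega> j) (\<lambda>i. w i j \<omega>) \<noteq> 0})"
    by (auto simp: full_rank_def)
  also have "\<dots> \<in> events"
    by (cases "p = 0") (auto intro!: sets.Int sets.finite_INT)
  finally show ?thesis .
qed

text \<open>A union bound over the steps; for p / n bounded away from 1 it is of order 1 /
  n.\<close>

lemma prob_not_full_rank_le:
  assumes pn: "p < n"
  shows "prob {\<omega> \<in> space M. \<not> full_rank n (W \<omega>) p} \<le> real p * ((48 * K)\<^sup>2 / (real n - real p)\<^sup>2)"
proof -
  have m: "{\<omega> \<in> space M. quad n (Q \<omega> j) (\<lambda>i. w i j \<omega>) = 0} \<in> events" if "j < p" for j
  proof -
    have [measurable]: "(\<lambda>\<omega>. quad n (Q \<omega> j) (\<lambda>i. w i j \<omega>)) \<in> borel_measurable M"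
      using that by (intro measurable_quad) auto
    show ?thesis by measurable
  qed
  have "prob {\<omega> \<in> space M. \<not> full_rank n (W \<omega>) p} =
    prob (\<Union>j\<in>{..<p}. {\<omega> \<in> space M. quad n (Q \<omega> j) (\<lambda>i. w i j \<omega>) = 0})"
    by (intro arg_cong[where f=prob]) (auto simp: full_rank_def)
  also have "\<dots> \<le> (\<Sum>j<p. prob {\<omega> \<in> space M. quad n (Q \<omega> j) (\<lambda>i. w i j \<omega>) = 0})"
    using m by (intro finite_measure_subadditive_finite) auto
  also have "\<dots> \<le> (\<Sum>j<p. (48 * K)\<^sup>2 / (real n - real p)\<^sup>2)"
    by (intro sum_mono prob_step_degenerate_le pn) auto
  finally show ?thesis by simp
qed

end

section \<open>Characteristic functions of quadratic polynomials in independent variables\<close>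

text \<open>The weighted inequality of arithmetic and geometric means. In \<open>stein_step\<close>
  the weight \<open>h\<close> splits third-order quantities into fourth and second moments.\<close>

lemma mult_abs_le: "h > 0 \<Longrightarrow> \<bar>a\<bar> * \<bar>b\<bar> \<le> (h * a\<^sup>2 + b\<^sup>2 / h) / 2" for a b h :: real
proof -
  assume h: "h > 0"
  have "0 \<le> (h * \<bar>a\<bar> - \<bar>b\<bar>)\<^sup>2 / h" using h by simp
  also have "\<dots> = h * a\<^sup>2 + b\<^sup>2 / h - 2 * (\<bar>a\<bar> * \<bar>b\<bar>)"
    using h by (simp add: power2_diff power_mult_distrib add_divide_distrib diff_divide_distrib power2_eq_square[of h])
  finally show ?thesis by simp
qed

lemma norm_iexp_diff1: "cmod (iexp y - 1) \<le> \<bar>y\<bar>"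
  using iexp_approx1[of y 0] by simp

lemma norm_iexp_diff2: "cmod (iexp y - 1 - \<i> * y) \<le> y\<^sup>2 / 2"
  using iexp_approx1[of y 1] by (simp add: power2_eq_square eval_nat_numeral algebra_simps)

text \<open>The diagonal is split off: squares enter centred, through \<open>v\<close>, and
  \<open>A\<close> has zero diagonal. So the linear form that multiplies \<open>x k\<close> in the
  quadratic part does not contain \<open>x k\<close>.\<close>

locale indep_poly = indep_std +
  fixes u v :: "nat \<Rightarrow> real" and A :: "nat \<Rightarrow> nat \<Rightarrow> real"
  assumes A_symm: "symm n A" and A_diag: "i < n \<Longrightarrow> A i i = 0"
begin

definition lin :: "nat \<Rightarrow> real \<Rightarrow> real" where
  "lin k t = u k * t + v k * (t\<^sup>2 - 1)"

definition B :: "'a \<Rightarrow> real" where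
  "B \<omega> = (\<Sum>k<n. lin k (x k \<omega>)) + quad n A (\<lambda>i. x i \<omega>)"

definition L :: "nat \<Rightarrow> 'a \<Rightarrow> real" where
  "L k \<omega> = (\<Sum>j<n. A k j * x j \<omega>)"

text \<open>\<open>T k\<close> is the share of the index \<open>k\<close> in \<open>B\<close>, and \<open>D k\<close> collects all terms of \<open>B\<close> that involve \<open>x k\<close>.\<close>
definition T :: "nat \<Rightarrow> 'a \<Rightarrow> real" where
  "T k \<omega> = lin k (x k \<omega>) + x k \<omega> * L k \<omega>"

definition D :: "nat \<Rightarrow> 'a \<Rightarrow> real" where
  "D k \<omega> = lin k (x k \<omega>) + 2 * (x k \<omega> * L k \<omega>)"

definition al :: "nat \<Rightarrow> real" where "al k = expectation (\<lambda>\<omega>. (lin k (x k \<omega>))\<^sup>2)"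
definition ga :: "nat \<Rightarrow> real" where "ga k = expectation (\<lambda>\<omega>. lin k (x k \<omega>) * x k \<omega>)"

text \<open>The conditional expectation of \<open>T k * D k\<close> given the other variables; the
  factors 3 and 2 come from the product of \<open>lin + x L\<close> and
  \<open>lin + 2 x L\<close>.\<close>

definition q :: "nat \<Rightarrow> 'a \<Rightarrow> real" where
  "q k \<omega> = al k + 3 * ga k * L k \<omega> + 2 * (L k \<omega>)\<^sup>2"

definition rowsum :: "nat \<Rightarrow> real" where
  "rowsum k = (\<Sum>j<n. (A k j)\<^sup>2)"

text \<open>The influence of the variable \<open>k\<close>: up to constants it bounds the second
  moment of \<open>D k\<close>, and its square bounds the fourth moments of \<open>T k\<close> and
  \<open>D k\<close> and the second moment of \<open>q k\<close>.\<close>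

definition s :: "nat \<Rightarrow> real" where
  "s k = (u k)\<^sup>2 + (v k)\<^sup>2 + rowsum k"

text \<open>\<open>B\<close> without the variable \<open>k\<close>, written as a function of
  coordinates so that \<open>indep_one\<close> applies to it.\<close>

definition B' :: "nat \<Rightarrow> (nat \<Rightarrow> real) \<Rightarrow> real" where
  "B' k y = (\<Sum>i\<in>{..<n}-{k}. lin i (y i) + (\<Sum>j\<in>{..<n}-{k}. A i j * y i * y j))"

lemma B_eq_sum_T: "B \<omega> = (\<Sum>k<n. T k \<omega>)"
  unfolding B_def T_def quad_def L_def by (simp add: sum.distrib sum_distrib_left mult_ac)

lemma L_eq: "k < n \<Longrightarrow> L k \<omega> = (\<Sum>j\<in>{..<n}-{k}. A k j * x j \<omega>)"
  unfolding L_def by (subst sum.remove[of _ k]) (auto simp: A_diag)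

text \<open>By symmetry an off-diagonal product occurs twice in \<open>B\<close>. One occurrence
  belongs to the share \<open>T k\<close>, the other to the share of its partner, while both belong
  to \<open>D k\<close>; hence the factor 2 there.\<close>

lemma B_eq: assumes k: "k < n" shows "B \<omega> = B' k (\<lambda>i. x i \<omega>) + D k \<omega>"
proof -
  let ?J = "{..<n} - {k}"
  have "quad n A (\<lambda>i. x i \<omega>) = x k \<omega> * L k \<omega> + (\<Sum>i\<in>?J. \<Sum>j<n. A i j * x i \<omega> * x j \<omega>)"
    unfolding quad_def L_def using k by (subst sum.remove[of _ k]) (auto simp: sum_distrib_left mult_ac)
  also have "(\<Sum>i\<in>?J. \<Sum>j<n. A i j * x i \<omega> * x j \<omega>) =
      (\<Sum>i\<in>?J. A k i * x i \<omega> * x k \<omega> + (\<Sum>j\<in>?J. A i j * x i \<omega> * x j \<omega>))"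
  proof (intro sum.cong refl)
    fix i assume i: "i \<in> ?J"
    then have "A i k = A k i" using A_symm k by (auto simp: symm_def)
    then show "(\<Sum>j<n. A i j * x i \<omega> * x j \<omega>) = A k i * x i \<omega> * x k \<omega> + (\<Sum>j\<in>?J. A i j * x i \<omega> * x j \<omega>)"
      using k by (subst sum.remove[of _ k]) auto
  qed
  also have "\<dots> = x k \<omega> * L k \<omega> + (\<Sum>i\<in>?J. \<Sum>j\<in>?J. A i j * x i \<omega> * x j \<omega>)"
    unfolding L_eq[OF k] by (simp add: sum.distrib sum_distrib_left mult_ac)
  finally have 1: "quad n A (\<lambda>i. x i \<omega>) = 2 * (x k \<omega> * L k \<omega>) + (\<Sum>i\<in>?J. \<Sum>j\<in>?J. A i j * x i \<omega> * x j \<omega>)"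
    by simp
  have 2: "(\<Sum>k<n. lin k (x k \<omega>)) = lin k (x k \<omega>) + (\<Sum>i\<in>?J. lin i (x i \<omega>))"
    using k by (subst sum.remove[of _ k]) auto
  show ?thesis unfolding B_def D_def B'_def 1 2 by (simp add: sum.distrib)
qed

lemma rowsum_nonneg: "0 \<le> rowsum k" by (simp add: rowsum_def sum_nonneg)
lemma s_nonneg: "0 \<le> s k" by (simp add: s_def rowsum_nonneg)

lemma L_L4: "L4 (L k)" unfolding L_def[abs_def] by (rule L4_lin) simp

lemma lin_L4: assumes "k < n" shows "L4 (\<lambda>\<omega>. lin k (x k \<omega>))"
  unfolding lin_def by (intro L4_add L4_cmult L4_x L4_diff L4_x2 assms L4_const)

lemma L_second: "expectation (\<lambda>\<omega>. (L k \<omega>)\<^sup>2) = rowsum k"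
  unfolding L_def rowsum_def by (rule second_moment_lin) simp

lemma L_fourth: "expectation (\<lambda>\<omega>. (L k \<omega>) ^ 4) \<le> 3 * K * (rowsum k)\<^sup>2"
  unfolding L_def rowsum_def by (rule fourth_moment_lin) simp

text \<open>\<open>L k\<close> and \<open>B' k\<close> do not involve \<open>x k\<close>, so any
  function of \<open>x k\<close> splits off. For \<open>t = 0\<close> the exponential is 1 and the
  statement gives the moments of \<open>x k * L k\<close>.\<close>

lemma factor:
  fixes f :: "real \<Rightarrow> real"
  assumes k: "k < n" and f: "f \<in> borel_measurable borel" "integrable M (\<lambda>\<omega>. f (x k \<omega>))" and m: "m \<le> 4"
  shows "integrable M (\<lambda>\<omega>. complex_of_real (f (x k \<omega>)) * (complex_of_real (L k \<omega> ^ m) * iexp (t * B' k (\<lambda>i. x i \<omega>))))"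
    "expectation (\<lambda>\<omega>. complex_of_real (f (x k \<omega>)) * (complex_of_real (L k \<omega> ^ m) * iexp (t * B' k (\<lambda>i. x i \<omega>)))) =
      of_real (expectation (\<lambda>\<omega>. f (x k \<omega>))) * expectation (\<lambda>\<omega>. complex_of_real (L k \<omega> ^ m) * iexp (t * B' k (\<lambda>i. x i \<omega>)))"
    "integrable M (\<lambda>\<omega>. complex_of_real (L k \<omega> ^ m) * iexp (t * B' k (\<lambda>i. x i \<omega>)))"
proof -
  let ?J = "{..<n} - {k}"
  define G where "G y = complex_of_real ((\<Sum>j\<in>?J. A k j * y j) ^ m) * iexp (t * B' k y)" for y
  have B': "B' k \<in> borel_measurable (Pi\<^sub>M ?J (\<lambda>_. borel))"
    unfolding B'_def lin_def
    by (intro borel_measurable_sum borel_measurable_add borel_measurable_times borel_measurable_diff borel_measurable_power) auto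
  have S: "(\<lambda>y. \<Sum>j\<in>?J. A k j * y j) \<in> borel_measurable (Pi\<^sub>M ?J (\<lambda>_. borel))"
    by (intro borel_measurable_sum borel_measurable_times) auto
  have G: "G \<in> borel_measurable (Pi\<^sub>M ?J (\<lambda>_. borel))"
    unfolding G_def using B' S by measurable
  have ext: "G (restrict y ?J) = G y" for y
  proof -
    have "(\<Sum>j\<in>?J. A i j * c * restrict y ?J j) = (\<Sum>j\<in>?J. A i j * c * y j)" for i c
      by (intro sum.cong) auto
    then have "B' k (restrict y ?J) = B' k y" "(\<Sum>j\<in>?J. A k j * restrict y ?J j) = (\<Sum>j\<in>?J. A k j * y j)"
      unfolding B'_def by (auto intro!: sum.cong)
    then show ?thesis by (simp only: G_def)
  qed
  have Lm: "integrable M (\<lambda>\<omega>. L k \<omega> ^ m)"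
  proof -
    consider "m = 0" | "m = 1" | "m = 2" | "m = 3" | "m = 4" using m by linarith
    then show ?thesis
      using L4_integrable[OF L_L4] L4_sq[OF L_L4] L4_cube[OF L_L4] L4_int4[OF L_L4] by cases auto
  qed
  have B'_meas: "(\<lambda>\<omega>. B' k (\<lambda>i. x i \<omega>)) \<in> borel_measurable M"
    unfolding B'_def lin_def
    by (intro borel_measurable_sum borel_measurable_add borel_measurable_times borel_measurable_diff borel_measurable_power) auto
  have Lmeas: "L k \<in> borel_measurable M" using L_L4 by (simp add: L4_def)
  have GL: "G (\<lambda>i. x i \<omega>) = complex_of_real (L k \<omega> ^ m) * iexp (t * B' k (\<lambda>i. x i \<omega>))" for \<omega>
    unfolding G_def L_eq[OF k] ..
  show i: "integrable M (\<lambda>\<omega>. complex_of_real (L k \<omega> ^ m) * iexp (t * B' k (\<lambda>i. x i \<omega>)))"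
  proof (rule Bochner_Integration.integrable_bound[OF Lm])
    show "(\<lambda>\<omega>. complex_of_real (L k \<omega> ^ m) * iexp (t * B' k (\<lambda>i. x i \<omega>))) \<in> borel_measurable M"
      using B'_meas Lmeas by measurable
    show "AE \<omega> in M. norm (complex_of_real (L k \<omega> ^ m) * iexp (t * B' k (\<lambda>i. x i \<omega>))) \<le> norm (L k \<omega> ^ m)"
      by (auto simp: norm_mult norm_power power_abs)
  qed
  have fm: "(\<lambda>t. complex_of_real (f t)) \<in> borel_measurable borel" using f by measurable
  note * = indep_one[where f="\<lambda>t. complex_of_real (f t)", OF k _ _ fm G ext]
  show "integrable M (\<lambda>\<omega>. complex_of_real (f (x k \<omega>)) * (complex_of_real (L k \<omega> ^ m) * iexp (t * B' k (\<lambda>i. x i \<omega>))))"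
    using *(1) i f unfolding GL by auto
  show "expectation (\<lambda>\<omega>. complex_of_real (f (x k \<omega>)) * (complex_of_real (L k \<omega> ^ m) * iexp (t * B' k (\<lambda>i. x i \<omega>)))) =
      of_real (expectation (\<lambda>\<omega>. f (x k \<omega>))) * expectation (\<lambda>\<omega>. complex_of_real (L k \<omega> ^ m) * iexp (t * B' k (\<lambda>i. x i \<omega>)))"
    using *(2) i f unfolding GL by auto
qed

lemma xL_bounds:
  assumes k: "k < n"
  shows "L4 (\<lambda>\<omega>. x k \<omega> * L k \<omega>)"
    "expectation (\<lambda>\<omega>. (x k \<omega> * L k \<omega>)\<^sup>2) = rowsum k"
    "expectation (\<lambda>\<omega>. (x k \<omega> * L k \<omega>) ^ 4) \<le> 3 * K\<^sup>2 * (rowsum k)\<^sup>2"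
proof -
  have f: "integrable M (\<lambda>\<omega>. f (x k \<omega>) * L k \<omega> ^ m)"
    "expectation (\<lambda>\<omega>. f (x k \<omega>) * L k \<omega> ^ m) = expectation (\<lambda>\<omega>. f (x k \<omega>)) * expectation (\<lambda>\<omega>. L k \<omega> ^ m)"
    if "f \<in> borel_measurable borel" "integrable M (\<lambda>\<omega>. f (x k \<omega>))" "m \<le> 4" for f :: "real \<Rightarrow> real" and m
  proof -
    have "integrable M (\<lambda>\<omega>. complex_of_real (f (x k \<omega>) * L k \<omega> ^ m))"
      using factor(1)[OF k that, of 0] by simp
    then show "integrable M (\<lambda>\<omega>. f (x k \<omega>) * L k \<omega> ^ m)" by (simp only: complex_of_real_integrable_eq)
    have "complex_of_real (expectation (\<lambda>\<omega>. f (x k \<omega>) * L k \<omega> ^ m)) =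
       of_real (expectation (\<lambda>\<omega>. f (x k \<omega>)) * expectation (\<lambda>\<omega>. L k \<omega> ^ m))"
      using factor(2)[OF k that, of 0] by (simp flip: integral_complex_of_real)
    then show "expectation (\<lambda>\<omega>. f (x k \<omega>) * L k \<omega> ^ m) = expectation (\<lambda>\<omega>. f (x k \<omega>)) * expectation (\<lambda>\<omega>. L k \<omega> ^ m)"
      by (simp only: of_real_eq_iff)
  qed
  have X: "L4 (x k)" by (rule L4_x[OF k])
  have i4: "integrable M (\<lambda>\<omega>. x k \<omega> ^ 4 * L k \<omega> ^ 4)" using f(1)[of "\<lambda>t. t ^ 4" 4] L4_int4[OF X] by simp
  have [measurable]: "L k \<in> borel_measurable M" "x k \<in> borel_measurable M" using L_L4 X by (auto simp: L4_def)
  show "L4 (\<lambda>\<omega>. x k \<omega> * L k \<omega>)"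
    unfolding L4_def using i4 by (auto simp: power_mult_distrib)
  show "expectation (\<lambda>\<omega>. (x k \<omega> * L k \<omega>)\<^sup>2) = rowsum k"
    using f(2)[of "\<lambda>t. t\<^sup>2" 2] L4_sq[OF X] var[OF k] L_second by (simp add: power_mult_distrib)
  have "expectation (\<lambda>\<omega>. (x k \<omega> * L k \<omega>) ^ 4) = expectation (\<lambda>\<omega>. x k \<omega> ^ 4) * expectation (\<lambda>\<omega>. L k \<omega> ^ 4)"
    using f(2)[of "\<lambda>t. t ^ 4" 4] L4_int4[OF X] by (simp add: power_mult_distrib)
  also have "\<dots> \<le> K * (3 * K * (rowsum k)\<^sup>2)"
    using mom4[OF k] L_fourth K_ge_1 by (intro mult_mono) auto
  finally show "expectation (\<lambda>\<omega>. (x k \<omega> * L k \<omega>) ^ 4) \<le> 3 * K\<^sup>2 * (rowsum k)\<^sup>2"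
    by (simp add: power2_eq_square mult_ac)
qed

lemma lin_bounds:
  assumes k: "k < n"
  shows "al k \<le> 2 * K * ((u k)\<^sup>2 + (v k)\<^sup>2)"
    "expectation (\<lambda>\<omega>. (lin k (x k \<omega>)) ^ 4) \<le> 128 * K * ((u k) ^ 4 + (v k) ^ 4)"
proof -
  have X: "L4 (x k)" by (rule L4_x[OF k])
  have Y: "L4 (\<lambda>\<omega>. (x k \<omega>)\<^sup>2 - 1)" by (intro L4_diff L4_x2 k L4_const)
  have "al k \<le> expectation (\<lambda>\<omega>. 2 * (u k)\<^sup>2 * (x k \<omega>)\<^sup>2 + 2 * (v k)\<^sup>2 * ((x k \<omega>)\<^sup>2 - 1)\<^sup>2)"
    unfolding al_def
  proof (rule integral_mono)
    fix \<omega>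
    show "(lin k (x k \<omega>))\<^sup>2 \<le> 2 * (u k)\<^sup>2 * (x k \<omega>)\<^sup>2 + 2 * (v k)\<^sup>2 * ((x k \<omega>)\<^sup>2 - 1)\<^sup>2"
      using sum_squares_bound[of "u k * x k \<omega>" "v k * ((x k \<omega>)\<^sup>2 - 1)"]
      by (simp add: lin_def power2_sum power_mult_distrib)
  qed (use L4_sq[OF lin_L4[OF k]] L4_sq[OF X] L4_sq[OF Y] in auto)
  also have "\<dots> = 2 * (u k)\<^sup>2 + 2 * (v k)\<^sup>2 * expectation (\<lambda>\<omega>. ((x k \<omega>)\<^sup>2 - 1)\<^sup>2)"
    using L4_sq[OF X] L4_sq[OF Y] var[OF k] by simp
  also have "\<dots> \<le> 2 * (u k)\<^sup>2 * K + 2 * (v k)\<^sup>2 * K"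
    using expectation_x4_bounds(1)[OF k] K_ge_1 by (intro add_mono mult_left_mono) (auto simp: mult_le_cancel_left1)
  finally show "al k \<le> 2 * K * ((u k)\<^sup>2 + (v k)\<^sup>2)" by (simp add: algebra_simps)
  have "expectation (\<lambda>\<omega>. (lin k (x k \<omega>)) ^ 4) \<le> expectation (\<lambda>\<omega>. 8 * ((u k)^4 * x k \<omega> ^ 4 + (v k)^4 * ((x k \<omega>)\<^sup>2 - 1) ^ 4))"
  proof (rule integral_mono)
    fix \<omega>
    show "(lin k (x k \<omega>)) ^ 4 \<le> 8 * ((u k)^4 * x k \<omega> ^ 4 + (v k)^4 * ((x k \<omega>)\<^sup>2 - 1) ^ 4)"
      using add_pow4_le[of "u k * x k \<omega>" "v k * ((x k \<omega>)\<^sup>2 - 1)"]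
      by (simp only: lin_def power_mult_distrib)
  qed (use L4_int4[OF lin_L4[OF k]] L4_int4[OF X] L4_int4[OF Y] in auto)
  also have "\<dots> = 8 * ((u k)^4 * expectation (\<lambda>\<omega>. x k \<omega> ^ 4) + (v k)^4 * expectation (\<lambda>\<omega>. ((x k \<omega>)\<^sup>2 - 1) ^ 4))"
    using L4_int4[OF X] L4_int4[OF Y] by simp
  also have "\<dots> \<le> 8 * ((u k)^4 * (16 * K) + (v k)^4 * (16 * K))"
    using mom4[OF k] expectation_x4_bounds(2)[OF k] K_ge_1 by (intro mult_left_mono add_mono) auto
  finally show "expectation (\<lambda>\<omega>. (lin k (x k \<omega>)) ^ 4) \<le> 128 * K * ((u k) ^ 4 + (v k) ^ 4)"
    by (simp add: algebra_simps)
qed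

lemma T_L4: "k < n \<Longrightarrow> L4 (T k)"
  unfolding T_def[abs_def] by (intro L4_add lin_L4 xL_bounds(1))

lemma D_L4: "k < n \<Longrightarrow> L4 (D k)"
  unfolding D_def[abs_def] by (intro L4_add L4_cmult lin_L4 xL_bounds(1))

text \<open>Cauchy-Schwarz against \<open>x k\<close>, which has variance one. Both signs are
  treated because \<open>expectation_Cauchy_Schwarz\<close> is one-sided.\<close>

lemma ga_le: assumes k: "k < n" shows "(ga k)\<^sup>2 \<le> al k"
proof -
  have al0: "0 \<le> al k" by (simp add: al_def)
  have *: "expectation (\<lambda>\<omega>. (c * lin k (x k \<omega>)) * x k \<omega>) \<le> sqrt (al k) * 1" if "c\<^sup>2 = 1" for c
  proof (rule expectation_Cauchy_Schwarz)
    show "expectation (\<lambda>\<omega>. (c * lin k (x k \<omega>))\<^sup>2) \<le> (sqrt (al k))\<^sup>2"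
      using al0 that by (simp add: power_mult_distrib al_def)
  qed (use L4_sq[OF lin_L4[OF k]] L4_sq[OF L4_x[OF k]] L4_prod2[OF lin_L4[OF k] L4_x[OF k]] var[OF k] al0 in
       \<open>auto simp: power_mult_distrib mult.assoc\<close>)
  have "ga k \<le> sqrt (al k)" "- ga k \<le> sqrt (al k)"
    using *[of 1] *[of "-1"] by (simp_all add: ga_def)
  then have "\<bar>ga k\<bar> \<le> sqrt (al k)" by simp
  then have "\<bar>ga k\<bar>\<^sup>2 \<le> (sqrt (al k))\<^sup>2" by (intro power_mono) auto
  then show ?thesis using al0 by simp
qed

lemma moment_bounds:
  assumes k: "k < n"
  shows "expectation (\<lambda>\<omega>. (D k \<omega>)\<^sup>2) \<le> 8 * K * s k"
    "expectation (\<lambda>\<omega>. D k \<omega> ^ 4) \<le> 1024 * K\<^sup>2 * (s k)\<^sup>2"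
    "expectation (\<lambda>\<omega>. T k \<omega> ^ 4) \<le> 1024 * K\<^sup>2 * (s k)\<^sup>2"
    "expectation (\<lambda>\<omega>. (q k \<omega>)\<^sup>2) \<le> 102 * K\<^sup>2 * (s k)\<^sup>2"
    "integrable M (\<lambda>\<omega>. (q k \<omega>)\<^sup>2)"
proof -
  note X = xL_bounds(1)[OF k] and C = lin_L4[OF k]
  have KK: "K \<le> K\<^sup>2" "0 \<le> K" using K_ge_1 by (auto simp: power2_eq_square)
  have r0: "0 \<le> rowsum k" by (rule rowsum_nonneg)
  have "expectation (\<lambda>\<omega>. (D k \<omega>)\<^sup>2) \<le> expectation (\<lambda>\<omega>. 2 * (lin k (x k \<omega>))\<^sup>2 + 8 * (x k \<omega> * L k \<omega>)\<^sup>2)"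
  proof (rule integral_mono)
    fix \<omega>
    show "(D k \<omega>)\<^sup>2 \<le> 2 * (lin k (x k \<omega>))\<^sup>2 + 8 * (x k \<omega> * L k \<omega>)\<^sup>2"
      using sum_squares_bound[of "lin k (x k \<omega>)" "2 * (x k \<omega> * L k \<omega>)"]
      unfolding D_def power2_sum by (simp add: power_mult_distrib)
  qed (use L4_sq[OF D_L4[OF k]] L4_sq[OF X] L4_sq[OF C] in auto)
  also have "\<dots> = 2 * al k + 8 * rowsum k"
    using L4_sq[OF X] L4_sq[OF C] xL_bounds(2)[OF k] by (simp add: al_def)
  also have "\<dots> \<le> 2 * (2 * K * ((u k)\<^sup>2 + (v k)\<^sup>2)) + 8 * (K * rowsum k)"
    using lin_bounds(1)[OF k] r0 K_ge_1 by (intro add_mono mult_left_mono) (auto simp: mult_le_cancel_right1)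
  also have "\<dots> \<le> 8 * K * s k"
    using KK mult_nonneg_nonneg[OF KK(2), of "(u k)\<^sup>2"] mult_nonneg_nonneg[OF KK(2), of "(v k)\<^sup>2"]
    by (simp add: s_def algebra_simps)
  finally show "expectation (\<lambda>\<omega>. (D k \<omega>)\<^sup>2) \<le> 8 * K * s k" .
  have s2: "(u k) ^ 4 + (v k) ^ 4 + (rowsum k)\<^sup>2 \<le> (s k)\<^sup>2"
  proof -
    have *: "a\<^sup>2 + b\<^sup>2 + c\<^sup>2 \<le> (a + b + c)\<^sup>2" if "0 \<le> a" "0 \<le> b" "0 \<le> c" for a b c :: real
      using that by (simp add: power2_sum distrib_right)
    show ?thesis using *[of "(u k)\<^sup>2" "(v k)\<^sup>2" "rowsum k"] r0 by (simp add: s_def)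
  qed
  have four: "expectation (\<lambda>\<omega>. (lin k (x k \<omega>) + c * (x k \<omega> * L k \<omega>)) ^ 4) \<le> 1024 * K\<^sup>2 * (s k)\<^sup>2"
    if c: "c = 1 \<or> c = 2" for c :: real
  proof -
    have "expectation (\<lambda>\<omega>. (lin k (x k \<omega>) + c * (x k \<omega> * L k \<omega>)) ^ 4) \<le>
      expectation (\<lambda>\<omega>. 8 * (lin k (x k \<omega>) ^ 4 + c ^ 4 * (x k \<omega> * L k \<omega>) ^ 4))"
    proof (rule integral_mono)
      fix \<omega>
      show "(lin k (x k \<omega>) + c * (x k \<omega> * L k \<omega>)) ^ 4 \<le> 8 * (lin k (x k \<omega>) ^ 4 + c ^ 4 * (x k \<omega> * L k \<omega>) ^ 4)"
        using add_pow4_le[of "lin k (x k \<omega>)" "c * (x k \<omega> * L k \<omega>)"] by (simp only: power_mult_distrib[of c])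
    qed (use L4_int4[OF L4_add[OF C L4_cmult[OF X]]] L4_int4[OF X] L4_int4[OF C] in auto)
    also have "\<dots> = 8 * (expectation (\<lambda>\<omega>. lin k (x k \<omega>) ^ 4) + c ^ 4 * expectation (\<lambda>\<omega>. (x k \<omega> * L k \<omega>) ^ 4))"
      using L4_int4[OF X] L4_int4[OF C] by simp
    also have "\<dots> \<le> 8 * (128 * K\<^sup>2 * ((u k) ^ 4 + (v k) ^ 4) + 16 * (3 * K\<^sup>2 * (rowsum k)\<^sup>2))"
    proof (intro mult_left_mono add_mono mult_mono)
      have "128 * K * ((u k) ^ 4 + (v k) ^ 4) \<le> 128 * K\<^sup>2 * ((u k) ^ 4 + (v k) ^ 4)"
        using KK by (intro mult_right_mono) auto
      then show "expectation (\<lambda>\<omega>. lin k (x k \<omega>) ^ 4) \<le> 128 * K\<^sup>2 * ((u k) ^ 4 + (v k) ^ 4)"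
        using lin_bounds(2)[OF k] by linarith
    qed (use xL_bounds(3)[OF k] c in auto)
    also have "\<dots> \<le> 1024 * K\<^sup>2 * ((u k) ^ 4 + (v k) ^ 4 + (rowsum k)\<^sup>2)"
      using mult_nonneg_nonneg[of "K\<^sup>2" "(rowsum k)\<^sup>2"] by (simp add: algebra_simps)
    also have "\<dots> \<le> 1024 * K\<^sup>2 * (s k)\<^sup>2" using s2 by (intro mult_left_mono) auto
    finally show ?thesis .
  qed
  show "expectation (\<lambda>\<omega>. D k \<omega> ^ 4) \<le> 1024 * K\<^sup>2 * (s k)\<^sup>2" "expectation (\<lambda>\<omega>. T k \<omega> ^ 4) \<le> 1024 * K\<^sup>2 * (s k)\<^sup>2"
    using four[of 2] four[of 1] by (simp_all add: D_def T_def)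
  have i: "integrable M (\<lambda>\<omega>. (L k \<omega>)\<^sup>2)" "integrable M (\<lambda>\<omega>. L k \<omega> ^ 4)"
    using L4_sq[OF L_L4] L4_int4[OF L_L4] by auto
  have Lm[measurable]: "L k \<in> borel_measurable M" using L_L4 by (simp add: L4_def)
  let ?g = "\<lambda>\<omega>. 3 * ((al k)\<^sup>2 + 9 * (ga k)\<^sup>2 * (L k \<omega>)\<^sup>2 + 4 * L k \<omega> ^ 4)"
  have pt: "(q k \<omega>)\<^sup>2 \<le> ?g \<omega>" for \<omega>
  proof -
    have *: "(a + b + c)\<^sup>2 \<le> 3 * (a\<^sup>2 + b\<^sup>2 + c\<^sup>2)" for a b c :: real
      using sum_squares_bound[of a b] sum_squares_bound[of a c] sum_squares_bound[of b c]
      by (simp add: power2_sum distrib_right)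
    show ?thesis using *[of "al k" "3 * ga k * L k \<omega>" "2 * (L k \<omega>)\<^sup>2"]
      by (simp add: q_def power_mult_distrib)
  qed
  show iq: "integrable M (\<lambda>\<omega>. (q k \<omega>)\<^sup>2)"
  proof (rule Bochner_Integration.integrable_bound)
    show "integrable M ?g" using i by auto
    show "(\<lambda>\<omega>. (q k \<omega>)\<^sup>2) \<in> borel_measurable M" unfolding q_def by measurable
    show "AE \<omega> in M. norm ((q k \<omega>)\<^sup>2) \<le> norm (?g \<omega>)" using pt by (auto intro: order_trans[OF _ abs_ge_self])
  qed
  have sk: "0 \<le> s k" "rowsum k \<le> s k" "al k \<le> 2 * K * s k" "0 \<le> al k"
  proof -
    show "al k \<le> 2 * K * s k"
      using lin_bounds(1)[OF k] mult_nonneg_nonneg[OF KK(2) r0] by (simp add: s_def algebra_simps)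
  qed (auto simp: s_nonneg s_def al_def rowsum_nonneg)
  have "expectation (\<lambda>\<omega>. (q k \<omega>)\<^sup>2) \<le> expectation ?g"
    using iq i pt by (intro integral_mono) auto
  also have "\<dots> = 3 * ((al k)\<^sup>2 + 9 * (ga k)\<^sup>2 * rowsum k + 4 * expectation (\<lambda>\<omega>. L k \<omega> ^ 4))"
    using i by (simp add: prob_space L_second)
  also have "\<dots> \<le> 3 * ((2 * K * s k)\<^sup>2 + 9 * (2 * K * s k) * s k + 4 * (3 * K * (s k)\<^sup>2))"
  proof (intro mult_left_mono add_mono power_mono mult_mono)
    have "expectation (\<lambda>\<omega>. L k \<omega> ^ 4) \<le> 3 * K * (rowsum k)\<^sup>2" by (rule L_fourth)
    also have "\<dots> \<le> 3 * K * (s k)\<^sup>2" using sk r0 K_ge_1 by (intro mult_left_mono power_mono) auto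
    finally show "expectation (\<lambda>\<omega>. L k \<omega> ^ 4) \<le> 3 * K * (s k)\<^sup>2" .
  qed (use sk ga_le[OF k] r0 K_ge_1 in auto)
  also have "\<dots> = 12 * K\<^sup>2 * (s k)\<^sup>2 + 90 * K * (s k)\<^sup>2" by (simp add: power2_eq_square algebra_simps)
  also have "\<dots> \<le> 12 * K\<^sup>2 * (s k)\<^sup>2 + 90 * K\<^sup>2 * (s k)\<^sup>2"
    using KK by (intro add_left_mono mult_right_mono mult_left_mono) auto
  finally show "expectation (\<lambda>\<omega>. (q k \<omega>)\<^sup>2) \<le> 102 * K\<^sup>2 * (s k)\<^sup>2" by simp
qed

end

lemma iexp_add: "iexp (a + b) = iexp a * iexp b"
  by (simp add: exp_add distrib_left)

lemma iexp_remainder_factor: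
  fixes e f :: complex and d b :: real
  shows "e * f - e - of_real d * \<i> * (of_real b * e) = e * (f - 1 - \<i> * of_real (d * b))"
  by (simp only: of_real_mult right_diff_distrib mult_1_right mult_1_left mult.assoc mult.left_commute mult.commute)

section \<open>The approximate differential equation for the characteristic function\<close>

context indep_poly
begin

lemma integrable_iexp_mult:
  assumes f: "integrable M f" and [measurable]: "g \<in> borel_measurable M"
  shows "integrable M (\<lambda>\<omega>. complex_of_real (f \<omega>) * iexp (g \<omega>))"
    "cmod (expectation (\<lambda>\<omega>. complex_of_real (f \<omega>) * iexp (g \<omega>))) \<le> expectation (\<lambda>\<omega>. \<bar>f \<omega>\<bar>)"
proof -
  have [measurable]: "f \<in> borel_measurable M" using f by auto
  show i: "integrable M (\<lambda>\<omega>. complex_of_real (f \<omega>) * iexp (g \<omega>))"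
    by (rule Bochner_Integration.integrable_bound[OF f]) (auto simp: norm_mult)
  have "cmod (expectation (\<lambda>\<omega>. complex_of_real (f \<omega>) * iexp (g \<omega>))) \<le>
      expectation (\<lambda>\<omega>. cmod (complex_of_real (f \<omega>) * iexp (g \<omega>)))"
    by (rule integral_norm_bound)
  then show "cmod (expectation (\<lambda>\<omega>. complex_of_real (f \<omega>) * iexp (g \<omega>))) \<le> expectation (\<lambda>\<omega>. \<bar>f \<omega>\<bar>)"
    by (simp add: norm_mult)
qed

lemma B_L4: "L4 B"
  unfolding B_eq_sum_T[abs_def] by (intro L4_sum T_L4) auto

lemma B_measurable [measurable]: "B \<in> borel_measurable M"
  using B_L4 by (simp add: L4_def)

lemma L_measurable [measurable]: "L k \<in> borel_measurable M"
  using L_L4 by (simp add: L4_def)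

lemma q_measurable [measurable]: "q k \<in> borel_measurable M"
  unfolding q_def[abs_def] by measurable

lemma q_integrable: "k < n \<Longrightarrow> integrable M (q k)"
  using expectation_square_le(1)[OF _ moment_bounds(5)] by simp

lemma B'_measurable: "k < n \<Longrightarrow> (\<lambda>\<omega>. B' k (\<lambda>i. x i \<omega>)) \<in> borel_measurable M"
  unfolding B'_def lin_def
  by (intro borel_measurable_sum borel_measurable_add borel_measurable_times borel_measurable_diff borel_measurable_power) auto

text \<open>Once \<open>x k\<close> is integrated out with the other variables fixed,
  \<open>T k\<close> becomes 0 and \<open>T k * D k\<close> becomes \<open>q k\<close>, while the
  exponential of \<open>B'\<close> is not affected.\<close>

lemma leave_one_out:
  assumes k: "k < n"
  shows "expectation (\<lambda>\<omega>. complex_of_real (T k \<omega>) * iexp (t * B' k (\<lambda>i. x i \<omega>))) = 0"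
    "expectation (\<lambda>\<omega>. complex_of_real (T k \<omega> * D k \<omega>) * iexp (t * B' k (\<lambda>i. x i \<omega>))) =
     expectation (\<lambda>\<omega>. complex_of_real (q k \<omega>) * iexp (t * B' k (\<lambda>i. x i \<omega>)))"
proof -
  let ?e = "\<lambda>\<omega>. iexp (t * B' k (\<lambda>i. x i \<omega>))"
  define E where "E m = expectation (\<lambda>\<omega>. complex_of_real (L k \<omega> ^ m) * ?e \<omega>)" for m
  have X: "L4 (x k)" and C: "L4 (\<lambda>\<omega>. lin k (x k \<omega>))" by (rule L4_x[OF k], rule lin_L4[OF k])
  have bm: "lin k \<in> borel_measurable borel" unfolding lin_def[abs_def] by measurable
  have Elin: "expectation (\<lambda>\<omega>. lin k (x k \<omega>)) = 0"
    unfolding lin_def using L4_integrable[OF X] L4_sq[OF X] mean[OF k] var[OF k]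
    by (simp add: prob_space)
  have idm: "(\<lambda>y :: real. y) \<in> borel_measurable borel" by measurable
  note f1 = factor[OF k bm L4_integrable[OF C], of 0 t]
    and f2 = factor[OF k idm L4_integrable[OF X], of 1 t]
  have sq: "(\<lambda>y. (lin k y)\<^sup>2) \<in> borel_measurable borel" "(\<lambda>y. lin k y * y) \<in> borel_measurable borel"
    "(\<lambda>y. y\<^sup>2) \<in> borel_measurable (borel :: real measure)"
    using bm by measurable
  note f3 = factor[OF k sq(1) L4_sq[OF C], of 0 t]
    and f4 = factor[OF k sq(2) L4_prod2[OF C X], of 1 t]
    and f5 = factor[OF k sq(3) L4_sq[OF X], of 2 t]
  have "expectation (\<lambda>\<omega>. complex_of_real (T k \<omega>) * ?e \<omega>) =
      expectation (\<lambda>\<omega>. complex_of_real (lin k (x k \<omega>)) * (complex_of_real (L k \<omega> ^ 0) * ?e \<omega>)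
         + complex_of_real (x k \<omega>) * (complex_of_real (L k \<omega> ^ 1) * ?e \<omega>))"
    by (intro Bochner_Integration.integral_cong) (auto simp: T_def algebra_simps)
  also have "\<dots> = 0"
    using f1 f2 Elin mean[OF k] by (subst Bochner_Integration.integral_add) auto
  finally show "expectation (\<lambda>\<omega>. complex_of_real (T k \<omega>) * ?e \<omega>) = 0" .
  have "expectation (\<lambda>\<omega>. complex_of_real (T k \<omega> * D k \<omega>) * ?e \<omega>) =
      expectation (\<lambda>\<omega>. complex_of_real ((lin k (x k \<omega>))\<^sup>2) * (complex_of_real (L k \<omega> ^ 0) * ?e \<omega>)
         + (3 * (complex_of_real (lin k (x k \<omega>) * x k \<omega>) * (complex_of_real (L k \<omega> ^ 1) * ?e \<omega>))
         + 2 * (complex_of_real ((x k \<omega>)\<^sup>2) * (complex_of_real (L k \<omega> ^ 2) * ?e \<omega>))))"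
    by (intro Bochner_Integration.integral_cong) (auto simp: T_def D_def power2_eq_square algebra_simps)
  also have "\<dots> = of_real (al k) * E 0 + (3 * (of_real (ga k) * E 1) + 2 * (1 * E 2))"
    using f3 f4 f5 var[OF k] by (simp add: al_def ga_def E_def)
  also have "\<dots> = expectation (\<lambda>\<omega>. of_real (al k) * (complex_of_real (L k \<omega> ^ 0) * ?e \<omega>)
     + (3 * of_real (ga k) * (complex_of_real (L k \<omega> ^ 1) * ?e \<omega>) + 2 * (complex_of_real (L k \<omega> ^ 2) * ?e \<omega>)))"
    unfolding E_def using f3(3) f4(3) f5(3) by simp
  also have "\<dots> = expectation (\<lambda>\<omega>. complex_of_real (q k \<omega>) * ?e \<omega>)"
    by (intro Bochner_Integration.integral_cong) (auto simp: q_def algebra_simps)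
  finally show "expectation (\<lambda>\<omega>. complex_of_real (T k \<omega> * D k \<omega>) * ?e \<omega>) =
     expectation (\<lambda>\<omega>. complex_of_real (q k \<omega>) * ?e \<omega>)" .
qed

text \<open>Write e^(itB) = e^(itB') e^(itD) and expand the second factor. Against T its constant
  term integrates to 0 and its linear term gives i t q e^(itB'); returning from B' to B changes the
  latter by at most t^2 |q| |D|. This error and the Taylor error t^2 |T| D^2 / 2 are split with
  weight \<open>h\<close> into fourth and second moments, and 307 = 256 + 51.\<close>

lemma stein_step:
  assumes k: "k < n" and h: "h > 0"
  shows "cmod (expectation (\<lambda>\<omega>. complex_of_real (T k \<omega>) * iexp (t * B \<omega>))
      - \<i> * t * expectation (\<lambda>\<omega>. complex_of_real (q k \<omega>) * iexp (t * B \<omega>)))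
    \<le> t\<^sup>2 * (307 * h * K\<^sup>2 * (s k)\<^sup>2 + 6 * K * s k / h)"
proof -
  let ?e = "\<lambda>\<omega>. iexp (t * B \<omega>)" and ?e' = "\<lambda>\<omega>. iexp (t * B' k (\<lambda>i. x i \<omega>))"
  note T4 = T_L4[OF k] and D4 = D_L4[OF k]
  have m[measurable]: "T k \<in> borel_measurable M" "D k \<in> borel_measurable M" using T4 D4 by (auto simp: L4_def)
  have m'[measurable]: "(\<lambda>\<omega>. B' k (\<lambda>i. x i \<omega>)) \<in> borel_measurable M" by (rule B'_measurable[OF k])
  have mt: "(\<lambda>\<omega>. t * B \<omega>) \<in> borel_measurable M" "(\<lambda>\<omega>. t * B' k (\<lambda>i. x i \<omega>)) \<in> borel_measurable M" by measurable
  note iT = L4_integrable[OF T4] and iTD = L4_prod2[OF T4 D4] and iq = q_integrable[OF k]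
  note i = integrable_iexp_mult(1)[OF iT mt(1)] integrable_iexp_mult(1)[OF iT mt(2)]
    integrable_iexp_mult(1)[OF iTD mt(2)] integrable_iexp_mult(1)[OF iq mt(1)] integrable_iexp_mult(1)[OF iq mt(2)]
  let ?R = "\<lambda>\<omega>. (complex_of_real (T k \<omega>) * ?e \<omega> - complex_of_real (T k \<omega>) * ?e' \<omega>
        - \<i> * t * (complex_of_real (T k \<omega> * D k \<omega>) * ?e' \<omega>))
      + \<i> * t * (complex_of_real (q k \<omega>) * ?e' \<omega> - complex_of_real (q k \<omega>) * ?e \<omega>)"
  let ?b = "\<lambda>\<omega>. t\<^sup>2 * (h * (T k \<omega> ^ 4 + D k \<omega> ^ 4) / 8 + h * (q k \<omega>)\<^sup>2 / 2 + 3 / 4 * (D k \<omega>)\<^sup>2 / h)"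
  have eq: "expectation (\<lambda>\<omega>. complex_of_real (T k \<omega>) * ?e \<omega>) - \<i> * t * expectation (\<lambda>\<omega>. complex_of_real (q k \<omega>) * ?e \<omega>)
     = expectation ?R"
    using i leave_one_out[OF k, of t] by (simp add: right_diff_distrib)
  have pt: "cmod (?R \<omega>) \<le> ?b \<omega>" for \<omega>
  proof -
    have e: "?e \<omega> = ?e' \<omega> * iexp (t * D k \<omega>)"
      unfolding B_eq[OF k] by (simp add: exp_add[symmetric] algebra_simps)
    have "?R \<omega> = complex_of_real (T k \<omega>) * ?e' \<omega> * (iexp (t * D k \<omega>) - 1 - \<i> * (t * D k \<omega>))
       - \<i> * t * complex_of_real (q k \<omega>) * ?e' \<omega> * (iexp (t * D k \<omega>) - 1)"
      unfolding e by (simp add: algebra_simps)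
    then have "cmod (?R \<omega>) \<le> \<bar>T k \<omega>\<bar> * cmod (iexp (t * D k \<omega>) - 1 - \<i> * (t * D k \<omega>))
       + \<bar>t\<bar> * \<bar>q k \<omega>\<bar> * cmod (iexp (t * D k \<omega>) - 1)"
      by (auto intro!: order_trans[OF norm_triangle_ineq4] simp: norm_mult)
    also have "\<dots> \<le> \<bar>T k \<omega>\<bar> * ((t * D k \<omega>)\<^sup>2 / 2) + \<bar>t\<bar> * \<bar>q k \<omega>\<bar> * \<bar>t * D k \<omega>\<bar>"
      using norm_iexp_diff1[of "t * D k \<omega>"] norm_iexp_diff2[of "t * D k \<omega>"]
      by (intro add_mono mult_left_mono) (auto simp: mult.assoc)
    also have "\<dots> = t\<^sup>2 * (\<bar>T k \<omega> * D k \<omega>\<bar> * \<bar>D k \<omega>\<bar> / 2 + \<bar>q k \<omega>\<bar> * \<bar>D k \<omega>\<bar>)"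
    proof -
      have "(t * D k \<omega>)\<^sup>2 = \<bar>t\<bar> * \<bar>t\<bar> * (\<bar>D k \<omega>\<bar> * \<bar>D k \<omega>\<bar>)" "t\<^sup>2 = \<bar>t\<bar> * \<bar>t\<bar>"
        by (simp_all add: power2_eq_square mult_ac)
      then show ?thesis by (simp only: abs_mult) (simp only: algebra_simps times_divide_eq_right times_divide_eq_left)
    qed
    also have "\<dots> \<le> ?b \<omega>"
    proof (intro mult_left_mono)
      have 1: "\<bar>T k \<omega> * D k \<omega>\<bar> * \<bar>D k \<omega>\<bar> \<le> (h * (T k \<omega> * D k \<omega>)\<^sup>2 + (D k \<omega>)\<^sup>2 / h) / 2"
        by (rule mult_abs_le[OF h])
      have 2: "\<bar>q k \<omega>\<bar> * \<bar>D k \<omega>\<bar> \<le> (h * (q k \<omega>)\<^sup>2 + (D k \<omega>)\<^sup>2 / h) / 2"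
        by (rule mult_abs_le[OF h])
      have "(T k \<omega> * D k \<omega>)\<^sup>2 \<le> (T k \<omega> ^ 4 + D k \<omega> ^ 4) / 2"
        using sum_squares_bound[of "(T k \<omega>)\<^sup>2" "(D k \<omega>)\<^sup>2"] by (simp add: power_mult_distrib)
      then have 3: "h * (T k \<omega> * D k \<omega>)\<^sup>2 \<le> h * ((T k \<omega> ^ 4 + D k \<omega> ^ 4) / 2)"
        using h by (intro mult_left_mono) auto
      show "\<bar>T k \<omega> * D k \<omega>\<bar> * \<bar>D k \<omega>\<bar> / 2 + \<bar>q k \<omega>\<bar> * \<bar>D k \<omega>\<bar>
         \<le> h * (T k \<omega> ^ 4 + D k \<omega> ^ 4) / 8 + h * (q k \<omega>)\<^sup>2 / 2 + 3 / 4 * (D k \<omega>)\<^sup>2 / h"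
        using 1 2 3 by argo
    qed simp
    finally show ?thesis .
  qed
  have ib: "integrable M ?b"
    using L4_int4[OF T4] L4_int4[OF D4] L4_sq[OF D4] moment_bounds(5)[OF k]
    by (intro integrable_mult_right Bochner_Integration.integrable_add integrable_divide) auto
  have "cmod (expectation ?R) \<le> expectation (\<lambda>\<omega>. cmod (?R \<omega>))" by (rule integral_norm_bound)
  also have "\<dots> \<le> expectation ?b" using i ib pt by (intro integral_mono) auto
  also have "\<dots> = t\<^sup>2 * (h * (expectation (\<lambda>\<omega>. T k \<omega> ^ 4) + expectation (\<lambda>\<omega>. D k \<omega> ^ 4)) / 8
       + h * expectation (\<lambda>\<omega>. (q k \<omega>)\<^sup>2) / 2 + 3 / 4 * expectation (\<lambda>\<omega>. (D k \<omega>)\<^sup>2) / h)"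
    using L4_int4[OF T4] L4_int4[OF D4] L4_sq[OF D4] moment_bounds(5)[OF k] by simp
  also have "\<dots> \<le> t\<^sup>2 * (h * (1024 * K\<^sup>2 * (s k)\<^sup>2 + 1024 * K\<^sup>2 * (s k)\<^sup>2) / 8
       + h * (102 * K\<^sup>2 * (s k)\<^sup>2) / 2 + 3 / 4 * (8 * K * s k) / h)"
    using moment_bounds(1-4)[OF k] h
    by (intro mult_left_mono add_mono divide_right_mono) auto
  also have "\<dots> = t\<^sup>2 * (307 * h * K\<^sup>2 * (s k)\<^sup>2 + 6 * K * s k / h)"
    by (simp add: algebra_simps)
  finally show ?thesis unfolding eq .
qed

definition qsum :: "'a \<Rightarrow> real" where "qsum \<omega> = (\<Sum>k<n. q k \<omega>)"

lemma qsum_integrable: "integrable M qsum"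
  unfolding qsum_def[abs_def] using q_integrable by (intro Bochner_Integration.integrable_sum) auto

lemma stein_sum:
  assumes h: "h > 0"
  shows "cmod (expectation (\<lambda>\<omega>. complex_of_real (B \<omega>) * iexp (t * B \<omega>))
      - \<i> * t * expectation (\<lambda>\<omega>. complex_of_real (qsum \<omega>) * iexp (t * B \<omega>)))
    \<le> t\<^sup>2 * (307 * h * K\<^sup>2 * (\<Sum>k<n. (s k)\<^sup>2) + 6 * K * (\<Sum>k<n. s k) / h)"
proof -
  let ?e = "\<lambda>\<omega>. iexp (t * B \<omega>)"
  have mt: "(\<lambda>\<omega>. t * B \<omega>) \<in> borel_measurable M" by measurable
  have 1: "expectation (\<lambda>\<omega>. complex_of_real (B \<omega>) * ?e \<omega>) = (\<Sum>k<n. expectation (\<lambda>\<omega>. complex_of_real (T k \<omega>) * ?e \<omega>))"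
  proof -
    have "(\<lambda>\<omega>. complex_of_real (B \<omega>) * ?e \<omega>) = (\<lambda>\<omega>. \<Sum>k<n. complex_of_real (T k \<omega>) * ?e \<omega>)"
      using B_eq_sum_T by (auto simp: sum_distrib_right)
    then show ?thesis
      using integrable_iexp_mult(1)[OF L4_integrable[OF T_L4] mt] by (simp add: Bochner_Integration.integral_sum)
  qed
  have 2: "expectation (\<lambda>\<omega>. complex_of_real (qsum \<omega>) * ?e \<omega>) = (\<Sum>k<n. expectation (\<lambda>\<omega>. complex_of_real (q k \<omega>) * ?e \<omega>))"
  proof -
    have "(\<lambda>\<omega>. complex_of_real (qsum \<omega>) * ?e \<omega>) = (\<lambda>\<omega>. \<Sum>k<n. complex_of_real (q k \<omega>) * ?e \<omega>)"
      by (auto simp: sum_distrib_right qsum_def)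
    then show ?thesis
      using integrable_iexp_mult(1)[OF q_integrable mt] by (simp add: Bochner_Integration.integral_sum)
  qed
  have "cmod ((\<Sum>k<n. expectation (\<lambda>\<omega>. complex_of_real (T k \<omega>) * ?e \<omega>))
      - \<i> * t * (\<Sum>k<n. expectation (\<lambda>\<omega>. complex_of_real (q k \<omega>) * ?e \<omega>)))
    \<le> (\<Sum>k<n. cmod (expectation (\<lambda>\<omega>. complex_of_real (T k \<omega>) * ?e \<omega>) - \<i> * t * expectation (\<lambda>\<omega>. complex_of_real (q k \<omega>) * ?e \<omega>)))"
    unfolding sum_distrib_left sum_subtractf[symmetric] by (rule norm_sum)
  also have "\<dots> \<le> (\<Sum>k<n. t\<^sup>2 * (307 * h * K\<^sup>2 * (s k)\<^sup>2 + 6 * K * s k / h))"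
    using stein_step[OF _ h] by (intro sum_mono) auto
  also have "\<dots> = t\<^sup>2 * (307 * h * K\<^sup>2 * (\<Sum>k<n. (s k)\<^sup>2) + 6 * K * (\<Sum>k<n. s k) / h)"
    by (simp add: sum_distrib_left sum.distrib sum_divide_distrib distrib_left)
  finally show ?thesis unfolding 1 2 .
qed

text \<open>The mean of \<open>qsum\<close> is the sum of \<open>al\<close> plus
  \<open>2 * frob2 n A\<close>. What is left is a linear form with coefficient vector A ga and a
  centred quadratic form with matrix A^T A. Both gain a factor \<open>\<kappa>\<close>, a bound for
  the operator norm of \<open>A\<close>, and this makes \<open>qsum\<close> almost constant even
  where the Frobenius norm of \<open>A\<close> is of order one. The constant is 20 = 3 * 2 + 2 * 7,
  where 7^2 exceeds 48.\<close>

lemma qsum_deviation: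
  assumes op: "\<And>y. ip n (mv n A y) (mv n A y) \<le> \<kappa>\<^sup>2 * ip n y y" and \<kappa>: "0 \<le> \<kappa>"
  shows "expectation (\<lambda>\<omega>. \<bar>qsum \<omega> - V\<bar>) \<le> \<bar>(\<Sum>k<n. al k) + 2 * frob2 n A - V\<bar> + 20 * K * \<kappa> * sqrt (\<Sum>k<n. s k)"
proof -
  define Ss where "Ss = (\<Sum>k<n. s k)"
  have Ss0: "0 \<le> Ss" by (simp add: Ss_def sum_nonneg s_nonneg)
  define A2 where "A2 i j = (\<Sum>k<n. A k i * A k j)" for i j
  define a where "a j = (\<Sum>k<n. ga k * A k j)" for j
  define l where "l \<omega> = (\<Sum>j<n. a j * x j \<omega>)" for \<omega>
  define Z where "Z \<omega> = quad n A2 (\<lambda>i. x i \<omega>) - trace n A2" for \<omega>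
  have sA2: "symm n A2" by (simp add: symm_def A2_def mult.commute)
  have sA: "A i j = A j i" if "i < n" "j < n" for i j using A_symm that by (simp add: symm_def)
  have tr: "trace n A2 = frob2 n A"
  proof -
    have "trace n A2 = (\<Sum>k<n. \<Sum>i<n. (A k i)\<^sup>2)"
      unfolding trace_def A2_def by (subst sum.swap) (simp add: power2_eq_square)
    then show ?thesis by (simp add: frob2_def)
  qed
  have frA: "frob2 n A \<le> Ss"
    unfolding frob2_def Ss_def by (intro sum_mono) (simp add: s_def rowsum_def)
  have sumga: "(\<Sum>k<n. ga k * L k \<omega>) = l \<omega>" for \<omega>
  proof -
    have "(\<Sum>k<n. ga k * L k \<omega>) = (\<Sum>k<n. \<Sum>j<n. ga k * A k j * x j \<omega>)"
      by (simp add: L_def sum_distrib_left mult.assoc)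
    also have "\<dots> = (\<Sum>j<n. \<Sum>k<n. ga k * A k j * x j \<omega>)" by (rule sum.swap)
    finally show ?thesis by (simp add: l_def a_def sum_distrib_right)
  qed
  have sumL2: "(\<Sum>k<n. (L k \<omega>)\<^sup>2) = quad n A2 (\<lambda>i. x i \<omega>)" for \<omega>
  proof -
    have "(\<Sum>k<n. (L k \<omega>)\<^sup>2) = (\<Sum>k<n. \<Sum>i<n. \<Sum>j<n. A k i * A k j * x i \<omega> * x j \<omega>)"
      unfolding L_def power2_eq_square sum_product by (simp add: mult_ac)
    also have "\<dots> = (\<Sum>i<n. \<Sum>k<n. \<Sum>j<n. A k i * A k j * x i \<omega> * x j \<omega>)" by (rule sum.swap)
    also have "\<dots> = (\<Sum>i<n. \<Sum>j<n. \<Sum>k<n. A k i * A k j * x i \<omega> * x j \<omega>)" by (intro sum.cong refl sum.swap)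
    finally show ?thesis by (simp add: quad_def A2_def sum_distrib_right)
  qed
  have qs: "qsum \<omega> - V = ((\<Sum>k<n. al k) + 2 * frob2 n A - V) + (3 * l \<omega> + 2 * Z \<omega>)" for \<omega>
  proof -
    have "qsum \<omega> = (\<Sum>k<n. al k) + 3 * (\<Sum>k<n. ga k * L k \<omega>) + 2 * (\<Sum>k<n. (L k \<omega>)\<^sup>2)"
      unfolding qsum_def q_def by (simp add: sum.distrib sum_distrib_left mult.assoc)
    then show ?thesis unfolding sumga sumL2 Z_def tr by simp
  qed
  have lL: "L4 l" unfolding l_def[abs_def] by (rule L4_lin) simp
  have ZL: "L4 Z" unfolding Z_def[abs_def] by (rule fourth_moment_quad(1)[OF sA2])
  have [measurable]: "l \<in> borel_measurable M" "Z \<in> borel_measurable M" using lL ZL by (auto simp: L4_def)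
  have a2: "(\<Sum>j<n. (a j)\<^sup>2) \<le> \<kappa>\<^sup>2 * (2 * K * Ss)"
  proof -
    have "(\<Sum>j<n. (a j)\<^sup>2) = ip n (mv n A ga) (mv n A ga)"
    proof -
      have "mv n A ga j = a j" if "j < n" for j
        unfolding mv_def a_def using that by (intro sum.cong refl) (simp add: sA[of j] mult.commute)
      then show ?thesis by (simp add: ip_def power2_eq_square)
    qed
    also have "\<dots> \<le> \<kappa>\<^sup>2 * ip n ga ga" by (rule op)
    also have "\<dots> \<le> \<kappa>\<^sup>2 * (\<Sum>k<n. 2 * K * s k)"
      unfolding ip_def
    proof (intro mult_left_mono sum_mono)
      fix k assume "k \<in> {..<n}"
      then have "ga k * ga k \<le> 2 * K * ((u k)\<^sup>2 + (v k)\<^sup>2)"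
        using ga_le[of k] lin_bounds(1)[of k] by (simp add: power2_eq_square[of "ga k"])
      also have "\<dots> \<le> 2 * K * s k" using K_ge_1 by (intro mult_left_mono) (auto simp: s_def rowsum_nonneg)
      finally show "ga k * ga k \<le> 2 * K * s k" .
    qed simp
    finally show ?thesis by (simp add: Ss_def sum_distrib_left)
  qed
  \<comment> \<open>The norm bound is applied to each column of \<open>A\<close>, so one of the two
    factors in A^T A costs only \<open>\<kappa>\<close>.\<close>
  have frA2: "frob2 n A2 \<le> \<kappa>\<^sup>2 * Ss"
  proof -
    have "frob2 n A2 = (\<Sum>j<n. \<Sum>i<n. (A2 i j)\<^sup>2)" unfolding frob2_def by (rule sum.swap)
    also have "\<dots> = (\<Sum>j<n. ip n (mv n A (\<lambda>k. A k j)) (mv n A (\<lambda>k. A k j)))"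
    proof -
      have "mv n A (\<lambda>k. A k j) i = A2 i j" if "i < n" for i j
        unfolding mv_def A2_def using that by (intro sum.cong refl) (simp add: sA[of i])
      then show ?thesis by (simp add: ip_def power2_eq_square)
    qed
    also have "\<dots> \<le> (\<Sum>j<n. \<kappa>\<^sup>2 * ip n (\<lambda>k. A k j) (\<lambda>k. A k j))" by (intro sum_mono op)
    also have "\<dots> = \<kappa>\<^sup>2 * frob2 n A"
      unfolding sum_distrib_left[symmetric] frob2_def ip_def
      by (subst sum.swap) (simp add: power2_eq_square)
    also have "\<dots> \<le> \<kappa>\<^sup>2 * Ss" using frA by (intro mult_left_mono) auto
    finally show ?thesis .
  qed
  have abs_le: "expectation (\<lambda>\<omega>. \<bar>f \<omega>\<bar>) \<le> c" if "L4 f" "expectation (\<lambda>\<omega>. (f \<omega>)\<^sup>2) \<le> c\<^sup>2" "0 \<le> c" for f c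
  proof (rule power2_le_imp_le[OF _ that(3)])
    have [measurable]: "f \<in> borel_measurable M" using that by (simp add: L4_def)
    have "(expectation (\<lambda>\<omega>. \<bar>f \<omega>\<bar>))\<^sup>2 \<le> expectation (\<lambda>\<omega>. \<bar>f \<omega>\<bar>\<^sup>2)"
      using L4_sq[OF that(1)] by (intro expectation_square_le(2)) auto
    also have "\<dots> \<le> c\<^sup>2" using that by simp
    finally show "(expectation (\<lambda>\<omega>. \<bar>f \<omega>\<bar>))\<^sup>2 \<le> c\<^sup>2" .
  qed
  define r where "r = \<kappa> * sqrt Ss"
  have r0: "0 \<le> r" and r2: "r\<^sup>2 = \<kappa>\<^sup>2 * Ss" using \<kappa> Ss0 by (auto simp: r_def power_mult_distrib)
  have KK: "K * r\<^sup>2 \<le> K\<^sup>2 * r\<^sup>2" using K_ge_1 by (intro mult_right_mono) (auto simp: power2_eq_square)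
  have KK0: "0 \<le> K\<^sup>2 * r\<^sup>2" "(2 * K * r)\<^sup>2 = 4 * (K\<^sup>2 * r\<^sup>2)" "(7 * K * r)\<^sup>2 = 49 * (K\<^sup>2 * r\<^sup>2)"
    by (simp_all add: power_mult_distrib)
  have "expectation (\<lambda>\<omega>. \<bar>l \<omega>\<bar>) \<le> 2 * K * r"
  proof (rule abs_le[OF lL])
    have "expectation (\<lambda>\<omega>. (l \<omega>)\<^sup>2) = (\<Sum>j<n. (a j)\<^sup>2)" unfolding l_def by (rule second_moment_lin) simp
    also have "\<dots> \<le> 2 * (K * r\<^sup>2)" using a2 by (simp add: r2 mult_ac)
    also have "\<dots> \<le> (2 * K * r)\<^sup>2" using KK KK0 by linarith
    finally show "expectation (\<lambda>\<omega>. (l \<omega>)\<^sup>2) \<le> (2 * K * r)\<^sup>2" .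
  qed (use K_ge_1 r0 in simp)
  moreover have "expectation (\<lambda>\<omega>. \<bar>Z \<omega>\<bar>) \<le> 7 * K * r"
  proof (rule abs_le[OF ZL])
    have "expectation (\<lambda>\<omega>. (Z \<omega>)\<^sup>2) \<le> 48 * K * frob2 n A2" unfolding Z_def by (rule variance_quad[OF sA2])
    also have "\<dots> \<le> 48 * K * r\<^sup>2" using frA2 K_ge_1 unfolding r2 by (intro mult_left_mono) auto
    also have "\<dots> \<le> (7 * K * r)\<^sup>2" using KK KK0 by linarith
    finally show "expectation (\<lambda>\<omega>. (Z \<omega>)\<^sup>2) \<le> (7 * K * r)\<^sup>2" .
  qed (use K_ge_1 r0 in simp)
  moreover have "expectation (\<lambda>\<omega>. \<bar>qsum \<omega> - V\<bar>) \<le>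
     expectation (\<lambda>\<omega>. \<bar>(\<Sum>k<n. al k) + 2 * frob2 n A - V\<bar> + (3 * \<bar>l \<omega>\<bar> + 2 * \<bar>Z \<omega>\<bar>))"
    using L4_integrable[OF lL] L4_integrable[OF ZL] qsum_integrable
    by (intro integral_mono) (auto simp: qs)
  moreover have "\<dots> = \<bar>(\<Sum>k<n. al k) + 2 * frob2 n A - V\<bar> + (3 * expectation (\<lambda>\<omega>. \<bar>l \<omega>\<bar>) + 2 * expectation (\<lambda>\<omega>. \<bar>Z \<omega>\<bar>))"
    using L4_integrable[OF lL] L4_integrable[OF ZL] by (simp add: prob_space)
  ultimately have "expectation (\<lambda>\<omega>. \<bar>qsum \<omega> - V\<bar>) \<le> \<bar>(\<Sum>k<n. al k) + 2 * frob2 n A - V\<bar> + (3 * (2 * K * r) + 2 * (7 * K * r))"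
    by linarith
  then show ?thesis by (simp add: r_def Ss_def mult_ac)
qed

text \<open>Integrating the second-order Taylor bound of the exponential leaves a remainder of at
  most (y - t)^2 E B^2, which yields the derivative directly.\<close>

lemma char_derivative:
  "((\<lambda>t. expectation (\<lambda>\<omega>. iexp (t * B \<omega>))) has_vector_derivative
     \<i> * expectation (\<lambda>\<omega>. complex_of_real (B \<omega>) * iexp (t * B \<omega>))) (at t within X)"
proof -
  let ?\<phi> = "\<lambda>t. expectation (\<lambda>\<omega>. iexp (t * B \<omega>))"
  let ?d = "\<i> * expectation (\<lambda>\<omega>. complex_of_real (B \<omega>) * iexp (t * B \<omega>))"
  define c where "c = expectation (\<lambda>\<omega>. (B \<omega>)\<^sup>2)"
  have c0: "0 \<le> c" by (simp add: c_def)
  have mt: "(\<lambda>\<omega>. t * B \<omega>) \<in> borel_measurable M" for t by measurable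
  have i1: "integrable M (\<lambda>\<omega>. iexp (t * B \<omega>))" for t
    using integrable_iexp_mult(1)[OF integrable_const[of 1] mt] by simp
  note i2 = integrable_iexp_mult(1)[OF L4_integrable[OF B_L4] mt]
  have *: "cmod (?\<phi> y - ?\<phi> t - (y - t) *\<^sub>R ?d) \<le> (y - t)\<^sup>2 * c" for y
  proof -
    define G where "G \<omega> = iexp (y * B \<omega>) - iexp (t * B \<omega>) - of_real (y - t) * \<i> * (complex_of_real (B \<omega>) * iexp (t * B \<omega>))" for \<omega>
    have G_le: "cmod (G \<omega>) \<le> (y - t)\<^sup>2 * (B \<omega>)\<^sup>2" for \<omega>
    proof -
      have "y * B \<omega> = t * B \<omega> + (y - t) * B \<omega>" by (simp add: left_diff_distrib)
      then have eq: "iexp (y * B \<omega>) = iexp (t * B \<omega>) * iexp ((y - t) * B \<omega>)"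
        by (simp only: iexp_add)
      have "G \<omega> = iexp (t * B \<omega>) * (iexp ((y - t) * B \<omega>) - 1 - \<i> * ((y - t) * B \<omega>))"
        unfolding G_def eq by (rule iexp_remainder_factor)
      then have "cmod (G \<omega>) = cmod (iexp ((y - t) * B \<omega>) - 1 - \<i> * ((y - t) * B \<omega>))"
        by (simp only: norm_mult norm_exp_i_times mult_1)
      also have "\<dots> \<le> ((y - t) * B \<omega>)\<^sup>2 / 2" by (rule norm_iexp_diff2)
      also have "\<dots> \<le> (y - t)\<^sup>2 * (B \<omega>)\<^sup>2" by (simp add: power_mult_distrib)
      finally show ?thesis .
    qed
    have iG: "integrable M G"
      unfolding G_def[abs_def]
      by (intro Bochner_Integration.integrable_diff i1 integrable_mult_right i2)
    have "?\<phi> y - ?\<phi> t - (y - t) *\<^sub>R ?d = expectation G"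
      unfolding G_def[abs_def] using i1 i2 by (simp add: scaleR_conv_of_real)
    also have "cmod \<dots> \<le> expectation (\<lambda>\<omega>. cmod (G \<omega>))"
      by (rule integral_norm_bound)
    also have "\<dots> \<le> expectation (\<lambda>\<omega>. (y - t)\<^sup>2 * (B \<omega>)\<^sup>2)"
      using iG G_le L4_sq[OF B_L4] by (intro integral_mono) auto
    also have "\<dots> = (y - t)\<^sup>2 * c" by (simp add: c_def)
    finally show ?thesis .
  qed
  show ?thesis
    unfolding has_vector_derivative_def has_derivative_within'
  proof (intro conjI allI impI)
    show "bounded_linear (\<lambda>x. x *\<^sub>R ?d)" by (rule bounded_linear_scaleR_left)
    fix e :: real assume e: "0 < e"
    show "\<exists>d>0. \<forall>y\<in>X. 0 < norm (y - t) \<and> norm (y - t) < d \<longrightarrow>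
        norm (?\<phi> y - ?\<phi> t - (y - t) *\<^sub>R ?d) / norm (y - t) < e"
    \<comment> \<open>The second moment \<open>c\<close> may be 0; hence
      \<open>c + 1\<close>.\<close>
    proof (intro exI[of _ "e / (c + 1)"] conjI ballI impI)
      show "0 < e / (c + 1)" using e c0 by simp
      fix y assume y: "0 < norm (y - t) \<and> norm (y - t) < e / (c + 1)"
      have "norm (?\<phi> y - ?\<phi> t - (y - t) *\<^sub>R ?d) / norm (y - t) \<le> (y - t)\<^sup>2 * c / \<bar>y - t\<bar>"
        using *[of y] y c0 by (intro frac_le) (auto simp del: of_real_mult)
      also have "\<dots> = \<bar>y - t\<bar> * c" using y by (simp add: power2_eq_square field_simps)
      also have "\<dots> \<le> \<bar>y - t\<bar> * (c + 1)" by (intro mult_left_mono) auto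
      also have "\<dots> < e" using y c0 by (simp add: field_simps)
      finally show "norm (?\<phi> y - ?\<phi> t - (y - t) *\<^sub>R ?d) / norm (y - t) < e" .
    qed
  qed
qed

text \<open>Integrating factor: exp (V t^2 / 2) \<phi>(t) has derivative exp (V t^2 / 2) (\<phi>'(t)
  + V t \<phi>(t)), and the bracket is small by \<open>stein_sum\<close> and
  \<open>qsum_deviation\<close>. The mean value inequality between 0 and \<theta> costs a factor exp
  (V \<theta>^2 / 2), which is cancelled exactly when the integrating factor is removed. Hence the
  bound is polynomial in \<theta>.\<close>

theorem char_approx:
  assumes h: "h > 0" and op: "\<And>y. ip n (mv n A y) (mv n A y) \<le> \<kappa>\<^sup>2 * ip n y y" and \<kappa>: "0 \<le> \<kappa>" and V: "0 \<le> V"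
  shows "cmod (expectation (\<lambda>\<omega>. iexp (\<theta> * B \<omega>)) - of_real (exp (- (\<theta>\<^sup>2 * V / 2))))
    \<le> \<theta>\<^sup>2 * (\<bar>(\<Sum>k<n. al k) + 2 * frob2 n A - V\<bar> + 20 * K * \<kappa> * sqrt (\<Sum>k<n. s k))
      + \<bar>\<theta>\<bar> ^ 3 * (307 * h * K\<^sup>2 * (\<Sum>k<n. (s k)\<^sup>2) + 6 * K * (\<Sum>k<n. s k) / h)"
proof -
  define d1 where "d1 = \<bar>(\<Sum>k<n. al k) + 2 * frob2 n A - V\<bar> + 20 * K * \<kappa> * sqrt (\<Sum>k<n. s k)"
  define d2 where "d2 = 307 * h * K\<^sup>2 * (\<Sum>k<n. (s k)\<^sup>2) + 6 * K * (\<Sum>k<n. s k) / h"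
  have d20: "0 \<le> d2" and d10: "0 \<le> d1" using h K_ge_1 \<kappa>
    by (auto simp: d1_def d2_def s_nonneg intro!: add_nonneg_nonneg mult_nonneg_nonneg sum_nonneg divide_nonneg_nonneg)
  define \<phi> where "\<phi> t = expectation (\<lambda>\<omega>. iexp (t * B \<omega>))" for t
  define \<phi>' where "\<phi>' t = \<i> * expectation (\<lambda>\<omega>. complex_of_real (B \<omega>) * iexp (t * B \<omega>))" for t
  define g where "g t = exp (V * t\<^sup>2 / 2) *\<^sub>R \<phi> t" for t
  define g' where "g' t = exp (V * t\<^sup>2 / 2) *\<^sub>R (\<phi>' t + (V * t) *\<^sub>R \<phi> t)" for t
  have deriv: "(g has_vector_derivative g' t) (at t within X)" for t X
  proof -
    have 1: "(\<phi> has_vector_derivative \<phi>' t) (at t within X)"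
      unfolding \<phi>_def[abs_def] \<phi>'_def by (rule char_derivative)
    have 2: "((\<lambda>t. exp (V * t\<^sup>2 / 2)) has_field_derivative (exp (V * t\<^sup>2 / 2) * (V * t))) (at t within X)"
      by (auto intro!: derivative_eq_intros)
    from has_vector_derivative_scaleR[OF 2 1]
    show ?thesis unfolding g_def[abs_def] g'_def
      by (simp add: scaleR_add_right mult.commute add.commute)
  qed
  have core: "cmod (\<phi>' t + (V * t) *\<^sub>R \<phi> t) \<le> t\<^sup>2 * d2 + \<bar>t\<bar> * d1" for t
  proof -
    have mt: "(\<lambda>\<omega>. t * B \<omega>) \<in> borel_measurable M" by measurable
    have i1: "integrable M (\<lambda>\<omega>. iexp (t * B \<omega>))"
      using integrable_iexp_mult(1)[OF integrable_const[of 1] mt] by simp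
    note i2 = integrable_iexp_mult(1)[OF qsum_integrable mt]
    let ?EB = "expectation (\<lambda>\<omega>. complex_of_real (B \<omega>) * iexp (t * B \<omega>))"
    let ?Eq = "expectation (\<lambda>\<omega>. complex_of_real (qsum \<omega>) * iexp (t * B \<omega>))"
    have iqV: "integrable M (\<lambda>\<omega>. qsum \<omega> - V)" using qsum_integrable by auto
    have "?Eq - V * \<phi> t = expectation (\<lambda>\<omega>. complex_of_real (qsum \<omega> - V) * iexp (t * B \<omega>))"
      unfolding \<phi>_def using i1 i2 by (simp add: left_diff_distrib)
    then have 1: "cmod (?Eq - V * \<phi> t) \<le> d1"
      using integrable_iexp_mult(2)[OF iqV mt] qsum_deviation[OF op \<kappa>, of V] unfolding d1_def by simp
    have "\<phi>' t + (V * t) *\<^sub>R \<phi> t = \<i> * (?EB - \<i> * t * ?Eq) - t * (?Eq - V * \<phi> t)"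
      by (simp add: \<phi>'_def scaleR_conv_of_real algebra_simps)
    then have "cmod (\<phi>' t + (V * t) *\<^sub>R \<phi> t) \<le> cmod (\<i> * (?EB - \<i> * t * ?Eq)) + cmod (t * (?Eq - V * \<phi> t))"
      by (simp only: norm_triangle_ineq4)
    also have "\<dots> \<le> t\<^sup>2 * d2 + \<bar>t\<bar> * d1"
      using stein_sum[OF h, of t] 1 unfolding norm_mult d2_def[symmetric]
      by (intro add_mono) (auto intro: mult_left_mono)
    finally show ?thesis .
  qed
  define a where "a = \<bar>\<theta>\<bar>"
  have bound: "norm (g \<theta> - g 0) \<le> (exp (V * a\<^sup>2 / 2) * (a\<^sup>2 * d2 + a * d1)) * norm (\<theta> - 0)"
  proof (rule differentiable_bound[of "{-a..a}" g "\<lambda>t h. h *\<^sub>R g' t"])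
    show "(g has_derivative (\<lambda>h. h *\<^sub>R g' t)) (at t within {-a..a})" for t
      using deriv[of t "{-a..a}"] unfolding has_vector_derivative_def .
    fix t assume t: "t \<in> {-a..a}"
    then have ta: "\<bar>t\<bar> \<le> a" by auto
    then have t2: "t\<^sup>2 \<le> a\<^sup>2" by (simp add: abs_le_square_iff[symmetric] a_def)
    have "norm (g' t) \<le> exp (V * a\<^sup>2 / 2) * (a\<^sup>2 * d2 + a * d1)"
      unfolding g'_def norm_scaleR
    proof (intro mult_mono)
      show "\<bar>exp (V * t\<^sup>2 / 2)\<bar> \<le> exp (V * a\<^sup>2 / 2)" using t2 V by (auto intro: mult_left_mono)
      show "cmod (\<phi>' t + (V * t) *\<^sub>R \<phi> t) \<le> a\<^sup>2 * d2 + a * d1"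
        using core[of t] mult_right_mono[OF t2 d20] mult_right_mono[OF ta d10] by linarith
    qed auto
    then show "onorm (\<lambda>h. h *\<^sub>R g' t) \<le> exp (V * a\<^sup>2 / 2) * (a\<^sup>2 * d2 + a * d1)"
      by (intro onorm_bound) (auto simp: mult.commute intro: mult_left_mono order_trans[OF norm_ge_zero])
  qed (auto simp: a_def)
  have g0: "g 0 = 1" by (simp add: g_def \<phi>_def prob_space)
  have "\<phi> \<theta> - of_real (exp (- (\<theta>\<^sup>2 * V / 2))) = exp (- (\<theta>\<^sup>2 * V / 2)) *\<^sub>R (g \<theta> - g 0)"
    unfolding g0 by (simp add: g_def scaleR_conv_of_real algebra_simps exp_add[symmetric] flip: of_real_mult)
  then have "cmod (\<phi> \<theta> - of_real (exp (- (\<theta>\<^sup>2 * V / 2)))) = exp (- (\<theta>\<^sup>2 * V / 2)) * norm (g \<theta> - g 0)"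
    by simp
  also have "\<dots> \<le> exp (- (\<theta>\<^sup>2 * V / 2)) * ((exp (V * a\<^sup>2 / 2) * (a\<^sup>2 * d2 + a * d1)) * a)"
    using bound by (intro mult_left_mono) (auto simp: a_def)
  also have "\<dots> = (exp (- (\<theta>\<^sup>2 * V / 2)) * exp (V * a\<^sup>2 / 2)) * ((a\<^sup>2 * d2 + a * d1) * a)"
    by (simp only: mult.assoc)
  also have "exp (- (\<theta>\<^sup>2 * V / 2)) * exp (V * a\<^sup>2 / 2) = 1"
    by (simp add: exp_add[symmetric] a_def mult.commute)
  finally show ?thesis
    unfolding d1_def[symmetric] d2_def[symmetric] \<phi>_def a_def
    by (simp add: power2_eq_square power3_eq_cube algebra_simps)
qed

end

section \<open>The linear model with standardised noise\<close>

context indep_std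
begin

text \<open>The bounds for quadratic forms, specialised to a diagonal matrix, for which
  \<open>frob2\<close> is the sum of the squared coefficients.\<close>

lemma diag_form:
  shows "L4 (\<lambda>\<omega>. \<Sum>i<n. c i * ((x i \<omega>)\<^sup>2 - 1))"
    "expectation (\<lambda>\<omega>. (\<Sum>i<n. c i * ((x i \<omega>)\<^sup>2 - 1))\<^sup>2) \<le> 48 * K * (\<Sum>i<n. (c i)\<^sup>2)"
proof -
  define Q where "Q i k = (if i = k then c i else 0)" for i k
  have Q: "symm n Q" by (auto simp: symm_def Q_def)
  have "quad n Q y = (\<Sum>i<n. c i * (y i)\<^sup>2)" for y
    unfolding quad_def Q_def
    by (intro sum.cong refl) (simp add: if_distrib[where f="\<lambda>t. t * _"] power2_eq_square cong: if_cong)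
  moreover have "trace n Q = (\<Sum>i<n. c i)" by (simp add: trace_def Q_def)
  ultimately have eq: "quad n Q y - trace n Q = (\<Sum>i<n. c i * ((y i)\<^sup>2 - 1))" for y
    by (simp add: right_diff_distrib sum_subtractf)
  have fr: "frob2 n Q = (\<Sum>i<n. (c i)\<^sup>2)"
    unfolding frob2_def Q_def
    by (intro sum.cong refl) (simp add: if_distrib[where f="\<lambda>t. t ^ _"] cong: if_cong)
  show "L4 (\<lambda>\<omega>. \<Sum>i<n. c i * ((x i \<omega>)\<^sup>2 - 1))"
    using fourth_moment_quad(1)[OF Q] unfolding eq .
  show "expectation (\<lambda>\<omega>. (\<Sum>i<n. c i * ((x i \<omega>)\<^sup>2 - 1))\<^sup>2) \<le> 48 * K * (\<Sum>i<n. (c i)\<^sup>2)"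
    using variance_quad[OF Q] unfolding eq fr .
qed

lemma expectation_abs_le:
  assumes "f \<in> borel_measurable M" "integrable M (\<lambda>\<omega>. (f \<omega>)\<^sup>2)" "expectation (\<lambda>\<omega>. (f \<omega>)\<^sup>2) \<le> c"
  shows "expectation (\<lambda>\<omega>. \<bar>f \<omega> :: real\<bar>) \<le> sqrt c"
proof (rule real_le_rsqrt)
  have "(expectation (\<lambda>\<omega>. \<bar>f \<omega>\<bar>))\<^sup>2 \<le> expectation (\<lambda>\<omega>. \<bar>f \<omega>\<bar>\<^sup>2)"
    using assms by (intro expectation_square_le(2)) auto
  also have "\<dots> \<le> c" using assms by simp
  finally show "(expectation (\<lambda>\<omega>. \<bar>f \<omega>\<bar>))\<^sup>2 \<le> c" .
qed

end

section \<open>Linear forms of the rows, and integration over the errors with the design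
  fixed\<close>

context indep_array
begin

definition K2 :: real where "K2 = 8 * ((48 * K)\<^sup>2 + 1)"

lemma K2_ge_1: "1 \<le> K2"
  by (simp add: K2_def add_increasing)

text \<open>For a unit vector c and x the corresponding form of a row, x^2 - 1 is the centred
  quadratic form of c c^T, whose trace and squared Frobenius norm are 1. Its fourth moment is thus
  at most (48 K)^2 in every dimension, and x^8 \<le> 8 ((x^2 - 1)^4 + 1) gives \<open>K2\<close>. In
  this way the signals and the responses become standardised variables themselves.\<close>

lemma row_form_indep_std:
  assumes c: "(\<Sum>j<Suc p. (c j)\<^sup>2) = 1"
  shows "indep_std M n (\<lambda>i \<omega>. \<Sum>j<Suc p. c j * w i j \<omega>) K2"
proof -
  have ind: "indep_vars (\<lambda>_. borel) (\<lambda>i \<omega>. \<Sum>j<Suc p. c j * w i j \<omega>) {..<n}"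
  proof -
    let ?X = "\<lambda>(i, j). w i j"
    have "indep_vars (\<lambda>i. Pi\<^sub>M ({i} \<times> {..p}) (\<lambda>_. borel)) (\<lambda>i \<omega>. restrict (\<lambda>b. ?X b \<omega>) ({i} \<times> {..p})) {..<n}"
      by (intro indep_vars_restrict[OF indep]) (auto simp: disjoint_family_on_def)
    then have "indep_vars (\<lambda>_. borel) (\<lambda>i \<omega>. (\<lambda>y. \<Sum>j<Suc p. c j * y (i, j)) (restrict (\<lambda>b. ?X b \<omega>) ({i} \<times> {..p}))) {..<n}"
      by (rule indep_vars_compose2) (auto intro!: borel_measurable_sum borel_measurable_times)
    also have "(\<lambda>i \<omega>. (\<lambda>y. \<Sum>j<Suc p. c j * y (i, j)) (restrict (\<lambda>b. ?X b \<omega>) ({i} \<times> {..p}))) =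
        (\<lambda>i \<omega>. \<Sum>j<Suc p. c j * w i j \<omega>)"
      by (auto simp: fun_eq_iff intro!: sum.cong)
    finally show ?thesis .
  qed
  define q where "q j k = c j * c k" for j k
  have sq: "symm (Suc p) q" by (auto simp: symm_def q_def)
  have qq: "quad (Suc p) q y = (\<Sum>j<Suc p. c j * y j)\<^sup>2" for y
    unfolding quad_def q_def power2_eq_square sum_product by (intro sum.cong refl) simp
  have tq: "trace (Suc p) q = 1" using c by (simp add: trace_def q_def power2_eq_square)
  have fq: "frob2 (Suc p) q = 1"
  proof -
    have "frob2 (Suc p) q = (\<Sum>j<Suc p. (c j)\<^sup>2) * (\<Sum>j<Suc p. (c j)\<^sup>2)"
      unfolding frob2_def q_def sum_product by (simp only: power_mult_distrib)
    then show ?thesis unfolding c by simp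
  qed
  show ?thesis
  proof (unfold_locales)
    fix i assume i: "i < n"
    interpret r: indep_std M "Suc p" "\<lambda>j. w i j" K by (rule row_indep_std[OF i])
    let ?x = "\<lambda>\<omega>. \<Sum>j<Suc p. c j * w i j \<omega>"
    show "expectation ?x = 0" by (rule r.expectation_lin) simp
    show "expectation (\<lambda>\<omega>. (?x \<omega>)\<^sup>2) = 1" using r.second_moment_lin[of "Suc p" c] c by simp
    have L: "L4 (\<lambda>\<omega>. (?x \<omega>)\<^sup>2 - 1)" using r.fourth_moment_quad(1)[OF sq] unfolding qq tq .
    have E: "expectation (\<lambda>\<omega>. ((?x \<omega>)\<^sup>2 - 1) ^ 4) \<le> (48 * K)\<^sup>2"
      using r.fourth_moment_quad(2)[OF sq] unfolding qq tq fq by simp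
    have le: "(?x \<omega>) ^ 8 \<le> 8 * (((?x \<omega>)\<^sup>2 - 1) ^ 4 + 1)" for \<omega>
    proof -
      have "((?x \<omega>)\<^sup>2 - 1 + 1) ^ 4 \<le> 8 * (((?x \<omega>)\<^sup>2 - 1) ^ 4 + 1 ^ 4)" by (rule add_pow4_le)
      moreover have "((?x \<omega>)\<^sup>2 - 1 + 1) ^ 4 = (?x \<omega>) ^ 8" by (simp flip: power_mult)
      ultimately show ?thesis by (simp only: power_one)
    qed
    have i4: "integrable M (\<lambda>\<omega>. ((?x \<omega>)\<^sup>2 - 1) ^ 4)" by (rule L4_int4[OF L])
    show i8: "integrable M (\<lambda>\<omega>. (?x \<omega>) ^ 8)"
    proof (rule Bochner_Integration.integrable_bound)
      show "integrable M (\<lambda>\<omega>. 8 * (((?x \<omega>)\<^sup>2 - 1) ^ 4 + 1))" using i4 by (intro integrable_mult_right Bochner_Integration.integrable_add) auto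
      show "(\<lambda>\<omega>. (?x \<omega>) ^ 8) \<in> borel_measurable M"
        using i by (intro borel_measurable_power borel_measurable_sum borel_measurable_times) auto
      show "AE \<omega> in M. norm ((?x \<omega>) ^ 8) \<le> norm (8 * (((?x \<omega>)\<^sup>2 - 1) ^ 4 + 1))"
      proof (rule AE_I2)
        fix \<omega>
        have "norm ((?x \<omega>) ^ 8) = (?x \<omega>) ^ 8" by simp
        also have "\<dots> \<le> 8 * (((?x \<omega>)\<^sup>2 - 1) ^ 4 + 1)" by (rule le)
        also have "\<dots> \<le> norm (8 * (((?x \<omega>)\<^sup>2 - 1) ^ 4 + 1))" by (simp only: real_norm_def abs_ge_self)
        finally show "norm ((?x \<omega>) ^ 8) \<le> norm (8 * (((?x \<omega>)\<^sup>2 - 1) ^ 4 + 1))" .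
      qed
    qed
    have "expectation (\<lambda>\<omega>. (?x \<omega>) ^ 8) \<le> expectation (\<lambda>\<omega>. 8 * (((?x \<omega>)\<^sup>2 - 1) ^ 4 + 1))"
      using i8 i4 le by (intro integral_mono integrable_mult_right Bochner_Integration.integrable_add) auto
    also have "\<dots> = 8 * (expectation (\<lambda>\<omega>. ((?x \<omega>)\<^sup>2 - 1) ^ 4) + 1)"
      using i4 by (subst Bochner_Integration.integral_mult_right) (auto simp: Bochner_Integration.integral_add prob_space intro!: Bochner_Integration.integrable_add)
    also have "\<dots> \<le> K2" using E unfolding K2_def by simp
    finally show "expectation (\<lambda>\<omega>. (?x \<omega>) ^ 8) \<le> K2" .
  qed (use ind K2_ge_1 in auto)
qed

definition dep_mat :: "((nat \<Rightarrow> nat \<Rightarrow> real) \<Rightarrow> (nat \<Rightarrow> real) \<Rightarrow> 'd) \<Rightarrow> bool" where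
  "dep_mat F \<longleftrightarrow> (\<forall>U U' e e'. (\<forall>i<n. \<forall>l<p. U i l = U' i l) \<longrightarrow> (\<forall>i<n. e i = e' i) \<longrightarrow> F U e = F U' e')"

lemma last_column_setup:
  fixes F :: "(nat \<Rightarrow> nat \<Rightarrow> real) \<Rightarrow> (nat \<Rightarrow> real) \<Rightarrow> 'd :: {banach, second_countable_topology}"
  assumes meas: "\<And>(N :: ((nat \<times> nat \<Rightarrow> real) \<times> (nat \<times> nat \<Rightarrow> real)) measure) U e.
        (\<And>i l. i < n \<Longrightarrow> l < p \<Longrightarrow> (\<lambda>\<omega>. U \<omega> i l) \<in> borel_measurable N) \<Longrightarrow>
        (\<And>i. i < n \<Longrightarrow> (\<lambda>\<omega>. e \<omega> i) \<in> borel_measurable N) \<Longrightarrow> (\<lambda>\<omega>. F (U \<omega>) (e \<omega>)) \<in> borel_measurable N"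
    and dep: "dep_mat F"
  defines "A \<equiv> {..<n} \<times> {..<p}" and "B \<equiv> {..<n} \<times> {p}"
    and "F' \<equiv> \<lambda>uv :: (nat \<times> nat \<Rightarrow> real) \<times> (nat \<times> nat \<Rightarrow> real). F (\<lambda>i l. fst uv (i, l)) (\<lambda>i. snd uv (i, p))"
  shows "F' \<in> borel_measurable (Pi\<^sub>M A (\<lambda>_. borel) \<Otimes>\<^sub>M Pi\<^sub>M B (\<lambda>_. borel))"
    "F' (restrict u A, restrict v B) = F' (u, v)"
proof -
  show "F' \<in> borel_measurable (Pi\<^sub>M A (\<lambda>_. borel) \<Otimes>\<^sub>M Pi\<^sub>M B (\<lambda>_. borel))"
    unfolding F'_def
  proof (rule meas)
    fix i l assume "i < n" "l < p"
    then have "(\<lambda>u. u (i, l)) \<in> borel_measurable (Pi\<^sub>M A (\<lambda>_. borel))"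
      by (intro measurable_component_singleton) (auto simp: A_def)
    from measurable_compose[OF measurable_fst this]
    show "(\<lambda>uv. fst uv (i, l)) \<in> borel_measurable (Pi\<^sub>M A (\<lambda>_. borel) \<Otimes>\<^sub>M Pi\<^sub>M B (\<lambda>_. borel))" .
  next
    fix i assume "i < n"
    then have "(\<lambda>u. u (i, p)) \<in> borel_measurable (Pi\<^sub>M B (\<lambda>_. borel))"
      by (intro measurable_component_singleton) (auto simp: B_def)
    from measurable_compose[OF measurable_snd this]
    show "(\<lambda>uv. snd uv (i, p)) \<in> borel_measurable (Pi\<^sub>M A (\<lambda>_. borel) \<Otimes>\<^sub>M Pi\<^sub>M B (\<lambda>_. borel))" .
  qed
  show "F' (restrict u A, restrict v B) = F' (u, v)"
    unfolding F'_def using dep unfolding dep_mat_def by (simp add: A_def B_def)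
qed

lemma decouple_last:
  fixes F :: "(nat \<Rightarrow> nat \<Rightarrow> real) \<Rightarrow> (nat \<Rightarrow> real) \<Rightarrow> 'd :: {banach, second_countable_topology}"
  assumes meas: "\<And>(N :: ((nat \<times> nat \<Rightarrow> real) \<times> (nat \<times> nat \<Rightarrow> real)) measure) U e.
        (\<And>i l. i < n \<Longrightarrow> l < p \<Longrightarrow> (\<lambda>\<omega>. U \<omega> i l) \<in> borel_measurable N) \<Longrightarrow>
        (\<And>i. i < n \<Longrightarrow> (\<lambda>\<omega>. e \<omega> i) \<in> borel_measurable N) \<Longrightarrow> (\<lambda>\<omega>. F (U \<omega>) (e \<omega>)) \<in> borel_measurable N"
    and dep: "dep_mat F"
    and int: "integrable M (\<lambda>\<omega>. F (W \<omega>) (\<lambda>i. w i p \<omega>))"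
  shows "expectation (\<lambda>\<omega>. F (W \<omega>) (\<lambda>i. w i p \<omega>)) = expectation (\<lambda>\<omega>. expectation (\<lambda>\<omega>'. F (W \<omega>) (\<lambda>i. w i p \<omega>')))"
    "integrable M (\<lambda>\<omega>. expectation (\<lambda>\<omega>'. F (W \<omega>) (\<lambda>i. w i p \<omega>')))"
proof -
  note s = last_column_setup[of F, OF meas dep]
  have *: "{..<n} \<times> {..<p} \<subseteq> {..<n} \<times> {..p}" "{..<n} \<times> {p} \<subseteq> {..<n} \<times> {..p}" "({..<n} \<times> {..<p}) \<inter> ({..<n} \<times> {p}) = {}"
    by auto
  show "expectation (\<lambda>\<omega>. F (W \<omega>) (\<lambda>i. w i p \<omega>)) = expectation (\<lambda>\<omega>. expectation (\<lambda>\<omega>'. F (W \<omega>) (\<lambda>i. w i p \<omega>')))"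
    "integrable M (\<lambda>\<omega>. expectation (\<lambda>\<omega>'. F (W \<omega>) (\<lambda>i. w i p \<omega>')))"
    unfolding atomize_conj
  proof -
    define F' where "F' uv = F (\<lambda>i l. fst uv (i, l)) (\<lambda>i. snd uv (i, p))"
      for uv :: "(nat \<times> nat \<Rightarrow> real) \<times> (nat \<times> nat \<Rightarrow> real)"
    have F': "F' \<in> borel_measurable (Pi\<^sub>M ({..<n} \<times> {..<p}) (\<lambda>_. borel) \<Otimes>\<^sub>M Pi\<^sub>M ({..<n} \<times> {p}) (\<lambda>_. borel))"
      unfolding F'_def[abs_def] by (rule s(1))
    have F'': "F' (restrict u ({..<n} \<times> {..<p}), restrict v ({..<n} \<times> {p})) = F' (u, v)" for u v
      unfolding F'_def by (rule s(2))
    have int': "integrable M (\<lambda>\<omega>. F' (\<lambda>(i, j). w i j \<omega>, \<lambda>(i, j). w i j \<omega>))" using int by (simp add: F'_def)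
    show "expectation (\<lambda>\<omega>. F (W \<omega>) (\<lambda>i. w i p \<omega>)) = expectation (\<lambda>\<omega>. expectation (\<lambda>\<omega>'. F (W \<omega>) (\<lambda>i. w i p \<omega>'))) \<and>
      integrable M (\<lambda>\<omega>. expectation (\<lambda>\<omega>'. F (W \<omega>) (\<lambda>i. w i p \<omega>')))"
      using decouple[OF * F' F'' int'] by (simp add: F'_def)
  qed
qed

text \<open>Integrability over design and errors together is a conclusion here. The truncations
  \<open>min (real k) (F U e)\<close> are bounded, so they can be decoupled and compared with
  \<open>g\<close>; monotone convergence then removes the truncation.\<close>

lemma decouple_last_le:
  fixes F :: "(nat \<Rightarrow> nat \<Rightarrow> real) \<Rightarrow> (nat \<Rightarrow> real) \<Rightarrow> real"
  assumes meas: "\<And>(N :: ((nat \<times> nat \<Rightarrow> real) \<times> (nat \<times> nat \<Rightarrow> real)) measure) U e.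
        (\<And>i l. i < n \<Longrightarrow> l < p \<Longrightarrow> (\<lambda>\<omega>. U \<omega> i l) \<in> borel_measurable N) \<Longrightarrow>
        (\<And>i. i < n \<Longrightarrow> (\<lambda>\<omega>. e \<omega> i) \<in> borel_measurable N) \<Longrightarrow> (\<lambda>\<omega>. F (U \<omega>) (e \<omega>)) \<in> borel_measurable N"
    and dep: "dep_mat F"
    and nonneg: "\<And>U e. 0 \<le> F U e"
    and measM: "(\<lambda>\<omega>. F (W \<omega>) (\<lambda>i. w i p \<omega>)) \<in> borel_measurable M"
    and inner: "\<And>\<omega>. integrable M (\<lambda>\<omega>'. F (W \<omega>) (\<lambda>i. w i p \<omega>'))"
       "\<And>\<omega>. expectation (\<lambda>\<omega>'. F (W \<omega>) (\<lambda>i. w i p \<omega>')) \<le> g \<omega>"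
    and g: "integrable M g"
  shows "integrable M (\<lambda>\<omega>. F (W \<omega>) (\<lambda>i. w i p \<omega>))"
    "expectation (\<lambda>\<omega>. F (W \<omega>) (\<lambda>i. w i p \<omega>)) \<le> expectation g"
proof -
  have tr: "expectation (\<lambda>\<omega>. min (real k) (F (W \<omega>) (\<lambda>i. w i p \<omega>))) \<le> expectation g" for k :: nat
  proof -
    let ?G = "\<lambda>U e. min (real k) (F U e)"
    have m: "(\<lambda>\<omega>. ?G (U \<omega>) (e \<omega>)) \<in> borel_measurable N"
      if "\<And>i l. i < n \<Longrightarrow> l < p \<Longrightarrow> (\<lambda>\<omega>. U \<omega> i l) \<in> borel_measurable N" "\<And>i. i < n \<Longrightarrow> (\<lambda>\<omega>. e \<omega> i) \<in> borel_measurable N"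
      for N :: "((nat \<times> nat \<Rightarrow> real) \<times> (nat \<times> nat \<Rightarrow> real)) measure" and U e
      using meas[OF that] by simp
    have d: "dep_mat ?G" unfolding dep_mat_def
    proof (intro allI impI)
      fix U U' :: "nat \<Rightarrow> nat \<Rightarrow> real" and e e' :: "nat \<Rightarrow> real"
      assume "\<forall>i<n. \<forall>l<p. U i l = U' i l" "\<forall>i<n. e i = e' i"
      then have "F U e = F U' e'" using dep unfolding dep_mat_def by blast
      then show "?G U e = ?G U' e'" by simp
    qed
    have i: "integrable M (\<lambda>\<omega>. ?G (W \<omega>) (\<lambda>i. w i p \<omega>))"
      using measM nonneg by (intro integrable_const_bound[of _ "real k"]) auto
    note dl = decouple_last[of ?G, OF m d i]
    have "expectation (\<lambda>\<omega>. ?G (W \<omega>) (\<lambda>i. w i p \<omega>)) = expectation (\<lambda>\<omega>. expectation (\<lambda>\<omega>'. ?G (W \<omega>) (\<lambda>i. w i p \<omega>')))"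
      by (rule dl)
    also have "\<dots> \<le> expectation g"
    proof (rule integral_mono[OF dl(2) g])
      fix \<omega>
      have "expectation (\<lambda>\<omega>'. ?G (W \<omega>) (\<lambda>i. w i p \<omega>')) \<le> expectation (\<lambda>\<omega>'. F (W \<omega>) (\<lambda>i. w i p \<omega>'))"
      proof (rule integral_mono)
        show "integrable M (\<lambda>\<omega>'. ?G (W \<omega>) (\<lambda>i. w i p \<omega>'))"
          using inner(1)[of \<omega>] nonneg by (intro integrable_const_bound[of _ "real k"]) auto
      qed (use inner(1)[of \<omega>] in auto)
      then show "expectation (\<lambda>\<omega>'. ?G (W \<omega>) (\<lambda>i. w i p \<omega>')) \<le> g \<omega>" using inner(2)[of \<omega>] by linarith
    qed
    finally show ?thesis .
  qed
  have eg: "0 \<le> expectation g" using tr[of 0] nonneg by (simp add: min_def)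
  have sup: "(SUP k. ennreal (min (real k) y)) = ennreal y" if "0 \<le> y" for y
  proof (rule antisym)
    show "(SUP k. ennreal (min (real k) y)) \<le> ennreal y"
      using that by (intro SUP_least ennreal_leI) auto
    obtain k where "y \<le> real k" using real_arch_simple by blast
    then show "ennreal y \<le> (SUP k. ennreal (min (real k) y))"
      by (intro SUP_upper2[of k]) (auto simp: min_def intro!: ennreal_leI)
  qed
  have nn: "(\<integral>\<^sup>+\<omega>. ennreal (F (W \<omega>) (\<lambda>i. w i p \<omega>)) \<partial>M) \<le> ennreal (expectation g)"
  proof -
    have "(\<integral>\<^sup>+\<omega>. ennreal (F (W \<omega>) (\<lambda>i. w i p \<omega>)) \<partial>M) =
        (\<integral>\<^sup>+\<omega>. (SUP k. ennreal (min (real k) (F (W \<omega>) (\<lambda>i. w i p \<omega>)))) \<partial>M)"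
      by (simp only: sup[OF nonneg])
    also have "\<dots> = (SUP k. \<integral>\<^sup>+\<omega>. ennreal (min (real k) (F (W \<omega>) (\<lambda>i. w i p \<omega>))) \<partial>M)"
      using measM by (intro nn_integral_monotone_convergence_SUP) (auto simp: incseq_def le_fun_def intro!: ennreal_leI)
    also have "\<dots> \<le> ennreal (expectation g)"
    proof (rule SUP_least)
      fix k :: nat
      have "(\<integral>\<^sup>+\<omega>. ennreal (min (real k) (F (W \<omega>) (\<lambda>i. w i p \<omega>))) \<partial>M) =
          ennreal (expectation (\<lambda>\<omega>. min (real k) (F (W \<omega>) (\<lambda>i. w i p \<omega>))))"
        using measM nonneg by (intro nn_integral_eq_integral integrable_const_bound[of _ "real k"]) auto
      also have "\<dots> \<le> ennreal (expectation g)" using tr by (intro ennreal_leI)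
      finally show "(\<integral>\<^sup>+\<omega>. ennreal (min (real k) (F (W \<omega>) (\<lambda>i. w i p \<omega>))) \<partial>M) \<le> ennreal (expectation g)" .
    qed
    finally show ?thesis .
  qed
  show i: "integrable M (\<lambda>\<omega>. F (W \<omega>) (\<lambda>i. w i p \<omega>))"
    using nn nonneg measM by (intro integrableI_bounded) (auto simp: abs_of_nonneg intro: le_less_trans)
  have "ennreal (expectation (\<lambda>\<omega>. F (W \<omega>) (\<lambda>i. w i p \<omega>))) \<le> ennreal (expectation g)"
    using nn nonneg by (subst nn_integral_eq_integral[OF i, symmetric]) auto
  then show "expectation (\<lambda>\<omega>. F (W \<omega>) (\<lambda>i. w i p \<omega>)) \<le> expectation g"
    using eg by (simp add: ennreal_le_iff)
qed

end

context indep_poly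
begin

lemma B_second_moment: "expectation (\<lambda>\<omega>. (B \<omega>)\<^sup>2) \<le> 144 * K * (\<Sum>k<n. s k)"
proof -
  let ?l = "\<lambda>\<omega>. \<Sum>k<n. u k * x k \<omega>" and ?d = "\<lambda>\<omega>. \<Sum>k<n. v k * ((x k \<omega>)\<^sup>2 - 1)"
  let ?q = "\<lambda>\<omega>. quad n A (\<lambda>i. x i \<omega>) - trace n A"
  have tr: "trace n A = 0" by (simp add: trace_def A_diag)
  have B: "B \<omega> = ?l \<omega> + ?d \<omega> + ?q \<omega>" for \<omega>
    by (simp add: B_def lin_def sum.distrib tr)
  have L: "L4 ?l" "L4 ?d" "L4 ?q" by (rule L4_lin, simp, rule diag_form(1), rule fourth_moment_quad(1)[OF A_symm])
  have *: "(a + b + c)\<^sup>2 \<le> 3 * (a\<^sup>2 + b\<^sup>2 + c\<^sup>2)" for a b c :: real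
    using sum_squares_bound[of a b] sum_squares_bound[of a c] sum_squares_bound[of b c]
    by (simp add: power2_sum distrib_right)
  have "expectation (\<lambda>\<omega>. (B \<omega>)\<^sup>2) \<le> expectation (\<lambda>\<omega>. 3 * ((?l \<omega>)\<^sup>2 + (?d \<omega>)\<^sup>2 + (?q \<omega>)\<^sup>2))"
    unfolding B using L4_sq[OF L(1)] L4_sq[OF L(2)] L4_sq[OF L(3)] L4_sq[OF L4_add[OF L4_add[OF L(1,2)] L(3)]]
    by (intro integral_mono integrable_mult_right Bochner_Integration.integrable_add *)
  also have "\<dots> = 3 * (expectation (\<lambda>\<omega>. (?l \<omega>)\<^sup>2) + expectation (\<lambda>\<omega>. (?d \<omega>)\<^sup>2) + expectation (\<lambda>\<omega>. (?q \<omega>)\<^sup>2))"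
    using L4_sq[OF L(1)] L4_sq[OF L(2)] L4_sq[OF L(3)] by simp
  also have "\<dots> \<le> 3 * (48 * K * (\<Sum>k<n. (u k)\<^sup>2) + 48 * K * (\<Sum>k<n. (v k)\<^sup>2) + 48 * K * frob2 n A)"
  proof (intro mult_left_mono add_mono)
    have "1 * (\<Sum>k<n. (u k)\<^sup>2) \<le> 48 * K * (\<Sum>k<n. (u k)\<^sup>2)"
      using K_ge_1 by (intro mult_right_mono sum_nonneg) auto
    then show "expectation (\<lambda>\<omega>. (?l \<omega>)\<^sup>2) \<le> 48 * K * (\<Sum>k<n. (u k)\<^sup>2)"
      using second_moment_lin[of n u] by simp
    show "expectation (\<lambda>\<omega>. (?d \<omega>)\<^sup>2) \<le> 48 * K * (\<Sum>k<n. (v k)\<^sup>2)" by (rule diag_form(2))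
    show "expectation (\<lambda>\<omega>. (?q \<omega>)\<^sup>2) \<le> 48 * K * frob2 n A" by (rule variance_quad[OF A_symm])
  qed simp
  also have "\<dots> = 144 * K * (\<Sum>k<n. s k)"
    by (simp add: s_def sum.distrib frob2_def rowsum_def distrib_left)
  finally show ?thesis .
qed

end

section \<open>The model with unit error variance, and its leading term\<close>

lemma proj_contraction:
  assumes "is_proj n Q" shows "ip n (mv n Q y) (mv n Q y) \<le> ip n y y"
proof -
  have "0 \<le> ip n (\<lambda>i. y i - mv n Q y i) (\<lambda>i. y i - mv n Q y i)" by (rule ip_self_nonneg)
  also have "\<dots> = ip n y y - 2 * ip n y (mv n Q y) + ip n (mv n Q y) (mv n Q y)"
    by (simp add: ip_def algebra_simps sum.distrib sum_subtractf sum_distrib_left)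
  also have "ip n y (mv n Q y) = ip n (mv n Q y) (mv n Q y)"
    using proj_quad[OF assms, of y] by (simp add: quad_ip)
  finally show ?thesis by simp
qed

text \<open>All quantities are in units of the error standard deviation and in whitened coordinates,
  so \<open>\<eta>\<close>, the squared norm of \<open>b\<close>, is the signal-to-noise ratio.
  \<open>H\<close> and \<open>R\<close> bound \<open>\<eta>\<close> and n / (n - p); in the
  application neither they nor \<open>K\<close> depend on n, and the constants below are built from
  these three alone.\<close>

locale lm_array = indep_array +
  fixes b :: "nat \<Rightarrow> real" and \<eta> H R \<nu>3 \<nu>4 \<mu>4 :: real
  assumes eta: "(\<Sum>j<p. (b j)\<^sup>2) = \<eta>" and eta_pos: "0 < \<eta>" and eta_H: "\<eta> \<le> H" and H_ge_1: "1 \<le> H"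
    and pn: "p < n" and nR: "real n \<le> R * (real n - real p)" and R_ge_1: "1 \<le> R"
    and nu3: "i < n \<Longrightarrow> expectation (\<lambda>\<omega>. w i p \<omega> ^ 3) = \<nu>3"
    and nu4: "i < n \<Longrightarrow> expectation (\<lambda>\<omega>. w i p \<omega> ^ 4) = \<nu>4"
    and mu4: "i < n \<Longrightarrow> expectation (\<lambda>\<omega>. (\<Sum>j<p. b j * w i j \<omega>) ^ 4) = \<mu>4"
begin

definition V :: real where "V = 1 + \<eta>"
definition m :: real where "m = real n - real p"
definition rn :: real where "rn = sqrt (real n)"
definition c0 :: real where "c0 = V * rn / m"

definition xi :: "(nat \<Rightarrow> nat \<Rightarrow> real) \<Rightarrow> nat \<Rightarrow> real" where
  "xi U i = (\<Sum>j<p. b j * U i j)"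

definition cA :: "(nat \<Rightarrow> nat \<Rightarrow> real) \<Rightarrow> nat \<Rightarrow> nat \<Rightarrow> real" where
  "cA U i k = (if i = k then 0 else - c0 * gs n U p i k)"

text \<open>The part of \<open>rn * (ybar - V * s2hat)\<close> that depends on the errors, after
  each diagonal entry of the projection has been replaced by m / n. As c0 m / n = V / rn, the
  squares keep the coefficient (1 - V) / rn = - \<eta> / rn.\<close>

definition Bst :: "(nat \<Rightarrow> nat \<Rightarrow> real) \<Rightarrow> (nat \<Rightarrow> real) \<Rightarrow> real" where
  "Bst U e = (\<Sum>k<n. 2 * xi U k / rn * e k + - \<eta> / rn * ((e k)\<^sup>2 - 1)) + quad n (cA U) e"

definition Ast :: "(nat \<Rightarrow> nat \<Rightarrow> real) \<Rightarrow> real" where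
  "Ast U = (\<Sum>i<n. ((xi U i)\<^sup>2 - \<eta>)) / rn"

text \<open>The effect of replacing the diagonal entries by their mean. The coefficients sum to 0,
  so centring the squares changes nothing.\<close>

definition Rem :: "(nat \<Rightarrow> nat \<Rightarrow> real) \<Rightarrow> (nat \<Rightarrow> real) \<Rightarrow> real" where
  "Rem U e = (\<Sum>i<n. - c0 * (gs n U p i i - trace n (gs n U p) / n) * ((e i)\<^sup>2 - 1))"

text \<open>The value around which the conditional variance of \<open>Bst\<close> given the design
  concentrates. It is deterministic, so its exponential leaves the integral over the design in
  \<open>main_char\<close>.\<close>

definition vv :: real where
  "vv = 4 * \<eta> + \<eta>\<^sup>2 * (\<nu>4 - 1) + 2 * V\<^sup>2 * (n / m - 1)"

lemma basic: "0 < n" "0 < m" "1 \<le> m" "1 \<le> rn" "rn * rn = real n" "rn\<^sup>2 = real n" "0 < rn" "1 \<le> V" "V \<le> 2 * H"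
   "0 \<le> c0" "n / m \<le> R" "m \<le> real n"
proof -
  show "0 < n" "0 < m" "1 \<le> m" using pn by (auto simp: m_def)
  show "1 \<le> rn" "rn * rn = real n" "rn\<^sup>2 = real n" "0 < rn" using pn by (auto simp: rn_def)
  show "1 \<le> V" "V \<le> 2 * H" using eta_pos eta_H H_ge_1 by (auto simp: V_def)
  show "0 \<le> c0" using \<open>0 < m\<close> \<open>1 \<le> rn\<close> \<open>1 \<le> V\<close> by (simp add: c0_def)
  show "n / m \<le> R" using nR \<open>0 < m\<close> by (simp add: m_def divide_le_eq)
  show "m \<le> real n" by (simp add: m_def)
qed

lemma c0_le: "c0 \<le> 2 * H * R / rn"
proof -
  have "c0 = V * (n / m) / rn" using basic by (simp add: c0_def field_simps)
  also have "\<dots> \<le> (2 * H) * R / rn" using basic H_ge_1 by (intro divide_right_mono mult_mono) auto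
  finally show ?thesis .
qed

lemma c0_sq_le: "c0\<^sup>2 \<le> 4 * H\<^sup>2 * R\<^sup>2 / n"
proof -
  have "c0\<^sup>2 \<le> (2 * H * R / rn)\<^sup>2" using c0_le basic by (intro power_mono) auto
  then show ?thesis using basic by (simp add: power_divide power_mult_distrib)
qed

lemma n_m2_le: "n / m\<^sup>2 \<le> R\<^sup>2 / n"
proof -
  have "(n / m)\<^sup>2 \<le> R\<^sup>2" using basic by (intro power_mono) auto
  then have "(n / m)\<^sup>2 / n \<le> R\<^sup>2 / n" using basic by (intro divide_right_mono) auto
  moreover have "(n / m)\<^sup>2 / n = n / m\<^sup>2" using basic by (simp add: power2_eq_square)
  ultimately show ?thesis by simp
qed

lemma xi_system: "indep_std M n (\<lambda>i \<omega>. xi (W \<omega>) i / sqrt \<eta>) K2"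
proof -
  let ?c = "\<lambda>j. if j < p then b j / sqrt \<eta> else 0"
  have c: "(\<Sum>j<Suc p. (?c j)\<^sup>2) = 1"
    using eta eta_pos by (simp add: power_divide sum_divide_distrib[symmetric])
  have eq: "(\<lambda>i \<omega>. \<Sum>j<Suc p. ?c j * w i j \<omega>) = (\<lambda>i \<omega>. xi (W \<omega>) i / sqrt \<eta>)"
    by (simp add: xi_def fun_eq_iff sum_divide_distrib)
  show ?thesis using row_form_indep_std[OF c] unfolding eq .
qed

lemma Y_system: "indep_std M n (\<lambda>i \<omega>. (xi (W \<omega>) i + w i p \<omega>) / sqrt V) K2"
proof -
  let ?c = "\<lambda>j. (if j < p then b j else 1) / sqrt V"
  have c: "(\<Sum>j<Suc p. (?c j)\<^sup>2) = 1"
    using eta basic by (simp add: power_divide sum_divide_distrib[symmetric] add_divide_distrib[symmetric] V_def)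
  have eq: "(\<lambda>i \<omega>. \<Sum>j<Suc p. ?c j * w i j \<omega>) = (\<lambda>i \<omega>. (xi (W \<omega>) i + w i p \<omega>) / sqrt V)"
    by (simp add: xi_def fun_eq_iff sum_divide_distrib add_divide_distrib)
  show ?thesis using row_form_indep_std[OF c] unfolding eq .
qed

lemma noise: "indep_std M n (\<lambda>i. w i p) K"
  by (rule column_indep_std) simp

lemma poly: "indep_poly M n (\<lambda>i. w i p) K (cA U)"
proof -
  interpret e: indep_std M n "\<lambda>i. w i p" K by (rule noise)
  show ?thesis
  proof
    show "symm n (cA U)"
      using proj_symm[OF gs_proj, of n U p] by (auto simp: symm_def cA_def)
  qed (simp add: cA_def)
qed

lemma dep_xi: "(\<And>l. l < p \<Longrightarrow> U i l = U' i l) \<Longrightarrow> xi U i = xi U' i"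
  by (simp add: xi_def)

lemma xi_meas:
  assumes "i < n" "\<And>i l. i < n \<Longrightarrow> l < p \<Longrightarrow> (\<lambda>\<omega>. U \<omega> i l) \<in> borel_measurable N"
  shows "(\<lambda>\<omega>. xi (U \<omega>) i) \<in> borel_measurable N"
  unfolding xi_def using assms by (intro borel_measurable_sum borel_measurable_times) auto

lemma Bst_meas:
  assumes U: "\<And>i l. i < n \<Longrightarrow> l < p \<Longrightarrow> (\<lambda>\<omega>. U \<omega> i l) \<in> borel_measurable N"
    and e: "\<And>i. i < n \<Longrightarrow> (\<lambda>\<omega>. e \<omega> i) \<in> borel_measurable N"
  shows "(\<lambda>\<omega>. Bst (U \<omega>) (e \<omega>)) \<in> borel_measurable N"
proof -
  have "(\<lambda>\<omega>. cA (U \<omega>) i k) \<in> borel_measurable N" for i k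
    using measurable_gs[of n p U N i k, OF U] by (cases "i = k") (auto simp: cA_def)
  then show ?thesis unfolding Bst_def
    using e xi_meas[OF _ U]
    by (intro borel_measurable_add borel_measurable_sum measurable_quad borel_measurable_times borel_measurable_divide
        borel_measurable_diff borel_measurable_power borel_measurable_const) auto
qed

lemma Ast_meas:
  assumes U: "\<And>i l. i < n \<Longrightarrow> l < p \<Longrightarrow> (\<lambda>\<omega>. U \<omega> i l) \<in> borel_measurable N"
  shows "(\<lambda>\<omega>. Ast (U \<omega>)) \<in> borel_measurable N"
  unfolding Ast_def using xi_meas[OF _ U]
  by (intro borel_measurable_divide borel_measurable_sum borel_measurable_diff borel_measurable_power borel_measurable_const) auto

lemma Rem_meas:
  assumes U: "\<And>i l. i < n \<Longrightarrow> l < p \<Longrightarrow> (\<lambda>\<omega>. U \<omega> i l) \<in> borel_measurable N"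
    and e: "\<And>i. i < n \<Longrightarrow> (\<lambda>\<omega>. e \<omega> i) \<in> borel_measurable N"
  shows "(\<lambda>\<omega>. Rem (U \<omega>) (e \<omega>)) \<in> borel_measurable N"
  unfolding Rem_def trace_def using e measurable_gs[of n p U N, OF U]
  by (intro borel_measurable_divide borel_measurable_sum borel_measurable_diff borel_measurable_times borel_measurable_power borel_measurable_const) auto

lemma deps:
  assumes "\<forall>i<n. \<forall>l<p. U i l = U' i l" "\<forall>i<n. e i = e' i"
  shows "Bst U e = Bst U' e'" "Ast U = Ast U'" "Rem U e = Rem U' e'"
proof -
  have g: "gs n U p = gs n U' p" by (rule gs_cong) (use assms in auto)
  have x: "xi U i = xi U' i" if "i < n" for i using assms that by (intro dep_xi) auto
  have "cA U = cA U'" unfolding cA_def[abs_def] g ..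
  then show "Bst U e = Bst U' e'" using x assms by (simp add: Bst_def quad_def)
  show "Ast U = Ast U'" using x by (simp add: Ast_def)
  show "Rem U e = Rem U' e'" using assms by (simp add: Rem_def g)
qed

lemma W_meas: "i < n \<Longrightarrow> l < p \<Longrightarrow> (\<lambda>\<omega>. w i l \<omega>) \<in> borel_measurable M" "i < n \<Longrightarrow> (\<lambda>\<omega>. w i p \<omega>) \<in> borel_measurable M"
  using w_measurable by auto

lemma stat_meas [measurable]:
  "(\<lambda>\<omega>. Bst (W \<omega>) (\<lambda>i. w i p \<omega>)) \<in> borel_measurable M" "(\<lambda>\<omega>. Ast (W \<omega>)) \<in> borel_measurable M"
  "(\<lambda>\<omega>. Rem (W \<omega>) (\<lambda>i. w i p \<omega>)) \<in> borel_measurable M" "(\<lambda>\<omega>. Bst U (\<lambda>i. w i p \<omega>)) \<in> borel_measurable M"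
  "i < n \<Longrightarrow> (\<lambda>\<omega>. xi (W \<omega>) i) \<in> borel_measurable M"
  using W_meas by (auto intro!: Bst_meas Ast_meas Rem_meas xi_meas)

definition ax2 :: "(nat \<Rightarrow> nat \<Rightarrow> real) \<Rightarrow> real" where "ax2 U = (\<Sum>i<n. (xi U i)\<^sup>2) / n"
definition ax4 :: "(nat \<Rightarrow> nat \<Rightarrow> real) \<Rightarrow> real" where "ax4 U = (\<Sum>i<n. (xi U i) ^ 4) / n"
definition ax1 :: "(nat \<Rightarrow> nat \<Rightarrow> real) \<Rightarrow> real" where "ax1 U = (\<Sum>i<n. xi U i) / n"
text \<open>Bounds \<open>n\<close> times that part of \<open>s k\<close> which does not involve the
  signal: H^2 R^2 for the centred squares and four times as much for a row of
  \<open>cA\<close>.\<close>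

definition gg :: real where "gg = 5 * H\<^sup>2 * R\<^sup>2"

lemma gg_nonneg: "0 \<le> gg" by (simp add: gg_def)

lemma ax_nonneg: "0 \<le> ax2 U" "0 \<le> ax4 U"
  by (simp_all add: ax2_def ax4_def sum_nonneg)

text \<open>The squared norm of a row of a projection is its diagonal entry, hence at most 1, so a
  row of \<open>cA\<close> contributes at most c0^2, of order 1 / n. No single variable dominates:
  the influences sum to order one and their squares to order 1 / n.\<close>

lemma s_bounds:
  fixes U :: "nat \<Rightarrow> nat \<Rightarrow> real"
  defines "S \<equiv> indep_poly.s n (\<lambda>k. 2 * xi U k / rn) (\<lambda>k. - \<eta> / rn) (cA U)"
  shows "(\<Sum>k<n. S k) \<le> 4 * ax2 U + gg" "(\<Sum>k<n. (S k)\<^sup>2) \<le> (32 * ax4 U + 2 * gg\<^sup>2) / n" "0 \<le> (\<Sum>k<n. S k)"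
proof -
  interpret P: indep_poly M n "\<lambda>i. w i p" K "\<lambda>k. 2 * xi U k / rn" "\<lambda>k. - \<eta> / rn" "cA U" by (rule poly)
  have S: "S k \<le> (4 * (xi U k)\<^sup>2 + gg) / n" if k: "k < n" for k
  proof -
    have "P.rowsum k \<le> (\<Sum>j<n. c0\<^sup>2 * (gs n U p k j)\<^sup>2)"
      unfolding P.rowsum_def by (intro sum_mono) (simp add: cA_def power_mult_distrib)
    also have "\<dots> = c0\<^sup>2 * gs n U p k k"
      unfolding sum_distrib_left[symmetric] proj_row[OF gs_proj k] ..
    also have "\<dots> \<le> c0\<^sup>2 * 1" using proj_diag_bounds[OF gs_proj k] by (intro mult_left_mono) auto
    also have "\<dots> \<le> 4 * H\<^sup>2 * R\<^sup>2 / n" using c0_sq_le by simp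
    finally have 1: "P.rowsum k \<le> 4 * H\<^sup>2 * R\<^sup>2 / n" .
    have "\<eta>\<^sup>2 \<le> H\<^sup>2 * R\<^sup>2"
    proof -
      have "\<eta>\<^sup>2 \<le> H\<^sup>2" using eta_pos eta_H by (intro power_mono) auto
      also have "\<dots> \<le> H\<^sup>2 * R\<^sup>2" using R_ge_1 by (simp add: mult_le_cancel_left1)
      finally show ?thesis .
    qed
    then have 2: "(- \<eta> / rn)\<^sup>2 \<le> H\<^sup>2 * R\<^sup>2 / n" using basic by (simp add: power_divide divide_right_mono)
    have 3: "(2 * xi U k / rn)\<^sup>2 = 4 * (xi U k)\<^sup>2 / n" using basic by (simp add: power_divide power_mult_distrib)
    have "S k \<le> 4 * (xi U k)\<^sup>2 / n + H\<^sup>2 * R\<^sup>2 / n + 4 * H\<^sup>2 * R\<^sup>2 / n"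
      unfolding S_def P.s_def using 1 2 3 by linarith
    then show ?thesis by (simp add: gg_def add_divide_distrib)
  qed
  have S0: "0 \<le> S k" for k unfolding S_def by (rule P.s_nonneg)
  then show "0 \<le> (\<Sum>k<n. S k)" by (simp add: sum_nonneg)
  have "(\<Sum>k<n. S k) \<le> (\<Sum>k<n. (4 * (xi U k)\<^sup>2 + gg) / n)" using S by (intro sum_mono) auto
  also have "\<dots> = 4 * ax2 U + gg"
    using basic by (simp add: ax2_def sum.distrib sum_divide_distrib[symmetric] sum_distrib_left[symmetric] add_divide_distrib)
  finally show "(\<Sum>k<n. S k) \<le> 4 * ax2 U + gg" .
  have "(\<Sum>k<n. (S k)\<^sup>2) \<le> (\<Sum>k<n. (32 * (xi U k) ^ 4 + 2 * gg\<^sup>2) / (real n)\<^sup>2)"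
  proof (intro sum_mono)
    fix k assume "k \<in> {..<n}"
    then have "(S k)\<^sup>2 \<le> ((4 * (xi U k)\<^sup>2 + gg) / n)\<^sup>2" using S S0 by (intro power_mono) auto
    also have "\<dots> = (4 * (xi U k)\<^sup>2 + gg)\<^sup>2 / (real n)\<^sup>2" by (simp add: power_divide)
    also have "\<dots> \<le> (32 * (xi U k) ^ 4 + 2 * gg\<^sup>2) / (real n)\<^sup>2"
    proof (rule divide_right_mono)
      have "(4 * (xi U k)\<^sup>2 + gg)\<^sup>2 \<le> 2 * (4 * (xi U k)\<^sup>2)\<^sup>2 + 2 * gg\<^sup>2"
        using sum_squares_bound[of "4 * (xi U k)\<^sup>2" gg] unfolding power2_sum by linarith
      then show "(4 * (xi U k)\<^sup>2 + gg)\<^sup>2 \<le> 32 * (xi U k) ^ 4 + 2 * gg\<^sup>2" by (simp add: power_mult_distrib)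
    qed simp
    finally show "(S k)\<^sup>2 \<le> (32 * (xi U k) ^ 4 + 2 * gg\<^sup>2) / (real n)\<^sup>2" .
  qed
  also have "\<dots> = (32 * ax4 U + 2 * gg\<^sup>2) / n"
    using basic by (simp add: ax4_def sum.distrib sum_divide_distrib[symmetric] sum_distrib_left[symmetric] add_divide_distrib power2_eq_square)
  finally show "(\<Sum>k<n. (S k)\<^sup>2) \<le> (32 * ax4 U + 2 * gg\<^sup>2) / n" .
qed

text \<open>Up to the factor - c0, \<open>cA\<close> is the projection minus its diagonal part, and
  both are contractions. The operator norm is therefore of order 1 / sqrt n.\<close>

lemma op_bound: "ip n (mv n (cA U) y) (mv n (cA U) y) \<le> (2 * c0)\<^sup>2 * ip n y y"
proof -
  let ?Q = "gs n U p"
  have mv: "mv n (cA U) y i = - c0 * (mv n ?Q y i - ?Q i i * y i)" if i: "i < n" for i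
  proof -
    have "mv n (cA U) y i = (\<Sum>k\<in>{..<n}-{i}. - c0 * (?Q i k * y k))"
      unfolding mv_def using i by (subst sum.remove[of _ i]) (auto simp: cA_def intro!: sum.cong)
    also have "\<dots> = - c0 * (mv n ?Q y i - ?Q i i * y i)"
      unfolding mv_def sum_distrib_left[symmetric] using i by (subst (2) sum.remove[of _ i]) auto
    finally show ?thesis .
  qed
  have "ip n (mv n (cA U) y) (mv n (cA U) y) = (\<Sum>i<n. c0\<^sup>2 * (mv n ?Q y i - ?Q i i * y i)\<^sup>2)"
    unfolding ip_def by (intro sum.cong refl) (simp add: mv power2_eq_square)
  also have "\<dots> \<le> (\<Sum>i<n. c0\<^sup>2 * (2 * (mv n ?Q y i)\<^sup>2 + 2 * (y i)\<^sup>2))"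
  proof (intro sum_mono mult_left_mono)
    fix i assume "i \<in> {..<n}"
    then have q: "0 \<le> ?Q i i" "?Q i i \<le> 1" using proj_diag_bounds[OF gs_proj] by auto
    have "(?Q i i * y i)\<^sup>2 \<le> 1 * (y i)\<^sup>2"
      unfolding power_mult_distrib using q by (intro mult_right_mono power_le_one) auto
    moreover have "(mv n ?Q y i - ?Q i i * y i)\<^sup>2 \<le> 2 * (mv n ?Q y i)\<^sup>2 + 2 * (?Q i i * y i)\<^sup>2"
      using sum_squares_bound[of "mv n ?Q y i" "- (?Q i i * y i)"] unfolding power2_diff power2_minus by linarith
    ultimately show "(mv n ?Q y i - ?Q i i * y i)\<^sup>2 \<le> 2 * (mv n ?Q y i)\<^sup>2 + 2 * (y i)\<^sup>2" by linarith
  qed simp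
  also have "\<dots> = c0\<^sup>2 * (2 * ip n (mv n ?Q y) (mv n ?Q y) + 2 * ip n y y)"
    by (simp add: ip_def power2_eq_square sum.distrib sum_distrib_left distrib_left)
  also have "\<dots> \<le> c0\<^sup>2 * (2 * ip n y y + 2 * ip n y y)"
    using proj_contraction[OF gs_proj] by (intro mult_left_mono add_mono) auto
  also have "\<dots> = (2 * c0)\<^sup>2 * ip n y y" by (simp add: power_mult_distrib)
  finally show ?thesis .
qed

lemma nu3_le: "\<bar>\<nu>3\<bar> \<le> K" and nu4_ge: "1 \<le> \<nu>4"
proof -
  interpret e: indep_std M n "\<lambda>i. w i p" K by (rule noise)
  have L: "L4 (w 0 p)" using basic by (intro e.L4_x) auto
  have *: "\<bar>y ^ 3\<bar> \<le> (y\<^sup>2 + y ^ 4) / 2" for y :: real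
  proof -
    have "\<bar>y ^ 3\<bar> = \<bar>y\<bar> * \<bar>y\<^sup>2\<bar>" by (simp add: power3_eq_cube power2_eq_square abs_mult)
    then show ?thesis using mult_abs_le[of 1 y "y\<^sup>2"] by simp
  qed
  have "\<bar>\<nu>3\<bar> \<le> expectation (\<lambda>\<omega>. \<bar>w 0 p \<omega> ^ 3\<bar>)"
    using nu3[of 0] basic integral_abs_bound[of M "\<lambda>\<omega>. w 0 p \<omega> ^ 3"] by simp
  also have "\<dots> \<le> expectation (\<lambda>\<omega>. ((w 0 p \<omega>)\<^sup>2 + w 0 p \<omega> ^ 4) / 2)"
    using L4_cube[OF L] L4_sq[OF L] L4_int4[OF L] * by (intro integral_mono) auto
  also have "\<dots> = (1 + expectation (\<lambda>\<omega>. w 0 p \<omega> ^ 4)) / 2"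
    using L4_sq[OF L] L4_int4[OF L] e.var[of 0] basic by simp
  also have "\<dots> \<le> K" using e.mom4[of 0] basic K_ge_1 by simp
  finally show "\<bar>\<nu>3\<bar> \<le> K" .
  have [measurable]: "w 0 p \<in> borel_measurable M" using basic by auto
  have "(expectation (\<lambda>\<omega>. (w 0 p \<omega>)\<^sup>2))\<^sup>2 \<le> expectation (\<lambda>\<omega>. ((w 0 p \<omega>)\<^sup>2)\<^sup>2)"
    using L4_int4[OF L] by (intro expectation_square_le(2)) auto
  then show "1 \<le> \<nu>4" using e.var[of 0] nu4[of 0] basic by simp
qed

lemma vv_ge: "4 * \<eta> \<le> vv"
proof -
  have "1 \<le> n / m" using basic by simp
  then show ?thesis using nu4_ge by (simp add: vv_def)
qed

text \<open>Idempotence makes \<open>frob2\<close> of the off-diagonal part equal to c0^2 times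
  \<Sum>i. (Q_ii - Q_ii^2) = t - t^2 / n - dev, where t is the trace: the potential is exactly the
  distance from the value for a constant diagonal. At t = m that value gives the last term of
  \<open>vv\<close>. The third moment of the errors enters together with \<open>ax1\<close>, the
  empirical mean of the signal, which is small.\<close>

lemma variance_deviation:
  "\<bar>(\<Sum>k<n. indep_poly.al M (\<lambda>i. w i p) (\<lambda>k. 2 * xi U k / rn) (\<lambda>k. - \<eta> / rn) k) + 2 * frob2 n (cA U) - vv\<bar>
   \<le> 4 * \<bar>ax2 U - \<eta>\<bar> + 4 * H * K * \<bar>ax1 U\<bar> + 8 * H\<^sup>2 * R\<^sup>2 / n * (\<bar>trace n (gs n U p) - m\<bar> + dev n (gs n U p))"
proof -
  interpret P: indep_poly M n "\<lambda>i. w i p" K "\<lambda>k. 2 * xi U k / rn" "\<lambda>k. - \<eta> / rn" "cA U" by (rule poly)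
  let ?Q = "gs n U p"
  have al: "P.al k = (4 * (xi U k)\<^sup>2 - 4 * \<eta> * \<nu>3 * xi U k + \<eta>\<^sup>2 * (\<nu>4 - 1)) / n" if k: "k < n" for k
  proof -
    define a where "a = 2 * xi U k / rn"
    define c where "c = - \<eta> / rn"
    have L: "L4 (w k p)" by (rule P.L4_x[OF k])
    have "P.al k = expectation (\<lambda>\<omega>. (a\<^sup>2 - 2 * c\<^sup>2) * (w k p \<omega>)\<^sup>2 + 2 * a * c * w k p \<omega> ^ 3 - 2 * a * c * w k p \<omega> + c\<^sup>2 * w k p \<omega> ^ 4 + c\<^sup>2)"
      unfolding P.al_def P.lin_def unfolding a_def[symmetric] c_def[symmetric]
      by (intro Bochner_Integration.integral_cong refl) (simp add: power2_eq_square eval_nat_numeral algebra_simps)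
    also have "\<dots> = (a\<^sup>2 - 2 * c\<^sup>2) * 1 + 2 * a * c * \<nu>3 - 2 * a * c * 0 + c\<^sup>2 * \<nu>4 + c\<^sup>2"
      using L4_integrable[OF L] L4_sq[OF L] L4_cube[OF L] L4_int4[OF L] P.var[OF k] P.mean[OF k] nu3[OF k] nu4[OF k]
      by (simp add: prob_space)
    also have "\<dots> = (4 * (xi U k)\<^sup>2 - 4 * \<eta> * \<nu>3 * xi U k + \<eta>\<^sup>2 * (\<nu>4 - 1)) / n"
    proof -
      have "a\<^sup>2 = 4 * (xi U k)\<^sup>2 / n" "c\<^sup>2 = \<eta>\<^sup>2 / n" "a * c = - 2 * \<eta> * xi U k / n"
        using basic by (simp_all add: a_def c_def power_divide power_mult_distrib)
      moreover have "(a\<^sup>2 - 2 * c\<^sup>2) * 1 + 2 * a * c * \<nu>3 - 2 * a * c * 0 + c\<^sup>2 * \<nu>4 + c\<^sup>2 =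
          a\<^sup>2 + 2 * (a * c) * \<nu>3 + c\<^sup>2 * (\<nu>4 - 1)" by (simp add: algebra_simps)
      ultimately show ?thesis by (simp only:) (simp add: add_divide_distrib diff_divide_distrib mult_ac)
    qed
    finally show ?thesis .
  qed
  have sal: "(\<Sum>k<n. P.al k) = 4 * ax2 U - 4 * \<eta> * \<nu>3 * ax1 U + \<eta>\<^sup>2 * (\<nu>4 - 1)"
  proof -
    have "(\<Sum>k<n. P.al k) = (\<Sum>k<n. (4 * (xi U k)\<^sup>2 - 4 * \<eta> * \<nu>3 * xi U k + \<eta>\<^sup>2 * (\<nu>4 - 1)) / n)"
      by (intro sum.cong refl al) auto
    also have "\<dots> = 4 * ax2 U - 4 * \<eta> * \<nu>3 * ax1 U + \<eta>\<^sup>2 * (\<nu>4 - 1)"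
      using basic by (simp add: ax1_def ax2_def sum.distrib sum_subtractf sum_divide_distrib[symmetric]
          sum_distrib_left[symmetric] add_divide_distrib diff_divide_distrib)
    finally show ?thesis .
  qed
  define t where "t = trace n ?Q"
  have t: "0 \<le> t" "t \<le> n" using trace_le[OF gs_proj] by (auto simp: t_def)
  have fr: "frob2 n (cA U) = c0\<^sup>2 * (t - t\<^sup>2 / n - dev n ?Q)"
  proof -
    have "frob2 n (cA U) = (\<Sum>i<n. c0\<^sup>2 * (?Q i i - (?Q i i)\<^sup>2))"
      unfolding frob2_def
    proof (intro sum.cong refl)
      fix i assume "i \<in> {..<n}"
      then have i: "i < n" by simp
      have "(\<Sum>k<n. (cA U i k)\<^sup>2) = (\<Sum>k\<in>{..<n}-{i}. c0\<^sup>2 * (?Q i k)\<^sup>2)"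
        using i by (subst sum.remove[of _ i]) (auto simp: cA_def power_mult_distrib intro!: sum.cong)
      also have "\<dots> = c0\<^sup>2 * ((\<Sum>k<n. (?Q i k)\<^sup>2) - (?Q i i)\<^sup>2)"
        unfolding sum_distrib_left[symmetric] using i by (subst (2) sum.remove[of _ i]) auto
      finally show "(\<Sum>k<n. (cA U i k)\<^sup>2) = c0\<^sup>2 * (?Q i i - (?Q i i)\<^sup>2)"
        unfolding proj_row[OF gs_proj i] .
    qed
    then show ?thesis
      by (simp add: dev_def t_def trace_def sum_distrib_left[symmetric] sum_subtractf)
  qed
  have vm: "2 * V\<^sup>2 * (n / m - 1) = 2 * c0\<^sup>2 * (m - m\<^sup>2 / n)"
    using basic by (simp add: c0_def power_divide power_mult_distrib field_simps power2_eq_square)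
  have 1: "(\<Sum>k<n. P.al k) + 2 * frob2 n (cA U) - vv =
      4 * (ax2 U - \<eta>) + (- 4 * \<eta> * \<nu>3 * ax1 U) + 2 * c0\<^sup>2 * ((t - m) * (1 - (t + m) / n) - dev n ?Q)"
    unfolding sal fr vv_def vm using basic by (simp add: field_simps power2_eq_square)
  have 2: "\<bar>- 4 * \<eta> * \<nu>3 * ax1 U\<bar> \<le> 4 * H * K * \<bar>ax1 U\<bar>"
    using eta_H eta_pos nu3_le H_ge_1 by (auto simp: abs_mult intro!: mult_mono)
  have 3: "\<bar>(t - m) * (1 - (t + m) / n) - dev n ?Q\<bar> \<le> \<bar>t - m\<bar> + dev n ?Q"
  proof -
    have "0 \<le> (t + m) / n" "(t + m) / n \<le> 2" using t basic by (auto simp: divide_le_eq)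
    then have "\<bar>1 - (t + m) / n\<bar> \<le> 1" by linarith
    then have "\<bar>(t - m) * (1 - (t + m) / n)\<bar> \<le> \<bar>t - m\<bar> * 1"
      unfolding abs_mult by (intro mult_left_mono) auto
    moreover have "\<bar>x - d\<bar> \<le> a + d" if "\<bar>x\<bar> \<le> a * 1" "0 \<le> d" for x a d :: real
      using that by linarith
    ultimately show ?thesis using dev_nonneg[OF gs_proj basic(1)] by blast
  qed
  have 4: "\<bar>2 * c0\<^sup>2 * ((t - m) * (1 - (t + m) / n) - dev n ?Q)\<bar> \<le> 8 * H\<^sup>2 * R\<^sup>2 / n * (\<bar>t - m\<bar> + dev n ?Q)"
  proof -
    have "\<bar>2 * c0\<^sup>2 * ((t - m) * (1 - (t + m) / n) - dev n ?Q)\<bar> =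
        2 * c0\<^sup>2 * \<bar>(t - m) * (1 - (t + m) / n) - dev n ?Q\<bar>" by (simp add: abs_mult)
    also have "\<dots> \<le> (8 * H\<^sup>2 * R\<^sup>2 / n) * (\<bar>t - m\<bar> + dev n ?Q)"
      using 3 c0_sq_le by (intro mult_mono) auto
    finally show ?thesis .
  qed
  have "\<bar>4 * x + y + z\<bar> \<le> 4 * \<bar>x\<bar> + y' + z'" if "\<bar>y\<bar> \<le> y'" "\<bar>z\<bar> \<le> z'" for x y z y' z' :: real
    using that by linarith
  from this[OF 2 4] show ?thesis unfolding 1 t_def[symmetric] .
qed

end

section \<open>The characteristic function of the leading term\<close>

context lm_array
begin

lemma xi_scale: "xi U i = sqrt \<eta> * (xi U i / sqrt \<eta>)"
  using eta_pos by simp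

lemma sqrt_eta_sq: "(sqrt \<eta>)\<^sup>2 = \<eta>" "(sqrt \<eta>) ^ 4 = \<eta>\<^sup>2"
proof -
  show "(sqrt \<eta>)\<^sup>2 = \<eta>" using eta_pos by simp
  then show "(sqrt \<eta>) ^ 4 = \<eta>\<^sup>2" using power_mult[of "sqrt \<eta>" 2 2] by simp
qed

lemma xi_pow: "(xi U i / sqrt \<eta>)\<^sup>2 = (xi U i)\<^sup>2 / \<eta>" "(xi U i / sqrt \<eta>) ^ 4 = (xi U i) ^ 4 / \<eta>\<^sup>2"
  by (simp_all add: power_divide sqrt_eta_sq)

lemma xi_L4: "i < n \<Longrightarrow> L4 (\<lambda>\<omega>. xi (W \<omega>) i)"
proof -
  assume i: "i < n"
  interpret X: indep_std M n "\<lambda>i \<omega>. xi (W \<omega>) i / sqrt \<eta>" K2 by (rule xi_system)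
  show ?thesis by (subst xi_scale) (intro L4_cmult X.L4_x[OF i])
qed

lemma xi_moments:
  assumes i: "i < n"
  shows "expectation (\<lambda>\<omega>. (xi (W \<omega>) i)\<^sup>2) = \<eta>" "\<mu>4 \<le> K2 * \<eta>\<^sup>2" "\<eta>\<^sup>2 \<le> \<mu>4"
    "expectation (\<lambda>\<omega>. (xi (W \<omega>) i) ^ 4) = \<mu>4"
proof -
  interpret X: indep_std M n "\<lambda>i \<omega>. xi (W \<omega>) i / sqrt \<eta>" K2 by (rule xi_system)
  note L = xi_L4[OF i]
  show E2: "expectation (\<lambda>\<omega>. (xi (W \<omega>) i)\<^sup>2) = \<eta>"
    using X.var[OF i] eta_pos unfolding xi_pow by (simp add: field_simps)
  show E4: "expectation (\<lambda>\<omega>. (xi (W \<omega>) i) ^ 4) = \<mu>4" using mu4[OF i] by (simp add: xi_def)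
  have "\<mu>4 / \<eta>\<^sup>2 \<le> K2" using X.mom4[OF i] E4 unfolding xi_pow by simp
  then show "\<mu>4 \<le> K2 * \<eta>\<^sup>2" using eta_pos by (simp add: divide_le_eq)
  have [measurable]: "(\<lambda>\<omega>. xi (W \<omega>) i) \<in> borel_measurable M" using L by (simp add: L4_def)
  have "(expectation (\<lambda>\<omega>. (xi (W \<omega>) i)\<^sup>2))\<^sup>2 \<le> expectation (\<lambda>\<omega>. ((xi (W \<omega>) i)\<^sup>2)\<^sup>2)"
    using L4_int4[OF L] by (intro expectation_square_le(2)) auto
  then show "\<eta>\<^sup>2 \<le> \<mu>4" using E2 E4 by simp
qed

lemma eta_sq_le: "\<eta>\<^sup>2 \<le> H\<^sup>2" using eta_pos eta_H by (intro power_mono) auto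

lemma eta_le_H2: "\<eta> \<le> H\<^sup>2"
proof -
  have "H * 1 \<le> H * H" using H_ge_1 by (intro mult_left_mono) auto
  then show ?thesis using eta_H by (simp add: power2_eq_square)
qed

lemma inv_n_le: "1 / real n \<le> 1 / rn"
  using basic mult_left_mono[of 1 rn rn] by (intro divide_left_mono) auto

lemma ax_expectations:
  "integrable M (\<lambda>\<omega>. ax1 (W \<omega>))" "integrable M (\<lambda>\<omega>. ax2 (W \<omega>))" "integrable M (\<lambda>\<omega>. ax4 (W \<omega>))"
  "expectation (\<lambda>\<omega>. ax2 (W \<omega>)) = \<eta>" "expectation (\<lambda>\<omega>. ax4 (W \<omega>)) \<le> K2 * H\<^sup>2"
  "expectation (\<lambda>\<omega>. \<bar>ax2 (W \<omega>) - \<eta>\<bar>) \<le> 7 * K2 * H / rn"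
  "expectation (\<lambda>\<omega>. \<bar>ax1 (W \<omega>)\<bar>) \<le> H / rn"
proof -
  interpret X: indep_std M n "\<lambda>i \<omega>. xi (W \<omega>) i / sqrt \<eta>" K2 by (rule xi_system)
  show i1: "integrable M (\<lambda>\<omega>. ax1 (W \<omega>))" and i2: "integrable M (\<lambda>\<omega>. ax2 (W \<omega>))" and i4: "integrable M (\<lambda>\<omega>. ax4 (W \<omega>))"
    unfolding ax1_def ax2_def ax4_def using L4_integrable[OF xi_L4] L4_sq[OF xi_L4] L4_int4[OF xi_L4]
    by (auto intro!: Bochner_Integration.integrable_sum integrable_divide)
  show "expectation (\<lambda>\<omega>. ax2 (W \<omega>)) = \<eta>"
    unfolding ax2_def using L4_sq[OF xi_L4] basic by (simp add: xi_moments)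
  have "expectation (\<lambda>\<omega>. ax4 (W \<omega>)) = \<mu>4"
    unfolding ax4_def using L4_int4[OF xi_L4] basic by (simp add: xi_moments)
  also have "\<dots> \<le> K2 * \<eta>\<^sup>2" using xi_moments(2) basic by blast
  also have "\<dots> \<le> K2 * H\<^sup>2" using eta_sq_le K2_ge_1 by (intro mult_left_mono) auto
  finally show "expectation (\<lambda>\<omega>. ax4 (W \<omega>)) \<le> K2 * H\<^sup>2" .
  have a2: "ax2 U - \<eta> = (\<Sum>i<n. \<eta> / n * ((xi U i / sqrt \<eta>)\<^sup>2 - 1))" for U
  proof -
    have "(\<Sum>i<n. \<eta> / n * ((xi U i / sqrt \<eta>)\<^sup>2 - 1)) = (\<Sum>i<n. (xi U i)\<^sup>2 / n - \<eta> / n)"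
      unfolding xi_pow using eta_pos basic by (intro sum.cong refl) (simp add: field_simps)
    also have "\<dots> = ax2 U - \<eta>"
      using basic by (simp add: ax2_def sum_subtractf sum_divide_distrib)
    finally show ?thesis by simp
  qed
  have "expectation (\<lambda>\<omega>. \<bar>ax2 (W \<omega>) - \<eta>\<bar>) \<le> sqrt ((7 * K2 * H / rn)\<^sup>2)"
  proof (rule X.expectation_abs_le)
    show "integrable M (\<lambda>\<omega>. (ax2 (W \<omega>) - \<eta>)\<^sup>2)" unfolding a2 by (rule L4_sq[OF X.diag_form(1)])
    have "expectation (\<lambda>\<omega>. (ax2 (W \<omega>) - \<eta>)\<^sup>2) \<le> 48 * K2 * (\<Sum>i<n. (\<eta> / n)\<^sup>2)"
      unfolding a2 by (rule X.diag_form(2))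
    also have "\<dots> = 48 * (K2 * \<eta>\<^sup>2) / n" using basic by (simp add: power2_eq_square)
    also have "\<dots> \<le> 49 * (K2\<^sup>2 * H\<^sup>2) / n"
    proof (intro divide_right_mono mult_mono)
      show "K2 \<le> K2\<^sup>2" using K2_ge_1 by (simp add: power2_eq_square)
    qed (use eta_sq_le K2_ge_1 in auto)
    also have "\<dots> = (7 * K2 * H / rn)\<^sup>2" using basic by (simp add: power_divide power_mult_distrib)
    finally show "expectation (\<lambda>\<omega>. (ax2 (W \<omega>) - \<eta>)\<^sup>2) \<le> (7 * K2 * H / rn)\<^sup>2" .
  qed (use i2 in measurable)
  then show "expectation (\<lambda>\<omega>. \<bar>ax2 (W \<omega>) - \<eta>\<bar>) \<le> 7 * K2 * H / rn"
    using K2_ge_1 H_ge_1 basic by simp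
  have a1: "ax1 U = (\<Sum>i<n. sqrt \<eta> / n * (xi U i / sqrt \<eta>))" for U
    using eta_pos by (simp add: ax1_def sum_divide_distrib)
  have "expectation (\<lambda>\<omega>. \<bar>ax1 (W \<omega>)\<bar>) \<le> sqrt ((H / rn)\<^sup>2)"
  proof (rule X.expectation_abs_le)
    show "integrable M (\<lambda>\<omega>. (ax1 (W \<omega>))\<^sup>2)" unfolding a1 by (rule L4_sq[OF X.L4_lin]) simp
    have "expectation (\<lambda>\<omega>. (ax1 (W \<omega>))\<^sup>2) = (\<Sum>i<n. (sqrt \<eta> / n)\<^sup>2)"
      unfolding a1 by (rule X.second_moment_lin) simp
    also have "\<dots> = \<eta> / n" using basic eta_pos by (simp add: power_divide power2_eq_square)
    also have "\<dots> \<le> H\<^sup>2 / n" using eta_le_H2 by (intro divide_right_mono) auto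
    also have "\<dots> = (H / rn)\<^sup>2" using basic by (simp add: power_divide)
    finally show "expectation (\<lambda>\<omega>. (ax1 (W \<omega>))\<^sup>2) \<le> (H / rn)\<^sup>2" .
  qed (use i1 in measurable)
  then show "expectation (\<lambda>\<omega>. \<bar>ax1 (W \<omega>)\<bar>) \<le> H / rn" using H_ge_1 basic by simp
qed

text \<open>The approximation error for a given design, kept as a function of the design so that it
  can be integrated afterwards.\<close>

definition err :: "(nat \<Rightarrow> nat \<Rightarrow> real) \<Rightarrow> real" where
  "err U = 4 * \<bar>ax2 U - \<eta>\<bar> + 4 * H * K * \<bar>ax1 U\<bar>
     + 8 * H\<^sup>2 * R\<^sup>2 / n * (\<bar>trace n (gs n U p) - m\<bar> + dev n (gs n U p))
     + 80 * K * H * R * (1 + 4 * ax2 U + gg) / rn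
     + (307 * K\<^sup>2 * (32 * ax4 U + 2 * gg\<^sup>2) + 6 * K * (4 * ax2 U + gg)) / rn"

text \<open>Valid for every fixed design. The operator norm bound is \<open>2 * c0\<close>, and
  \<open>h = rn\<close> balances h times the sum of squared influences, of order h / n, against the
  sum of influences divided by h.\<close>

lemma inner_char:
  "cmod (expectation (\<lambda>\<omega>. iexp (\<theta> * Bst U (\<lambda>i. w i p \<omega>))) - of_real (exp (- (\<theta>\<^sup>2 * vv / 2))))
     \<le> (\<theta>\<^sup>2 + \<bar>\<theta>\<bar> ^ 3) * err U"
proof -
  interpret P: indep_poly M n "\<lambda>i. w i p" K "\<lambda>k. 2 * xi U k / rn" "\<lambda>k. - \<eta> / rn" "cA U" by (rule poly)
  have B: "P.B = (\<lambda>\<omega>. Bst U (\<lambda>i. w i p \<omega>))" by (rule ext) (simp only: P.B_def P.lin_def Bst_def)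
  define d1 where "d1 = 4 * \<bar>ax2 U - \<eta>\<bar> + 4 * H * K * \<bar>ax1 U\<bar>
     + 8 * H\<^sup>2 * R\<^sup>2 / n * (\<bar>trace n (gs n U p) - m\<bar> + dev n (gs n U p))
     + 80 * K * H * R * (1 + 4 * ax2 U + gg) / rn"
  define d2 where "d2 = (307 * K\<^sup>2 * (32 * ax4 U + 2 * gg\<^sup>2) + 6 * K * (4 * ax2 U + gg)) / rn"
  have dv: "0 \<le> dev n (gs n U p)" by (rule dev_nonneg[OF gs_proj]) (use basic in simp)
  have d0: "0 \<le> d1" "0 \<le> d2"
    using K_ge_1 H_ge_1 R_ge_1 basic gg_nonneg ax_nonneg dv unfolding d1_def d2_def
    by (auto intro!: add_nonneg_nonneg mult_nonneg_nonneg divide_nonneg_nonneg)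
  have vv0: "0 \<le> vv" using vv_ge eta_pos by linarith
  have k0: "0 \<le> 2 * c0" using basic by simp
  have s1: "20 * K * (2 * c0) * sqrt (\<Sum>k<n. P.s k) \<le> 80 * K * H * R * (1 + 4 * ax2 U + gg) / rn"
  proof -
    have "sqrt y \<le> 1 + y" if "0 \<le> y" for y :: real
    proof -
      have "sqrt y \<le> sqrt ((1 + y)\<^sup>2)" using that by (intro real_sqrt_le_mono) (simp add: power2_sum add_increasing)
      then show ?thesis using that by simp
    qed
    then have "sqrt (\<Sum>k<n. P.s k) \<le> 1 + 4 * ax2 U + gg"
      using s_bounds(1,3)[of U] by fastforce
    then have "20 * K * (2 * c0) * sqrt (\<Sum>k<n. P.s k) \<le> 20 * K * (2 * (2 * H * R / rn)) * (1 + 4 * ax2 U + gg)"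
      using c0_le k0 K_ge_1 H_ge_1 R_ge_1 basic s_bounds(3)[of U]
      by (intro mult_mono) auto
    then show ?thesis by (simp add: mult_ac)
  qed
  have s2: "307 * rn * K\<^sup>2 * (\<Sum>k<n. (P.s k)\<^sup>2) + 6 * K * (\<Sum>k<n. P.s k) / rn \<le> d2"
  proof -
    have "307 * rn * K\<^sup>2 * (\<Sum>k<n. (P.s k)\<^sup>2) \<le> 307 * rn * K\<^sup>2 * ((32 * ax4 U + 2 * gg\<^sup>2) / n)"
      using s_bounds(2)[of U] basic by (intro mult_left_mono) auto
    also have "\<dots> = 307 * K\<^sup>2 * (32 * ax4 U + 2 * gg\<^sup>2) / rn"
      unfolding basic(5)[symmetric] using basic(7) by simp
    finally have 1: "307 * rn * K\<^sup>2 * (\<Sum>k<n. (P.s k)\<^sup>2) \<le> 307 * K\<^sup>2 * (32 * ax4 U + 2 * gg\<^sup>2) / rn" .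
    have 2: "6 * K * (\<Sum>k<n. P.s k) / rn \<le> 6 * K * (4 * ax2 U + gg) / rn"
      using s_bounds(1)[of U] K_ge_1 basic by (intro divide_right_mono mult_left_mono) auto
    show ?thesis unfolding d2_def add_divide_distrib using 1 2 by (rule add_mono)
  qed
  have "cmod (expectation (\<lambda>\<omega>. iexp (\<theta> * P.B \<omega>)) - of_real (exp (- (\<theta>\<^sup>2 * vv / 2))))
    \<le> \<theta>\<^sup>2 * (\<bar>(\<Sum>k<n. P.al k) + 2 * frob2 n (cA U) - vv\<bar> + 20 * K * (2 * c0) * sqrt (\<Sum>k<n. P.s k))
      + \<bar>\<theta>\<bar> ^ 3 * (307 * rn * K\<^sup>2 * (\<Sum>k<n. (P.s k)\<^sup>2) + 6 * K * (\<Sum>k<n. P.s k) / rn)"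
    by (rule P.char_approx[OF basic(7) op_bound k0 vv0])
  also have "\<dots> \<le> \<theta>\<^sup>2 * d1 + \<bar>\<theta>\<bar> ^ 3 * d2"
  proof (intro add_mono mult_left_mono s2)
    show "\<bar>(\<Sum>k<n. P.al k) + 2 * frob2 n (cA U) - vv\<bar> + 20 * K * (2 * c0) * sqrt (\<Sum>k<n. P.s k) \<le> d1"
      unfolding d1_def by (rule add_mono[OF variance_deviation s1])
  qed auto
  also have "\<dots> \<le> (\<theta>\<^sup>2 + \<bar>\<theta>\<bar> ^ 3) * (d1 + d2)"
    using d0 by (simp add: algebra_simps)
  also have "d1 + d2 = err U" by (simp add: err_def d1_def d2_def)
  finally show ?thesis unfolding B .
qed

lemma trace_Q_bounds: "\<bar>trace n (Q \<omega> p) - m\<bar> \<le> real n" "\<bar>trace n (Q \<omega> p)\<bar> \<le> real n"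
proof -
  have "0 \<le> trace n (Q \<omega> p)" "trace n (Q \<omega> p) \<le> real n" by (rule trace_le[OF gs_proj])+
  then show "\<bar>trace n (Q \<omega> p) - m\<bar> \<le> real n" "\<bar>trace n (Q \<omega> p)\<bar> \<le> real n"
    using basic(2,12) by linarith+
qed

lemma trace_Q_integrable: "integrable M (\<lambda>\<omega>. trace n (Q \<omega> p))"
proof (rule integrable_const_bound[of _ "real n"])
  show "(\<lambda>\<omega>. trace n (Q \<omega> p)) \<in> borel_measurable M" unfolding trace_def by (intro borel_measurable_sum) auto
qed (use trace_Q_bounds in auto)

text \<open>The trace is \<open>m\<close> unless the rank drops. That event has probability of order
  1 / n and the deviation is at most \<open>n\<close>, so the mean stays bounded, which is
  negligible after the division by \<open>n\<close> in \<open>err\<close>.\<close>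

lemma trace_deviation:
  "integrable M (\<lambda>\<omega>. \<bar>trace n (Q \<omega> p) - m\<bar>)"
  "expectation (\<lambda>\<omega>. \<bar>trace n (Q \<omega> p) - m\<bar>) \<le> n * ((48 * K)\<^sup>2 * R\<^sup>2 / n)"
proof -
  have bd: "\<bar>trace n (Q \<omega> p) - m\<bar> \<le> n * indicat_real {\<omega> \<in> space M. \<not> full_rank n (W \<omega>) p} \<omega>" if "\<omega> \<in> space M" for \<omega>
  proof (cases "full_rank n (W \<omega>) p")
    case True
    then show ?thesis using gs_trace_eq[OF True, of p] by (simp add: m_def)
  next
    case False
    then show ?thesis using trace_Q_bounds that by simp
  qed
  show i: "integrable M (\<lambda>\<omega>. \<bar>trace n (Q \<omega> p) - m\<bar>)"
    using trace_Q_integrable by (intro integrable_abs Bochner_Integration.integrable_diff) auto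
  have S: "{\<omega> \<in> space M. \<not> full_rank n (W \<omega>) p} \<in> events" by measurable
  have "expectation (\<lambda>\<omega>. \<bar>trace n (Q \<omega> p) - m\<bar>) \<le> expectation (\<lambda>\<omega>. n * indicat_real {\<omega> \<in> space M. \<not> full_rank n (W \<omega>) p} \<omega>)"
    using i S bd by (intro integral_mono integrable_mult_right integrable_real_indicator) (auto simp: less_top[symmetric])
  also have "\<dots> = n * prob {\<omega> \<in> space M. \<not> full_rank n (W \<omega>) p}"
    using S by simp
  also have "\<dots> \<le> n * ((48 * K)\<^sup>2 * R\<^sup>2 / n)"
  proof (rule mult_left_mono)
    have "prob {\<omega> \<in> space M. \<not> full_rank n (W \<omega>) p} \<le> real p * ((48 * K)\<^sup>2 / m\<^sup>2)"
      using prob_not_full_rank_le[OF pn] by (simp add: m_def)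
    also have "\<dots> \<le> real n * ((48 * K)\<^sup>2 / m\<^sup>2)" using pn by (intro mult_right_mono) auto
    also have "\<dots> = (48 * K)\<^sup>2 * (n / m\<^sup>2)" by simp
    also have "\<dots> \<le> (48 * K)\<^sup>2 * (R\<^sup>2 / n)" using n_m2_le by (intro mult_left_mono) auto
    finally show "prob {\<omega> \<in> space M. \<not> full_rank n (W \<omega>) p} \<le> (48 * K)\<^sup>2 * R\<^sup>2 / n" by simp
  qed simp
  finally show "expectation (\<lambda>\<omega>. \<bar>trace n (Q \<omega> p) - m\<bar>) \<le> n * ((48 * K)\<^sup>2 * R\<^sup>2 / n)" .
qed

lemma dev_expectation: "expectation (\<lambda>\<omega>. dev n (Q \<omega> p)) \<le> n * (253 * K * R / rn)"
proof -
  have "rn / sqrt m \<le> R"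
  proof -
    have "rn / sqrt m = sqrt (n / m)" by (simp add: rn_def real_sqrt_divide)
    also have "\<dots> \<le> sqrt R" using basic by simp
    also have "\<dots> \<le> sqrt (R\<^sup>2)" using R_ge_1 mult_left_mono[of 1 R R] by (intro real_sqrt_le_mono) (simp add: power2_eq_square)
    finally show ?thesis using R_ge_1 by simp
  qed
  then have *: "1 / sqrt m \<le> R / rn" using basic by (simp add: field_simps)
  have "expectation (\<lambda>\<omega>. dev n (Q \<omega> p)) \<le> real p * (253 * K * (1 / sqrt m))"
    using expectation_dev_le[OF pn] by (simp add: m_def)
  also have "\<dots> \<le> real n * (253 * K * (R / rn))"
    using * pn K_ge_1 basic by (intro mult_mono mult_left_mono) auto
  finally show ?thesis by simp
qed

definition C1 :: real where
  "C1 = 28 * K2 * H + 4 * H\<^sup>2 * K + 8 * H\<^sup>2 * R\<^sup>2 * ((48 * K)\<^sup>2 * R\<^sup>2 + 253 * K * R)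
     + 80 * K * H * R * (1 + 4 * H + gg) + (307 * K\<^sup>2 * (32 * (K2 * H\<^sup>2) + 2 * gg\<^sup>2) + 6 * K * (4 * H + gg))"

lemma err_expectation:
  "integrable M (\<lambda>\<omega>. err (W \<omega>))" "expectation (\<lambda>\<omega>. err (W \<omega>)) \<le> C1 / rn"
proof -
  note i = ax_expectations(1-3) trace_deviation(1) trace_Q_integrable dev_Q_integrable[OF basic(1) order_refl]
  show "integrable M (\<lambda>\<omega>. err (W \<omega>))"
    unfolding err_def using i
    by (intro Bochner_Integration.integrable_add integrable_mult_right integrable_abs Bochner_Integration.integrable_diff integrable_divide integrable_const)
  have "expectation (\<lambda>\<omega>. err (W \<omega>)) =
     4 * expectation (\<lambda>\<omega>. \<bar>ax2 (W \<omega>) - \<eta>\<bar>) + 4 * H * K * expectation (\<lambda>\<omega>. \<bar>ax1 (W \<omega>)\<bar>)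
     + 8 * H\<^sup>2 * R\<^sup>2 / n * (expectation (\<lambda>\<omega>. \<bar>trace n (Q \<omega> p) - m\<bar>) + expectation (\<lambda>\<omega>. dev n (Q \<omega> p)))
     + 80 * K * H * R * (1 + 4 * expectation (\<lambda>\<omega>. ax2 (W \<omega>)) + gg) / rn
     + (307 * K\<^sup>2 * (32 * expectation (\<lambda>\<omega>. ax4 (W \<omega>)) + 2 * gg\<^sup>2) + 6 * K * (4 * expectation (\<lambda>\<omega>. ax2 (W \<omega>)) + gg)) / rn"
    unfolding err_def using i by (simp add: prob_space)
  also have "\<dots> \<le> 4 * (7 * K2 * H / rn) + 4 * H * K * (H / rn)
     + 8 * H\<^sup>2 * R\<^sup>2 / n * (n * ((48 * K)\<^sup>2 * R\<^sup>2 / n) + n * (253 * K * R / rn))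
     + 80 * K * H * R * (1 + 4 * H + gg) / rn
     + (307 * K\<^sup>2 * (32 * (K2 * H\<^sup>2) + 2 * gg\<^sup>2) + 6 * K * (4 * H + gg)) / rn"
    using ax_expectations(4-7) eta_H trace_deviation(2) dev_expectation K_ge_1 H_ge_1 R_ge_1 basic gg_nonneg
    by (intro add_mono mult_left_mono divide_right_mono order_refl) auto
  also have "8 * H\<^sup>2 * R\<^sup>2 / n * (n * ((48 * K)\<^sup>2 * R\<^sup>2 / n) + n * (253 * K * R / rn)) =
     8 * H\<^sup>2 * R\<^sup>2 * ((48 * K)\<^sup>2 * R\<^sup>2 * (1 / n) + 253 * K * R / rn)"
    using basic by (simp add: distrib_left)
  also have "\<dots> \<le> 8 * H\<^sup>2 * R\<^sup>2 * ((48 * K)\<^sup>2 * R\<^sup>2 * (1 / rn) + 253 * K * R / rn)"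
    using inv_n_le by (intro mult_left_mono add_right_mono) auto
  finally have "expectation (\<lambda>\<omega>. err (W \<omega>)) \<le> 4 * (7 * K2 * H / rn) + 4 * H * K * (H / rn)
     + 8 * H\<^sup>2 * R\<^sup>2 * ((48 * K)\<^sup>2 * R\<^sup>2 * (1 / rn) + 253 * K * R / rn)
     + 80 * K * H * R * (1 + 4 * H + gg) / rn
     + (307 * K\<^sup>2 * (32 * (K2 * H\<^sup>2) + 2 * gg\<^sup>2) + 6 * K * (4 * H + gg)) / rn" by simp
  also have "\<dots> = C1 / rn"
    unfolding C1_def by (simp add: add_divide_distrib power2_eq_square[of H] distrib_left mult.commute mult.left_commute)
  finally show "expectation (\<lambda>\<omega>. err (W \<omega>)) \<le> C1 / rn" .
qed

definition C2 :: real where "C2 = 307 * K2\<^sup>2 * H ^ 4 + 6 * K2 * H\<^sup>2"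

lemma Ast_eq: "Ast U = (\<Sum>i<n. \<eta> / rn * ((xi U i / sqrt \<eta>)\<^sup>2 - 1))"
  unfolding xi_pow Ast_def sum_divide_distrib using eta_pos basic
  by (intro sum.cong refl) (simp add: field_simps)

text \<open>In the standardised signals, \<open>Ast\<close> is again a polynomial of the kind
  treated above, without linear and off-diagonal part. So \<open>char_approx\<close> applies with
  \<kappa> = 0, and the variance is matched exactly.\<close>

lemma outer_char:
  "cmod (expectation (\<lambda>\<omega>. iexp (\<theta> * Ast (W \<omega>))) - of_real (exp (- (\<theta>\<^sup>2 * (\<mu>4 - \<eta>\<^sup>2) / 2)))) \<le> \<bar>\<theta>\<bar> ^ 3 * (C2 / rn)"
proof -
  interpret X: indep_std M n "\<lambda>i \<omega>. xi (W \<omega>) i / sqrt \<eta>" K2 by (rule xi_system)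
  interpret P: indep_poly M n "\<lambda>i \<omega>. xi (W \<omega>) i / sqrt \<eta>" K2 "\<lambda>_. 0" "\<lambda>_. \<eta> / rn" "\<lambda>_ _. 0"
    by unfold_locales (auto simp: symm_def)
  have B: "P.B = (\<lambda>\<omega>. Ast (W \<omega>))"
    by (simp add: P.B_def P.lin_def Ast_eq quad_def fun_eq_iff)
  have s: "P.s k = \<eta>\<^sup>2 / n" for k
    using basic by (simp add: P.s_def P.rowsum_def power_divide)
  have al: "P.al k = (\<mu>4 - \<eta>\<^sup>2) / n" if k: "k < n" for k
  proof -
    note L = xi_L4[OF k]
    have "P.al k = expectation (\<lambda>\<omega>. ((xi (W \<omega>) k) ^ 4 - 2 * \<eta> * (xi (W \<omega>) k)\<^sup>2 + \<eta>\<^sup>2) / n)"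
      unfolding P.al_def P.lin_def xi_pow
    proof (intro Bochner_Integration.integral_cong refl)
      fix \<omega>
      have "\<eta> / rn * ((xi (W \<omega>) k)\<^sup>2 / \<eta> - 1) = ((xi (W \<omega>) k)\<^sup>2 - \<eta>) / rn"
        using eta_pos by (simp add: right_diff_distrib diff_divide_distrib)
      then show "(0 * (xi (W \<omega>) k / sqrt \<eta>) + \<eta> / rn * ((xi (W \<omega>) k)\<^sup>2 / \<eta> - 1))\<^sup>2 =
          ((xi (W \<omega>) k) ^ 4 - 2 * \<eta> * (xi (W \<omega>) k)\<^sup>2 + \<eta>\<^sup>2) / n"
        using basic by (simp add: power_divide power2_diff mult_ac)
    qed
    also have "\<dots> = (\<mu>4 - 2 * \<eta> * \<eta> + \<eta>\<^sup>2) / n"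
      using L4_sq[OF L] L4_int4[OF L] xi_moments[OF k] by (simp add: prob_space)
    finally show ?thesis by (simp add: power2_eq_square)
  qed
  have sal: "(\<Sum>k<n. P.al k) = \<mu>4 - \<eta>\<^sup>2" using basic by (simp add: al)
  have ss: "(\<Sum>k<n. P.s k) = \<eta>\<^sup>2" "(\<Sum>k<n. (P.s k)\<^sup>2) = \<eta> ^ 4 / n"
    using basic by (simp_all add: s power_divide power2_eq_square eval_nat_numeral)
  have fr: "frob2 n (\<lambda>_ _. 0) = 0" by (simp add: frob2_def)
  have mu: "0 \<le> \<mu>4 - \<eta>\<^sup>2" using xi_moments(3) basic by fastforce
  have "cmod (expectation (\<lambda>\<omega>. iexp (\<theta> * P.B \<omega>)) - of_real (exp (- (\<theta>\<^sup>2 * (\<mu>4 - \<eta>\<^sup>2) / 2))))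
    \<le> \<theta>\<^sup>2 * (\<bar>(\<Sum>k<n. P.al k) + 2 * frob2 n (\<lambda>_ _. 0) - (\<mu>4 - \<eta>\<^sup>2)\<bar> + 20 * K2 * 0 * sqrt (\<Sum>k<n. P.s k))
      + \<bar>\<theta>\<bar> ^ 3 * (307 * rn * K2\<^sup>2 * (\<Sum>k<n. (P.s k)\<^sup>2) + 6 * K2 * (\<Sum>k<n. P.s k) / rn)"
    by (rule P.char_approx[OF basic(7) _ order_refl mu]) (simp add: ip_def mv_def)
  also have "\<dots> = \<bar>\<theta>\<bar> ^ 3 * (307 * rn * K2\<^sup>2 * (\<eta> ^ 4 / n) + 6 * K2 * \<eta>\<^sup>2 / rn)"
    unfolding sal ss fr by simp
  also have "\<dots> = \<bar>\<theta>\<bar> ^ 3 * ((307 * K2\<^sup>2 * \<eta> ^ 4 + 6 * K2 * \<eta>\<^sup>2) / rn)"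
    unfolding basic(5)[symmetric] using basic(7) by (simp add: add_divide_distrib)
  also have "\<dots> \<le> \<bar>\<theta>\<bar> ^ 3 * (C2 / rn)"
    unfolding C2_def using eta_H eta_pos K2_ge_1 basic(7)
    by (intro mult_left_mono divide_right_mono add_mono power_mono) auto
  finally show ?thesis unfolding B .
qed

text \<open>With the design fixed, the error part has a characteristic function close to exp (-
  \<theta>^2 vv / 2), a number free of the design. It leaves the outer expectation as a constant,
  and \<open>Ast\<close> can then be treated on its own; this is why the variances add although
  \<open>Bst\<close> depends on the design.\<close>

theorem main_char:
  "cmod (expectation (\<lambda>\<omega>. iexp (\<theta> * (Ast (W \<omega>) + Bst (W \<omega>) (\<lambda>i. w i p \<omega>))))
      - of_real (exp (- (\<theta>\<^sup>2 * (\<mu>4 - \<eta>\<^sup>2 + vv) / 2))))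
    \<le> (\<theta>\<^sup>2 + \<bar>\<theta>\<bar> ^ 3) * ((C1 + C2) / rn)"
proof -
  let ?F = "\<lambda>U e. iexp (\<theta> * (Ast U + Bst U e))"
  define \<phi> where "\<phi> U = expectation (\<lambda>\<omega>'. iexp (\<theta> * Bst U (\<lambda>i. w i p \<omega>')))" for U
  define ev where "ev = complex_of_real (exp (- (\<theta>\<^sup>2 * vv / 2)))"
  define ea where "ea = complex_of_real (exp (- (\<theta>\<^sup>2 * (\<mu>4 - \<eta>\<^sup>2) / 2)))"
  have mF: "(\<lambda>\<omega>. ?F (U \<omega>) (e \<omega>)) \<in> borel_measurable N"
    if "\<And>i l. i < n \<Longrightarrow> l < p \<Longrightarrow> (\<lambda>\<omega>. U \<omega> i l) \<in> borel_measurable N" "\<And>i. i < n \<Longrightarrow> (\<lambda>\<omega>. e \<omega> i) \<in> borel_measurable N"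
    for N :: "'z measure" and U e
  proof -
    have [measurable]: "(\<lambda>\<omega>. Ast (U \<omega>)) \<in> borel_measurable N" "(\<lambda>\<omega>. Bst (U \<omega>) (e \<omega>)) \<in> borel_measurable N"
      using Ast_meas[of U N] Bst_meas[of U N e] that by auto
    show ?thesis by measurable
  qed
  have dF: "dep_mat ?F" unfolding dep_mat_def by (intro allI impI) (simp only: deps)
  have iF: "integrable M (\<lambda>\<omega>. ?F (W \<omega>) (\<lambda>i. w i p \<omega>))"
    by (rule integrable_const_bound[of _ 1]) auto
  note d = decouple_last[of ?F, OF mF dF iF]
  have spl: "expectation (\<lambda>\<omega>'. ?F U (\<lambda>i. w i p \<omega>')) = iexp (\<theta> * Ast U) * \<phi> U" for U
  proof -
    have "expectation (\<lambda>\<omega>'. ?F U (\<lambda>i. w i p \<omega>')) = expectation (\<lambda>\<omega>'. iexp (\<theta> * Ast U) * iexp (\<theta> * Bst U (\<lambda>i. w i p \<omega>')))"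
      by (simp only: distrib_left iexp_add)
    then show ?thesis by (simp add: \<phi>_def)
  qed
  have splW: "(\<lambda>\<omega>. expectation (\<lambda>\<omega>'. ?F (W \<omega>) (\<lambda>i. w i p \<omega>'))) = (\<lambda>\<omega>. iexp (\<theta> * Ast (W \<omega>)) * \<phi> (W \<omega>))"
    by (rule ext) (rule spl)
  have iA: "integrable M (\<lambda>\<omega>. iexp (\<theta> * Ast (W \<omega>)))"
    by (rule integrable_const_bound[of _ 1]) auto
  have i\<phi>: "integrable M (\<lambda>\<omega>. iexp (\<theta> * Ast (W \<omega>)) * \<phi> (W \<omega>))"
    using d(2) by (simp only: splW)
  define G where "G \<omega> = iexp (\<theta> * Ast (W \<omega>)) * (\<phi> (W \<omega>) - ev)" for \<omega>
  define Z where "Z = expectation (\<lambda>\<omega>. iexp (\<theta> * Ast (W \<omega>))) - ea"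
  have iG: "integrable M G" unfolding G_def[abs_def] right_diff_distrib
    using iA i\<phi> by (intro Bochner_Integration.integrable_diff integrable_mult_left)
  have "expectation G = expectation (\<lambda>\<omega>. iexp (\<theta> * Ast (W \<omega>)) * \<phi> (W \<omega>)) - expectation (\<lambda>\<omega>. iexp (\<theta> * Ast (W \<omega>))) * ev"
    unfolding G_def[abs_def] right_diff_distrib
    by (simp only: Bochner_Integration.integral_diff[OF i\<phi> integrable_mult_left[OF iA]] Bochner_Integration.integral_mult_left_zero)
  also have "expectation (\<lambda>\<omega>. iexp (\<theta> * Ast (W \<omega>)) * \<phi> (W \<omega>)) = expectation (\<lambda>\<omega>. ?F (W \<omega>) (\<lambda>i. w i p \<omega>))"
    using d(1) by (simp only: splW)
  finally have eq: "expectation (\<lambda>\<omega>. ?F (W \<omega>) (\<lambda>i. w i p \<omega>)) - ea * ev = expectation G + ev * Z"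
    unfolding Z_def by (simp only: right_diff_distrib mult.commute diff_add_eq) simp
  have b1: "cmod (expectation G) \<le> (\<theta>\<^sup>2 + \<bar>\<theta>\<bar> ^ 3) * (C1 / rn)"
  proof -
    have G_le: "cmod (G \<omega>) \<le> (\<theta>\<^sup>2 + \<bar>\<theta>\<bar> ^ 3) * err (W \<omega>)" for \<omega>
    proof -
      have "cmod (G \<omega>) = cmod (\<phi> (W \<omega>) - ev)" by (simp only: G_def norm_mult norm_exp_i_times mult_1)
      also have "\<dots> \<le> (\<theta>\<^sup>2 + \<bar>\<theta>\<bar> ^ 3) * err (W \<omega>)" unfolding \<phi>_def ev_def by (rule inner_char)
      finally show ?thesis .
    qed
    have "cmod (expectation G) \<le> expectation (\<lambda>\<omega>. cmod (G \<omega>))" by (rule integral_norm_bound)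
    also have "\<dots> \<le> expectation (\<lambda>\<omega>. (\<theta>\<^sup>2 + \<bar>\<theta>\<bar> ^ 3) * err (W \<omega>))"
      by (rule integral_mono[OF integrable_norm[OF iG] integrable_mult_right[OF err_expectation(1)] G_le])
    also have "\<dots> = (\<theta>\<^sup>2 + \<bar>\<theta>\<bar> ^ 3) * expectation (\<lambda>\<omega>. err (W \<omega>))" by simp
    also have "\<dots> \<le> (\<theta>\<^sup>2 + \<bar>\<theta>\<bar> ^ 3) * (C1 / rn)"
      using err_expectation(2) by (intro mult_left_mono) auto
    finally show ?thesis .
  qed
  have b2: "cmod (ev * Z) \<le> 1 * (\<bar>\<theta>\<bar> ^ 3 * (C2 / rn))"
  proof -
    have "0 \<le> vv" using vv_ge eta_pos by linarith
    then have "cmod ev \<le> 1" by (simp add: ev_def)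
    moreover have "cmod Z \<le> \<bar>\<theta>\<bar> ^ 3 * (C2 / rn)" unfolding Z_def ea_def by (rule outer_char)
    ultimately show ?thesis unfolding norm_mult by (intro mult_mono) auto
  qed
  have "cmod (expectation (\<lambda>\<omega>. ?F (W \<omega>) (\<lambda>i. w i p \<omega>)) - ea * ev) \<le> (\<theta>\<^sup>2 + \<bar>\<theta>\<bar> ^ 3) * (C1 / rn) + 1 * (\<bar>\<theta>\<bar> ^ 3 * (C2 / rn))"
    unfolding eq by (rule order_trans[OF norm_triangle_ineq add_mono[OF b1 b2]])
  also have "\<dots> \<le> (\<theta>\<^sup>2 + \<bar>\<theta>\<bar> ^ 3) * ((C1 + C2) / rn)"
  proof -
    have "0 \<le> C2 / rn" using K2_ge_1 H_ge_1 basic by (simp add: C2_def)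
    then have "\<bar>\<theta>\<bar> ^ 3 * (C2 / rn) \<le> (\<theta>\<^sup>2 + \<bar>\<theta>\<bar> ^ 3) * (C2 / rn)" by (intro mult_right_mono) auto
    then show ?thesis by (simp add: add_divide_distrib distrib_left)
  qed
  also have "ea * ev = of_real (exp (- (\<theta>\<^sup>2 * (\<mu>4 - \<eta>\<^sup>2 + vv) / 2)))"
    unfolding ea_def ev_def of_real_mult[symmetric] exp_add[symmetric] by (simp add: field_simps)
  finally show ?thesis .
qed

definition C3 :: real where "C3 = 2 * (48 * K2 * H\<^sup>2 + 144 * K * (4 * H + gg))"
definition C4 :: real where "C4 = 48 * K * (4 * H\<^sup>2 * R\<^sup>2) * (253 * K * R)"

lemma dep_matI: "(\<And>U U' e e'. \<forall>i<n. \<forall>l<p. U i l = U' i l \<Longrightarrow> \<forall>i<n. e i = e' i \<Longrightarrow> F U e = F U' e') \<Longrightarrow> dep_mat F"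
  unfolding dep_mat_def by blast

lemma Bst_second: "integrable M (\<lambda>\<omega>. (Bst (W \<omega>) (\<lambda>i. w i p \<omega>))\<^sup>2)"
  "expectation (\<lambda>\<omega>. (Bst (W \<omega>) (\<lambda>i. w i p \<omega>))\<^sup>2) \<le> 144 * K * (4 * H + gg)"
proof -
  let ?g = "\<lambda>\<omega>. 144 * K * (4 * ax2 (W \<omega>) + gg)"
  have ig: "integrable M ?g" using ax_expectations(2) by auto
  have m: "(\<lambda>\<omega>. (Bst (U \<omega>) (e \<omega>))\<^sup>2) \<in> borel_measurable N"
    if "\<And>i l. i < n \<Longrightarrow> l < p \<Longrightarrow> (\<lambda>\<omega>. U \<omega> i l) \<in> borel_measurable N" "\<And>i. i < n \<Longrightarrow> (\<lambda>\<omega>. e \<omega> i) \<in> borel_measurable N"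
    for N :: "'z measure" and U e
    using Bst_meas[of U N e] that by (intro borel_measurable_power) auto
  have dF: "dep_mat (\<lambda>U e. (Bst U e)\<^sup>2)" by (rule dep_matI) (simp only: deps)
  have inner: "integrable M (\<lambda>\<omega>'. (Bst U (\<lambda>i. w i p \<omega>'))\<^sup>2)"
     "expectation (\<lambda>\<omega>'. (Bst U (\<lambda>i. w i p \<omega>'))\<^sup>2) \<le> 144 * K * (4 * ax2 U + gg)" for U
  proof -
    interpret P: indep_poly M n "\<lambda>i. w i p" K "\<lambda>k. 2 * xi U k / rn" "\<lambda>k. - \<eta> / rn" "cA U" by (rule poly)
    have B: "P.B = (\<lambda>\<omega>. Bst U (\<lambda>i. w i p \<omega>))" by (rule ext) (simp only: P.B_def P.lin_def Bst_def)
    show "integrable M (\<lambda>\<omega>'. (Bst U (\<lambda>i. w i p \<omega>'))\<^sup>2)" using L4_sq[OF P.B_L4] unfolding B .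
    have "expectation (\<lambda>\<omega>'. (Bst U (\<lambda>i. w i p \<omega>'))\<^sup>2) \<le> 144 * K * (\<Sum>k<n. P.s k)"
      using P.B_second_moment unfolding B .
    also have "\<dots> \<le> 144 * K * (4 * ax2 U + gg)" using s_bounds(1)[of U] K_ge_1 by (intro mult_left_mono) auto
    finally show "expectation (\<lambda>\<omega>'. (Bst U (\<lambda>i. w i p \<omega>'))\<^sup>2) \<le> 144 * K * (4 * ax2 U + gg)" .
  qed
  have mM: "(\<lambda>\<omega>. (Bst (W \<omega>) (\<lambda>i. w i p \<omega>))\<^sup>2) \<in> borel_measurable M" by measurable
  note d = decouple_last_le[of "\<lambda>U e. (Bst U e)\<^sup>2" ?g, OF m dF zero_le_power2 mM inner ig]
  show "integrable M (\<lambda>\<omega>. (Bst (W \<omega>) (\<lambda>i. w i p \<omega>))\<^sup>2)" by (rule d(1))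
  have "expectation (\<lambda>\<omega>. (Bst (W \<omega>) (\<lambda>i. w i p \<omega>))\<^sup>2) \<le> expectation ?g" by (rule d(2))
  also have "\<dots> = 144 * K * (4 * \<eta> + gg)"
    using ax_expectations(2,4) by (simp add: prob_space)
  also have "\<dots> \<le> 144 * K * (4 * H + gg)" using eta_H K_ge_1 by (intro mult_left_mono) auto
  finally show "expectation (\<lambda>\<omega>. (Bst (W \<omega>) (\<lambda>i. w i p \<omega>))\<^sup>2) \<le> 144 * K * (4 * H + gg)" .
qed

lemma AB_second: "integrable M (\<lambda>\<omega>. (Ast (W \<omega>) + Bst (W \<omega>) (\<lambda>i. w i p \<omega>))\<^sup>2)"
  "expectation (\<lambda>\<omega>. (Ast (W \<omega>) + Bst (W \<omega>) (\<lambda>i. w i p \<omega>))\<^sup>2) \<le> C3"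
proof -
  interpret X: indep_std M n "\<lambda>i \<omega>. xi (W \<omega>) i / sqrt \<eta>" K2 by (rule xi_system)
  have iA: "integrable M (\<lambda>\<omega>. (Ast (W \<omega>))\<^sup>2)" unfolding Ast_eq by (rule L4_sq[OF X.diag_form(1)])
  have "expectation (\<lambda>\<omega>. (Ast (W \<omega>))\<^sup>2) \<le> 48 * K2 * (\<Sum>i<n. (\<eta> / rn)\<^sup>2)" unfolding Ast_eq by (rule X.diag_form(2))
  also have "\<dots> = 48 * K2 * \<eta>\<^sup>2" using basic by (simp add: power_divide)
  also have "\<dots> \<le> 48 * K2 * H\<^sup>2" using eta_sq_le K2_ge_1 by (intro mult_left_mono) auto
  finally have EA: "expectation (\<lambda>\<omega>. (Ast (W \<omega>))\<^sup>2) \<le> 48 * K2 * H\<^sup>2" .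
  let ?g = "\<lambda>\<omega>. 2 * ((Ast (W \<omega>))\<^sup>2 + (Bst (W \<omega>) (\<lambda>i. w i p \<omega>))\<^sup>2)"
  have ig: "integrable M ?g" using iA Bst_second(1) by auto
  have le: "(a + c)\<^sup>2 \<le> 2 * (a\<^sup>2 + c\<^sup>2)" for a c :: real
    using sum_squares_bound[of a c] by (simp add: power2_sum)
  show i: "integrable M (\<lambda>\<omega>. (Ast (W \<omega>) + Bst (W \<omega>) (\<lambda>i. w i p \<omega>))\<^sup>2)"
    by (rule Bochner_Integration.integrable_bound[OF ig]) (auto intro!: AE_I2 order_trans[OF le])
  have "expectation (\<lambda>\<omega>. (Ast (W \<omega>) + Bst (W \<omega>) (\<lambda>i. w i p \<omega>))\<^sup>2) \<le> expectation ?g"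
    using i ig le by (intro integral_mono)
  also have "\<dots> = 2 * (expectation (\<lambda>\<omega>. (Ast (W \<omega>))\<^sup>2) + expectation (\<lambda>\<omega>. (Bst (W \<omega>) (\<lambda>i. w i p \<omega>))\<^sup>2))"
    using iA Bst_second(1) by simp
  also have "\<dots> \<le> C3" unfolding C3_def using EA Bst_second(2) by (intro mult_left_mono add_mono) auto
  finally show "expectation (\<lambda>\<omega>. (Ast (W \<omega>) + Bst (W \<omega>) (\<lambda>i. w i p \<omega>))\<^sup>2) \<le> C3" .
qed

text \<open>Given the design, \<open>Rem\<close> is a diagonal form whose squared coefficients add
  up to c0^2 dev. As c0^2 is of order 1 / n and the expected potential of order sqrt n, the second
  moment is of order 1 / sqrt n.\<close>

lemma Rem_second: "integrable M (\<lambda>\<omega>. (Rem (W \<omega>) (\<lambda>i. w i p \<omega>))\<^sup>2)"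
  "expectation (\<lambda>\<omega>. (Rem (W \<omega>) (\<lambda>i. w i p \<omega>))\<^sup>2) \<le> C4 / rn"
proof -
  interpret e: indep_std M n "\<lambda>i. w i p" K by (rule noise)
  let ?g = "\<lambda>\<omega>. 48 * K * (4 * H\<^sup>2 * R\<^sup>2 / n) * dev n (Q \<omega> p)"
  have ig: "integrable M ?g" using dev_Q_integrable[OF basic(1) order_refl] by auto
  have m: "(\<lambda>\<omega>. (Rem (U \<omega>) (e \<omega>))\<^sup>2) \<in> borel_measurable N"
    if "\<And>i l. i < n \<Longrightarrow> l < p \<Longrightarrow> (\<lambda>\<omega>. U \<omega> i l) \<in> borel_measurable N" "\<And>i. i < n \<Longrightarrow> (\<lambda>\<omega>. e \<omega> i) \<in> borel_measurable N"
    for N :: "'z measure" and U e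
    using Rem_meas[of U N e] that by (intro borel_measurable_power) auto
  have dF: "dep_mat (\<lambda>U e. (Rem U e)\<^sup>2)" by (rule dep_matI) (simp only: deps)
  have inner: "integrable M (\<lambda>\<omega>'. (Rem U (\<lambda>i. w i p \<omega>'))\<^sup>2)"
     "expectation (\<lambda>\<omega>'. (Rem U (\<lambda>i. w i p \<omega>'))\<^sup>2) \<le> 48 * K * (4 * H\<^sup>2 * R\<^sup>2 / n) * dev n (gs n U p)" for U
  proof -
    let ?t = "trace n (gs n U p)" and ?q = "\<lambda>i. gs n U p i i"
    show "integrable M (\<lambda>\<omega>'. (Rem U (\<lambda>i. w i p \<omega>'))\<^sup>2)"
      unfolding Rem_def by (rule L4_sq[OF e.diag_form(1)])
    have dv: "(\<Sum>i<n. (?q i - ?t / n)\<^sup>2) = dev n (gs n U p)"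
    proof -
      have "(\<Sum>i<n. (?q i - ?t / n)\<^sup>2) = (\<Sum>i<n. (?q i)\<^sup>2 - 2 * ?t / n * ?q i + (?t / n)\<^sup>2)"
        by (intro sum.cong refl) (simp add: power2_diff)
      also have "\<dots> = (\<Sum>i<n. (?q i)\<^sup>2) - 2 * ?t / n * ?t + n * (?t / n)\<^sup>2"
      proof -
        have "(\<Sum>i<n. 2 * ?t / n * ?q i) = 2 * ?t / n * ?t"
          by (simp only: sum_distrib_left[symmetric] trace_def[symmetric])
        then show ?thesis by (simp add: sum.distrib sum_subtractf)
      qed
      also have "\<dots> = dev n (gs n U p)" using basic by (simp add: dev_def power2_eq_square)
      finally show ?thesis .
    qed
    have "expectation (\<lambda>\<omega>'. (Rem U (\<lambda>i. w i p \<omega>'))\<^sup>2) \<le> 48 * K * (\<Sum>i<n. (- c0 * (?q i - ?t / n))\<^sup>2)"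
      unfolding Rem_def by (rule e.diag_form(2))
    also have "(\<Sum>i<n. (- c0 * (?q i - ?t / n))\<^sup>2) = c0\<^sup>2 * dev n (gs n U p)"
      unfolding dv[symmetric] sum_distrib_left by (intro sum.cong refl) (simp add: power_mult_distrib)
    also have "48 * K * (c0\<^sup>2 * dev n (gs n U p)) \<le> 48 * K * (4 * H\<^sup>2 * R\<^sup>2 / n * dev n (gs n U p))"
      using c0_sq_le dev_nonneg[OF gs_proj basic(1)] K_ge_1 by (intro mult_left_mono mult_right_mono) auto
    finally show "expectation (\<lambda>\<omega>'. (Rem U (\<lambda>i. w i p \<omega>'))\<^sup>2) \<le> 48 * K * (4 * H\<^sup>2 * R\<^sup>2 / n) * dev n (gs n U p)"
      by (simp only: mult.assoc)
  qed
  have mM: "(\<lambda>\<omega>. (Rem (W \<omega>) (\<lambda>i. w i p \<omega>))\<^sup>2) \<in> borel_measurable M" by measurable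
  note d = decouple_last_le[of "\<lambda>U e. (Rem U e)\<^sup>2" ?g, OF m dF zero_le_power2 mM inner ig]
  show "integrable M (\<lambda>\<omega>. (Rem (W \<omega>) (\<lambda>i. w i p \<omega>))\<^sup>2)" by (rule d(1))
  have "expectation (\<lambda>\<omega>. (Rem (W \<omega>) (\<lambda>i. w i p \<omega>))\<^sup>2) \<le> expectation ?g" by (rule d(2))
  also have "\<dots> = 48 * K * (4 * H\<^sup>2 * R\<^sup>2 / n) * expectation (\<lambda>\<omega>. dev n (Q \<omega> p))" by simp
  also have "\<dots> \<le> 48 * K * (4 * H\<^sup>2 * R\<^sup>2 / n) * (n * (253 * K * R / rn))"
    using dev_expectation K_ge_1 by (intro mult_left_mono) auto
  also have "\<dots> = C4 / rn" using basic by (simp add: C4_def)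
  finally show "expectation (\<lambda>\<omega>. (Rem (W \<omega>) (\<lambda>i. w i p \<omega>))\<^sup>2) \<le> C4 / rn" .
qed

lemma Y_second:
  "integrable M (\<lambda>\<omega>. ((\<Sum>i<n. (xi (W \<omega>) i + w i p \<omega>)\<^sup>2) / n - V)\<^sup>2)"
  "expectation (\<lambda>\<omega>. ((\<Sum>i<n. (xi (W \<omega>) i + w i p \<omega>)\<^sup>2) / n - V)\<^sup>2) \<le> 192 * K2 * H\<^sup>2 / n"
proof -
  interpret Y: indep_std M n "\<lambda>i \<omega>. (xi (W \<omega>) i + w i p \<omega>) / sqrt V" K2 by (rule Y_system)
  have eq: "(\<Sum>i<n. (xi (W \<omega>) i + w i p \<omega>)\<^sup>2) / n - V = (\<Sum>i<n. V / n * (((xi (W \<omega>) i + w i p \<omega>) / sqrt V)\<^sup>2 - 1))" for \<omega>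
  proof -
    have "(\<Sum>i<n. V / n * (((xi (W \<omega>) i + w i p \<omega>) / sqrt V)\<^sup>2 - 1)) = (\<Sum>i<n. (xi (W \<omega>) i + w i p \<omega>)\<^sup>2 / n - V / n)"
      using basic by (intro sum.cong refl) (simp add: power_divide right_diff_distrib)
    then show ?thesis using basic by (simp add: sum_subtractf sum_divide_distrib)
  qed
  show "integrable M (\<lambda>\<omega>. ((\<Sum>i<n. (xi (W \<omega>) i + w i p \<omega>)\<^sup>2) / n - V)\<^sup>2)"
    unfolding eq by (rule L4_sq[OF Y.diag_form(1)])
  have "expectation (\<lambda>\<omega>. ((\<Sum>i<n. (xi (W \<omega>) i + w i p \<omega>)\<^sup>2) / n - V)\<^sup>2) \<le> 48 * K2 * (\<Sum>i<n. (V / n)\<^sup>2)"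
    unfolding eq by (rule Y.diag_form(2))
  also have "\<dots> = 48 * K2 * V\<^sup>2 / n" using basic by (simp add: power2_eq_square)
  also have "\<dots> \<le> 48 * K2 * (2 * H)\<^sup>2 / n"
    using basic K2_ge_1 by (intro divide_right_mono mult_left_mono power_mono) auto
  finally show "expectation (\<lambda>\<omega>. ((\<Sum>i<n. (xi (W \<omega>) i + w i p \<omega>)\<^sup>2) / n - V)\<^sup>2) \<le> 192 * K2 * H\<^sup>2 / n"
    by (simp add: power_mult_distrib)
qed

end

section \<open>From the leading term to the estimator\<close>

context lm_array
begin

text \<open>The mean squared response in units of the error variance; \<open>s2hat\<close> below is
  in the same units the residual variance estimate, provided that the design has full rank.\<close>

definition ybar :: "'a \<Rightarrow> real" where
  "ybar \<omega> = (\<Sum>i<n. (xi (W \<omega>) i + w i p \<omega>)\<^sup>2) / n"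

definition s2hat :: "'a \<Rightarrow> real" where
  "s2hat \<omega> = quad n (Q \<omega> p) (\<lambda>i. w i p \<omega>) / m"

definition stat :: "'a \<Rightarrow> real" where
  "stat \<omega> = Ast (W \<omega>) + Bst (W \<omega>) (\<lambda>i. w i p \<omega>)"

definition remd :: "'a \<Rightarrow> real" where
  "remd \<omega> = Rem (W \<omega>) (\<lambda>i. w i p \<omega>)"

lemma ybar_measurable [measurable]: "ybar \<in> borel_measurable M"
  unfolding ybar_def by (intro borel_measurable_divide borel_measurable_sum borel_measurable_power borel_measurable_add) auto

lemma stat_measurable [measurable]: "stat \<in> borel_measurable M" "remd \<in> borel_measurable M"
  unfolding stat_def[abs_def] remd_def[abs_def] by measurable

text \<open>The off-diagonal terms of the projection form give \<open>cA\<close>; the diagonal ones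
  split into their mean and \<open>Rem\<close>. Full rank makes the trace equal to \<open>m\<close>,
  so that all centring constants cancel.\<close>

lemma statistic_identity:
  assumes "full_rank n (W \<omega>) p"
  shows "rn * (ybar \<omega> - V * s2hat \<omega>) = stat \<omega> + remd \<omega>"
proof -
  define e where "e i = w i p \<omega>" for i
  define q where "q = gs n (W \<omega>) p"
  define x where "x = xi (W \<omega>)"
  have t: "trace n q = m" using gs_trace_eq[OF assms, of p] by (simp add: q_def m_def)
  define mm where "mm = m / n"
  have c0: "c0 * mm = V / rn"
    using basic by (simp add: c0_def mm_def field_simps)
  have split: "quad n q e = (\<Sum>i<n. q i i * (e i)\<^sup>2) + (\<Sum>i<n. \<Sum>k\<in>{..<n}-{i}. q i k * e i * e k)"
    unfolding quad_def sum.distrib[symmetric]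
    by (intro sum.cong refl) (simp add: sum.remove power2_eq_square mult.assoc)
  have qA: "quad n (cA (W \<omega>)) e = - c0 * (\<Sum>i<n. \<Sum>k\<in>{..<n}-{i}. q i k * e i * e k)"
  proof -
    have "(\<Sum>k<n. cA (W \<omega>) i k * e i * e k) = - c0 * (\<Sum>k\<in>{..<n} - {i}. q i k * e i * e k)" if "i < n" for i
      unfolding sum_distrib_left using that by (subst sum.remove[of _ i]) (auto simp: cA_def q_def intro!: sum.cong)
    then have "quad n (cA (W \<omega>)) e = (\<Sum>i<n. - c0 * (\<Sum>k\<in>{..<n} - {i}. q i k * e i * e k))"
      unfolding quad_def by (intro sum.cong) auto
    then show ?thesis by (simp only: sum_distrib_left)
  qed
  have R: "remd \<omega> = - c0 * (\<Sum>i<n. q i i * (e i)\<^sup>2) + c0 * m + V / rn * (\<Sum>i<n. (e i)\<^sup>2) - V / rn * n"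
  proof -
    have "remd \<omega> = (\<Sum>i<n. - c0 * (q i i * (e i)\<^sup>2) + c0 * q i i + c0 * mm * (e i)\<^sup>2 - c0 * mm)"
      unfolding remd_def Rem_def q_def[symmetric] t e_def[symmetric] mm_def[symmetric]
      by (intro sum.cong refl) (simp add: algebra_simps)
    also have "\<dots> = - c0 * (\<Sum>i<n. q i i * (e i)\<^sup>2) + c0 * trace n q + V / rn * (\<Sum>i<n. (e i)\<^sup>2) - V / rn * n"
      unfolding c0 by (simp add: sum.distrib sum_subtractf sum_distrib_left trace_def sum_negf mult.commute)
    finally show ?thesis unfolding t .
  qed
  have A: "Ast (W \<omega>) = (\<Sum>i<n. (x i)\<^sup>2) / rn - \<eta> * rn"
    using basic unfolding Ast_def x_def by (simp add: sum_subtractf diff_divide_distrib divide_eq_eq mult.assoc)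
  have B: "Bst (W \<omega>) e = 2 * (\<Sum>i<n. x i * e i) / rn - \<eta> * (\<Sum>i<n. (e i)\<^sup>2) / rn + \<eta> * rn
      - c0 * (\<Sum>i<n. \<Sum>k\<in>{..<n}-{i}. q i k * e i * e k)"
  proof -
    have "(\<Sum>k<n. 2 * xi (W \<omega>) k / rn * e k + - \<eta> / rn * ((e k)\<^sup>2 - 1)) =
        (\<Sum>k<n. 2 / rn * (x k * e k) - \<eta> / rn * (e k)\<^sup>2 + \<eta> / rn)"
      unfolding x_def by (intro sum.cong refl) (simp add: algebra_simps)
    also have "\<dots> = 2 / rn * (\<Sum>k<n. x k * e k) - \<eta> / rn * (\<Sum>k<n. (e k)\<^sup>2) + real n * (\<eta> / rn)"
      by (simp add: sum.distrib sum_subtractf sum_distrib_left)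
    also have "real n * (\<eta> / rn) = \<eta> * rn" using basic by (simp add: field_simps)
    finally show ?thesis unfolding Bst_def qA by simp
  qed
  have Y: "rn * ybar \<omega> = (\<Sum>i<n. (x i)\<^sup>2) / rn + 2 * (\<Sum>i<n. x i * e i) / rn + (\<Sum>i<n. (e i)\<^sup>2) / rn"
  proof -
    have "rn * ybar \<omega> = (\<Sum>i<n. (x i + e i)\<^sup>2) / rn"
      unfolding ybar_def x_def e_def using basic by (simp add: field_simps)
    also have "(\<Sum>i<n. (x i + e i)\<^sup>2) = (\<Sum>i<n. (x i)\<^sup>2) + 2 * (\<Sum>i<n. x i * e i) + (\<Sum>i<n. (e i)\<^sup>2)"
      by (simp add: power2_sum sum.distrib sum_distrib_left mult.assoc)
    finally show ?thesis by (simp add: add_divide_distrib)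
  qed
  have S: "rn * (V * s2hat \<omega>) = c0 * quad n q e"
    unfolding s2hat_def q_def e_def[abs_def] c0_def by simp
  have n: "V / rn * n = V * rn" "c0 * m = V * rn" using basic by (simp_all add: field_simps c0_def)
  have st: "stat \<omega> = Ast (W \<omega>) + Bst (W \<omega>) e" by (simp add: stat_def e_def[abs_def])
  have "stat \<omega> + remd \<omega> = rn * ybar \<omega> - rn * (V * s2hat \<omega>)"
    unfolding st A B R Y S split n using basic by (simp add: V_def add_divide_distrib algebra_simps)
  then show ?thesis by (simp add: right_diff_distrib)
qed

lemma prob_abs_gt_le:
  assumes [measurable]: "f \<in> borel_measurable M" and i: "integrable M (\<lambda>\<omega>. (f \<omega>)\<^sup>2)" and e: "0 < e"
  shows "prob {\<omega> \<in> space M. e < \<bar>f \<omega> :: real\<bar>} \<le> expectation (\<lambda>\<omega>. (f \<omega>)\<^sup>2) / e\<^sup>2"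
proof -
  have "prob {\<omega> \<in> space M. e < \<bar>f \<omega>\<bar>} \<le> prob {\<omega> \<in> space M. e\<^sup>2 \<le> (f \<omega>)\<^sup>2}"
  proof (intro finite_measure_mono subsetI)
    fix \<omega> assume "\<omega> \<in> {\<omega> \<in> space M. e < \<bar>f \<omega>\<bar>}"
    then have "\<omega> \<in> space M" "e\<^sup>2 \<le> \<bar>f \<omega>\<bar>\<^sup>2" using e power_mono[of e "\<bar>f \<omega>\<bar>" 2] by simp_all
    then show "\<omega> \<in> {\<omega> \<in> space M. e\<^sup>2 \<le> (f \<omega>)\<^sup>2}" by simp
  qed measurable
  also have "\<dots> \<le> expectation (\<lambda>\<omega>. (f \<omega>)\<^sup>2) / e\<^sup>2"
    using e i by (intro integral_Markov_inequality_measure[where A="{}"]) auto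
  finally show ?thesis .
qed

definition C5 :: "real \<Rightarrow> real" where
  "C5 d = (48 * K)\<^sup>2 * R\<^sup>2 + 768 * K2 * H\<^sup>2 + (C3 + 192 * K2 * H\<^sup>2) / (2 * d) + C4 / d\<^sup>2"

text \<open>A finite-sample form of Slutsky's theorem. With y = \<open>ybar\<close>, the difference
  is (stat (V - y) + remd V) / (t y). Four exceptional events are removed: rank deficiency, y far
  from V, a large product stat (y - V), a large \<open>remd\<close>. Off them y \<ge> 1/2 and V
  \<le> 2 y, so each summand is at most 2 d / t0, whence d = e t0 / 4. The lower bound
  \<open>t0\<close> makes the result uniform in \<open>t\<close>.\<close>

lemma slutsky_bound:
  assumes T[measurable]: "T \<in> borel_measurable M"
    and TS: "\<And>\<omega>. \<omega> \<in> space M \<Longrightarrow> full_rank n (W \<omega>) p \<Longrightarrow> 0 < ybar \<omega> \<Longrightarrow> T \<omega> = (stat \<omega> + remd \<omega>) / t * (V / ybar \<omega>)"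
    and t: "0 < t0" "t0 \<le> t" and e: "0 < e"
  shows "prob {\<omega> \<in> space M. e < \<bar>T \<omega> - stat \<omega> / t\<bar>} \<le> C5 (e * t0 / 4) / rn"
proof -
  define d where "d = e * t0 / 4"
  have d: "0 < d" using t e by (simp add: d_def)
  let ?E1 = "{\<omega> \<in> space M. \<not> full_rank n (W \<omega>) p}"
  let ?E2 = "{\<omega> \<in> space M. 1 / 2 < \<bar>ybar \<omega> - V\<bar>}"
  let ?E3 = "{\<omega> \<in> space M. d \<le> \<bar>stat \<omega>\<bar> * \<bar>ybar \<omega> - V\<bar>}"
  let ?E4 = "{\<omega> \<in> space M. d < \<bar>remd \<omega>\<bar>}"
  have sub: "{\<omega> \<in> space M. e < \<bar>T \<omega> - stat \<omega> / t\<bar>} \<subseteq> ?E1 \<union> (?E2 \<union> (?E3 \<union> ?E4))"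
  proof (rule subsetI, rule ccontr)
    fix \<omega> assume w: "\<omega> \<in> {\<omega> \<in> space M. e < \<bar>T \<omega> - stat \<omega> / t\<bar>}" and "\<omega> \<notin> ?E1 \<union> (?E2 \<union> (?E3 \<union> ?E4))"
    then have 1: "full_rank n (W \<omega>) p" and 2: "\<bar>ybar \<omega> - V\<bar> \<le> 1 / 2" and 3: "\<bar>stat \<omega>\<bar> * \<bar>ybar \<omega> - V\<bar> < d"
      and 4: "\<bar>remd \<omega>\<bar> \<le> d" by auto
    define y where "y = ybar \<omega>"
    have y: "1 / 2 \<le> y" "0 < y" "V \<le> 2 * y" using 2 basic(8) unfolding y_def by linarith+
    have "T \<omega> - stat \<omega> / t = (stat \<omega> * (V - y) + remd \<omega> * V) / (t * y)"
      using TS[of \<omega>] w 1 y t by (simp add: y_def field_simps)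
    then have "\<bar>T \<omega> - stat \<omega> / t\<bar> = \<bar>stat \<omega> * (V - y) + remd \<omega> * V\<bar> / (t * y)"
      using y t by (simp add: abs_divide abs_mult)
    also have "\<dots> \<le> (d + d * V) / (t * y)"
    proof (rule divide_right_mono)
      have "\<bar>stat \<omega> * (V - y)\<bar> \<le> d" using 3 by (simp add: abs_mult y_def abs_minus_commute)
      moreover have "\<bar>remd \<omega> * V\<bar> \<le> d * V" using 4 basic(8) by (simp add: abs_mult)
      ultimately show "\<bar>stat \<omega> * (V - y) + remd \<omega> * V\<bar> \<le> d + d * V" by linarith
    qed (use t y in simp)
    also have "\<dots> = d / (t * y) + d * V / (t * y)" by (rule add_divide_distrib)
    also have "\<dots> \<le> 2 * d / t0 + 2 * d / t0"
    proof (rule add_mono)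
      have "d / (t * y) \<le> d / (t0 * (1/2))" using d t y by (intro divide_left_mono mult_mono) auto
      then show "d / (t * y) \<le> 2 * d / t0" by (simp add: mult.commute)
      have "d * V / (t * y) \<le> d * (2 * y) / (t * y)" using d t y by (intro divide_right_mono mult_left_mono) auto
      also have "\<dots> = 2 * d / t" using y by simp
      also have "\<dots> \<le> 2 * d / t0" using d t by (intro divide_left_mono) auto
      finally show "d * V / (t * y) \<le> 2 * d / t0" .
    qed
    also have "\<dots> = e" using t by (simp add: d_def)
    finally show False using w by simp
  qed
  have ms: "?E1 \<in> events" "?E2 \<in> events" "?E3 \<in> events" "?E4 \<in> events" by measurable
  have b1: "prob ?E1 \<le> (48 * K)\<^sup>2 * R\<^sup>2 / rn"
  proof -
    have "prob ?E1 \<le> real p * ((48 * K)\<^sup>2 / m\<^sup>2)"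
      using prob_not_full_rank_le[OF pn] by (simp add: m_def)
    also have "\<dots> \<le> real n * ((48 * K)\<^sup>2 / m\<^sup>2)" using pn by (intro mult_right_mono) auto
    also have "\<dots> = (48 * K)\<^sup>2 * (n / m\<^sup>2)" by simp
    also have "\<dots> \<le> (48 * K)\<^sup>2 * (R\<^sup>2 / n)" using n_m2_le by (intro mult_left_mono) auto
    also have "\<dots> = (48 * K)\<^sup>2 * R\<^sup>2 * (1 / n)" by simp
    also have "\<dots> \<le> (48 * K)\<^sup>2 * R\<^sup>2 * (1 / rn)" using inv_n_le by (intro mult_left_mono) auto
    finally show ?thesis by simp
  qed
  note Ys = Y_second[folded ybar_def]
  have b2: "prob ?E2 \<le> 768 * K2 * H\<^sup>2 / rn"
  proof -
    have "prob ?E2 \<le> expectation (\<lambda>\<omega>. (ybar \<omega> - V)\<^sup>2) / (1 / 2)\<^sup>2"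
      using Ys(1) by (intro prob_abs_gt_le) auto
    also have "\<dots> \<le> (192 * K2 * H\<^sup>2 / n) / (1 / 2)\<^sup>2" using Ys(2) by (intro divide_right_mono) auto
    also have "\<dots> = 768 * K2 * H\<^sup>2 * (1 / n)" by (simp add: power2_eq_square[of "1/2"])
    also have "\<dots> \<le> 768 * K2 * H\<^sup>2 * (1 / rn)" using inv_n_le K2_ge_1 by (intro mult_left_mono) auto
    finally show ?thesis by simp
  qed
  note Ss = AB_second[folded stat_def]
  have b3: "prob ?E3 \<le> (C3 + 192 * K2 * H\<^sup>2) / (2 * d) / rn"
  proof -
    \<comment> \<open>The factors are dependent, of orders 1 and 1 / sqrt n. The weight 1 / rn
      splits the product into two second-moment terms, both of order 1 / sqrt n.\<close>
    let ?g = "\<lambda>\<omega>. (1 / rn * (stat \<omega>)\<^sup>2 + rn * (ybar \<omega> - V)\<^sup>2) / 2"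
    have ig: "integrable M ?g" using Ss(1) Ys(1) by auto
    have g0: "0 \<le> ?g \<omega>" for \<omega> using basic(7) by simp
    have "prob ?E3 \<le> prob {\<omega> \<in> space M. d \<le> ?g \<omega>}"
    proof (intro finite_measure_mono subsetI)
      fix \<omega> assume w: "\<omega> \<in> ?E3"
      have "\<bar>stat \<omega>\<bar> * \<bar>ybar \<omega> - V\<bar> \<le> ?g \<omega>"
        using mult_abs_le[of "1 / rn" "stat \<omega>" "ybar \<omega> - V"] basic(7) by (simp add: mult.commute)
      then show "\<omega> \<in> {\<omega> \<in> space M. d \<le> ?g \<omega>}" using w by simp
    qed measurable
    also have "\<dots> \<le> expectation ?g / d"
      using d ig g0 by (intro integral_Markov_inequality_measure[where A="{}"]) auto
    also have "expectation ?g = (1 / rn * expectation (\<lambda>\<omega>. (stat \<omega>)\<^sup>2) + rn * expectation (\<lambda>\<omega>. (ybar \<omega> - V)\<^sup>2)) / 2"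
      using Ss(1) Ys(1) by simp
    also have "\<dots> / d \<le> (1 / rn * C3 + rn * (192 * K2 * H\<^sup>2 / n)) / 2 / d"
      using Ss(2) Ys(2) basic(7) d by (intro divide_right_mono add_mono mult_left_mono) auto
    also have "rn * (192 * K2 * H\<^sup>2 / n) = 1 / rn * (192 * K2 * H\<^sup>2)"
      unfolding basic(5)[symmetric] using basic(7) by simp
    also have "(1 / rn * C3 + 1 / rn * (192 * K2 * H\<^sup>2)) / 2 / d = (C3 + 192 * K2 * H\<^sup>2) / (2 * d) / rn"
      using d basic(7) by (simp add: field_simps)
    finally show ?thesis .
  qed
  note Rs = Rem_second[folded remd_def]
  have b4: "prob ?E4 \<le> C4 / d\<^sup>2 / rn"
  proof -
    have "prob ?E4 \<le> expectation (\<lambda>\<omega>. (remd \<omega>)\<^sup>2) / d\<^sup>2"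
      using Rs(1) d by (intro prob_abs_gt_le) auto
    also have "\<dots> \<le> C4 / rn / d\<^sup>2" using Rs(2) by (intro divide_right_mono) auto
    finally show ?thesis by (simp add: mult.commute)
  qed
  have "prob {\<omega> \<in> space M. e < \<bar>T \<omega> - stat \<omega> / t\<bar>} \<le> prob (?E1 \<union> (?E2 \<union> (?E3 \<union> ?E4)))"
    using ms by (intro finite_measure_mono sub) auto
  also have "\<dots> \<le> prob ?E1 + (prob ?E2 + (prob ?E3 + prob ?E4))"
    using ms by (intro order_trans[OF measure_Un_le] add_left_mono sets.Un) auto
  also have "\<dots> \<le> C5 d / rn"
  proof -
    have "C5 d / rn = (48 * K)\<^sup>2 * R\<^sup>2 / rn + (768 * K2 * H\<^sup>2 / rn + ((C3 + 192 * K2 * H\<^sup>2) / (2 * d) / rn + C4 / d\<^sup>2 / rn))"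
      unfolding C5_def by (simp only: add_divide_distrib[of _ _ rn] add.assoc)
    then show ?thesis using add_mono[OF b1 add_mono[OF b2 add_mono[OF b3 b4]]] by simp
  qed
  finally show ?thesis by (simp add: d_def)
qed

lemma stat_tail: "0 < c \<Longrightarrow> prob {\<omega> \<in> space M. c < \<bar>stat \<omega>\<bar>} \<le> C3 / c\<^sup>2"
proof -
  assume c: "0 < c"
  note Ss = AB_second[folded stat_def]
  have "prob {\<omega> \<in> space M. c < \<bar>stat \<omega>\<bar>} \<le> expectation (\<lambda>\<omega>. (stat \<omega>)\<^sup>2) / c\<^sup>2"
    using Ss(1) c by (intro prob_abs_gt_le) auto
  also have "\<dots> \<le> C3 / c\<^sup>2" using Ss(2) by (intro divide_right_mono) auto
  finally show ?thesis .
qed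

lemma main_char_stat:
  "cmod (expectation (\<lambda>\<omega>. iexp (\<theta> * stat \<omega>)) - of_real (exp (- (\<theta>\<^sup>2 * (\<mu>4 - \<eta>\<^sup>2 + vv) / 2))))
    \<le> (\<theta>\<^sup>2 + \<bar>\<theta>\<bar> ^ 3) * ((C1 + C2) / rn)"
  unfolding stat_def by (rule main_char)

end

section \<open>Convergence in distribution\<close>

text \<open>Slutsky's theorem at the level of characteristic functions, followed by Levy continuity.
  The hypotheses are eventual because the array is well behaved only for large n.\<close>

lemma std_normal_weak_convI:
  fixes M :: "nat \<Rightarrow> 'a measure" and X T :: "nat \<Rightarrow> 'a \<Rightarrow> real"
  assumes ps: "\<forall>\<^sub>F n in sequentially. prob_space (M n)"
    and mX: "\<forall>\<^sub>F n in sequentially. X n \<in> borel_measurable (M n)"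
    and mT: "\<forall>\<^sub>F n in sequentially. T n \<in> borel_measurable (M n)"
    and char: "\<And>\<theta>. (\<lambda>n. \<integral>\<omega>. iexp (\<theta> * X n \<omega>) \<partial>M n) \<longlonglongrightarrow> of_real (exp (- \<theta>\<^sup>2 / 2))"
    and close: "\<And>e. e > 0 \<Longrightarrow> (\<lambda>n. measure (M n) {\<omega> \<in> space (M n). e < \<bar>T n \<omega> - X n \<omega>\<bar>}) \<longlonglongrightarrow> 0"
  shows "weak_conv_m (\<lambda>n. distr (M n) borel (T n)) std_normal_distribution"
proof -
  obtain N where N: "\<And>n. n \<ge> N \<Longrightarrow> prob_space (M n)" "\<And>n. n \<ge> N \<Longrightarrow> X n \<in> borel_measurable (M n)"
     "\<And>n. n \<ge> N \<Longrightarrow> T n \<in> borel_measurable (M n)"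
    using eventually_conj[OF ps eventually_conj[OF mX mT]] unfolding eventually_sequentially by blast
  \<comment> \<open>\<open>levy_continuity\<close> asks for a probability law at every index; the
    finitely many early ones are replaced by the limit law.\<close>
  define \<mu> where "\<mu> n = (if n \<ge> N then distr (M n) borel (T n) else std_normal_distribution)" for n
  have rd: "real_distribution (\<mu> n)" for n
  proof (cases "n \<ge> N")
    case True
    then show ?thesis unfolding \<mu>_def using prob_space.real_distribution_distr[OF N(1)[OF True] N(3)[OF True]] by simp
  qed (simp add: \<mu>_def real_dist_normal_dist)
  have lim: "(\<lambda>n. char (\<mu> n) \<theta>) \<longlonglongrightarrow> char std_normal_distribution \<theta>" for \<theta>
  proof -
    have chn: "char (\<mu> n) \<theta> = (\<integral>\<omega>. iexp (\<theta> * T n \<omega>) \<partial>M n)" if "n \<ge> N" for n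
      using that N(3)[OF that] by (simp add: \<mu>_def char_def integral_distr)
    have "(\<lambda>n. (\<integral>\<omega>. iexp (\<theta> * T n \<omega>) \<partial>M n) - (\<integral>\<omega>. iexp (\<theta> * X n \<omega>) \<partial>M n)) \<longlonglongrightarrow> 0"
    proof (rule LIMSEQ_I)
      fix r :: real assume r: "0 < r"
      define e where "e = r / (2 * (\<bar>\<theta>\<bar> + 1))"
      have e: "0 < e" "\<bar>\<theta>\<bar> * e \<le> r / 2"
      proof -
        show "0 < e" using r by (simp add: e_def)
        have "\<bar>\<theta>\<bar> * e = r / 2 * (\<bar>\<theta>\<bar> / (\<bar>\<theta>\<bar> + 1))" by (simp add: e_def)
        also have "\<dots> \<le> r / 2 * 1" using r by (intro mult_left_mono) auto
        finally show "\<bar>\<theta>\<bar> * e \<le> r / 2" by simp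
      qed
      have "\<forall>\<^sub>F n in sequentially. measure (M n) {\<omega> \<in> space (M n). e < \<bar>T n \<omega> - X n \<omega>\<bar>} < r / 4"
        using order_tendstoD(2)[OF close[OF e(1)], of "r / 4"] r by simp
      then obtain N' where N': "\<And>n. n \<ge> N' \<Longrightarrow> measure (M n) {\<omega> \<in> space (M n). e < \<bar>T n \<omega> - X n \<omega>\<bar>} < r / 4"
        unfolding eventually_sequentially by blast
      show "\<exists>no. \<forall>n\<ge>no. norm ((\<integral>\<omega>. iexp (\<theta> * T n \<omega>) \<partial>M n) - (\<integral>\<omega>. iexp (\<theta> * X n \<omega>) \<partial>M n) - 0) < r"
      proof (intro exI[of _ "max N N'"] allI impI)
        fix n assume n: "max N N' \<le> n"
        interpret prob_space "M n" using N(1) n by simp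
        have [measurable]: "T n \<in> borel_measurable (M n)" "X n \<in> borel_measurable (M n)" using N n by auto
        let ?B = "{\<omega> \<in> space (M n). e < \<bar>T n \<omega> - X n \<omega>\<bar>}"
        define G where "G \<omega> = iexp (\<theta> * T n \<omega>) - iexp (\<theta> * X n \<omega>)" for \<omega>
        have iG: "integrable (M n) (\<lambda>\<omega>. iexp (\<theta> * T n \<omega>))" "integrable (M n) (\<lambda>\<omega>. iexp (\<theta> * X n \<omega>))"
          by (rule integrable_const_bound[of _ 1]; auto)+
        have G_le: "cmod (G \<omega>) \<le> r / 2 + 2 * indicat_real ?B \<omega>" if "\<omega> \<in> space (M n)" for \<omega>
        proof (cases "\<omega> \<in> ?B")
          case True
          have "cmod (G \<omega>) \<le> cmod (iexp (\<theta> * T n \<omega>)) + cmod (iexp (\<theta> * X n \<omega>))" unfolding G_def by (rule norm_triangle_ineq4)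
          also have "\<dots> = 2" by (simp only: norm_exp_i_times)
          finally show ?thesis using True r by simp
        next
          case False
          have "\<theta> * T n \<omega> = \<theta> * X n \<omega> + \<theta> * (T n \<omega> - X n \<omega>)" by (simp add: right_diff_distrib)
          then have "iexp (\<theta> * T n \<omega>) = iexp (\<theta> * X n \<omega>) * iexp (\<theta> * (T n \<omega> - X n \<omega>))" by (simp only: iexp_add)
          then have "G \<omega> = iexp (\<theta> * X n \<omega>) * (iexp (\<theta> * (T n \<omega> - X n \<omega>)) - 1)"
            by (simp only: G_def right_diff_distrib mult_1_right)
          then have "cmod (G \<omega>) = cmod (iexp (\<theta> * (T n \<omega> - X n \<omega>)) - 1)" by (simp only: norm_mult norm_exp_i_times mult_1)
          also have "\<dots> \<le> \<bar>\<theta> * (T n \<omega> - X n \<omega>)\<bar>" by (rule norm_iexp_diff1)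
          also have "\<dots> \<le> \<bar>\<theta>\<bar> * e" unfolding abs_mult using False that by (intro mult_left_mono) auto
          also have "\<dots> \<le> r / 2" by (rule e(2))
          finally show ?thesis using False by simp
        qed
        have "(\<integral>\<omega>. iexp (\<theta> * T n \<omega>) \<partial>M n) - (\<integral>\<omega>. iexp (\<theta> * X n \<omega>) \<partial>M n) = expectation G"
          unfolding G_def[abs_def] using iG by simp
        also have "cmod \<dots> \<le> expectation (\<lambda>\<omega>. cmod (G \<omega>))" by (rule integral_norm_bound)
        also have "\<dots> \<le> expectation (\<lambda>\<omega>. r / 2 + 2 * indicat_real ?B \<omega>)"
        proof (rule integral_mono)
          show "integrable (M n) (\<lambda>\<omega>. cmod (G \<omega>))" unfolding G_def[abs_def] using iG by auto
          show "integrable (M n) (\<lambda>\<omega>. r / 2 + 2 * indicat_real ?B \<omega>)"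
            by (intro Bochner_Integration.integrable_add integrable_mult_right integrable_real_indicator integrable_const) (auto simp: less_top[symmetric])
        qed (use G_le in auto)
        also have "\<dots> = r / 2 + 2 * prob ?B"
        proof -
          have "integrable (M n) (indicat_real ?B)" by (intro integrable_real_indicator) (auto simp: less_top[symmetric])
          then show ?thesis by (simp add: prob_space)
        qed
        also have "\<dots> < r" using N'[of n] n by simp
        finally show "norm ((\<integral>\<omega>. iexp (\<theta> * T n \<omega>) \<partial>M n) - (\<integral>\<omega>. iexp (\<theta> * X n \<omega>) \<partial>M n) - 0) < r" by simp
      qed
    qed
    from tendsto_add[OF this char[of \<theta>]]
    have "(\<lambda>n. \<integral>\<omega>. iexp (\<theta> * T n \<omega>) \<partial>M n) \<longlonglongrightarrow> of_real (exp (- \<theta>\<^sup>2 / 2))" by simp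
    moreover have "\<forall>\<^sub>F n in sequentially. (\<integral>\<omega>. iexp (\<theta> * T n \<omega>) \<partial>M n) = char (\<mu> n) \<theta>"
      using chn by (auto simp: eventually_sequentially intro!: exI[of _ N])
    ultimately show ?thesis
      by (simp add: char_std_normal_distribution tendsto_cong)
  qed
  have wc: "weak_conv_m \<mu> std_normal_distribution"
    by (rule levy_continuity[OF rd real_dist_normal_dist lim])
  have ev: "\<forall>\<^sub>F n in sequentially. cdf (\<mu> n) x = cdf (distr (M n) borel (T n)) x" for x
    by (auto simp: eventually_sequentially \<mu>_def intro!: exI[of _ N])
  show ?thesis
    unfolding weak_conv_m_def weak_conv_def
  proof (intro allI impI)
    fix x assume "isCont (cdf std_normal_distribution) x"
    then have "(\<lambda>n. cdf (\<mu> n) x) \<longlonglongrightarrow> cdf std_normal_distribution x"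
      using wc by (simp add: weak_conv_m_def weak_conv_def)
    then show "(\<lambda>n. cdf (distr (M n) borel (T n)) x) \<longlonglongrightarrow> cdf std_normal_distribution x"
      by (rule Lim_transform_eventually[OF _ ev])
  qed
qed

section \<open>The limit theorem for the standardised array\<close>

context lm_array
begin

text \<open>The total variance \<open>\<mu>4 - \<eta>\<^sup>2 + vv\<close> with n / m - 1 replaced
  by its limit \<tau> / (1 - \<tau>). It is n V^4 times the variance prescribed by the
  theorem.\<close>

definition t2 :: "real \<Rightarrow> real" where
  "t2 \<tau> = \<mu>4 - \<eta>\<^sup>2 + 4 * \<eta> + \<eta>\<^sup>2 * (\<nu>4 - 1) + 2 * V\<^sup>2 * (\<tau> / (1 - \<tau>))"

lemma t2_vv: "\<mu>4 - \<eta>\<^sup>2 + vv - t2 \<tau> = 2 * V\<^sup>2 * (n / m - 1 - \<tau> / (1 - \<tau>))"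
  by (simp add: t2_def vv_def algebra_simps)

lemma t2_bounds:
  assumes "0 \<le> \<tau>" "\<tau> < 1"
  shows "4 * \<eta> \<le> t2 \<tau>" "t2 \<tau> \<le> K2 * H\<^sup>2 + 4 * H + H\<^sup>2 * K + 8 * H\<^sup>2 * (\<tau> / (1 - \<tau>))"
proof -
  have mu: "\<eta>\<^sup>2 \<le> \<mu>4" "\<mu>4 \<le> K2 * \<eta>\<^sup>2" using xi_moments(2,3) basic by blast+
  have t: "0 \<le> \<tau> / (1 - \<tau>)" using assms by simp
  have "0 \<le> \<eta>\<^sup>2 * (\<nu>4 - 1)" "0 \<le> 2 * V\<^sup>2 * (\<tau> / (1 - \<tau>))"
    using nu4_ge by (simp, intro mult_nonneg_nonneg t) auto
  then show "4 * \<eta> \<le> t2 \<tau>" using mu unfolding t2_def by linarith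
  interpret e: indep_std M n "\<lambda>i. w i p" K by (rule noise)
  have nu: "\<nu>4 \<le> K" using e.mom4[of 0] nu4[of 0] basic by simp
  have "K2 * \<eta>\<^sup>2 \<le> K2 * H\<^sup>2" using eta_sq_le K2_ge_1 by (intro mult_left_mono) auto
  moreover have "\<eta>\<^sup>2 * (\<nu>4 - 1) \<le> H\<^sup>2 * K" using eta_sq_le nu nu4_ge by (intro mult_mono) auto
  moreover have "2 * V\<^sup>2 * (\<tau> / (1 - \<tau>)) \<le> 2 * (2 * H)\<^sup>2 * (\<tau> / (1 - \<tau>))"
    using basic t by (intro mult_right_mono mult_left_mono power_mono) auto
  moreover have "2 * (2 * H)\<^sup>2 * (\<tau> / (1 - \<tau>)) = 8 * H\<^sup>2 * (\<tau> / (1 - \<tau>))" by (simp add: power_mult_distrib)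
  ultimately show "t2 \<tau> \<le> K2 * H\<^sup>2 + 4 * H + H\<^sup>2 * K + 8 * H\<^sup>2 * (\<tau> / (1 - \<tau>))"
    using mu eta_H zero_le_power2[of \<eta>] unfolding t2_def by linarith
qed

text \<open>The interface to the limit argument. The witness \<open>X\<close> is \<open>stat\<close>
  divided by its asymptotic standard deviation; outside the locale only the approximate
  characteristic function, the closeness to \<open>D / sd\<close> and the tail bound are
  visible.\<close>

lemma summary:
  assumes \<tau>: "0 \<le> \<tau>" "\<tau> < 1" and h: "0 < h" "h \<le> \<eta>"
    and D[measurable]: "D \<in> borel_measurable M"
    and D_eq: "\<And>\<omega>. \<omega> \<in> space M \<Longrightarrow> full_rank n (W \<omega>) p \<Longrightarrow> 0 < ybar \<omega> \<Longrightarrow>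
        D \<omega> = (ybar \<omega> - V * s2hat \<omega>) / (V * ybar \<omega>)"
  defines "sd \<equiv> sqrt (t2 \<tau> / n) / V\<^sup>2"
  shows "\<exists>X. X \<in> borel_measurable M \<and>
     (\<forall>\<theta>. cmod (expectation (\<lambda>\<omega>. iexp (\<theta> * X \<omega>)) - of_real (exp (- (\<theta>\<^sup>2 * (1 + 2 * V\<^sup>2 * (n / m - 1 - \<tau> / (1 - \<tau>)) / t2 \<tau>) / 2))))
         \<le> (\<theta>\<^sup>2 / t2 \<tau> + \<bar>\<theta>\<bar> ^ 3 / sqrt (t2 \<tau>) ^ 3) * ((C1 + C2) / rn)) \<and>
     (\<forall>e>0. prob {\<omega> \<in> space M. e < \<bar>D \<omega> / sd - X \<omega>\<bar>} \<le> C5 (e * sqrt (4 * h) / 4) / rn) \<and>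
     (\<forall>c>0. prob {\<omega> \<in> space M. c < \<bar>X \<omega>\<bar>} \<le> C3 / (t2 \<tau> * c\<^sup>2))"
proof -
  define t where "t = sqrt (t2 \<tau>)"
  have T: "0 < t2 \<tau>" using t2_bounds(1)[OF \<tau>] eta_pos by linarith
  have t: "0 < t" "t\<^sup>2 = t2 \<tau>" using T by (simp_all add: t_def)
  have t0: "0 < sqrt (4 * h)" "sqrt (4 * h) \<le> t" using h t2_bounds(1)[OF \<tau>] by (simp_all add: t_def)
  have sd: "sd = t / (rn * V\<^sup>2)" by (simp add: sd_def t_def rn_def real_sqrt_divide)
  let ?X = "\<lambda>\<omega>. stat \<omega> / t"
  have 1: "cmod (expectation (\<lambda>\<omega>. iexp (\<theta> * ?X \<omega>)) - of_real (exp (- (\<theta>\<^sup>2 * (1 + 2 * V\<^sup>2 * (n / m - 1 - \<tau> / (1 - \<tau>)) / t2 \<tau>) / 2))))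
         \<le> (\<theta>\<^sup>2 / t2 \<tau> + \<bar>\<theta>\<bar> ^ 3 / sqrt (t2 \<tau>) ^ 3) * ((C1 + C2) / rn)" for \<theta>
  proof -
    have "(\<theta> / t)\<^sup>2 * (\<mu>4 - \<eta>\<^sup>2 + vv) = \<theta>\<^sup>2 * (1 + 2 * V\<^sup>2 * (n / m - 1 - \<tau> / (1 - \<tau>)) / t2 \<tau>)"
      unfolding t2_vv[symmetric] power_divide t(2) using T by (simp add: field_simps)
    moreover have "(\<theta> / t)\<^sup>2 + \<bar>\<theta> / t\<bar> ^ 3 = \<theta>\<^sup>2 / t2 \<tau> + \<bar>\<theta>\<bar> ^ 3 / sqrt (t2 \<tau>) ^ 3"
      using t by (simp add: power_divide abs_divide t_def[symmetric])
    ultimately show ?thesis using main_char_stat[of "\<theta> / t"] by simp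
  qed
  have 2: "prob {\<omega> \<in> space M. e < \<bar>D \<omega> / sd - ?X \<omega>\<bar>} \<le> C5 (e * sqrt (4 * h) / 4) / rn" if e: "e > 0" for e
  proof (rule slutsky_bound[OF _ _ t0 e])
    show "(\<lambda>\<omega>. D \<omega> / sd) \<in> borel_measurable M" by measurable
    fix \<omega> assume w: "\<omega> \<in> space M" "full_rank n (W \<omega>) p" "0 < ybar \<omega>"
    have "D \<omega> / sd = rn * (ybar \<omega> - V * s2hat \<omega>) / t * (V / ybar \<omega>)"
      unfolding D_eq[OF w] sd using t basic w by (simp add: power2_eq_square mult_ac)
    then show "D \<omega> / sd = (stat \<omega> + remd \<omega>) / t * (V / ybar \<omega>)"
      unfolding statistic_identity[OF w(2)] .
  qed
  have 3: "prob {\<omega> \<in> space M. c < \<bar>?X \<omega>\<bar>} \<le> C3 / (t2 \<tau> * c\<^sup>2)" if c: "c > 0" for c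
  proof -
    have "prob {\<omega> \<in> space M. c < \<bar>?X \<omega>\<bar>} = prob {\<omega> \<in> space M. t * c < \<bar>stat \<omega>\<bar>}"
      using t by (intro arg_cong[where f=prob]) (auto simp: abs_divide field_simps)
    also have "\<dots> \<le> C3 / (t * c)\<^sup>2" using t c by (intro stat_tail) auto
    finally show ?thesis by (simp add: power_mult_distrib t)
  qed
  show ?thesis using 1 2 3 by (intro exI[of _ ?X]) auto
qed

end

text \<open>The Gaussian approximation of \<open>X n\<close> has a variance that differs from 1 by a
  multiple of \<open>r n\<close>, which tends to 0; \<open>h \<le> \<eta> n\<close> keeps the
  normalising variance away from 0. Consistency follows from the same bounds, since
  \<open>sd n\<close> is of order 1 / sqrt n and \<open>X n\<close> is bounded in
  probability.\<close>

theorem lm_limit: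
  fixes M :: "nat \<Rightarrow> 'a measure" and p :: "nat \<Rightarrow> nat" and w :: "nat \<Rightarrow> nat \<Rightarrow> nat \<Rightarrow> 'a \<Rightarrow> real"
    and D :: "nat \<Rightarrow> 'a \<Rightarrow> real"
  assumes lm: "\<And>n. n \<ge> N \<Longrightarrow> lm_array (M n) n (p n) (w n) K (b n) (\<eta> n) H R (\<nu>3 n) (\<nu>4 n) (\<mu>4 n)"
    and p: "(\<lambda>n. real (p n) / real n) \<longlonglongrightarrow> \<tau>" and \<tau>: "0 \<le> \<tau>" "\<tau> < 1"
    and h: "0 < h" "\<And>n. n \<ge> N \<Longrightarrow> h \<le> \<eta> n"
    and D: "\<And>n. n \<ge> N \<Longrightarrow> D n \<in> borel_measurable (M n)"
    and D_eq: "\<And>n \<omega>. n \<ge> N \<Longrightarrow> \<omega> \<in> space (M n) \<Longrightarrow> full_rank n (\<lambda>i j. w n i j \<omega>) (p n) \<Longrightarrow>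
       0 < (\<Sum>i<n. ((\<Sum>j<p n. b n j * w n i j \<omega>) + w n i (p n) \<omega>)\<^sup>2) / n \<Longrightarrow>
       D n \<omega> = ((\<Sum>i<n. ((\<Sum>j<p n. b n j * w n i j \<omega>) + w n i (p n) \<omega>)\<^sup>2) / n
           - (1 + \<eta> n) * (quad n (gs n (\<lambda>i j. w n i j \<omega>) (p n)) (\<lambda>i. w n i (p n) \<omega>) / (real n - real (p n))))
         / ((1 + \<eta> n) * ((\<Sum>i<n. ((\<Sum>j<p n. b n j * w n i j \<omega>) + w n i (p n) \<omega>)\<^sup>2) / n))"
  defines "tt \<equiv> \<lambda>n. \<mu>4 n - (\<eta> n)\<^sup>2 + 4 * \<eta> n + (\<eta> n)\<^sup>2 * (\<nu>4 n - 1) + 2 * (1 + \<eta> n)\<^sup>2 * (\<tau> / (1 - \<tau>))"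
  assumes sd: "\<And>n. n \<ge> N \<Longrightarrow> sd n = sqrt (tt n / n) / (1 + \<eta> n)\<^sup>2"
  shows "small_oP M D" "weak_conv_m (\<lambda>n. distr (M n) borel (\<lambda>\<omega>. D n \<omega> / sd n)) std_normal_distribution"
proof -
  define Cc where "Cc = lm_array.C1 K H R + lm_array.C2 K H"
  define B where "B = indep_array.K2 K * H\<^sup>2 + 4 * H + H\<^sup>2 * K + 8 * H\<^sup>2 * (\<tau> / (1 - \<tau>))"
  define r where "r n = real n / (real n - real (p n)) - 1 - \<tau> / (1 - \<tau>)" for n
  have tt: "4 * h \<le> tt n" "tt n \<le> B" if n: "n \<ge> N" for n
  proof -
    interpret lm_array "M n" n "p n" "w n" K "b n" "\<eta> n" H R "\<nu>3 n" "\<nu>4 n" "\<mu>4 n" by (rule lm[OF n])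
    have e: "lm_array.t2 (\<eta> n) (\<nu>4 n) (\<mu>4 n) \<tau> = tt n" by (simp add: tt_def lm_array.t2_def[OF lm[OF n]] V_def)
    show "4 * h \<le> tt n" "tt n \<le> B" using t2_bounds[OF \<tau>] h(2)[OF n] unfolding e B_def by auto
  qed
  define P where "P n X \<longleftrightarrow> X \<in> borel_measurable (M n) \<and>
     (\<forall>\<theta>. cmod ((\<integral>\<omega>. iexp (\<theta> * X \<omega>) \<partial>M n) - of_real (exp (- (\<theta>\<^sup>2 * (1 + 2 * (1 + \<eta> n)\<^sup>2 * r n / tt n) / 2))))
         \<le> (\<theta>\<^sup>2 / tt n + \<bar>\<theta>\<bar> ^ 3 / sqrt (tt n) ^ 3) * (Cc / sqrt n)) \<and>
     (\<forall>e>0. measure (M n) {\<omega> \<in> space (M n). e < \<bar>D n \<omega> / sd n - X \<omega>\<bar>} \<le> lm_array.C5 K H R (e * sqrt (4 * h) / 4) / sqrt n) \<and>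
     (\<forall>c>0. measure (M n) {\<omega> \<in> space (M n). c < \<bar>X \<omega>\<bar>} \<le> lm_array.C3 K H R / (tt n * c\<^sup>2))" for n and X :: "'a \<Rightarrow> real"
  have ex: "\<exists>X. n \<ge> N \<longrightarrow> P n X" for n
  proof (cases "n \<ge> N")
    case True
    interpret lm_array "M n" n "p n" "w n" K "b n" "\<eta> n" H R "\<nu>3 n" "\<nu>4 n" "\<mu>4 n" by (rule lm[OF True])
    have e: "lm_array.t2 (\<eta> n) (\<nu>4 n) (\<mu>4 n) \<tau> = tt n" by (simp add: tt_def lm_array.t2_def[OF lm[OF True]] V_def)
    have "D n \<omega> = (ybar \<omega> - V * s2hat \<omega>) / (V * ybar \<omega>)"
      if "\<omega> \<in> space (M n)" "full_rank n (W \<omega>) (p n)" "0 < ybar \<omega>" for \<omega>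
      using D_eq[OF True that(1,2)] that(3) by (simp add: ybar_def s2hat_def V_def m_def xi_def)
    from summary[OF \<tau> h(1) h(2)[OF True] D[OF True] this]
    show ?thesis unfolding P_def e Cc_def r_def
      by (simp add: sd[OF True] V_def m_def rn_def)
  qed simp
  obtain X where "\<forall>n. n \<ge> N \<longrightarrow> P n (X n)"
    using choice[of "\<lambda>n X. n \<ge> N \<longrightarrow> P n X"] ex by blast
  then have X: "\<And>n. n \<ge> N \<Longrightarrow> X n \<in> borel_measurable (M n)"
     "\<And>n \<theta>. n \<ge> N \<Longrightarrow> cmod ((\<integral>\<omega>. iexp (\<theta> * X n \<omega>) \<partial>M n) - of_real (exp (- (\<theta>\<^sup>2 * (1 + 2 * (1 + \<eta> n)\<^sup>2 * r n / tt n) / 2))))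
         \<le> (\<theta>\<^sup>2 / tt n + \<bar>\<theta>\<bar> ^ 3 / sqrt (tt n) ^ 3) * (Cc / sqrt n)"
     "\<And>n e. n \<ge> N \<Longrightarrow> e > 0 \<Longrightarrow> measure (M n) {\<omega> \<in> space (M n). e < \<bar>D n \<omega> / sd n - X n \<omega>\<bar>} \<le> lm_array.C5 K H R (e * sqrt (4 * h) / 4) / sqrt n"
     "\<And>n c. n \<ge> N \<Longrightarrow> c > 0 \<Longrightarrow> measure (M n) {\<omega> \<in> space (M n). c < \<bar>X n \<omega>\<bar>} \<le> lm_array.C3 K H R / (tt n * c\<^sup>2)"
    unfolding P_def by blast+
  define C5h where "C5h e = lm_array.C5 K H R (e * sqrt (4 * h) / 4)" for e
  define C3h where "C3h = \<bar>lm_array.C3 K H R\<bar>"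
  have ps: "prob_space (M n)" if n: "n \<ge> N" for n
    using lm[OF n] by (simp add: lm_array_def indep_array_def)
  have etaH: "\<eta> n \<le> H" "0 < \<eta> n" if n: "n \<ge> N" for n
    using lm_array.eta_H[OF lm[OF n]] lm_array.eta_pos[OF lm[OF n]] by auto
  have npos: "0 < n" if n: "n \<ge> N" for n using lm_array.pn[OF lm[OF n]] by simp
  have B: "0 < B" using tt[of N] h by linarith
  have ev: "\<forall>\<^sub>F n in sequentially. N \<le> n" by (rule eventually_ge_at_top)
  have sqrt_lim: "(\<lambda>n. c / sqrt (real n)) \<longlonglongrightarrow> 0" for c by real_asymp
  have close: "(\<lambda>n. measure (M n) {\<omega> \<in> space (M n). e < \<bar>D n \<omega> / sd n - X n \<omega>\<bar>}) \<longlonglongrightarrow> 0" if e: "e > 0" for e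
  proof (rule tendsto_sandwich[OF _ _ tendsto_const sqrt_lim[of "C5h e"]])
    show "\<forall>\<^sub>F n in sequentially. measure (M n) {\<omega> \<in> space (M n). e < \<bar>D n \<omega> / sd n - X n \<omega>\<bar>} \<le> C5h e / sqrt (real n)"
      using ev by eventually_elim (simp add: X(3) e C5h_def)
  qed simp
  show "small_oP M D"
    unfolding small_oP_def
  proof (intro conjI allI impI)
    show "\<forall>\<^sub>F n in sequentially. D n \<in> borel_measurable (M n)" using ev by eventually_elim (rule D)
    fix e :: real assume e: "0 < e"
    \<comment> \<open>From sd n \<le> sqrt (B / n) one gets e / sd n \<ge> a sqrt n. So |D n| > e
      makes |D n / sd n| exceed c + 1 with c = a sqrt n - 1, and then either it is more than 1 away
      from \<open>X n\<close> or |X n| exceeds c.\<close>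
    define a where "a = e / sqrt B"
    have a: "0 < a" using e B by (simp add: a_def)
    have lim: "(\<lambda>n. C5h 1 / sqrt (real n) + C3h / (4 * h * (a * sqrt (real n) - 1)\<^sup>2)) \<longlonglongrightarrow> 0"
      using a h by real_asymp
    have big: "\<forall>\<^sub>F n in sequentially. 0 < a * sqrt (real n) - 1" using a by real_asymp
    show "(\<lambda>n. measure (M n) {\<omega> \<in> space (M n). e < \<bar>D n \<omega>\<bar>}) \<longlonglongrightarrow> 0"
    proof (rule tendsto_sandwich[OF _ _ tendsto_const lim])
      show "\<forall>\<^sub>F n in sequentially. measure (M n) {\<omega> \<in> space (M n). e < \<bar>D n \<omega>\<bar>} \<le>
          C5h 1 / sqrt (real n) + C3h / (4 * h * (a * sqrt (real n) - 1)\<^sup>2)"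
        using ev big
      proof eventually_elim
        case (elim n)
        interpret prob_space "M n" using ps elim by blast
        define c where "c = a * sqrt (real n) - 1"
        have c: "0 < c" using elim by (simp add: c_def)
        have [measurable]: "D n \<in> borel_measurable (M n)" "X n \<in> borel_measurable (M n)" using D X(1) elim by auto
        have sdn: "0 < sd n" "sd n \<le> sqrt (B / n)"
        proof -
          have 1: "0 < tt n / n" using tt[OF elim(1)] h npos[OF elim(1)] by auto
          then show "0 < sd n" using etaH(2)[OF elim(1)] by (simp add: sd[OF elim(1)])
          have "1 \<le> (1 + \<eta> n)\<^sup>2" using etaH(2)[OF elim(1)] by (intro one_le_power) simp
          then have "sd n \<le> sqrt (tt n / n) / 1"
            unfolding sd[OF elim(1)] using 1 by (intro divide_left_mono) auto
          also have "\<dots> \<le> sqrt (B / n)" using tt(2)[OF elim(1)] by (simp add: divide_right_mono)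
          finally show "sd n \<le> sqrt (B / n)" .
        qed
        have ae: "a * sqrt (real n) \<le> e / sd n"
        proof -
          have "a * sqrt (real n) = e / sqrt (B / n)" by (simp add: a_def real_sqrt_divide)
          also have "\<dots> \<le> e / sd n" using sdn e B npos[OF elim(1)] by (intro divide_left_mono) auto
          finally show ?thesis .
        qed
        have "prob {\<omega> \<in> space (M n). e < \<bar>D n \<omega>\<bar>} \<le>
            prob ({\<omega> \<in> space (M n). 1 < \<bar>D n \<omega> / sd n - X n \<omega>\<bar>} \<union> {\<omega> \<in> space (M n). c < \<bar>X n \<omega>\<bar>})"
        proof (intro finite_measure_mono subsetI)
          fix \<omega> assume w: "\<omega> \<in> {\<omega> \<in> space (M n). e < \<bar>D n \<omega>\<bar>}"
          then have "e / sd n < \<bar>D n \<omega>\<bar> / sd n" using sdn by (intro divide_strict_right_mono) auto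
          then have "c + 1 < \<bar>D n \<omega> / sd n\<bar>" using ae sdn by (simp add: c_def abs_divide)
          then show "\<omega> \<in> {\<omega> \<in> space (M n). 1 < \<bar>D n \<omega> / sd n - X n \<omega>\<bar>} \<union> {\<omega> \<in> space (M n). c < \<bar>X n \<omega>\<bar>}"
            using w by auto
        qed measurable
        also have "\<dots> \<le> prob {\<omega> \<in> space (M n). 1 < \<bar>D n \<omega> / sd n - X n \<omega>\<bar>} + prob {\<omega> \<in> space (M n). c < \<bar>X n \<omega>\<bar>}"
          by (intro measure_Un_le) measurable
        also have "\<dots> \<le> C5h 1 / sqrt (real n) + C3h / (4 * h * c\<^sup>2)"
        proof (rule add_mono)
          show "prob {\<omega> \<in> space (M n). 1 < \<bar>D n \<omega> / sd n - X n \<omega>\<bar>} \<le> C5h 1 / sqrt (real n)"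
            using X(3)[OF elim(1), of 1] by (simp add: C5h_def)
          have "prob {\<omega> \<in> space (M n). c < \<bar>X n \<omega>\<bar>} \<le> lm_array.C3 K H R / (tt n * c\<^sup>2)" by (rule X(4)[OF elim(1) c])
          also have "\<dots> \<le> C3h / (4 * h * c\<^sup>2)"
            unfolding C3h_def using tt(1)[OF elim(1)] h c by (intro frac_le mult_right_mono) auto
          finally show "prob {\<omega> \<in> space (M n). c < \<bar>X n \<omega>\<bar>} \<le> C3h / (4 * h * c\<^sup>2)" .
        qed
        finally show ?case by (simp add: c_def)
      qed
    qed simp
  qed
  have r: "r \<longlonglongrightarrow> 0"
  proof -
    have "(\<lambda>n. 1 / (1 - real (p n) / real n) - 1 - \<tau> / (1 - \<tau>)) \<longlonglongrightarrow> 1 / (1 - \<tau>) - 1 - \<tau> / (1 - \<tau>)"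
      using \<tau> by (intro tendsto_intros p) auto
    moreover have "1 / (1 - \<tau>) - 1 - \<tau> / (1 - \<tau>) = 0" using \<tau> by (simp add: field_simps)
    moreover have "\<forall>\<^sub>F n in sequentially. 1 / (1 - real (p n) / real n) - 1 - \<tau> / (1 - \<tau>) = r n"
      using ev
    proof eventually_elim
      case (elim n)
      have "0 < real n" using npos[OF elim] by simp
      then have "1 - real (p n) / real n = (real n - real (p n)) / real n" by (simp add: diff_divide_distrib)
      then show ?case by (simp add: r_def)
    qed
    ultimately show ?thesis by (simp add: tendsto_cong)
  qed
  show "weak_conv_m (\<lambda>n. distr (M n) borel (\<lambda>\<omega>. D n \<omega> / sd n)) std_normal_distribution"
  proof (rule std_normal_weak_convI[OF _ _ _ _ close])
    show "\<forall>\<^sub>F n in sequentially. prob_space (M n)" using ev by eventually_elim (rule ps)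
    show "\<forall>\<^sub>F n in sequentially. X n \<in> borel_measurable (M n)" using ev by eventually_elim (rule X(1))
    show "\<forall>\<^sub>F n in sequentially. (\<lambda>\<omega>. D n \<omega> / sd n) \<in> borel_measurable (M n)"
      using ev
    proof eventually_elim
      case (elim n)
      from D[OF elim] show ?case by measurable
    qed
    fix \<theta> :: real
    define q where "q n = 2 * (1 + \<eta> n)\<^sup>2 * r n / tt n" for n
    have q: "q \<longlonglongrightarrow> 0"
    proof (rule Lim_null_comparison)
      show "\<forall>\<^sub>F n in sequentially. norm (q n) \<le> 2 * (1 + H)\<^sup>2 / (4 * h) * \<bar>r n\<bar>"
        using ev
      proof eventually_elim
        case (elim n)
        have "norm (q n) = 2 * (1 + \<eta> n)\<^sup>2 * \<bar>r n\<bar> / tt n"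
          using tt(1)[OF elim] h by (simp add: q_def abs_mult abs_divide)
        also have "\<dots> \<le> 2 * (1 + H)\<^sup>2 * \<bar>r n\<bar> / (4 * h)"
          using tt(1)[OF elim] h etaH[OF elim] by (intro frac_le mult_right_mono mult_left_mono power_mono) auto
        finally show ?case by (simp add: mult.commute)
      qed
      show "(\<lambda>n. 2 * (1 + H)\<^sup>2 / (4 * h) * \<bar>r n\<bar>) \<longlonglongrightarrow> 0"
        by (rule tendsto_mult_right_zero[OF tendsto_rabs_zero[OF r]])
    qed
    have e1: "(\<lambda>n. complex_of_real (exp (- (\<theta>\<^sup>2 * (1 + q n) / 2)))) \<longlonglongrightarrow> of_real (exp (- (\<theta>\<^sup>2 * (1 + 0) / 2)))"
      by (intro tendsto_intros q) auto
    have e2: "(\<lambda>n. (\<integral>\<omega>. iexp (\<theta> * X n \<omega>) \<partial>M n) - complex_of_real (exp (- (\<theta>\<^sup>2 * (1 + q n) / 2)))) \<longlonglongrightarrow> 0"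
    proof (rule Lim_null_comparison)
      define c where "c = (\<theta>\<^sup>2 / (4 * h) + \<bar>\<theta>\<bar> ^ 3 / sqrt (4 * h) ^ 3) * \<bar>Cc\<bar>"
      show "(\<lambda>n. c / sqrt (real n)) \<longlonglongrightarrow> 0" by (rule sqrt_lim)
      show "\<forall>\<^sub>F n in sequentially. norm ((\<integral>\<omega>. iexp (\<theta> * X n \<omega>) \<partial>M n) - complex_of_real (exp (- (\<theta>\<^sup>2 * (1 + q n) / 2)))) \<le> c / sqrt (real n)"
        using ev
      proof eventually_elim
        case (elim n)
        have "norm ((\<integral>\<omega>. iexp (\<theta> * X n \<omega>) \<partial>M n) - complex_of_real (exp (- (\<theta>\<^sup>2 * (1 + q n) / 2)))) \<le>
            (\<theta>\<^sup>2 / tt n + \<bar>\<theta>\<bar> ^ 3 / sqrt (tt n) ^ 3) * (Cc / sqrt n)"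
          unfolding q_def by (rule X(2)[OF elim])
        also have "\<dots> \<le> (\<theta>\<^sup>2 / (4 * h) + \<bar>\<theta>\<bar> ^ 3 / sqrt (4 * h) ^ 3) * (\<bar>Cc\<bar> / sqrt n)"
        proof (rule order_trans[OF mult_left_mono mult_right_mono])
          show "Cc / sqrt n \<le> \<bar>Cc\<bar> / sqrt n" by (intro divide_right_mono) auto
          show "0 \<le> \<theta>\<^sup>2 / tt n + \<bar>\<theta>\<bar> ^ 3 / sqrt (tt n) ^ 3" using tt(1)[OF elim] h by simp
          show "\<theta>\<^sup>2 / tt n + \<bar>\<theta>\<bar> ^ 3 / sqrt (tt n) ^ 3 \<le> \<theta>\<^sup>2 / (4 * h) + \<bar>\<theta>\<bar> ^ 3 / sqrt (4 * h) ^ 3"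
            using tt(1)[OF elim] h by (intro add_mono divide_left_mono power_mono mult_pos_pos zero_less_power) auto
        qed simp
        finally show ?case by (simp add: c_def)
      qed
    qed
    from tendsto_add[OF e2 e1]
    show "(\<lambda>n. \<integral>\<omega>. iexp (\<theta> * X n \<omega>) \<partial>M n) \<longlonglongrightarrow> of_real (exp (- \<theta>\<^sup>2 / 2))" by simp
  qed
qed

section \<open>Least squares through the Gram-Schmidt projection\<close>

text \<open>What the projection removes from a vector lies in the span of the columns treated so
  far: a step removes a multiple of the projected column, and that is the column minus an element of
  the earlier span. The induction hypothesis is thus used for \<open>v\<close> and for the
  column.\<close>

lemma gs_span: "\<exists>a. \<forall>i<n. v i - mv n (gs n W j) v i = (\<Sum>l<j. a l * W i l)"
proof (induction j arbitrary: v)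
  case 0
  have "mv n (gs n W 0) v i = v i" if "i < n" for i
    using that by (simp add: mv_def if_distrib[where f="\<lambda>x. x * _"] cong: if_cong)
  then show ?case by simp
next
  case (Suc j)
  let ?Q = "gs n W j" and ?c = "\<lambda>i. W i j"
  define k where "k = ip n (mv n ?Q ?c) v / quad n ?Q ?c"
  obtain a where a: "\<And>i. i < n \<Longrightarrow> v i - mv n ?Q v i = (\<Sum>l<j. a l * W i l)" using Suc.IH[of v] by auto
  obtain a' where a': "\<And>i. i < n \<Longrightarrow> ?c i - mv n ?Q ?c i = (\<Sum>l<j. a' l * W i l)" using Suc.IH[of ?c] by auto
  have "v i - mv n (gs n W (Suc j)) v i = (\<Sum>l<Suc j. (if l < j then a l - k * a' l else k) * W i l)" if i: "i < n" for i
  proof -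
    have "v i - mv n (gs n W (Suc j)) v i = (v i - mv n ?Q v i) + k * (?c i - (?c i - mv n ?Q ?c i))"
      using i by (simp add: gs_step_mv[OF gs_proj] k_def)
    also have "\<dots> = (\<Sum>l<j. (a l - k * a' l) * W i l) + k * W i j"
      unfolding a[OF i] a'[OF i] by (simp add: sum_subtractf sum_distrib_left algebra_simps)
    finally show ?thesis by simp
  qed
  then have "\<forall>i<n. v i - mv n (gs n W (Suc j)) v i = (\<Sum>l<Suc j. (if l < j then a l - k * a' l else k) * W i l)"
    by (intro allI impI)
  then show ?case by (rule exI[of _ "\<lambda>l. if l < j then a l - k * a' l else k"])
qed

text \<open>At a degenerate step \<open>j\<close> the projected column vanishes, so column
  \<open>j\<close> is a combination of the earlier ones. The witness has coefficient -1 at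
  \<open>j\<close>.\<close>

lemma not_full_rank_dependent:
  assumes "\<not> full_rank n W p"
  obtains a j where "j < p" "a j \<noteq> 0" "\<And>i. i < n \<Longrightarrow> (\<Sum>l<p. a l * W i l) = 0"
proof -
  obtain j where j: "j < p" "quad n (gs n W j) (\<lambda>i. W i j) = 0"
    using assms by (auto simp: full_rank_def)
  obtain a where a: "\<And>i. i < n \<Longrightarrow> W i j - mv n (gs n W j) (\<lambda>i. W i j) i = (\<Sum>l<j. a l * W i l)"
    using gs_span[of n "\<lambda>i. W i j" W j] by auto
  define a' where "a' l = (if l < j then a l else if l = j then -1 else 0)" for l
  have "(\<Sum>l<p. a' l * W i l) = 0" if i: "i < n" for i
  proof -
    have "(\<Sum>l<p. a' l * W i l) = (\<Sum>l<Suc j. a' l * W i l)"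
      using j by (intro sum.mono_neutral_right) (auto simp: a'_def)
    also have "\<dots> = (\<Sum>l<j. a l * W i l) - W i j" by (simp add: a'_def)
    also have "\<dots> = 0" using a[OF i] proj_quad_zero[OF gs_proj j(2) i] by simp
    finally show ?thesis .
  qed
  then show ?thesis using that[of j a'] j by (simp add: a'_def)
qed

lemma mult_mat_zero_vec: "A \<in> carrier_mat nr nc \<Longrightarrow> A *\<^sub>v 0\<^sub>v nc = (0\<^sub>v nr :: real vec)"
  by (intro eq_vecI) auto

text \<open>The design \<open>X = Z R\<close> with rows \<open>R z\<^sub>i\<close>, for a symmetric invertible \<open>R\<close>.\<close>
locale ols =
  fixes n d :: nat and X R :: "real mat" and Z :: "nat \<Rightarrow> nat \<Rightarrow> real" and \<beta> Y :: "real vec" and e :: "nat \<Rightarrow> real"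
  assumes X: "X \<in> carrier_mat n d" and R: "R \<in> carrier_mat d d" and R_sym: "transpose_mat R = R"
    and R_inj: "\<And>v. v \<in> carrier_vec d \<Longrightarrow> R *\<^sub>v v = 0\<^sub>v d \<Longrightarrow> v = 0\<^sub>v d"
    and X_eq: "\<And>i. i < n \<Longrightarrow> row X i = R *\<^sub>v vec d (Z i)"
    and \<beta>: "\<beta> \<in> carrier_vec d" and Y: "Y \<in> carrier_vec n"
    and Y_eq: "\<And>i. i < n \<Longrightarrow> Y $ i = row X i \<bullet> \<beta> + e i"
    and dn: "d < n"
begin

text \<open>That is, X v = Z (R v): by symmetry, \<open>R\<close> moves from the rows to the
  coefficient vector.\<close>

lemma mult_vec_X:
  assumes v: "v \<in> carrier_vec d" and i: "i < n"
  shows "(X *\<^sub>v v) $ i = (\<Sum>l<d. (R *\<^sub>v v) $ l * Z i l)"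
proof -
  have "(X *\<^sub>v v) $ i = (R *\<^sub>v vec d (Z i)) \<bullet> v" using X i by (simp add: X_eq)
  also have "\<dots> = vec d (Z i) \<bullet> (R *\<^sub>v v)"
    using transpose_vec_mult_scalar[OF R v, of "vec d (Z i)"] by (simp add: R_sym)
  also have "\<dots> = (\<Sum>l<d. (R *\<^sub>v v) $ l * Z i l)"
    using R by (simp add: scalar_prod_def lessThan_atLeast0 mult.commute)
  finally show ?thesis .
qed

lemma gram: "transpose_mat X * X \<in> carrier_mat d d"
  using X by auto

lemma gram_zero:
  assumes v: "v \<in> carrier_vec d" and z: "(transpose_mat X * X) *\<^sub>v v = 0\<^sub>v d"
  shows "X *\<^sub>v v = 0\<^sub>v n"
proof -
  have Xv: "X *\<^sub>v v \<in> carrier_vec n" by (rule mult_mat_vec_carrier[OF X v])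
  have "(X *\<^sub>v v) \<bullet> (X *\<^sub>v v) = (transpose_mat X *\<^sub>v (X *\<^sub>v v)) \<bullet> v"
    by (rule transpose_vec_mult_scalar[OF X v Xv, symmetric])
  also have "transpose_mat X *\<^sub>v (X *\<^sub>v v) = 0\<^sub>v d"
    using z X v by (simp add: assoc_mult_mat_vec[of "transpose_mat X" d n X d v])
  finally have "(X *\<^sub>v v) \<bullet> (X *\<^sub>v v) = 0" using v by simp
  then have "(\<Sum>i<n. ((X *\<^sub>v v) $ i)\<^sup>2) = 0"
    using X by (simp add: scalar_prod_def lessThan_atLeast0 power2_eq_square)
  then have "\<forall>i<n. (X *\<^sub>v v) $ i = 0" by (subst (asm) sum_nonneg_eq_0_iff) auto
  then show ?thesis using X by (intro eq_vecI) auto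
qed

text \<open>Identifies the exact event on which \<open>beta_hat\<close> falls back to its default.
  An equivalence is required because the measurability of the estimator depends on its values on
  both sides.\<close>

lemma gram_inverse_iff: "(\<exists>G. mat_inverse (transpose_mat X * X) = Some G) \<longleftrightarrow> full_rank n Z d"
proof
  assume fr: "full_rank n Z d"
  have "det (transpose_mat X * X) \<noteq> 0"
  proof
    assume "det (transpose_mat X * X) = 0"
    then obtain v where v: "v \<in> carrier_vec d" "v \<noteq> 0\<^sub>v d" "(transpose_mat X * X) *\<^sub>v v = 0\<^sub>v d"
      using det_0_iff_vec_prod_zero[OF gram] by auto
    have Xv: "X *\<^sub>v v = 0\<^sub>v n" by (rule gram_zero[OF v(1,3)])
    have "(R *\<^sub>v v) $ l = 0" if "l < d" for l
    proof (rule full_rank_independent[OF fr _ that])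
      fix i assume i: "i < n"
      show "(\<Sum>j<d. (R *\<^sub>v v) $ j * Z i j) = 0" using mult_vec_X[OF v(1) i] Xv i by simp
    qed
    then have "R *\<^sub>v v = 0\<^sub>v d" using R by (intro eq_vecI) auto
    then show False using R_inj v by auto
  qed
  then have "transpose_mat X * X \<in> Units (ring_mat TYPE(real) d ())"
    by (rule det_non_zero_imp_unit[OF gram])
  then show "\<exists>G. mat_inverse (transpose_mat X * X) = Some G"
    using mat_inverse(1)[OF gram, of "()"] by (cases "mat_inverse (transpose_mat X * X)") auto
next
  assume "\<exists>G. mat_inverse (transpose_mat X * X) = Some G"
  then obtain G where G: "mat_inverse (transpose_mat X * X) = Some G" by blast
  note inv = mat_inverse(2)[OF gram G]
  show "full_rank n Z d"
  proof (rule ccontr)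
    assume "\<not> full_rank n Z d"
    then obtain a :: "nat \<Rightarrow> real" and j where a: "j < d" "a j \<noteq> 0" "\<And>i. i < n \<Longrightarrow> (\<Sum>l<d. a l * Z i l) = 0"
      using not_full_rank_dependent[of n Z d thesis] by blast
    have "det R \<noteq> 0" using det_0_iff_vec_prod_zero[OF R] R_inj by blast
    then obtain R' where R': "R' \<in> carrier_mat d d" "R * R' = 1\<^sub>m d"
      using det_non_zero_imp_unit[OF R] by (auto simp: Units_def ring_mat_def)
    define v where "v = R' *\<^sub>v vec d a"
    have v: "v \<in> carrier_vec d" using R' by (simp add: v_def)
    have Rv: "R *\<^sub>v v = vec d a"
    proof -
      have "R *\<^sub>v v = (R * R') *\<^sub>v vec d a"
        unfolding v_def using R R' by (intro assoc_mult_mat_vec[symmetric]) auto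
      then show ?thesis by (simp add: R')
    qed
    have Xv: "X *\<^sub>v v = 0\<^sub>v n"
    proof (rule eq_vecI)
      fix i assume "i < dim_vec (0\<^sub>v n)"
      then have i: "i < n" by simp
      show "(X *\<^sub>v v) $ i = 0\<^sub>v n $ i" using mult_vec_X[OF v i] a(3)[OF i] i by (simp add: Rv)
    qed (use X in simp)
    have "v = (G * (transpose_mat X * X)) *\<^sub>v v" using inv v by simp
    also have "\<dots> = G *\<^sub>v ((transpose_mat X * X) *\<^sub>v v)" using inv gram v by (intro assoc_mult_mat_vec) auto
    also have "(transpose_mat X * X) *\<^sub>v v = transpose_mat X *\<^sub>v (X *\<^sub>v v)"
      using X v by (intro assoc_mult_mat_vec) auto
    also have "G *\<^sub>v \<dots> = 0\<^sub>v d"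
      unfolding Xv using inv X mult_mat_zero_vec[of "transpose_mat X" d n] mult_mat_zero_vec[of G d d] by simp
    finally have "R *\<^sub>v v = 0\<^sub>v d" using mult_mat_zero_vec[OF R] by simp
    then have "vec d a $ j = 0" using a(1) unfolding Rv by simp
    then show False using a by simp
  qed
qed

text \<open>The residual r is orthogonal to the columns of X and, \<open>R\<close> being injective,
  to those of Z; so the projection Q fixes it. Since r differs from the errors by a combination of
  columns of Z, which Q kills, r = Q e. With Pythagoras and the correction for degrees of freedom,
  eta_hat = a - q, hence eta_hat + sigma2_hat = a.\<close>

lemma rho_hat_full_rank:
  assumes fr: "full_rank n Z d"
  defines "a \<equiv> (\<Sum>i<n. (Y $ i)\<^sup>2) / n"
  shows "rho_hat X Y = (a - quad n (gs n Z d) e / (real n - real d)) / a"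
proof -
  obtain G where G: "mat_inverse (transpose_mat X * X) = Some G" using fr gram_inverse_iff by blast
  note inv = mat_inverse(2)[OF gram G]
  define b where "b = beta_hat X Y"
  have XtY: "transpose_mat X *\<^sub>v Y \<in> carrier_vec d" using X Y by (intro mult_mat_vec_carrier) auto
  have b_eq: "b = G *\<^sub>v (transpose_mat X *\<^sub>v Y)" by (simp add: b_def beta_hat_def G)
  have b: "b \<in> carrier_vec d" using inv XtY by (auto simp: b_eq)
  have normal: "(transpose_mat X * X) *\<^sub>v b = transpose_mat X *\<^sub>v Y"
  proof -
    have "(transpose_mat X * X) *\<^sub>v b = ((transpose_mat X * X) * G) *\<^sub>v (transpose_mat X *\<^sub>v Y)"
      unfolding b_eq using inv gram XtY by (intro assoc_mult_mat_vec[symmetric]) auto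
    then show ?thesis using inv XtY by simp
  qed
  have Xb: "X *\<^sub>v b \<in> carrier_vec n" by (rule mult_mat_vec_carrier[OF X b])
  define r where "r = Y - X *\<^sub>v b"
  have r: "r \<in> carrier_vec n" using Y Xb by (simp add: r_def)
  have Xtr: "transpose_mat X *\<^sub>v r = 0\<^sub>v d"
  proof -
    have "transpose_mat X *\<^sub>v r = transpose_mat X *\<^sub>v Y - transpose_mat X *\<^sub>v (X *\<^sub>v b)"
      unfolding r_def using X Y Xb by (intro mult_minus_distrib_mat_vec) auto
    also have "transpose_mat X *\<^sub>v (X *\<^sub>v b) = (transpose_mat X * X) *\<^sub>v b"
      using X b by (intro assoc_mult_mat_vec[symmetric]) auto
    finally show ?thesis using normal XtY by simp
  qed
  have orth: "(X *\<^sub>v v) \<bullet> r = 0" if v: "v \<in> carrier_vec d" for v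
  proof -
    have "(X *\<^sub>v v) \<bullet> r = r \<bullet> (X *\<^sub>v v)" by (rule comm_scalar_prod[OF mult_mat_vec_carrier[OF X v] r])
    also have "\<dots> = (transpose_mat X *\<^sub>v r) \<bullet> v" by (rule transpose_vec_mult_scalar[OF X v r, symmetric])
    finally show ?thesis using Xtr v by simp
  qed
  \<comment> \<open>The inner products of r with the columns of Z form a vector z, and orthogonality
    to the columns of X says R z = 0.\<close>
  have Ztr: "ip n (\<lambda>i. Z i l) (\<lambda>i. r $ i) = 0" if l: "l < d" for l
  proof -
    define z where "z = vec d (\<lambda>l. ip n (\<lambda>i. Z i l) (\<lambda>i. r $ i))"
    have z: "z \<in> carrier_vec d" by (simp add: z_def)
    have "R *\<^sub>v z = 0\<^sub>v d"
    proof (rule eq_vecI)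
      fix k assume "k < dim_vec (0\<^sub>v d)"
      then have k: "k < d" by simp
      have ek: "unit_vec d k \<in> carrier_vec d" by simp
      have Rek: "(R *\<^sub>v unit_vec d k) $ l = R $$ (k, l)" if "l < d" for l
      proof -
        have "(R *\<^sub>v unit_vec d k) $ l = R $$ (l, k)" using R k that by (simp add: scalar_prod_right_unit)
        also have "\<dots> = transpose_mat R $$ (k, l)" using R k that by simp
        finally show ?thesis by (simp add: R_sym)
      qed
      have "0 = (X *\<^sub>v unit_vec d k) \<bullet> r" using orth[OF ek] by simp
      also have "\<dots> = (\<Sum>i<n. (\<Sum>l<d. R $$ (k, l) * Z i l) * r $ i)"
        unfolding scalar_prod_def using r by (auto simp: lessThan_atLeast0[symmetric] mult_vec_X[OF ek] Rek intro!: sum.cong)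
      also have "\<dots> = (\<Sum>i<n. \<Sum>l<d. R $$ (k, l) * (Z i l * r $ i))" by (simp add: sum_distrib_right mult.assoc)
      also have "\<dots> = (\<Sum>l<d. \<Sum>i<n. R $$ (k, l) * (Z i l * r $ i))" by (rule sum.swap)
      also have "\<dots> = (\<Sum>l<d. R $$ (k, l) * z $ l)" by (simp add: z_def ip_def sum_distrib_left)
      also have "\<dots> = (R *\<^sub>v z) $ k" using R k z by (simp add: scalar_prod_def lessThan_atLeast0)
      finally show "(R *\<^sub>v z) $ k = 0\<^sub>v d $ k" using k by simp
    qed (use R in simp)
    then have "z = 0\<^sub>v d" by (rule R_inj[OF z])
    then have "z $ l = 0" using l by simp
    then show ?thesis using l by (simp add: z_def)
  qed
  let ?Q = "gs n Z d"
  have rQ: "r $ i = mv n ?Q e i" if i: "i < n" for i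
  proof -
    define g where "g = R *\<^sub>v (\<beta> - b)"
    have bb: "\<beta> - b \<in> carrier_vec d" using \<beta> b by simp
    have r_eq: "r $ k = e k + (\<Sum>l<d. g $ l * Z k l)" if k: "k < n" for k
    proof -
      have "(X *\<^sub>v (\<beta> - b)) $ k = (X *\<^sub>v \<beta>) $ k - (X *\<^sub>v b) $ k"
        using mult_minus_distrib_mat_vec[OF X \<beta> b] X k by simp
      then have "r $ k = e k + (X *\<^sub>v (\<beta> - b)) $ k"
        using X Y k Y_eq[OF k] by (simp add: r_def)
      then show ?thesis by (simp add: mult_vec_X[OF bb k] g_def)
    qed
    have "r $ i = mv n ?Q (\<lambda>i. r $ i) i" by (rule gs_fix[OF Ztr i, symmetric])
    also have "\<dots> = mv n ?Q (\<lambda>k. e k + (\<Sum>l<d. g $ l * Z k l)) i" by (rule mv_cong) (rule r_eq)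
    also have "\<dots> = mv n ?Q e i + mv n ?Q (\<lambda>k. \<Sum>l<d. g $ l * Z k l) i"
      by (simp add: mv_def distrib_left sum.distrib)
    also have "mv n ?Q (\<lambda>k. \<Sum>l<d. g $ l * Z k l) i = 0"
      unfolding mv_sum mv_cmult using i by (simp add: gs_kernel)
    finally show ?thesis by simp
  qed
  have rr: "r \<bullet> r = quad n ?Q e"
    unfolding proj_quad[OF gs_proj] ip_def scalar_prod_def using r by (auto simp: rQ lessThan_atLeast0)
  have s2: "sigma2_hat X Y = quad n ?Q e / (real n - real d)"
    using X unfolding sigma2_hat_def Let_def b_def[symmetric] r_def[symmetric] rr by simp
  have YY: "Y \<bullet> Y = (\<Sum>i<n. (Y $ i)\<^sup>2)" using Y by (simp add: scalar_prod_def lessThan_atLeast0 power2_eq_square)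
  have pyth: "(X *\<^sub>v b) \<bullet> (X *\<^sub>v b) = Y \<bullet> Y - r \<bullet> r"
  proof -
    have Y': "Y = X *\<^sub>v b + r" unfolding r_def using Y X by (intro eq_vecI) auto
    have "Y \<bullet> Y = (X *\<^sub>v b) \<bullet> (X *\<^sub>v b) + (X *\<^sub>v b) \<bullet> r + (r \<bullet> (X *\<^sub>v b) + r \<bullet> r)"
      using Xb r by (subst (1 2) Y') (simp add: add_scalar_prod_distrib[of _ n] scalar_prod_add_distrib[of _ n])
    moreover have "r \<bullet> (X *\<^sub>v b) = (X *\<^sub>v b) \<bullet> r" by (rule comm_scalar_prod[OF r Xb])
    ultimately show ?thesis using orth[OF b] by simp
  qed
  have gramb: "b \<bullet> (((1 / real n) \<cdot>\<^sub>m (transpose_mat X * X)) *\<^sub>v b) = (X *\<^sub>v b) \<bullet> (X *\<^sub>v b) / n"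
  proof -
    have "((1 / real n) \<cdot>\<^sub>m (transpose_mat X * X)) *\<^sub>v b = (1 / real n) \<cdot>\<^sub>v ((transpose_mat X * X) *\<^sub>v b)"
      using gram b by (intro eq_vecI) auto
    also have "(transpose_mat X * X) *\<^sub>v b = transpose_mat X *\<^sub>v (X *\<^sub>v b)"
      using X b by (intro assoc_mult_mat_vec) auto
    also have "b \<bullet> ((1 / real n) \<cdot>\<^sub>v (transpose_mat X *\<^sub>v (X *\<^sub>v b))) = 1 / real n * (b \<bullet> (transpose_mat X *\<^sub>v (X *\<^sub>v b)))"
      using X b by (intro scalar_prod_smult_right) auto
    also have "b \<bullet> (transpose_mat X *\<^sub>v (X *\<^sub>v b)) = (X *\<^sub>v b) \<bullet> (X *\<^sub>v b)"
    proof -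
      have "transpose_mat X *\<^sub>v (X *\<^sub>v b) \<in> carrier_vec d" using X by (intro mult_mat_vec_carrier[OF _ Xb]) auto
      from comm_scalar_prod[OF b this] show ?thesis using transpose_vec_mult_scalar[OF X b Xb] by simp
    qed
    finally show ?thesis by simp
  qed
  define q where "q = quad n ?Q e / (real n - real d)"
  have nd: "real n - real d \<noteq> 0" "real n \<noteq> 0" using dn by auto
  have eta: "eta_hat X Y = a - q"
  proof -
    have "eta_hat X Y = (Y \<bullet> Y - r \<bullet> r) / n - q * real d / n"
      using X unfolding eta_hat_def b_def[symmetric] s2 q_def[symmetric] by (simp add: gramb pyth)
    \<comment> \<open>The residual sum of squares is q (n - d); the correction q d / n completes its
      n-th part to q.\<close>
    also have "r \<bullet> r = q * (real n - real d)" using nd unfolding rr q_def by simp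
    finally have "eta_hat X Y = (Y \<bullet> Y - q * (real n - real d)) / n - q * real d / n" .
    also have "\<dots> = (Y \<bullet> Y - q * n) / n"
      by (simp add: diff_divide_distrib[symmetric] right_diff_distrib)
    also have "\<dots> = a - q" using nd by (simp add: a_def YY diff_divide_distrib)
    finally show ?thesis .
  qed
  show ?thesis unfolding rho_hat_def eta s2 q_def[symmetric] by simp
qed

text \<open>The default \<open>beta_hat\<close> makes the estimator an explicit function of |Y|^2,
  which serves its measurability.\<close>

lemma rho_hat_not_full_rank:
  assumes fr: "\<not> full_rank n Z d"
  defines "s \<equiv> (\<Sum>i<n. (Y $ i)\<^sup>2) / (real n - real d)"
  shows "rho_hat X Y = (- (s * real d / n)) / (- (s * real d / n) + s)"
proof -
  have G: "mat_inverse (transpose_mat X * X) = None" using fr gram_inverse_iff by auto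
  have b: "beta_hat X Y = 0\<^sub>v d" using X by (simp add: beta_hat_def G)
  have X0: "X *\<^sub>v 0\<^sub>v d = 0\<^sub>v n" by (rule mult_mat_zero_vec[OF X])
  have Y0: "Y - 0\<^sub>v n = Y" using Y by (intro eq_vecI) auto
  have YY: "Y \<bullet> Y = (\<Sum>i<n. (Y $ i)\<^sup>2)" using Y by (simp add: scalar_prod_def lessThan_atLeast0 power2_eq_square)
  have s2: "sigma2_hat X Y = s" using X by (simp add: sigma2_hat_def b X0 Y0 Let_def YY s_def)
  have g: "((1 / real n) \<cdot>\<^sub>m (transpose_mat X * X)) *\<^sub>v 0\<^sub>v d \<in> carrier_vec d"
    using gram by (intro mult_mat_vec_carrier[of _ d d]) auto
  have "eta_hat X Y = - (s * real d / n)"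
    using X g unfolding eta_hat_def s2 b by simp
  then show ?thesis unfolding rho_hat_def s2 by simp
qed

end

section \<open>From the model to the standardised array\<close>

text \<open>Arises by integer layers: f^8 is at most the sum of (k + 1)^8 over the integers k with 0
  \<le> k \<le> |f|, and each layer is weighted by its tail bound.\<close>

definition subgauss8 :: "real \<Rightarrow> real" where
  "subgauss8 c = (\<Sum>k. 2 * (real k + 1) ^ 8 * exp (- c * (real k)\<^sup>2))"

lemma subgauss8_summable: "c > 0 \<Longrightarrow> summable (\<lambda>k. 2 * (real k + 1) ^ 8 * exp (- c * (real k)\<^sup>2))"
proof -
  assume c: "c > 0"
  have "(\<lambda>k. 2 * (real k + 1) ^ 8 * exp (- c * (real k)\<^sup>2)) \<in> O(\<lambda>k. 1 / real k ^ 2)"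
    using c by real_asymp
  moreover have "summable (\<lambda>k. norm (1 / real k ^ 2))"
    using inverse_power_summable[of 2, where 'a=real] by (simp add: field_simps)
  ultimately show ?thesis by (rule summable_comparison_test_bigo[rotated])
qed

lemma (in prob_space) subgaussian_eighth_moment:
  assumes [measurable]: "f \<in> borel_measurable M" and c: "c > 0"
    and tail: "\<And>t. t > 0 \<Longrightarrow> prob {\<omega> \<in> space M. t \<le> \<bar>f \<omega>\<bar>} \<le> 2 * exp (- c * t\<^sup>2)"
  shows "integrable M (\<lambda>\<omega>. (f \<omega> :: real) ^ 8)" "expectation (\<lambda>\<omega>. f \<omega> ^ 8) \<le> subgauss8 c"
proof -
  let ?g = "\<lambda>k. 2 * (real k + 1) ^ 8 * exp (- c * (real k)\<^sup>2)"
  \<comment> \<open>The tail hypothesis speaks of positive arguments; at k = 0 its bound is 2 and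
    exceeds any probability.\<close>
  have tail': "prob {\<omega> \<in> space M. real k \<le> \<bar>f \<omega>\<bar>} \<le> 2 * exp (- c * (real k)\<^sup>2)" for k :: nat
  proof (cases "k = 0")
    case True
    have "prob {\<omega> \<in> space M. real k \<le> \<bar>f \<omega>\<bar>} \<le> 1" by (rule prob_le_1)
    then show ?thesis using True by (simp add: prob_space)
  qed (use tail in auto)
  have pt: "ennreal (f \<omega> ^ 8) \<le> (\<Sum>k. ennreal ((real k + 1) ^ 8) * indicator {\<omega> \<in> space M. real k \<le> \<bar>f \<omega>\<bar>} \<omega>)"
    if w: "\<omega> \<in> space M" for \<omega>
  proof -
    define k where "k = nat \<lfloor>\<bar>f \<omega>\<bar>\<rfloor>"
    have k: "real k \<le> \<bar>f \<omega>\<bar>" "\<bar>f \<omega>\<bar> \<le> real k + 1" unfolding k_def by linarith+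
    have "f \<omega> ^ 8 = \<bar>f \<omega>\<bar> ^ 8" by simp
    also have "\<dots> \<le> (real k + 1) ^ 8" using k by (intro power_mono) auto
    finally have "ennreal (f \<omega> ^ 8) \<le> ennreal ((real k + 1) ^ 8) * indicator {\<omega> \<in> space M. real k \<le> \<bar>f \<omega>\<bar>} \<omega>"
      using w k by (simp add: ennreal_leI)
    also have "\<dots> \<le> (\<Sum>k. ennreal ((real k + 1) ^ 8) * indicator {\<omega> \<in> space M. real k \<le> \<bar>f \<omega>\<bar>} \<omega>)"
    proof -
      have "h k \<le> (\<Sum>k. h k)" for h :: "nat \<Rightarrow> ennreal"
        using sum_le_suminf[OF summableI, of "{k}" h] by simp
      then show ?thesis .
    qed
    finally show ?thesis .
  qed
  have "(\<integral>\<^sup>+\<omega>. ennreal (f \<omega> ^ 8) \<partial>M) \<le> (\<integral>\<^sup>+\<omega>. (\<Sum>k. ennreal ((real k + 1) ^ 8) * indicator {\<omega> \<in> space M. real k \<le> \<bar>f \<omega>\<bar>} \<omega>) \<partial>M)"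
    by (intro nn_integral_mono pt)
  also have "\<dots> = (\<Sum>k. ennreal ((real k + 1) ^ 8) * emeasure M {\<omega> \<in> space M. real k \<le> \<bar>f \<omega>\<bar>})"
    by (subst nn_integral_suminf) (auto intro!: suminf_cong nn_integral_cmult_indicator)
  also have "\<dots> \<le> (\<Sum>k. ennreal (?g k))"
  proof (intro suminf_le summableI)
    fix k :: nat
    have "ennreal ((real k + 1) ^ 8) * emeasure M {\<omega> \<in> space M. real k \<le> \<bar>f \<omega>\<bar>} =
        ennreal ((real k + 1) ^ 8 * prob {\<omega> \<in> space M. real k \<le> \<bar>f \<omega>\<bar>})"
      by (simp add: emeasure_eq_measure ennreal_mult)
    also have "\<dots> \<le> ennreal ((real k + 1) ^ 8 * (2 * exp (- c * (real k)\<^sup>2)))"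
      by (intro ennreal_leI mult_left_mono tail') auto
    finally show "ennreal ((real k + 1) ^ 8) * emeasure M {\<omega> \<in> space M. real k \<le> \<bar>f \<omega>\<bar>} \<le> ennreal (?g k)"
      by (simp add: mult_ac)
  qed
  also have "\<dots> = ennreal (subgauss8 c)"
    unfolding subgauss8_def by (rule suminf_ennreal2[OF _ subgauss8_summable[OF c]]) simp
  finally have nn: "(\<integral>\<^sup>+\<omega>. ennreal (f \<omega> ^ 8) \<partial>M) \<le> ennreal (subgauss8 c)" .
  show i: "integrable M (\<lambda>\<omega>. f \<omega> ^ 8)"
    using nn by (intro integrableI_bounded) (auto simp: power_abs intro: le_less_trans)
  have s0: "0 \<le> subgauss8 c" unfolding subgauss8_def by (intro suminf_nonneg subgauss8_summable c) simp
  show "expectation (\<lambda>\<omega>. f \<omega> ^ 8) \<le> subgauss8 c"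
    using nn s0 unfolding nn_integral_eq_integral[OF i, of] by (subst (asm) nn_integral_eq_integral[OF i]) (auto simp: ennreal_le_iff)
qed

section \<open>Joint independence of the whitened entries and the errors\<close>

lemma space_borel_vec [simp]: "space (borel_vec d) = carrier_vec d"
  by (simp add: borel_vec_def)

lemma borel_vec_component [measurable]: "j < d \<Longrightarrow> (\<lambda>v. v $ j) \<in> borel_measurable (borel_vec d)"
proof -
  assume j: "j < d"
  have "(\<lambda>v. \<lambda>j\<in>{..<d}. v $ j) \<in> borel_vec d \<rightarrow>\<^sub>M Pi\<^sub>M {..<d} (\<lambda>_. borel)"
    unfolding borel_vec_def by (rule measurable_vimage_algebra1) (auto simp: space_PiM)
  from measurable_compose[OF this measurable_component_singleton[of j]]
  show ?thesis using j by (simp add: restrict_apply)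
qed

lemma same_distr_integral:
  fixes g :: "'b \<Rightarrow> real"
  assumes "distr M N U = distr M N U'" "U \<in> M \<rightarrow>\<^sub>M N" "U' \<in> M \<rightarrow>\<^sub>M N" "g \<in> borel_measurable N"
  shows "(\<integral>\<omega>. g (U \<omega>) \<partial>M) = (\<integral>\<omega>. g (U' \<omega>) \<partial>M)"
  using integral_distr[OF assms(2,4)] integral_distr[OF assms(3,4)] assms(1) by simp

lemma (in prob_space) indep_ofD:
  assumes "indep_of M N U K V" "A \<in> sets N" "B \<in> sets K"
  shows "prob ((U -` A \<inter> space M) \<inter> (V -` B \<inter> space M)) = prob (U -` A \<inter> space M) * prob (V -` B \<inter> space M)"
proof -
  have "indep_set (sets (vimage_algebra (space M) U N)) (sets (vimage_algebra (space M) V K))"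
    using assms(1) by (simp add: indep_of_def)
  then show ?thesis
    by (rule indep_setD) (intro in_vimage_algebra assms)+
qed

text \<open>Three independence hypotheses are merged: between rows, within a row, and between rows
  and errors. The first and the last concern X, the second its whitened version; the functions
  \<open>g\<close>, which recover the latter from the former, link them. The probability of a
  rectangle then factors in turn: errors from rows, observation by observation, and entry by entry
  within a row.\<close>

lemma (in prob_space) joint_independence:
  fixes X :: "nat \<Rightarrow> 'a \<Rightarrow> real vec" and z :: "nat \<Rightarrow> nat \<Rightarrow> 'a \<Rightarrow> real" and e :: "nat \<Rightarrow> 'a \<Rightarrow> real"
  assumes n: "n > 0" and d: "d > 0"
    and X: "indep_vars (\<lambda>_. borel_vec d) X {..<n}"
    and g: "\<And>j. j < d \<Longrightarrow> g j \<in> borel_measurable (borel_vec d)"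
    and z: "\<And>i j \<omega>. i < n \<Longrightarrow> j < d \<Longrightarrow> \<omega> \<in> space M \<Longrightarrow> z i j \<omega> = g j (X i \<omega>)"
    and zi: "\<And>i. i < n \<Longrightarrow> indep_vars (\<lambda>_. borel) (z i) {..<d}"
    and e: "indep_vars (\<lambda>_. borel) e {..<n}"
    and eX: "indep_of M (Pi\<^sub>M {..<n} (\<lambda>_. borel)) (\<lambda>\<omega>. \<lambda>i\<in>{..<n}. e i \<omega>)
               (Pi\<^sub>M {..<n} (\<lambda>_. borel_vec d)) (\<lambda>\<omega>. \<lambda>i\<in>{..<n}. X i \<omega>)"
  shows "indep_vars (\<lambda>_. borel) (\<lambda>(i, j). if j < d then z i j else (\<lambda>\<omega>. e i \<omega> / s)) ({..<n} \<times> {..d})"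
proof -
  let ?I = "{..<n} \<times> {..d}" and ?W = "\<lambda>(i, j). if j < d then z i j else (\<lambda>\<omega>. e i \<omega> / s)"
  have mX: "X i \<in> M \<rightarrow>\<^sub>M borel_vec d" if "i < n" for i using X that by (auto simp: indep_vars_def)
  have mz: "z i j \<in> borel_measurable M" if "i < n" "j < d" for i j using zi[OF that(1)] that by (auto simp: indep_vars_def)
  have me: "e i \<in> borel_measurable M" if "i < n" for i using e that by (auto simp: indep_vars_def)
  have I: "?I \<noteq> {}" "finite ?I" using n by auto
  have rv: "?W a \<in> borel_measurable M" if "a \<in> ?I" for a
    using that mz me by (auto split: prod.splits)
  have "(\<forall>A\<in>(\<Pi> a\<in>?I. sets borel). prob (\<Inter>a\<in>?I. ?W a -` A a \<inter> space M) = (\<Prod>a\<in>?I. prob (?W a -` A a \<inter> space M)))"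
  proof (intro ballI)
    fix A :: "nat \<times> nat \<Rightarrow> real set" assume A: "A \<in> (\<Pi> a\<in>?I. sets borel)"
    \<comment> \<open>The conditions on the whitened entries of row \<open>i\<close>, expressed as a
      set of values of \<open>X i\<close>.\<close>
    define BX where "BX i = (\<Inter>j\<in>{..<d}. g j -` A (i, j) \<inter> space (borel_vec d))" for i
    define Be where "Be i = (\<lambda>y :: real. y / s) -` A (i, d)" for i
    have Am: "A (i, j) \<in> sets borel" if "i < n" "j \<le> d" for i j using A that by auto
    have BX: "BX i \<in> sets (borel_vec d)" if "i < n" for i
      unfolding BX_def using d that by (intro sets.finite_INT measurable_sets[OF g] Am) auto
    have Be: "Be i \<in> sets borel" if "i < n" for i
      unfolding Be_def using measurable_sets[of "\<lambda>y :: real. y / s" borel borel, OF _ Am[OF that order_refl]] by simp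
    have EX: "X i -` BX i \<inter> space M = (\<Inter>j\<in>{..<d}. z i j -` A (i, j) \<inter> space M)" if i: "i < n" for i
      using z[OF i] d measurable_space[OF mX[OF i]] by (auto simp: BX_def)
    have Ee: "e i -` Be i \<inter> space M = (\<lambda>\<omega>. e i \<omega> / s) -` A (i, d) \<inter> space M" for i
      by (auto simp: Be_def)
    let ?SX = "Pi\<^sub>E {..<n} BX" and ?Se = "Pi\<^sub>E {..<n} Be"
    have SX: "?SX \<in> sets (Pi\<^sub>M {..<n} (\<lambda>_. borel_vec d))" using BX by (intro sets_PiM_I_finite) auto
    have Se: "?Se \<in> sets (Pi\<^sub>M {..<n} (\<lambda>_. borel))" using Be by (intro sets_PiM_I_finite) auto
    have vX: "(\<lambda>\<omega>. \<lambda>i\<in>{..<n}. X i \<omega>) -` ?SX \<inter> space M = (\<Inter>i\<in>{..<n}. X i -` BX i \<inter> space M)"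
      using n by (auto simp: PiE_iff)
    have ve: "(\<lambda>\<omega>. \<lambda>i\<in>{..<n}. e i \<omega>) -` ?Se \<inter> space M = (\<Inter>i\<in>{..<n}. e i -` Be i \<inter> space M)"
      using n by (auto simp: PiE_iff)
    have "(\<Inter>a\<in>?I. ?W a -` A a \<inter> space M) =
        ((\<lambda>\<omega>. \<lambda>i\<in>{..<n}. e i \<omega>) -` ?Se \<inter> space M) \<inter> ((\<lambda>\<omega>. \<lambda>i\<in>{..<n}. X i \<omega>) -` ?SX \<inter> space M)"
    proof -
      have "(\<Inter>a\<in>?I. ?W a -` A a \<inter> space M) = (\<Inter>i\<in>{..<n}. \<Inter>j\<in>{..d}. ?W (i, j) -` A (i, j) \<inter> space M)" by auto
      also have "\<dots> = (\<Inter>i\<in>{..<n}. (\<Inter>j\<in>{..<d}. z i j -` A (i, j) \<inter> space M) \<inter> ((\<lambda>\<omega>. e i \<omega> / s) -` A (i, d) \<inter> space M))"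
        unfolding lessThan_Suc_atMost[symmetric] lessThan_Suc by auto
      also have "\<dots> = (\<Inter>i\<in>{..<n}. (X i -` BX i \<inter> space M) \<inter> (e i -` Be i \<inter> space M))"
        by (intro INF_cong refl) (simp add: EX Ee)
      also have "\<dots> = (\<Inter>i\<in>{..<n}. e i -` Be i \<inter> space M) \<inter> (\<Inter>i\<in>{..<n}. X i -` BX i \<inter> space M)" by auto
      finally show ?thesis unfolding vX ve .
    qed
    then have "prob (\<Inter>a\<in>?I. ?W a -` A a \<inter> space M) =
        prob ((\<lambda>\<omega>. \<lambda>i\<in>{..<n}. e i \<omega>) -` ?Se \<inter> space M) * prob ((\<lambda>\<omega>. \<lambda>i\<in>{..<n}. X i \<omega>) -` ?SX \<inter> space M)"
      using indep_ofD[OF eX Se SX] by simp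
    also have "\<dots> = (\<Prod>i<n. prob (e i -` Be i \<inter> space M)) * (\<Prod>i<n. prob (X i -` BX i \<inter> space M))"
    proof -
      have "prob (\<Inter>i\<in>{..<n}. X i -` BX i \<inter> space M) = (\<Prod>i<n. prob (X i -` BX i \<inter> space M))"
        using n BX by (intro indep_varsD_finite[OF X]) auto
      moreover have "prob (\<Inter>i\<in>{..<n}. e i -` Be i \<inter> space M) = (\<Prod>i<n. prob (e i -` Be i \<inter> space M))"
        using n Be by (intro indep_varsD_finite[OF e]) auto
      ultimately show ?thesis unfolding vX ve by (simp only:)
    qed
    also have "\<dots> = (\<Prod>i<n. prob ((\<lambda>\<omega>. e i \<omega> / s) -` A (i, d) \<inter> space M)) * (\<Prod>i<n. \<Prod>j<d. prob (z i j -` A (i, j) \<inter> space M))"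
    proof -
      have "prob (X i -` BX i \<inter> space M) = (\<Prod>j<d. prob (z i j -` A (i, j) \<inter> space M))" if i: "i < n" for i
        unfolding EX[OF i] using d i Am by (intro indep_varsD_finite[OF zi[OF i]]) auto
      then show ?thesis unfolding Ee by simp
    qed
    also have "\<dots> = (\<Prod>i<n. \<Prod>j\<le>d. prob (?W (i, j) -` A (i, j) \<inter> space M))"
      unfolding lessThan_Suc_atMost[symmetric] by (simp add: prod.distrib mult.commute)
    also have "\<dots> = (\<Prod>a\<in>?I. prob (?W a -` A a \<inter> space M))"
      unfolding prod.cartesian_product by (intro prod.cong refl) auto
    finally show "prob (\<Inter>a\<in>?I. ?W a -` A a \<inter> space M) = (\<Prod>a\<in>?I. prob (?W a -` A a \<inter> space M))" .
  qed
  then show ?thesis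
    by (subst indep_vars_finite[where E="\<lambda>_. sets borel", OF I])
      (use rv in \<open>auto simp: sets.sigma_sets_eq[of borel, simplified] Int_stable_def intro: sets.top[of borel, simplified]\<close>)
qed

lemma (in prob_space) iidD:
  assumes "iid M N n U"
  shows "indep_vars (\<lambda>_. N) U {..<n}" "i < n \<Longrightarrow> U i \<in> M \<rightarrow>\<^sub>M N"
    "i < n \<Longrightarrow> distr M N (U i) = distr M N (U 0)"
  using assms unfolding iid_def indep_vars_def by blast+

lemma (in prob_space) iid_integral:
  fixes g :: "'b \<Rightarrow> real"
  assumes "iid M N n U" "i < n" "g \<in> borel_measurable N"
  shows "expectation (\<lambda>\<omega>. g (U i \<omega>)) = expectation (\<lambda>\<omega>. g (U 0 \<omega>))"
  by (rule same_distr_integral[OF iidD(3)[OF assms(1,2)] iidD(2)[OF assms(1,2)] iidD(2)[OF assms(1)] assms(3)])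
    (use assms(2) in simp)

text \<open>The hypotheses at one sample size, with the existential quantifiers opened.
  \<open>C8\<close> comes from the order condition on the eighth error moment; after division by
  \<open>\<sigma>\<close> it bounds that moment uniformly.\<close>

locale lm_model = prob_space M for M :: "'a measure" +
  fixes n d :: nat and X Z :: "nat \<Rightarrow> 'a \<Rightarrow> real vec" and \<epsilon> :: "nat \<Rightarrow> 'a \<Rightarrow> real"
    and R S :: "real mat" and \<beta> :: "real vec" and \<sigma> c C8 :: real
  assumes dn: "d < n" and d_pos: "0 < d"
    and \<beta>: "\<beta> \<in> carrier_vec d" and S: "S \<in> carrier_mat d d" and sqrt_S: "is_psd_sqrt d R S" and lam: "0 < lambda_min S"
    and X_iid: "iid M (borel_vec d) n X"
    and Z_meas: "i < n \<Longrightarrow> Z i \<in> M \<rightarrow>\<^sub>M borel_vec d"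
    and XZ: "i < n \<Longrightarrow> \<omega> \<in> space M \<Longrightarrow> X i \<omega> = R *\<^sub>v Z i \<omega>"
    and Z_indep: "i < n \<Longrightarrow> indep_vars (\<lambda>_. borel) (\<lambda>j \<omega>. Z i \<omega> $ j) {..<d}"
    and Z_mean: "i < n \<Longrightarrow> j < d \<Longrightarrow> expectation (\<lambda>\<omega>. Z i \<omega> $ j) = 0"
    and Z_var: "i < n \<Longrightarrow> j < d \<Longrightarrow> expectation (\<lambda>\<omega>. (Z i \<omega> $ j)\<^sup>2) = 1"
    and c: "0 < c"
    and tail: "i < n \<Longrightarrow> j < d \<Longrightarrow> 0 < t \<Longrightarrow> prob {\<omega> \<in> space M. t \<le> \<bar>Z i \<omega> $ j\<bar>} \<le> 2 * exp (- c * t\<^sup>2)"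
    and e_iid: "iid M borel n \<epsilon>"
    and e_X: "indep_of M (Pi\<^sub>M {..<n} (\<lambda>_. borel)) (\<lambda>\<omega>. \<lambda>i\<in>{..<n}. \<epsilon> i \<omega>)
               (Pi\<^sub>M {..<n} (\<lambda>_. borel_vec d)) (\<lambda>\<omega>. \<lambda>i\<in>{..<n}. X i \<omega>)"
    and e_int8: "i < n \<Longrightarrow> integrable M (\<lambda>\<omega>. \<epsilon> i \<omega> ^ 8)"
    and e_mean: "i < n \<Longrightarrow> expectation (\<epsilon> i) = 0"
    and e_var: "i < n \<Longrightarrow> expectation (\<lambda>\<omega>. (\<epsilon> i \<omega>)\<^sup>2) = \<sigma>\<^sup>2"
    and \<sigma>: "\<sigma> \<noteq> 0"
    and e_mom8: "expectation (\<lambda>\<omega>. \<epsilon> 0 \<omega> ^ 8) \<le> C8 * \<sigma> ^ 8"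
begin

definition w :: "nat \<Rightarrow> nat \<Rightarrow> 'a \<Rightarrow> real" where
  "w i j = (if j < d then (\<lambda>\<omega>. Z i \<omega> $ j) else (\<lambda>\<omega>. \<epsilon> i \<omega> / \<sigma>))"

definition b :: "nat \<Rightarrow> real" where "b j = (R *\<^sub>v \<beta>) $ j / \<sigma>"
definition \<eta> :: real where "\<eta> = eta0 \<beta> S / \<sigma>\<^sup>2"
definition \<nu>3 :: real where "\<nu>3 = expectation (\<lambda>\<omega>. (\<epsilon> 0 \<omega> / \<sigma>) ^ 3)"
definition \<nu>4 :: real where "\<nu>4 = expectation (\<lambda>\<omega>. (\<epsilon> 0 \<omega> / \<sigma>) ^ 4)"
definition \<mu>4 :: real where "\<mu>4 = expectation (\<lambda>\<omega>. (X 0 \<omega> \<bullet> \<beta> / \<sigma>) ^ 4)"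

lemma R: "R \<in> carrier_mat d d" "transpose_mat R = R" "R * R = S"
  using sqrt_S by (auto simp: is_psd_sqrt_def)

text \<open>A nonzero kernel vector of \<open>R\<close> would be an eigenvector of
  \<open>R * R = S\<close> for the eigenvalue 0, against \<open>lambda_min\<close>.\<close>

lemma R_inj:
  assumes v: "v \<in> carrier_vec d" and "R *\<^sub>v v = 0\<^sub>v d" shows "v = 0\<^sub>v d"
proof (rule ccontr)
  assume "v \<noteq> 0\<^sub>v d"
  have "S *\<^sub>v v = R *\<^sub>v (R *\<^sub>v v)"
    unfolding R(3)[symmetric] using R(1) v by (intro assoc_mult_mat_vec) auto
  also have "\<dots> = 0 \<cdot>\<^sub>v v" using assms mult_mat_zero_vec[OF R(1)] v by (auto intro!: eq_vecI)
  finally have "eigenvalue S 0"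
    unfolding eigenvalue_def eigenvector_def using v \<open>v \<noteq> 0\<^sub>v d\<close> S by auto
  then have "0 \<in> spectrum S" by (simp add: spectrum_def)
  then have "lambda_min S \<le> 0"
    unfolding lambda_min_def using card_finite_spectrum(1)[OF S] by (intro Min_le)
  then show False using lam by simp
qed

lemma n_pos: "0 < n" using dn by simp

lemma X_meas: "i < n \<Longrightarrow> X i \<in> M \<rightarrow>\<^sub>M borel_vec d"
  by (rule iidD(2)[OF X_iid])

lemma e_meas [measurable]: "i < n \<Longrightarrow> \<epsilon> i \<in> borel_measurable M"
  by (rule iidD(2)[OF e_iid])

lemma Z_comp [measurable]: "i < n \<Longrightarrow> j < d \<Longrightarrow> (\<lambda>\<omega>. Z i \<omega> $ j) \<in> borel_measurable M"
  using measurable_compose[OF Z_meas borel_vec_component] .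

lemma Z_carrier: "i < n \<Longrightarrow> \<omega> \<in> space M \<Longrightarrow> Z i \<omega> \<in> carrier_vec d"
  using measurable_space[OF Z_meas] by simp

lemma X_carrier: "i < n \<Longrightarrow> \<omega> \<in> space M \<Longrightarrow> X i \<omega> \<in> carrier_vec d"
  using measurable_space[OF X_meas] by simp

text \<open>The inverse of \<open>R\<close> exhibits each whitened entry as a measurable function of
  \<open>X i\<close>, so that the independence between the rows of X and from the errors carries
  over.\<close>

lemma w_indep: "indep_vars (\<lambda>_. borel) (\<lambda>(i, j). w i j) ({..<n} \<times> {..d})"
proof -
  have "det R \<noteq> 0" using det_0_iff_vec_prod_zero[OF R(1)] R_inj by blast
  then obtain R' where R': "R' \<in> carrier_mat d d" "R' * R = 1\<^sub>m d"
    using det_non_zero_imp_unit[OF R(1)] by (auto simp: Units_def ring_mat_def)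
  define g where "g j v = (\<Sum>k<d. R' $$ (j, k) * v $ k)" for j and v :: "real vec"
  have g: "g j \<in> borel_measurable (borel_vec d)" if "j < d" for j
    unfolding g_def by (intro borel_measurable_sum borel_measurable_times borel_measurable_const borel_vec_component) auto
  have z: "Z i \<omega> $ j = g j (X i \<omega>)" if i: "i < n" and j: "j < d" and w: "\<omega> \<in> space M" for i j \<omega>
  proof -
    note zc = Z_carrier[OF i w]
    have "R' *\<^sub>v X i \<omega> = (R' * R) *\<^sub>v Z i \<omega>"
      unfolding XZ[OF i w] using R' R(1) zc by (intro assoc_mult_mat_vec[symmetric]) auto
    also have "\<dots> = Z i \<omega>" using R' zc by simp
    finally have "Z i \<omega> $ j = (R' *\<^sub>v X i \<omega>) $ j" by simp
    also have "\<dots> = g j (X i \<omega>)"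
      using R' X_carrier[OF i w] j by (simp add: g_def scalar_prod_def lessThan_atLeast0)
    finally show ?thesis .
  qed
  have iX: "indep_vars (\<lambda>_. borel_vec d) X {..<n}" and ie: "indep_vars (\<lambda>_. borel) \<epsilon> {..<n}"
    by (rule iidD(1)[OF X_iid], rule iidD(1)[OF e_iid])
  have "indep_vars (\<lambda>_. borel) (\<lambda>(i, j). if j < d then (\<lambda>\<omega>. Z i \<omega> $ j) else (\<lambda>\<omega>. \<epsilon> i \<omega> / \<sigma>)) ({..<n} \<times> {..d})"
    by (rule joint_independence[OF n_pos d_pos iX g z Z_indep ie e_X])
  then show ?thesis by (simp add: w_def[abs_def] case_prod_beta')
qed

definition K :: real where "K = max 1 (max (subgauss8 c) C8)"

lemma e_same:
  assumes "i < n" "(g :: real \<Rightarrow> real) \<in> borel_measurable borel"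
  shows "expectation (\<lambda>\<omega>. g (\<epsilon> i \<omega>)) = expectation (\<lambda>\<omega>. g (\<epsilon> 0 \<omega>))"
  by (rule iid_integral[OF e_iid assms])

lemma array: "indep_array M n d w K"
proof
  show "indep_vars (\<lambda>_. borel) (\<lambda>(i, j). w i j) ({..<n} \<times> {..d})" by (rule w_indep)
  show "1 \<le> K" by (simp add: K_def)
  fix i j assume i: "i < n" and j: "j \<le> d"
  show "expectation (w i j) = 0" "expectation (\<lambda>\<omega>. (w i j \<omega>)\<^sup>2) = 1"
    using i \<sigma> Z_mean[OF i] Z_var[OF i] e_mean[OF i] e_var[OF i] by (auto simp: w_def power_divide)
  show "integrable M (\<lambda>\<omega>. w i j \<omega> ^ 8)"
  proof (cases "j < d")
    case True
    then show ?thesis using subgaussian_eighth_moment(1)[OF Z_comp[OF i True] c tail[OF i True]] by (simp add: w_def)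
  next
    case False
    then show ?thesis using e_int8[OF i] by (simp add: w_def power_divide)
  qed
  show "expectation (\<lambda>\<omega>. w i j \<omega> ^ 8) \<le> K"
  proof (cases "j < d")
    case True
    then show ?thesis using subgaussian_eighth_moment(2)[OF Z_comp[OF i True] c tail[OF i True]] by (simp add: w_def K_def)
  next
    case False
    have "expectation (\<lambda>\<omega>. \<epsilon> i \<omega> ^ 8) \<le> C8 * \<sigma> ^ 8"
      using e_same[OF i, of "\<lambda>t. t ^ 8"] e_mom8 by simp
    then have "expectation (\<lambda>\<omega>. \<epsilon> i \<omega> ^ 8) / \<sigma> ^ 8 \<le> C8" using \<sigma> by (simp add: divide_le_eq)
    then show ?thesis using False by (simp add: w_def K_def power_divide)
  qed
qed

lemma xi_eq:
  assumes i: "i < n" and w: "\<omega> \<in> space M"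
  shows "(\<Sum>j<d. b j * w i j \<omega>) = X i \<omega> \<bullet> \<beta> / \<sigma>"
proof -
  note zc = Z_carrier[OF i w]
  have "X i \<omega> \<bullet> \<beta> = Z i \<omega> \<bullet> (R *\<^sub>v \<beta>)"
    unfolding XZ[OF i w] using transpose_vec_mult_scalar[OF R(1) \<beta> zc] by (simp add: R(2))
  also have "\<dots> = (\<Sum>j<d. (R *\<^sub>v \<beta>) $ j * Z i \<omega> $ j)"
    using R(1) by (simp add: scalar_prod_def lessThan_atLeast0 mult.commute)
  finally show ?thesis by (simp add: b_def w_def sum_divide_distrib)
qed

lemma eta_eq: "(\<Sum>j<d. (b j)\<^sup>2) = \<eta>"
proof -
  have Rb: "R *\<^sub>v \<beta> \<in> carrier_vec d" by (rule mult_mat_vec_carrier[OF R(1) \<beta>])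
  have "eta0 \<beta> S = \<beta> \<bullet> (R *\<^sub>v (R *\<^sub>v \<beta>))"
    unfolding eta0_def R(3)[symmetric] using R(1) \<beta> by (subst assoc_mult_mat_vec[of R d d R d]) auto
  also have "\<dots> = (R *\<^sub>v \<beta>) \<bullet> (R *\<^sub>v \<beta>)"
    using transpose_vec_mult_scalar[OF R(1) Rb \<beta>] by (simp add: R(2))
  also have "\<dots> = (\<Sum>j<d. ((R *\<^sub>v \<beta>) $ j)\<^sup>2)"
    using R(1) by (simp add: scalar_prod_def lessThan_atLeast0 power2_eq_square)
  finally show ?thesis by (simp add: \<eta>_def b_def power_divide sum_divide_distrib)
qed

lemma response_eq:
  assumes "i < n" "\<omega> \<in> space M"
  shows "response X \<beta> \<epsilon> i \<omega> = \<sigma> * ((\<Sum>j<d. b j * w i j \<omega>) + w i d \<omega>)"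
  unfolding xi_eq[OF assms] response_def using \<sigma> by (simp add: w_def distrib_left)

lemma to_lm_array:
  assumes "0 < \<eta>" "\<eta> \<le> H" "1 \<le> H" "real n \<le> Rc * (real n - real d)" "1 \<le> Rc"
  shows "lm_array M n d w K b \<eta> H Rc \<nu>3 \<nu>4 \<mu>4"
proof -
  interpret indep_array M n d w K by (rule array)
  show ?thesis
  proof (unfold_locales)
    fix i assume i: "i < n"
    show "expectation (\<lambda>\<omega>. w i d \<omega> ^ 3) = \<nu>3"
      using e_same[OF i, of "\<lambda>t. (t / \<sigma>) ^ 3"] by (simp add: w_def \<nu>3_def)
    show "expectation (\<lambda>\<omega>. w i d \<omega> ^ 4) = \<nu>4"
      using e_same[OF i, of "\<lambda>t. (t / \<sigma>) ^ 4"] by (simp add: w_def \<nu>4_def)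
    let ?g = "\<lambda>v. ((\<Sum>j<d. v $ j * \<beta> $ j) / \<sigma>) ^ 4"
    have g: "?g \<in> borel_measurable (borel_vec d)"
      by (intro borel_measurable_power borel_measurable_divide borel_measurable_sum borel_measurable_times
          borel_measurable_const borel_vec_component) auto
    have eqg: "(X i \<omega> \<bullet> \<beta> / \<sigma>) ^ 4 = ?g (X i \<omega>)" for i \<omega>
      using \<beta> by (simp add: scalar_prod_def lessThan_atLeast0)
    have "expectation (\<lambda>\<omega>. (\<Sum>j<d. b j * w i j \<omega>) ^ 4) = expectation (\<lambda>\<omega>. ?g (X i \<omega>))"
      unfolding eqg[symmetric] by (intro Bochner_Integration.integral_cong refl) (simp add: xi_eq[OF i])
    also have "\<dots> = expectation (\<lambda>\<omega>. ?g (X 0 \<omega>))"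
      by (rule iid_integral[OF X_iid i g])
    also have "\<dots> = \<mu>4" unfolding \<mu>4_def eqg ..
    finally show "expectation (\<lambda>\<omega>. (\<Sum>j<d. b j * w i j \<omega>) ^ 4) = \<mu>4" .
  qed (use assms eta_eq dn in auto)
qed

text \<open>Signal and error of an observation are independent and centred, so the odd mixed terms
  of the fourth power vanish. The middle term contributes 6 \<eta>, as the scaled error has variance
  one.\<close>

lemma fourth_moments:
  "expectation (\<lambda>\<omega>. \<epsilon> 0 \<omega> ^ 4) = \<sigma> ^ 4 * \<nu>4"
  "expectation (\<lambda>\<omega>. response X \<beta> \<epsilon> 0 \<omega> ^ 4) = \<sigma> ^ 4 * (\<mu>4 + 6 * \<eta> + \<nu>4)"
proof -
  show "expectation (\<lambda>\<omega>. \<epsilon> 0 \<omega> ^ 4) = \<sigma> ^ 4 * \<nu>4"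
    using \<sigma> by (simp add: \<nu>4_def power_divide)
  interpret A: indep_array M n d w K by (rule array)
  interpret r: indep_std M "Suc d" "\<lambda>j. w 0 j" K by (rule A.row_indep_std[OF n_pos])
  let ?S = "\<lambda>\<omega>. \<Sum>j<d. b j * w 0 j \<omega>" and ?e = "w 0 d"
  have LS: "L4 ?S" by (rule r.L4_lin) simp
  have Le: "L4 ?e" by (rule r.L4_x) simp
  have ES4: "expectation (\<lambda>\<omega>. ?S \<omega> ^ 4) = \<mu>4"
    unfolding \<mu>4_def by (intro Bochner_Integration.integral_cong refl) (simp add: xi_eq[OF n_pos])
  have Ee4: "expectation (\<lambda>\<omega>. ?e \<omega> ^ 4) = \<nu>4" by (simp add: \<nu>4_def w_def)
  have S1: "expectation ?S = 0" by (rule r.expectation_lin) simp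
  have S2: "expectation (\<lambda>\<omega>. (?S \<omega>)\<^sup>2) = \<eta>" using r.second_moment_lin[of d b] eta_eq by simp
  have f1: "expectation (\<lambda>\<omega>. ?e \<omega> * ?S \<omega> ^ 3) = 0"
    using r.indep_lin_pow[of d "\<lambda>t. t" b 3] r.mean[of d] L4_integrable[OF Le] L4_cube[OF LS] by simp
  have f2: "expectation (\<lambda>\<omega>. (?e \<omega>)\<^sup>2 * (?S \<omega>)\<^sup>2) = \<eta>"
    using r.indep_lin_pow[of d "\<lambda>t. t\<^sup>2" b 2] r.var[of d] L4_sq[OF Le] L4_sq[OF LS] S2 by simp
  have f3: "expectation (\<lambda>\<omega>. ?e \<omega> ^ 3 * ?S \<omega> ^ 1) = 0"
    using r.indep_lin_pow[of d "\<lambda>t. t ^ 3" b 1] L4_cube[OF Le] L4_integrable[OF LS] S1 by simp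
  have i: "integrable M (\<lambda>\<omega>. ?e \<omega> * ?S \<omega> ^ 3)" "integrable M (\<lambda>\<omega>. (?e \<omega>)\<^sup>2 * (?S \<omega>)\<^sup>2)"
    "integrable M (\<lambda>\<omega>. ?e \<omega> ^ 3 * ?S \<omega> ^ 1)"
    using L4_prod4[OF Le LS LS LS] L4_sq_sq[OF Le LS] L4_prod4[OF Le Le Le LS]
    by (simp_all add: power3_eq_cube mult.assoc)
  define Sf where "Sf \<omega> = ?S \<omega>" for \<omega>
  have "expectation (\<lambda>\<omega>. response X \<beta> \<epsilon> 0 \<omega> ^ 4) = expectation (\<lambda>\<omega>. \<sigma> ^ 4 * (Sf \<omega> ^ 4 + 4 * (?e \<omega> * Sf \<omega> ^ 3)
      + 6 * ((?e \<omega>)\<^sup>2 * (Sf \<omega>)\<^sup>2) + 4 * (?e \<omega> ^ 3 * Sf \<omega> ^ 1) + ?e \<omega> ^ 4))"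
  proof (intro Bochner_Integration.integral_cong refl)
    fix \<omega> assume w: "\<omega> \<in> space M"
    have "response X \<beta> \<epsilon> 0 \<omega> = \<sigma> * (Sf \<omega> + ?e \<omega>)" unfolding Sf_def by (rule response_eq[OF n_pos w])
    then show "response X \<beta> \<epsilon> 0 \<omega> ^ 4 = \<sigma> ^ 4 * (Sf \<omega> ^ 4 + 4 * (?e \<omega> * Sf \<omega> ^ 3)
      + 6 * ((?e \<omega>)\<^sup>2 * (Sf \<omega>)\<^sup>2) + 4 * (?e \<omega> ^ 3 * Sf \<omega> ^ 1) + ?e \<omega> ^ 4)"
      by (simp only: power_mult_distrib) (simp add: eval_nat_numeral algebra_simps)
  qed
  also have "\<dots> = \<sigma> ^ 4 * (expectation (\<lambda>\<omega>. Sf \<omega> ^ 4) + 4 * expectation (\<lambda>\<omega>. ?e \<omega> * Sf \<omega> ^ 3)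
      + 6 * expectation (\<lambda>\<omega>. (?e \<omega>)\<^sup>2 * (Sf \<omega>)\<^sup>2) + 4 * expectation (\<lambda>\<omega>. ?e \<omega> ^ 3 * Sf \<omega> ^ 1) + expectation (\<lambda>\<omega>. ?e \<omega> ^ 4))"
    using i[folded Sf_def] L4_int4[OF LS, folded Sf_def] L4_int4[OF Le] by simp
  also have "\<dots> = \<sigma> ^ 4 * (\<mu>4 + 6 * \<eta> + \<nu>4)"
    unfolding Sf_def ES4 f1 f2 f3 Ee4 by simp
  finally show "expectation (\<lambda>\<omega>. response X \<beta> \<epsilon> 0 \<omega> ^ 4) = \<sigma> ^ 4 * (\<mu>4 + 6 * \<eta> + \<nu>4)" .
qed

text \<open>Divided by \<sigma>^8 and written with u = \<tau> / (1 - \<tau>), the bracket is a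
  polynomial in \<eta> and u. The difference of the two fourth moments contributes \<mu>4 + 6
  \<eta>, of which the second summand takes away 2 \<eta>, and the terms with u combine to 2 (1 +
  \<eta>)^2 u.\<close>

lemma var_rho_hat_eq:
  assumes \<tau>: "\<tau> < 1" and eta: "0 < \<eta>"
  shows "sqrt (var_rho_hat n \<tau> (eta0 \<beta> S) \<sigma> (expectation (\<lambda>\<omega>. response X \<beta> \<epsilon> 0 \<omega> ^ 4)) (expectation (\<lambda>\<omega>. \<epsilon> 0 \<omega> ^ 4))) =
    sqrt ((\<mu>4 - \<eta>\<^sup>2 + 4 * \<eta> + \<eta>\<^sup>2 * (\<nu>4 - 1) + 2 * (1 + \<eta>)\<^sup>2 * (\<tau> / (1 - \<tau>))) / n) / (1 + \<eta>)\<^sup>2"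
proof -
  define u where "u = \<tau> / (1 - \<tau>)"
  have u: "\<tau> / (\<tau> - 1) = - u" "(4 * \<tau> - 2) / (1 - \<tau>) = 2 * u - 2"
    using \<tau> by (simp_all add: u_def field_simps)
  have e0: "eta0 \<beta> S = \<sigma>\<^sup>2 * \<eta>" using \<sigma> by (simp add: \<eta>_def)
  define t where "t = \<mu>4 - \<eta>\<^sup>2 + 4 * \<eta> + \<eta>\<^sup>2 * (\<nu>4 - 1) + 2 * (1 + \<eta>)\<^sup>2 * u"
  have br: "2 * \<sigma> ^ 8 * \<tau> / (1 - \<tau>) - (2 + 4 * \<tau> / (\<tau> - 1)) * \<sigma> ^ 6 * (\<sigma>\<^sup>2 * \<eta>)
      + \<sigma> ^ 4 * (\<sigma> ^ 4 * (\<mu>4 + 6 * \<eta> + \<nu>4) - \<sigma> ^ 4 * \<nu>4 + (\<sigma>\<^sup>2 * \<eta>)\<^sup>2 * ((4 * \<tau> - 2) / (1 - \<tau>))) + (\<sigma>\<^sup>2 * \<eta>)\<^sup>2 * (\<sigma> ^ 4 * \<nu>4)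
     = \<sigma> ^ 8 * t"
  proof -
    have "2 * \<sigma> ^ 8 * \<tau> / (1 - \<tau>) = 2 * \<sigma> ^ 8 * u" "4 * \<tau> / (\<tau> - 1) = 4 * (- u)"
      unfolding u(1)[symmetric] by (simp_all add: u_def)
    then show ?thesis unfolding u(2) t_def
      by (simp only:) (simp add: eval_nat_numeral algebra_simps)
  qed
  have V: "(\<sigma>\<^sup>2 * \<eta> + \<sigma>\<^sup>2) ^ 4 = \<sigma> ^ 8 * ((1 + \<eta>)\<^sup>2)\<^sup>2"
  proof -
    have "\<sigma>\<^sup>2 * \<eta> + \<sigma>\<^sup>2 = \<sigma>\<^sup>2 * (1 + \<eta>)" by (simp add: distrib_left)
    then show ?thesis by (simp add: power_mult_distrib flip: power_mult)
  qed
  have "var_rho_hat n \<tau> (eta0 \<beta> S) \<sigma> (expectation (\<lambda>\<omega>. response X \<beta> \<epsilon> 0 \<omega> ^ 4)) (expectation (\<lambda>\<omega>. \<epsilon> 0 \<omega> ^ 4)) =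
     t / n / ((1 + \<eta>)\<^sup>2)\<^sup>2"
    unfolding var_rho_hat_def fourth_moments e0 br V using \<sigma> by simp
  then have "sqrt (var_rho_hat n \<tau> (eta0 \<beta> S) \<sigma> (expectation (\<lambda>\<omega>. response X \<beta> \<epsilon> 0 \<omega> ^ 4)) (expectation (\<lambda>\<omega>. \<epsilon> 0 \<omega> ^ 4))) =
     sqrt (t / n) / (1 + \<eta>)\<^sup>2"
    by (simp only: real_sqrt_divide[of "t / n"] real_sqrt_abs abs_of_nonneg[OF zero_le_power2])
  then show ?thesis unfolding t_def u_def .
qed

abbreviation des :: "'a \<Rightarrow> real mat" where "des \<equiv> design n d X"
abbreviation rsp :: "'a \<Rightarrow> real vec" where "rsp \<equiv> response_vec n X \<beta> \<epsilon>"
abbreviation Zf :: "'a \<Rightarrow> nat \<Rightarrow> nat \<Rightarrow> real" where "Zf \<omega> \<equiv> \<lambda>i j. Z i \<omega> $ j"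

lemma ols: assumes w: "\<omega> \<in> space M" shows "ols n d (des \<omega>) R (Zf \<omega>) \<beta> (rsp \<omega>) (\<lambda>i. \<epsilon> i \<omega>)"
proof
  show "des \<omega> \<in> carrier_mat n d" by (simp add: design_def)
  show "R \<in> carrier_mat d d" "transpose_mat R = R" by (rule R)+
  show "v \<in> carrier_vec d \<Longrightarrow> R *\<^sub>v v = 0\<^sub>v d \<Longrightarrow> v = 0\<^sub>v d" for v by (rule R_inj)
  show "\<beta> \<in> carrier_vec d" "d < n" by (rule \<beta>, rule dn)
  show "rsp \<omega> \<in> carrier_vec n" by (simp add: response_vec_def)
  fix i assume i: "i < n"
  have row: "row (des \<omega>) i = X i \<omega>"
    using X_carrier[OF i w] i by (intro eq_vecI) (auto simp: design_def)
  have z: "vec d (\<lambda>j. Z i \<omega> $ j) = Z i \<omega>" using Z_carrier[OF i w] by (intro eq_vecI) auto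
  show "row (des \<omega>) i = R *\<^sub>v vec d (\<lambda>j. Z i \<omega> $ j)" unfolding row z by (rule XZ[OF i w])
  show "rsp \<omega> $ i = row (des \<omega>) i \<bullet> \<beta> + \<epsilon> i \<omega>" unfolding row using i by (simp add: response_vec_def response_def)
qed

lemma gs_w: "j \<le> d \<Longrightarrow> gs n (\<lambda>i j. w i j \<omega>) j = gs n (Zf \<omega>) j"
  by (rule gs_cong) (simp add: w_def)

lemma full_rank_w: "full_rank n (\<lambda>i j. w i j \<omega>) d \<longleftrightarrow> full_rank n (Zf \<omega>) d"
proof -
  have "(\<lambda>i. w i j \<omega>) = (\<lambda>i. Zf \<omega> i j)" if "j < d" for j using that by (simp add: w_def)
  then show ?thesis
    unfolding full_rank_def by (intro all_cong1 imp_cong refl) (simp only: gs_w less_imp_le)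
qed

text \<open>In units of the error variance the estimate is (a - q) / a and the target \<eta> / (1 +
  \<eta>); their difference is exact, with no linearisation.\<close>

lemma rho_hat_deviation:
  assumes w: "\<omega> \<in> space M" and fr: "full_rank n (\<lambda>i j. w i j \<omega>) d" and eta: "0 < \<eta>"
  defines "a \<equiv> (\<Sum>i<n. ((\<Sum>j<d. b j * w i j \<omega>) + w i d \<omega>)\<^sup>2) / n"
  assumes a: "0 < a"
  shows "rho_hat (des \<omega>) (rsp \<omega>) - rho0 \<beta> S \<sigma> =
    (a - (1 + \<eta>) * (quad n (gs n (\<lambda>i j. w i j \<omega>) d) (\<lambda>i. w i d \<omega>) / (real n - real d))) / ((1 + \<eta>) * a)"
proof -
  interpret ols n d "des \<omega>" R "Zf \<omega>" \<beta> "rsp \<omega>" "\<lambda>i. \<epsilon> i \<omega>" by (rule ols[OF w])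
  define q where "q = quad n (gs n (\<lambda>i j. w i j \<omega>) d) (\<lambda>i. w i d \<omega>) / (real n - real d)"
  have YY: "(\<Sum>i<n. (rsp \<omega> $ i)\<^sup>2) / n = \<sigma>\<^sup>2 * a"
  proof -
    have "(\<Sum>i<n. (rsp \<omega> $ i)\<^sup>2) = (\<Sum>i<n. \<sigma>\<^sup>2 * ((\<Sum>j<d. b j * w i j \<omega>) + w i d \<omega>)\<^sup>2)"
      by (intro sum.cong refl) (simp add: response_vec_def response_eq[OF _ w] power_mult_distrib)
    then show ?thesis by (simp only: sum_distrib_left[symmetric] a_def times_divide_eq_right)
  qed
  have qq: "quad n (gs n (Zf \<omega>) d) (\<lambda>i. \<epsilon> i \<omega>) / (real n - real d) = \<sigma>\<^sup>2 * q"
  proof -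
    have "quad n (gs n (Zf \<omega>) d) (\<lambda>i. \<epsilon> i \<omega>) = \<sigma>\<^sup>2 * quad n (gs n (\<lambda>i j. w i j \<omega>) d) (\<lambda>i. w i d \<omega>)"
      unfolding gs_w[OF order_refl] quad_def sum_distrib_left using \<sigma>
      by (intro sum.cong refl) (simp add: w_def power2_eq_square)
    then show ?thesis by (simp add: q_def)
  qed
  have r1: "rho_hat (des \<omega>) (rsp \<omega>) = (a - q) / a"
  proof -
    have "rho_hat (des \<omega>) (rsp \<omega>) = (\<sigma>\<^sup>2 * a - \<sigma>\<^sup>2 * q) / (\<sigma>\<^sup>2 * a)"
      using rho_hat_full_rank fr unfolding full_rank_w YY qq by simp
    also have "\<dots> = \<sigma>\<^sup>2 * (a - q) / (\<sigma>\<^sup>2 * a)" by (simp only: right_diff_distrib)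
    finally show ?thesis using \<sigma> by simp
  qed
  have r2: "rho0 \<beta> S \<sigma> = \<eta> / (1 + \<eta>)"
  proof -
    have "eta0 \<beta> S = \<sigma>\<^sup>2 * \<eta>" using \<sigma> by (simp add: \<eta>_def)
    then have "rho0 \<beta> S \<sigma> = \<sigma>\<^sup>2 * \<eta> / (\<sigma>\<^sup>2 * (1 + \<eta>))" by (simp add: rho0_def distrib_left add.commute)
    then show ?thesis using \<sigma> by simp
  qed
  show ?thesis unfolding r1 r2 q_def[symmetric] using a eta by (simp add: field_simps)
qed

text \<open>Matrix inversion is bypassed: on either side of the full rank event the estimator is
  given by a formula that is measurable in the entries of the array.\<close>

lemma rho_hat_measurable: "(\<lambda>\<omega>. rho_hat (des \<omega>) (rsp \<omega>)) \<in> borel_measurable M"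
proof -
  interpret A: indep_array M n d w K by (rule array)
  define y where "y \<omega> = (\<Sum>i<n. (\<sigma> * ((\<Sum>j<d. b j * w i j \<omega>) + w i d \<omega>))\<^sup>2)" for \<omega>
  define q where "q \<omega> = quad n (gs n (\<lambda>i j. w i j \<omega>) d) (\<lambda>i. \<epsilon> i \<omega>) / (real n - real d)" for \<omega>
  have [measurable]: "y \<in> borel_measurable M"
    unfolding y_def by (intro borel_measurable_sum borel_measurable_power borel_measurable_times borel_measurable_add) auto
  have [measurable]: "q \<in> borel_measurable M"
    unfolding q_def by (intro borel_measurable_divide measurable_quad) auto
  let ?f = "\<lambda>\<omega>. if \<omega> \<in> {\<omega> \<in> space M. full_rank n (\<lambda>i j. w i j \<omega>) d} then (y \<omega> / n - q \<omega>) / (y \<omega> / n)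
     else (- (y \<omega> / (real n - real d) * real d / n)) / (- (y \<omega> / (real n - real d) * real d / n) + y \<omega> / (real n - real d))"
  have "?f \<in> borel_measurable M"
    using A.full_rank_sets by (intro measurable_If_set) measurable
  moreover have "rho_hat (des \<omega>) (rsp \<omega>) = ?f \<omega>" if w: "\<omega> \<in> space M" for \<omega>
  proof -
    interpret ols n d "des \<omega>" R "Zf \<omega>" \<beta> "rsp \<omega>" "\<lambda>i. \<epsilon> i \<omega>" by (rule ols[OF w])
    have y: "(\<Sum>i<n. (rsp \<omega> $ i)\<^sup>2) = y \<omega>"
      unfolding y_def by (intro sum.cong refl) (simp add: response_vec_def response_eq[OF _ w])
    show ?thesis
      using rho_hat_full_rank rho_hat_not_full_rank w
      unfolding y by (simp add: q_def gs_w full_rank_w)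
  qed
  ultimately show ?thesis by (simp cong: measurable_cong)
qed

end

theorem theorem5:
  fixes M :: "nat \<Rightarrow> 'a measure" and p :: "nat \<Rightarrow> nat"
    and X :: "nat \<Rightarrow> nat \<Rightarrow> 'a \<Rightarrow> real vec" and \<epsilon> :: "nat \<Rightarrow> nat \<Rightarrow> 'a \<Rightarrow> real"
    and \<beta> :: "nat \<Rightarrow> real vec" and S :: "nat \<Rightarrow> real mat" and \<sigma> :: "nat \<Rightarrow> real"
    and \<tau> C1 C2 :: real
  defines "\<rho>h \<equiv> \<lambda>n \<omega>. rho_hat (design n (p n) (X n) \<omega>) (response_vec n (X n) (\<beta> n) (\<epsilon> n) \<omega>)"
    and "\<rho> \<equiv> \<lambda>n. rho0 (\<beta> n) (S n) (\<sigma> n)"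
    and "sd \<equiv> \<lambda>n. sqrt (var_rho_hat n \<tau> (eta0 (\<beta> n) (S n)) (\<sigma> n)
                  (\<integral>\<omega>. (response (X n) (\<beta> n) (\<epsilon> n) 0 \<omega>) ^ 4 \<partial>M n)
                  (\<integral>\<omega>. (\<epsilon> n 0 \<omega>) ^ 4 \<partial>M n))"
  assumes "linear_model M p X \<beta> S \<sigma>"
    and "(\<lambda>n. real (p n) / real n) \<longlonglongrightarrow> \<tau>" and "0 \<le> \<tau>" and "\<tau> < 1"
    and "0 < C1" and "C1 \<le> C2" and "C2 < 1"
    and "\<forall>n\<ge>1. C1 \<le> \<rho> n \<and> \<rho> n \<le> C2"
    and "condition_A M p X \<beta> \<epsilon> S \<sigma>"
  shows "small_oP M (\<lambda>n \<omega>. \<rho>h n \<omega> - \<rho> n) \<and>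
    weak_conv_m (\<lambda>n. distr (M n) borel (\<lambda>\<omega>. (\<rho>h n \<omega> - \<rho> n) / sd n)) std_normal_distribution"
proof -
  note model = assms(4)[unfolded linear_model_def, THEN conjunct1]
  note pn = assms(5) and \<tau> = assms(6,7) and C = assms(8-10) and \<rho>_bd = assms(11)
  have A1: "condition_A1 M p X S" and A2: "condition_A2 M p X \<epsilon> \<sigma>" and A3: "condition_A3 S"
    using assms(12) by (auto simp: condition_A_def)
  obtain R Z c where Z: "\<forall>n\<ge>1. is_psd_sqrt (p n) (R n) (S n) \<and>
               (\<forall>i<n. Z n i \<in> M n \<rightarrow>\<^sub>M borel_vec (p n) \<and>
                  (\<forall>\<omega>\<in>space (M n). X n i \<omega> = R n *\<^sub>v Z n i \<omega>) \<and>
                  prob_space.indep_vars (M n) (\<lambda>_. borel) (\<lambda>j \<omega>. Z n i \<omega> $ j) {..<p n} \<and>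
                  (\<forall>j<p n. integrable (M n) (\<lambda>\<omega>. Z n i \<omega> $ j) \<and>
                     (\<integral>\<omega>. Z n i \<omega> $ j \<partial>M n) = 0 \<and>
                     integrable (M n) (\<lambda>\<omega>. (Z n i \<omega> $ j)\<^sup>2) \<and>
                     (\<integral>\<omega>. (Z n i \<omega> $ j)\<^sup>2 \<partial>M n) = 1))"
    and c: "0 < c" and tail: "\<forall>n\<ge>1. \<forall>i<n. \<forall>j<p n. \<forall>t>0.
               measure (M n) {\<omega> \<in> space (M n). \<bar>Z n i \<omega> $ j\<bar> \<ge> t} \<le> 2 * exp (- c * t\<^sup>2)"
    using A1 unfolding condition_A1_def by (elim conjE exE) (rule that)
  have X_iid: "\<forall>n\<ge>1. iid (M n) (borel_vec (p n)) n (X n)" using A1 by (simp add: condition_A1_def)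
  obtain s where s: "0 < s" "\<forall>n\<ge>1. s \<le> (\<sigma> n)\<^sup>2" using A2 by (auto simp: condition_A2_def)
  have \<sigma>: "\<sigma> n \<noteq> 0" if "1 \<le> n" for n
  proof
    assume "\<sigma> n = 0" then show False using s(1) s(2)[rule_format, OF that] by simp
  qed
  obtain C8 where C8: "\<forall>\<^sub>F n in sequentially. norm (\<integral>\<omega>. (\<epsilon> n 0 \<omega>) ^ 8 \<partial>M n) \<le> C8 * norm ((\<sigma> n) ^ 8)"
    using A2 by (auto simp: condition_A2_def elim!: landau_o.bigE)
  have "\<forall>\<^sub>F n in sequentially. p n / n < (1 + \<tau>) / 2"
    using \<tau> by (intro order_tendstoD(2)[OF pn]) simp
  then have "\<forall>\<^sub>F n in sequentially. 1 \<le> n \<and> p n / n < (1 + \<tau>) / 2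
      \<and> norm (\<integral>\<omega>. (\<epsilon> n 0 \<omega>) ^ 8 \<partial>M n) \<le> C8 * norm ((\<sigma> n) ^ 8)"
    by (intro eventually_conj eventually_ge_at_top C8)
  then obtain N where N: "\<And>n. N \<le> n \<Longrightarrow> 1 \<le> n" "\<And>n. N \<le> n \<Longrightarrow> p n / n < (1 + \<tau>) / 2"
    "\<And>n. N \<le> n \<Longrightarrow> norm (\<integral>\<omega>. (\<epsilon> n 0 \<omega>) ^ 8 \<partial>M n) \<le> C8 * norm ((\<sigma> n) ^ 8)"
    unfolding eventually_sequentially by blast
  \<comment> \<open>Eventually p / n < (1 + \<tau>) / 2, so n - p exceeds (1 - \<tau>) n / 2 and
    \<open>Q\<close> bounds n / (n - p). \<open>H\<close> bounds the signal-to-noise ratio: \<eta> /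
    (1 + \<eta>) \<le> C2 means \<eta> \<le> C2 / (1 - C2).\<close>
  define Q where "Q = 2 / (1 - \<tau>)"
  define H where "H = 1 / (1 - C2)"
  have Q: "1 \<le> Q" using \<tau> by (simp add: Q_def)
  have H: "1 \<le> H" using C by (simp add: H_def)
  have nQ: "n \<le> Q * (real n - real (p n))" "p n < n" if n: "N \<le> n" for n
  proof -
    have "p n < (1 + \<tau>) / 2 * n" using N(2)[OF n] N(1)[OF n] by (simp add: divide_less_eq)
    then have *: "(1 - \<tau>) * n \<le> 2 * (real n - real (p n))" by argo
    then show "n \<le> Q * (real n - real (p n))" using \<tau> by (simp add: Q_def pos_le_divide_eq mult.commute)
    have "0 < (1 - \<tau>) * n" using \<tau> N(1)[OF n] by simp
    with * show "p n < n" by simp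
  qed
  have mm: "lm_model (M n) n (p n) (X n) (Z n) (\<epsilon> n) (R n) (S n) (\<beta> n) (\<sigma> n) c C8" if n: "N \<le> n" for n
  proof -
    note n1 = N(1)[OF n]
    have n0: "0 < n" using n1 by simp
    have \<beta>: "\<beta> n \<in> carrier_vec (p n)" and S: "S n \<in> carrier_mat (p n) (p n)" and P: "prob_space (M n)"
      using model n1 by auto
    \<comment> \<open>In dimension 0 the signal strength would be 0, against C1 > 0.\<close>
    have p0: "0 < p n"
    proof (rule ccontr)
      assume "\<not> 0 < p n"
      then have "eta0 (\<beta> n) (S n) = 0" using \<beta> S by (simp add: eta0_def scalar_prod_def)
      then have "\<rho> n = 0" by (simp add: \<rho>_def rho0_def)
      then show False using \<rho>_bd n1 C(1) by force
    qed
    note Zn = Z[rule_format, OF n1]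
    from A2 have E: "iid (M n) borel n (\<epsilon> n)" "indep_of (M n)
          (Pi\<^sub>M {..<n} (\<lambda>_. borel)) (\<lambda>\<omega>. \<lambda>i\<in>{..<n}. \<epsilon> n i \<omega>)
          (Pi\<^sub>M {..<n} (\<lambda>_. borel_vec (p n))) (\<lambda>\<omega>. \<lambda>i\<in>{..<n}. X n i \<omega>)"
      "\<And>i. i < n \<Longrightarrow> integrable (M n) (\<lambda>\<omega>. (\<epsilon> n i \<omega>) ^ 8)"
      "\<And>i. i < n \<Longrightarrow> (\<integral>\<omega>. \<epsilon> n i \<omega> \<partial>M n) = 0" "\<And>i. i < n \<Longrightarrow> (\<integral>\<omega>. (\<epsilon> n i \<omega>)\<^sup>2 \<partial>M n) = (\<sigma> n)\<^sup>2"
      using n1 by (simp_all add: condition_A2_def)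
    have lam: "0 < lambda_min (S n)" using A3 n1 by (force simp: condition_A3_def)
    have "(\<integral>\<omega>. (\<epsilon> n 0 \<omega>) ^ 8 \<partial>M n) \<le> C8 * (\<sigma> n) ^ 8"
      using N(3)[OF n] by simp
    then show ?thesis
      by (intro lm_model.intro lm_model_axioms.intro P nQ(2)[OF n] p0 \<beta> S lam c E \<sigma>[OF n1])
        (use Zn X_iid tail n1 in auto)
  qed
  define \<eta> where "\<eta> n = eta0 (\<beta> n) (S n) / (\<sigma> n)\<^sup>2" for n
  have \<eta>: "C1 \<le> \<eta> n" "\<eta> n \<le> H" if n: "N \<le> n" for n
  proof -
    let ?e = "eta0 (\<beta> n) (S n)"
    have s2: "0 < (\<sigma> n)\<^sup>2" using \<sigma>[OF N(1)[OF n]] by simp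
    have r: "C1 \<le> ?e / (?e + (\<sigma> n)\<^sup>2)" "?e / (?e + (\<sigma> n)\<^sup>2) \<le> C2"
      using \<rho>_bd N(1)[OF n] by (auto simp: \<rho>_def rho0_def)
    have e: "?e = (\<sigma> n)\<^sup>2 * \<eta> n" using s2 by (simp add: \<eta>_def)
    have r': "?e / (?e + (\<sigma> n)\<^sup>2) = \<eta> n / (1 + \<eta> n)"
    proof -
      have "?e / (?e + (\<sigma> n)\<^sup>2) = ((\<sigma> n)\<^sup>2 * \<eta> n) / ((\<sigma> n)\<^sup>2 * (1 + \<eta> n))"
        unfolding e by (simp add: distrib_left add.commute)
      then show ?thesis using s2 by simp
    qed
    \<comment> \<open>The sign is read off from the bounds on the ratio: a negative denominator
      would make the ratio at least 1 > C2, and a zero one would give the default value 0 <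
      C1.\<close>
    have pos: "0 < 1 + \<eta> n"
    proof (rule ccontr)
      assume "\<not> 0 < 1 + \<eta> n"
      then have "1 \<le> \<eta> n / (1 + \<eta> n) \<or> 1 + \<eta> n = 0" by (cases "1 + \<eta> n = 0") (auto simp: le_divide_eq)
      then show False using r r' C by auto
    qed
    then have b: "C1 * (1 + \<eta> n) \<le> \<eta> n" "\<eta> n \<le> C2 * (1 + \<eta> n)"
      using r unfolding r' by (simp_all add: le_divide_eq divide_le_eq mult.commute)
    have "0 < \<eta> n" using b(1) mult_pos_pos[OF C(1) pos] by linarith
    then have "0 \<le> C1 * \<eta> n" using C(1) by simp
    then show "C1 \<le> \<eta> n" using b(1) by (simp add: distrib_left)
    have "\<eta> n * (1 - C2) \<le> 1" using b(2) C by (simp add: algebra_simps)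
    then show "\<eta> n \<le> H" using C by (simp add: H_def le_divide_eq)
  qed
  let ?w = "\<lambda>n. lm_model.w (p n) (Z n) (\<epsilon> n) (\<sigma> n)"
  let ?b = "\<lambda>n. lm_model.b (R n) (\<beta> n) (\<sigma> n)"
  let ?\<nu>3 = "\<lambda>n. lm_model.\<nu>3 (M n) (\<epsilon> n) (\<sigma> n)"
  let ?\<nu>4 = "\<lambda>n. lm_model.\<nu>4 (M n) (\<epsilon> n) (\<sigma> n)"
  let ?\<mu>4 = "\<lambda>n. lm_model.\<mu>4 (M n) (X n) (\<beta> n) (\<sigma> n)"
  let ?K = "lm_model.K c C8"
  have \<eta>_eq: "lm_model.\<eta> (S n) (\<beta> n) (\<sigma> n) = \<eta> n" if "N \<le> n" for n
    using lm_model.\<eta>_def[OF mm[OF that]] by (simp add: \<eta>_def)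
  define D where "D n \<omega> = \<rho>h n \<omega> - \<rho> n" for n \<omega>
  define sd' where "sd' n = sqrt ((?\<mu>4 n - (\<eta> n)\<^sup>2 + 4 * \<eta> n + (\<eta> n)\<^sup>2 * (?\<nu>4 n - 1) + 2 * (1 + \<eta> n)\<^sup>2 * (\<tau> / (1 - \<tau>))) / n) / (1 + \<eta> n)\<^sup>2" for n
  have sd: "sd n = sd' n" if n: "N \<le> n" for n
    using lm_model.var_rho_hat_eq[OF mm[OF n] \<tau>(2)] \<eta>(1)[OF n] C(1)
    by (simp add: \<eta>_eq[OF n] sd_def sd'_def)
  have arr: "lm_array (M n) n (p n) (?w n) ?K (?b n) (\<eta> n) H Q (?\<nu>3 n) (?\<nu>4 n) (?\<mu>4 n)" if n: "N \<le> n" for n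
    using lm_model.to_lm_array[OF mm[OF n], of H Q] \<eta>[OF n] C(1) H Q nQ(1)[OF n]
    by (simp add: \<eta>_eq[OF n])
  have meas: "D n \<in> borel_measurable (M n)" if n: "N \<le> n" for n
    unfolding D_def \<rho>h_def using lm_model.rho_hat_measurable[OF mm[OF n]] by simp
  have dev: "D n \<omega> = ((\<Sum>i<n. ((\<Sum>j<p n. ?b n j * ?w n i j \<omega>) + ?w n i (p n) \<omega>)\<^sup>2) / n
           - (1 + \<eta> n) * (quad n (gs n (\<lambda>i j. ?w n i j \<omega>) (p n)) (\<lambda>i. ?w n i (p n) \<omega>) / (real n - real (p n))))
         / ((1 + \<eta> n) * ((\<Sum>i<n. ((\<Sum>j<p n. ?b n j * ?w n i j \<omega>) + ?w n i (p n) \<omega>)\<^sup>2) / n))"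
    if n: "N \<le> n" and w: "\<omega> \<in> space (M n)" and fr: "full_rank n (\<lambda>i j. ?w n i j \<omega>) (p n)"
      and a: "0 < (\<Sum>i<n. ((\<Sum>j<p n. ?b n j * ?w n i j \<omega>) + ?w n i (p n) \<omega>)\<^sup>2) / n" for n \<omega>
  proof -
    have "0 < \<eta> n" using \<eta>(1)[OF n] C(1) by simp
    then show ?thesis
      unfolding D_def \<rho>h_def \<rho>_def
      by (rule lm_model.rho_hat_deviation[OF mm[OF n] w fr _ a, unfolded \<eta>_eq[OF n]])
  qed
  note lim = lm_limit[OF arr pn \<tau> C(1) \<eta>(1) meas dev sd[unfolded sd'_def]]
  show ?thesis using lim unfolding D_def by (rule conjI)
qed

end
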